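(* Let $G=(V,E)$ be a dynamic graph, $s\in V$, and $\mathcal{P}$ a connected graph. One can maintain the non-induced $s$-subgraph count $\mathbf{c}(G,\mathcal{P},s)$ in (i) worst-case constant update time and constant space if $\mathcal{P}$ is the claw; (ii) amortized update time $O(\sqrt m)$ and $O(n)$ space if $\mathcal{P}$ is the 3-cycle or the length-3 path; (iii) amortized update time $O(m^{2/3})$ and $O(n^2)$ space if $\mathcal{P}$ is the paw, the 4-cycle, or the diamond; (iv) worst-case update time $O(m)$ and constant space if $\mathcal{P}$ is the 4-clique.
   Context: A dynamic graph $G=(V,E)$ is a simple undirected graph on a fixed vertex set of $n$ vertices undergoing edge insertions and deletions; $m$ is the current number of edges. Degrees and adjacency are accessible in constant time. $\mathbf{c}(G,\mathcal{P},s)$ is the number of (not necessarily induced) subgraphs of $G$ isomorphic to $\mathcal{P}$ that contain the vertex $s$; maintaining it means it can be retrieved in constant time after each update. Patterns: the claw $K_{1,3}$; the length-3 path (path with three edges); the paw (triangle with an extra edge attached at one triangle vertex); the 4-cycle; the diamond ($K_4$ minus one edge); the 4-clique $K_4$. *)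

theory Defs
  imports Complex_Main
begin

section \<open>Simple graphs, isomorphism, non-induced counts\<close>

text \<open>A graph is a pair of a vertex set and a set of two-element edges.\<close>

type_synonym 'a ugraph = "'a set \<times> 'a set set"

definition simple_graph :: "'a ugraph \<Rightarrow> bool" where
  "simple_graph G \<longleftrightarrow> finite (fst G) \<and> (\<forall>e \<in> snd G. e \<subseteq> fst G \<and> card e = 2)"

definition connected_graph :: "'a ugraph \<Rightarrow> bool" where
  "connected_graph G \<longleftrightarrow> fst G \<noteq> {} \<and>
     (\<forall>u \<in> fst G. \<forall>v \<in> fst G. (u, v) \<in> {(x, y). {x, y} \<in> snd G}\<^sup>*)"

definition isomorphic_graphs :: "'a ugraph \<Rightarrow> 'b ugraph \<Rightarrow> bool" where
  "isomorphic_graphs H P \<longleftrightarrow>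
     (\<exists>f. bij_betw f (fst H) (fst P) \<and> (\<lambda>e. f ` e) ` snd H = snd P)"

definition subgraph_of :: "'a ugraph \<Rightarrow> 'a ugraph \<Rightarrow> bool" where
  "subgraph_of H G \<longleftrightarrow> simple_graph H \<and> fst H \<subseteq> fst G \<and> snd H \<subseteq> snd G"

definition s_subgraph_count :: "'a ugraph \<Rightarrow> 'b ugraph \<Rightarrow> 'a \<Rightarrow> nat" where
  "s_subgraph_count G P s = card {H. subgraph_of H G \<and> isomorphic_graphs H P \<and> s \<in> fst H}"

definition claw :: "nat ugraph" where
  "claw = ({0, 1, 2, 3}, {{0, 1}, {0, 2}, {0, 3}})"

definition cycle3 :: "nat ugraph" where
  "cycle3 = ({0, 1, 2}, {{0, 1}, {1, 2}, {2, 0}})"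

definition path3 :: "nat ugraph" where
  "path3 = ({0, 1, 2, 3}, {{0, 1}, {1, 2}, {2, 3}})"

definition paw :: "nat ugraph" where
  "paw = ({0, 1, 2, 3}, {{0, 1}, {1, 2}, {2, 0}, {2, 3}})"

definition cycle4 :: "nat ugraph" where
  "cycle4 = ({0, 1, 2, 3}, {{0, 1}, {1, 2}, {2, 3}, {3, 0}})"

definition clique4 :: "nat ugraph" where
  "clique4 = ({0, 1, 2, 3}, {e. e \<subseteq> {0, 1, 2, 3} \<and> card e = 2})"

definition diamond :: "nat ugraph" where
  "diamond = (fst clique4, snd clique4 - {{2, 3}})"


section \<open>Dynamic graphs\<close>

text \<open>The fixed vertex set of a dynamic graph on n vertices is \<open>{..<n}\<close>.\<close>

datatype update = Insert_Edge nat nat | Delete_Edge nat nat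

fun valid_update :: "nat \<Rightarrow> nat set set \<Rightarrow> update \<Rightarrow> bool" where
  "valid_update n E (Insert_Edge u v) \<longleftrightarrow> u < n \<and> v < n \<and> u \<noteq> v \<and> {u, v} \<notin> E"
| "valid_update n E (Delete_Edge u v) \<longleftrightarrow> {u, v} \<in> E"

fun apply_update :: "update \<Rightarrow> nat set set \<Rightarrow> nat set set" where
  "apply_update (Insert_Edge u v) E = insert {u, v} E"
| "apply_update (Delete_Edge u v) E = E - {{u, v}}"

text \<open>\<open>L v\<close> lists the neighbours of \<open>v\<close> without repetition. The order is left
  unspecified, so an algorithm has to cope with every order, and the order may change
  from one update to the next.\<close>

definition adjacency_lists :: "nat set set \<Rightarrow> (nat \<Rightarrow> nat list) \<Rightarrow> bool" where
  "adjacency_lists E L \<longleftrightarrow> (\<forall>v. distinct (L v) \<and> set (L v) = {w. {v, w} \<in> E})"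


section \<open>A word RAM with access to the dynamic graph\<close>

text \<open>The memory consists of cells addressed by natural numbers. The number of vertices, the
  vertex \<open>s\<close>, the endpoints and kind of the current update, and the graph (degrees,
  adjacency tests, i-th neighbour) are read-only inputs which are not part of the memory.
  Truth values are represented by 0 (false) and nonzero numbers (true).\<close>

datatype exp =
    Num nat | Num_Vertices | Source | Arg_U | Arg_V | Is_Insertion
  | Load exp
  | Degree exp | Adjacent exp exp | Neighbour exp exp
  | Add exp exp | Sub exp exp | Mul exp exp | Div exp exp | Lt exp exp | Equal exp exp

datatype com =
    Skip | Store exp exp | Seq com com | Cond exp com com | While exp com

type_synonym memory = "nat \<Rightarrow> nat"

record inputs =
  in_n :: nat
  in_s :: nat
  in_u :: nat
  in_v :: nat
  in_ins :: bool
  in_nbs :: "nat \<Rightarrow> nat list"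

fun eval_exp :: "inputs \<Rightarrow> memory \<Rightarrow> exp \<Rightarrow> nat" where
  "eval_exp I M (Num c) = c"
| "eval_exp I M Num_Vertices = in_n I"
| "eval_exp I M Source = in_s I"
| "eval_exp I M Arg_U = in_u I"
| "eval_exp I M Arg_V = in_v I"
| "eval_exp I M Is_Insertion = of_bool (in_ins I)"
| "eval_exp I M (Load a) = M (eval_exp I M a)"
| "eval_exp I M (Degree a) = length (in_nbs I (eval_exp I M a))"
| "eval_exp I M (Adjacent a b) = of_bool (eval_exp I M b \<in> set (in_nbs I (eval_exp I M a)))"
| "eval_exp I M (Neighbour a b) =
     (let l = in_nbs I (eval_exp I M a); i = eval_exp I M b in if i < length l then l ! i else 0)"
| "eval_exp I M (Add a b) = eval_exp I M a + eval_exp I M b"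
| "eval_exp I M (Sub a b) = eval_exp I M a - eval_exp I M b"
| "eval_exp I M (Mul a b) = eval_exp I M a * eval_exp I M b"
| "eval_exp I M (Div a b) = eval_exp I M a div eval_exp I M b"
| "eval_exp I M (Lt a b) = of_bool (eval_exp I M a < eval_exp I M b)"
| "eval_exp I M (Equal a b) = of_bool (eval_exp I M a = eval_exp I M b)"

fun exp_cost :: "exp \<Rightarrow> nat" where
  "exp_cost (Load a) = 1 + exp_cost a"
| "exp_cost (Degree a) = 1 + exp_cost a"
| "exp_cost (Adjacent a b) = 1 + exp_cost a + exp_cost b"
| "exp_cost (Neighbour a b) = 1 + exp_cost a + exp_cost b"
| "exp_cost (Add a b) = 1 + exp_cost a + exp_cost b"
| "exp_cost (Sub a b) = 1 + exp_cost a + exp_cost b"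
| "exp_cost (Mul a b) = 1 + exp_cost a + exp_cost b"
| "exp_cost (Div a b) = 1 + exp_cost a + exp_cost b"
| "exp_cost (Lt a b) = 1 + exp_cost a + exp_cost b"
| "exp_cost (Equal a b) = 1 + exp_cost a + exp_cost b"
| "exp_cost _ = 1"

text \<open>\<open>exec S W I c M t M'\<close>: on inputs \<open>I\<close>, the command \<open>c\<close> started in memory \<open>M\<close> halts after
  \<open>t\<close> steps in memory \<open>M'\<close>, writes only to cells with address less than \<open>S\<close> (the space), and
  writes only values less than \<open>W\<close> (a machine word). A store that violates one of the two
  limits has no execution.\<close>

inductive exec :: "nat \<Rightarrow> nat \<Rightarrow> inputs \<Rightarrow> com \<Rightarrow> memory \<Rightarrow> nat \<Rightarrow> memory \<Rightarrow> bool"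
  for S W :: nat and I :: inputs where
  exec_Skip: "exec S W I Skip M 1 M"
| exec_Store: "eval_exp I M a < S \<Longrightarrow> eval_exp I M b < W \<Longrightarrow>
    exec S W I (Store a b) M (1 + exp_cost a + exp_cost b) (M(eval_exp I M a := eval_exp I M b))"
| exec_Seq: "exec S W I c1 M t1 M1 \<Longrightarrow> exec S W I c2 M1 t2 M2 \<Longrightarrow>
    exec S W I (Seq c1 c2) M (t1 + t2) M2"
| exec_Cond_True: "eval_exp I M b \<noteq> 0 \<Longrightarrow> exec S W I c1 M t M' \<Longrightarrow>
    exec S W I (Cond b c1 c2) M (1 + exp_cost b + t) M'"
| exec_Cond_False: "eval_exp I M b = 0 \<Longrightarrow> exec S W I c2 M t M' \<Longrightarrow>
    exec S W I (Cond b c1 c2) M (1 + exp_cost b + t) M'"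
| exec_While_False: "eval_exp I M b = 0 \<Longrightarrow>
    exec S W I (While b c) M (1 + exp_cost b) M"
| exec_While_True: "eval_exp I M b \<noteq> 0 \<Longrightarrow> exec S W I c M t1 M1 \<Longrightarrow>
    exec S W I (While b c) M1 t2 M2 \<Longrightarrow>
    exec S W I (While b c) M (1 + exp_cost b + t1 + t2) M2"


section \<open>Maintaining a count\<close>

fun update_inputs :: "nat \<Rightarrow> nat \<Rightarrow> update \<Rightarrow> (nat \<Rightarrow> nat list) \<Rightarrow> inputs" where
  "update_inputs n s (Insert_Edge u v) L =
     \<lparr>in_n = n, in_s = s, in_u = u, in_v = v, in_ins = True, in_nbs = L\<rparr>"
| "update_inputs n s (Delete_Edge u v) L =
     \<lparr>in_n = n, in_s = s, in_u = u, in_v = v, in_ins = False, in_nbs = L\<rparr>"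

definition query_inputs :: "nat \<Rightarrow> nat \<Rightarrow> (nat \<Rightarrow> nat list) \<Rightarrow> inputs" where
  "query_inputs n s L =
     \<lparr>in_n = n, in_s = s, in_u = 0, in_v = 0, in_ins = False, in_nbs = L\<rparr>"

text \<open>\<open>run S W n s up E M tr\<close>: some sequence of updates, starting from the edgeless graph on n
  vertices and the all-zero memory, leads to the edge set \<open>E\<close> and the memory \<open>M\<close>; the i-th entry
  of \<open>tr\<close> holds the time spent on the i-th update and the number of edges after it. The update
  procedure \<open>up\<close> is called after the graph itself has been changed.\<close>

inductive run :: "nat \<Rightarrow> nat \<Rightarrow> nat \<Rightarrow> nat \<Rightarrow> com \<Rightarrow>
    nat set set \<Rightarrow> memory \<Rightarrow> (nat \<times> nat) list \<Rightarrow> bool"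
  for S W n s :: nat and up :: com where
  run_start: "run S W n s up {} (\<lambda>_. 0) []"
| run_update: "run S W n s up E M tr \<Longrightarrow> valid_update n E x \<Longrightarrow>
    adjacency_lists (apply_update x E) L \<Longrightarrow>
    exec S W (update_inputs n s x L) up M t M' \<Longrightarrow>
    run S W n s up (apply_update x E) M' (tr @ [(t, card (apply_update x E))])"

text \<open>Every update is processed within the limits \<open>S\<close> and \<open>W\<close>, and at any time the query
  procedure \<open>qu\<close> puts the count for the current graph into cell 0 within \<open>q\<close> steps.\<close>

definition maintains_count ::
  "nat \<Rightarrow> nat \<Rightarrow> nat \<Rightarrow> nat \<Rightarrow> nat \<Rightarrow> com \<Rightarrow> com \<Rightarrow> 'b ugraph \<Rightarrow> bool" where
  "maintains_count S W q n s up qu P \<longleftrightarrow>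
     (\<forall>E M tr. run S W n s up E M tr \<longrightarrow>
        (\<forall>x L. valid_update n E x \<longrightarrow> adjacency_lists (apply_update x E) L \<longrightarrow>
           (\<exists>t M'. exec S W (update_inputs n s x L) up M t M')) \<and>
        (\<forall>L. adjacency_lists E L \<longrightarrow>
           (\<exists>t M'. exec S W (query_inputs n s L) qu M t M' \<and> t \<le> q \<and>
                   M' 0 = s_subgraph_count ({..<n}, E) P s)))"

text \<open>The programs and the constant \<open>k\<close> are independent of n, of \<open>s\<close> and of the update sequence.
  Words have \<open>O(log n)\<close> bits. Since the bounds \<open>f\<close> may vanish at 0, an update that removes the
  last edge is charged for one edge.\<close>

definition maintainable_worst_case ::
  "'b ugraph \<Rightarrow> (real \<Rightarrow> real) \<Rightarrow> (nat \<Rightarrow> nat) \<Rightarrow> bool" where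
  "maintainable_worst_case P f g \<longleftrightarrow>
     (\<exists>up qu k. \<forall>n s. s < n \<longrightarrow>
        maintains_count (k * g n) (k * (n + 1) ^ k) k n s up qu P \<and>
        (\<forall>E M tr. run (k * g n) (k * (n + 1) ^ k) n s up E M tr \<longrightarrow>
           (\<forall>(t, m) \<in> set tr. real t \<le> real k * f (real (max 1 m)))))"

definition maintainable_amortized ::
  "'b ugraph \<Rightarrow> (real \<Rightarrow> real) \<Rightarrow> (nat \<Rightarrow> nat) \<Rightarrow> bool" where
  "maintainable_amortized P f g \<longleftrightarrow>
     (\<exists>up qu k. \<forall>n s. s < n \<longrightarrow>
        maintains_count (k * g n) (k * (n + 1) ^ k) k n s up qu P \<and>
        (\<forall>E M tr. run (k * g n) (k * (n + 1) ^ k) n s up E M tr \<longrightarrow>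
           (\<Sum>(t, m) \<leftarrow> tr. real t) \<le> real k * (\<Sum>(t, m) \<leftarrow> tr. f (real (max 1 m)))))"

end

theory Submission
  imports Defs
begin

text \<open>Delete the source \<open>s\<close> from the graph and keep the indicator of its neighbourhood instead. Every count
  is then a fixed combination of the degree of \<open>s\<close> and a few sums over vertices, edges and walks of the remaining
  graph, weighted by this indicator; the combination is found by counting embeddings of the pattern by the position of
  \<open>s\<close> and dividing by the number of automorphisms. An update toggles one edge or one mark, and each sum changes by
  a local quantity at the toggled place, evaluated in the graph without the toggled edge, so that a deletion subtracts
  exactly what an insertion adds.

  For the claw the local quantities are degrees. For the 4-clique they are found by walking over all paths of two
  edges that start at an endpoint. For the other patterns call a vertex heavy if its degree to the power \<open>p\<close>
  exceeds \<open>m\<close>, with \<open>p = 2\<close> or \<open>p = 3\<close>: a local quantity at a light vertex is found by enumerating its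
  neighbours or pairs of neighbours, and one at a heavy vertex is read from a table. An update changes \<open>O(|H|)\<close>
  table entries for the set \<open>H\<close> of heavy vertices, besides those found by enumeration at light endpoints.
  Only endpoints of the update become heavy, and heavy vertices that fall below the threshold are dropped at once.
  The potential charges each light vertex for the excess of its degree over the threshold and each heavy vertex for the
  threshold itself, so it pays for a change of status and grows by only \<open>O(m powr (1 - 1 / p))\<close> per update.\<close>

section \<open>Additive updates of tables in memory\<close>

text \<open>The threshold balances two costs. Enumeration at a vertex of degree \<open>d\<close>
  takes \<open>d ^ (p - 1)\<close> steps, which is about \<open>m powr (1 - 1 / p)\<close> at the
  threshold, while the degree sum \<open>2 * m\<close> leaves room for at most
  \<open>2 * m powr (1 - 1 / p)\<close> vertices above it. Single neighbours are enumerated for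
  \<open>p = 2\<close>, pairs for \<open>p = 3\<close>. For \<open>p = 3\<close>, sums over two-edge
  walks are split by their middle vertex: the share of the light ones is tabulated and changes with
  the edges at them, the share of the heavy ones is summed on demand along the list of heavy
  vertices. A deletion lowers the threshold of every vertex, and finding those that now exceed it
  would take a pass over all of them. So a heavy vertex exceeds the threshold, but a light one may
  exceed it too until an update touches it; this is why the bound is only amortized. The graph has
  already changed when the procedure starts, and tables are read while they are being changed. A
  table whose toggled part would be read is corrected before reading on a deletion and after reading
  on an insertion; in both cases the reader sees the graph without the toggled edge.\<close>

lemma exec_deterministic:
  assumes "exec S W I c M t M'" "exec S W I c M t2 M2"
  shows "t2 = t \<and> M2 = M'"
  using assms
proof (induction arbitrary: t2 M2)
  case (exec_Skip M)
  then show ?case by (auto elim: exec.cases)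
next
  case (exec_Store M a b)
  from exec_Store.prems exec_Store.hyps show ?case by (auto elim: exec.cases)
next
  case (exec_Seq c1 M t1 M1 c2 t2' M2')
  from exec_Seq.prems obtain u1 N1 u2 where "exec S W I c1 M u1 N1" "exec S W I c2 N1 u2 M2"
    "t2 = u1 + u2" by (auto elim: exec.cases)
  then show ?case using exec_Seq.IH by blast
next
  case (exec_Cond_True M b c1 t M' c2)
  from exec_Cond_True.prems exec_Cond_True.hyps
  obtain u where "exec S W I c1 M u M2" "t2 = 1 + exp_cost b + u" by (auto elim: exec.cases)
  then show ?case using exec_Cond_True.IH by blast
next
  case (exec_Cond_False M b c2 t M' c1)
  from exec_Cond_False.prems exec_Cond_False.hyps
  obtain u where "exec S W I c2 M u M2" "t2 = 1 + exp_cost b + u" by (auto elim: exec.cases)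
  then show ?case using exec_Cond_False.IH by blast
next
  case (exec_While_False M b c)
  from exec_While_False.prems exec_While_False.hyps show ?case by (auto elim: exec.cases)
next
  case (exec_While_True M b c t1 M1 t2' M2')
  from exec_While_True.prems exec_While_True.hyps(1)
  obtain u1 N1 u2 where "exec S W I c M u1 N1" "exec S W I (While b c) N1 u2 M2"
    "t2 = 1 + exp_cost b + u1 + u2" by (auto elim: exec.cases)
  then show ?case using exec_While_True.IH by blast
qed

text \<open>The time of one pass in which every loop body counts once. Running times are bounded by
  this constant times a number \<open>N\<close> that accounts for the iterations, so that programs
  need not be timed exactly.\<close>

fun com_size :: "com \<Rightarrow> nat" where
  "com_size Skip = 1"
| "com_size (Store a b) = 1 + exp_cost a + exp_cost b"
| "com_size (Seq c1 c2) = com_size c1 + com_size c2"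
| "com_size (Cond b c1 c2) = 1 + exp_cost b + com_size c1 + com_size c2"
| "com_size (While b c) = 1 + exp_cost b + com_size c"

text \<open>The memory is divided into 64 interleaved tables, and entry 0 of a table also serves as a variable. Tables 1 to 6
  hold the current update (insertion flag, the endpoints \<open>x\<close> and \<open>y\<close>, the ignored neighbour of the source, the degrees
  of \<open>x\<close> and \<open>y\<close>), table 7 the number of edges, tables 8 to 10 the heavy vertices (number, list, flags), tables 11 and 12
  the scan of this list, tables 14 to 17 loop counters and elements, tables 20 to 31 intermediate results; the tables
  from 32 on persist between updates.\<close>

definition cell :: "nat \<Rightarrow> exp \<Rightarrow> exp" where
  "cell j p = Add (Mul p (Num 64)) (Num j)"

definition ld :: "nat \<Rightarrow> exp \<Rightarrow> exp" where
  "ld j p = Load (cell j p)"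

abbreviation var :: "nat \<Rightarrow> exp" where
  "var j \<equiv> ld j (Num 0)"

definition tab :: "memory \<Rightarrow> nat \<Rightarrow> nat \<Rightarrow> nat" where
  "tab M j p = M (p * 64 + j)"

definition mem :: "(nat \<Rightarrow> nat \<Rightarrow> nat) \<Rightarrow> memory" where
  "mem T a = T (a mod 64) (a div 64)"

lemma tab_mem [simp]: "j < 64 \<Longrightarrow> tab (mem T) j = T j"
  by (auto simp: tab_def mem_def fun_eq_iff)

lemma tab_upd: "j < 64 \<Longrightarrow> k < 64 \<Longrightarrow>
    tab (M(p * 64 + j := v)) k = (if k = j then (tab M j)(p := v) else tab M k)"
proof -
  assume jk: "j < 64" "k < 64"
  have "q * 64 + k = p * 64 + j \<longleftrightarrow> k = j \<and> q = p" for q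
  proof
    assume e: "q * 64 + k = p * 64 + j"
    have "k = (q * 64 + k) mod 64" "j = (p * 64 + j) mod 64" using jk by simp_all
    then show "k = j \<and> q = p" using e by auto
  qed simp
  then show ?thesis by (auto simp: tab_def fun_eq_iff)
qed

definition agr :: "nat set \<Rightarrow> memory \<Rightarrow> (nat \<Rightarrow> nat \<Rightarrow> nat) \<Rightarrow> bool" where
  "agr R M T \<longleftrightarrow> (\<forall>k<64. k \<notin> R \<longrightarrow> tab M k = T k)"

lemma agr_mem [simp]: "agr R (mem T) T"
  by (simp add: agr_def)

lemma agrD: "agr R M T \<Longrightarrow> k < 64 \<Longrightarrow> k \<notin> R \<Longrightarrow> tab M k = T k"
  by (simp add: agr_def)

lemma agr_mono: "agr R M T \<Longrightarrow> R \<subseteq> R' \<Longrightarrow> agr R' M T"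
  by (auto simp: agr_def)

text \<open>Evaluation against tables instead of a memory: \<open>mem T\<close> is one canonical
  memory with these tables, and an independent expression has the same value in every memory that
  agrees with them.\<close>

definition ev :: "inputs \<Rightarrow> (nat \<Rightarrow> nat \<Rightarrow> nat) \<Rightarrow> exp \<Rightarrow> nat" where
  "ev I T e = eval_exp I (mem T) e"

lemma eval_cell [simp]: "eval_exp I M (cell j p) = eval_exp I M p * 64 + j"
  by (simp add: cell_def)

lemma eval_ld [simp]: "eval_exp I M (ld j p) = tab M j (eval_exp I M p)"
  by (simp add: ld_def tab_def)

lemma ev_simps [simp]:
  "ev I T (Num c) = c"
  "ev I T Num_Vertices = in_n I"
  "ev I T Source = in_s I"
  "ev I T Arg_U = in_u I"
  "ev I T Arg_V = in_v I"
  "ev I T Is_Insertion = of_bool (in_ins I)"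
  "ev I T (Degree a) = length (in_nbs I (ev I T a))"
  "ev I T (Adjacent a b) = of_bool (ev I T b \<in> set (in_nbs I (ev I T a)))"
  "ev I T (Add a b) = ev I T a + ev I T b"
  "ev I T (Sub a b) = ev I T a - ev I T b"
  "ev I T (Mul a b) = ev I T a * ev I T b"
  "ev I T (Div a b) = ev I T a div ev I T b"
  "ev I T (Lt a b) = of_bool (ev I T a < ev I T b)"
  "ev I T (Equal a b) = of_bool (ev I T a = ev I T b)"
  by (simp_all add: ev_def)

lemma ev_Neighbour: "ev I T (Neighbour a b) =
    (let l = in_nbs I (ev I T a); i = ev I T b in if i < length l then l ! i else 0)"
  by (simp add: ev_def)

lemma ev_ld [simp]: "j < 64 \<Longrightarrow> ev I T (ld j p) = T j (ev I T p)"
  by (simp add: ev_def)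

text \<open>Independence is semantic: the value is determined by the tables outside
  \<open>R\<close>. It is derived compositionally for \<open>ld\<close>; a plain \<open>Load\<close>
  gets no rule, because its address may fall into any table.\<close>

definition indep :: "inputs \<Rightarrow> nat set \<Rightarrow> exp \<Rightarrow> bool" where
  "indep I R e \<longleftrightarrow> (\<forall>M T. agr R M T \<longrightarrow> eval_exp I M e = ev I T e)"

lemma indep_simps [simp]:
  "indep I R (Num c)" "indep I R Num_Vertices" "indep I R Source" "indep I R Arg_U"
  "indep I R Arg_V" "indep I R Is_Insertion"
  "indep I R a \<Longrightarrow> indep I R (Degree a)"
  "indep I R a \<Longrightarrow> indep I R b \<Longrightarrow> indep I R (Adjacent a b)"
  "indep I R a \<Longrightarrow> indep I R b \<Longrightarrow> indep I R (Neighbour a b)"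
  "indep I R a \<Longrightarrow> indep I R b \<Longrightarrow> indep I R (Add a b)"
  "indep I R a \<Longrightarrow> indep I R b \<Longrightarrow> indep I R (Sub a b)"
  "indep I R a \<Longrightarrow> indep I R b \<Longrightarrow> indep I R (Mul a b)"
  "indep I R a \<Longrightarrow> indep I R b \<Longrightarrow> indep I R (Div a b)"
  "indep I R a \<Longrightarrow> indep I R b \<Longrightarrow> indep I R (Lt a b)"
  "indep I R a \<Longrightarrow> indep I R b \<Longrightarrow> indep I R (Equal a b)"
  "k < 64 \<Longrightarrow> k \<notin> R \<Longrightarrow> indep I R a \<Longrightarrow> indep I R (ld k a)"
  by (auto simp: indep_def ev_Neighbour agrD)

lemma indepD: "indep I R e \<Longrightarrow> agr R M T \<Longrightarrow> eval_exp I M e = ev I T e"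
  by (simp add: indep_def)

definition accum :: "bool \<Rightarrow> nat \<Rightarrow> nat \<Rightarrow> nat" where
  "accum b x y = (if b then x + y else x - y)"

lemma accum_accum: "accum b (accum b x y) z = accum b x (y + z)"
  by (simp add: accum_def)

lemma accum_0 [simp]: "accum b x 0 = x"
  by (simp add: accum_def)

definition upd :: "exp \<Rightarrow> nat \<Rightarrow> exp \<Rightarrow> exp \<Rightarrow> com" where
  "upd b j p v = Cond b (Store (cell j p) (Add (ld j p) v)) (Store (cell j p) (Sub (ld j p) v))"

text \<open>The current element is copied to entry 0 of table \<open>z\<close>, so the bodies of
  nested loops can name it by \<open>var z\<close>.\<close>

definition loop :: "nat \<Rightarrow> nat \<Rightarrow> exp \<Rightarrow> exp \<Rightarrow> com \<Rightarrow> com" where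
  "loop i z len el c = Seq (Store (cell i (Num 0)) (Num 0))
     (While (Lt (var i) len)
       (Seq (Store (cell z (Num 0)) el) (Seq c (Store (cell i (Num 0)) (Add (var i) (Num 1))))))"

text \<open>All tables other than \<open>j\<close> and the scratch tables \<open>R\<close> are fixed to \<open>T\<close>, so the command
  can be repeated although it changes table \<open>j\<close>. Truncated subtraction is harmless because
  \<open>x - y - z = x - (y + z)\<close> holds without side conditions.\<close>

definition adds :: "nat \<Rightarrow> nat \<Rightarrow> inputs \<Rightarrow> bool \<Rightarrow> com \<Rightarrow> (nat \<Rightarrow> nat \<Rightarrow> nat) \<Rightarrow> nat set \<Rightarrow> nat \<Rightarrow> nat
    \<Rightarrow> (nat \<Rightarrow> nat) \<Rightarrow> bool" where
  "adds S W I b c T R j N e \<longleftrightarrow>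
     (\<forall>M. agr (insert j R) M T \<longrightarrow>
        (\<forall>p. tab M j p < W \<and> (b \<longrightarrow> tab M j p + e p < W)) \<longrightarrow>
        (\<exists>t M'. exec S W I c M t M' \<and> t \<le> com_size c * N \<and>
           (\<forall>p. tab M' j p = accum b (tab M j p) (e p)) \<and> agr (insert j R) M' T))"

lemma addsD:
  assumes "adds S W I b c T R j N e" "agr (insert j R) M T"
    "\<And>p. tab M j p < W" "\<And>p. b \<Longrightarrow> tab M j p + e p < W"
  obtains t M' where "exec S W I c M t M'" "t \<le> com_size c * N"
    "\<And>p. tab M' j p = accum b (tab M j p) (e p)" "agr (insert j R) M' T"
  using assms unfolding adds_def by blast

lemma adds_mono:
  assumes "adds S W I b c T R j N e" "N \<le> N'" "\<And>p. e p = e' p"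
  shows "adds S W I b c T R j N' e'"
  unfolding adds_def
proof (intro allI impI)
  fix M
  assume M: "agr (insert j R) M T" and bd: "\<forall>p. tab M j p < W \<and> (b \<longrightarrow> tab M j p + e' p < W)"
  obtain t M' where "exec S W I c M t M'" "t \<le> com_size c * N"
    "\<And>p. tab M' j p = accum b (tab M j p) (e p)" "agr (insert j R) M' T"
    by (rule addsD[OF assms(1) M]) (use bd in \<open>auto simp: assms(3)\<close>)
  moreover have "com_size c * N \<le> com_size c * N'" using assms(2) by simp
  ultimately show "\<exists>t M'. exec S W I c M t M' \<and> t \<le> com_size c * N' \<and>
           (\<forall>p. tab M' j p = accum b (tab M j p) (e' p)) \<and> agr (insert j R) M' T"
    using assms(3) by (metis le_trans)
qed

lemma adds_upd:
  assumes "j < 64" "indep I (insert j R) x" "indep I (insert j R) p" "indep I (insert j R) v"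
    and "ev I T p * 64 + j < S" "b \<longleftrightarrow> ev I T x \<noteq> 0" "N \<ge> 1"
  shows "adds S W I b (upd x j p v) T R j N (\<lambda>q. if q = ev I T p then ev I T v else 0)"
proof (rule adds_mono[OF _ assms(7) refl], unfold adds_def, intro allI impI)
  fix M
  assume M: "agr (insert j R) M T"
    and bd: "\<forall>p'. tab M j p' < W \<and> (b \<longrightarrow> tab M j p' + (if p' = ev I T p then ev I T v else 0) < W)"
  have e: "eval_exp I M x = ev I T x" "eval_exp I M p = ev I T p" "eval_exp I M v = ev I T v"
    using assms M indepD by blast+
  let ?M = "M(ev I T p * 64 + j := accum b (tab M j (ev I T p)) (ev I T v))"
  have 1: "\<exists>t. exec S W I (upd x j p v) M t ?M \<and> t \<le> com_size (upd x j p v) * 1"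
  proof (cases b)
    case True
    have "tab M j (ev I T p) + ev I T v < W" using bd[rule_format, of "ev I T p"] True by simp
    then have "exec S W I (Store (cell j p) (Add (ld j p) v)) M
        (1 + exp_cost (cell j p) + exp_cost (Add (ld j p) v)) ?M"
      using exec_Store[of I M "cell j p" S "Add (ld j p) v" W] assms(5) bd True e
      by (auto simp: accum_def)
    from exec_Cond_True[OF _ this, of x] True e assms(6) show ?thesis
      unfolding upd_def by fastforce
  next
    case False
    have "tab M j (ev I T p) - ev I T v < W" using bd by (meson less_imp_diff_less)
    then have "exec S W I (Store (cell j p) (Sub (ld j p) v)) M
        (1 + exp_cost (cell j p) + exp_cost (Sub (ld j p) v)) ?M"
      using exec_Store[of I M "cell j p" S "Sub (ld j p) v" W] assms(5) False e
      by (auto simp: accum_def)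
    from exec_Cond_False[OF _ this, of x] False e assms(6) show ?thesis
      unfolding upd_def by fastforce
  qed
  then show "\<exists>t M'. exec S W I (upd x j p v) M t M' \<and> t \<le> com_size (upd x j p v) * 1 \<and>
       (\<forall>pa. tab M' j pa = accum b (tab M j pa) (if pa = ev I T p then ev I T v else 0)) \<and>
       agr (insert j R) M' T"
    using assms(1) M by (auto intro!: exI[of _ ?M] simp: tab_upd agr_def)
qed

lemma adds_seq:
  assumes "adds S W I b c1 T R j N e1" "adds S W I b c2 T R j N e2"
  shows "adds S W I b (Seq c1 c2) T R j N (\<lambda>p. e1 p + e2 p)"
  unfolding adds_def
proof (intro allI impI)
  fix M
  assume M: "agr (insert j R) M T"
    and bd: "\<forall>p. tab M j p < W \<and> (b \<longrightarrow> tab M j p + (e1 p + e2 p) < W)"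
  have bd1: "b \<Longrightarrow> tab M j p + e1 p < W" for p
    using bd by (metis add.assoc add_lessD1)
  obtain t1 M1 where 1: "exec S W I c1 M t1 M1" "t1 \<le> com_size c1 * N"
    "\<And>p. tab M1 j p = accum b (tab M j p) (e1 p)" "agr (insert j R) M1 T"
    by (rule addsD[OF assms(1) M]) (use bd bd1 in auto)
  have bd2: "tab M1 j p < W" "b \<Longrightarrow> tab M1 j p + e2 p < W" for p
    using bd[rule_format, of p] 1(3)[of p] by (auto simp: accum_def)
  obtain t2 M2 where 2: "exec S W I c2 M1 t2 M2" "t2 \<le> com_size c2 * N"
    "\<And>p. tab M2 j p = accum b (tab M1 j p) (e2 p)" "agr (insert j R) M2 T"
    by (rule addsD[OF assms(2) 1(4)]) (use bd2 in auto)
  show "\<exists>t M'. exec S W I (Seq c1 c2) M t M' \<and> t \<le> com_size (Seq c1 c2) * N \<and>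
     (\<forall>p. tab M' j p = accum b (tab M j p) (e1 p + e2 p)) \<and> agr (insert j R) M' T"
  proof (intro exI conjI)
    show "exec S W I (Seq c1 c2) M (t1 + t2) M2" by (rule exec_Seq[OF 1(1) 2(1)])
    show "t1 + t2 \<le> com_size (Seq c1 c2) * N" using 1(2) 2(2) by (simp add: add_mult_distrib)
    show "\<forall>p. tab M2 j p = accum b (tab M j p) (e1 p + e2 p)" using 1(3) 2(3) by (simp add: accum_accum)
  qed (rule 2(4))
qed

lemma adds_Skip:
  assumes "N \<ge> 1"
  shows "adds S W I b Skip T R j N (\<lambda>_. 0)"
  unfolding adds_def using assms by (fastforce intro: exec_Skip)

lemma adds_cond:
  assumes "indep I (insert j R) x"
    and "ev I T x \<noteq> 0 \<Longrightarrow> adds S W I b c1 T R j N e1"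
    and "ev I T x = 0 \<Longrightarrow> adds S W I b c2 T R j N e2" and "N \<ge> 1"
  shows "adds S W I b (Cond x c1 c2) T R j N (if ev I T x \<noteq> 0 then e1 else e2)"
  unfolding adds_def
proof (intro allI impI)
  fix M
  assume M: "agr (insert j R) M T"
    and bd: "\<forall>p. tab M j p < W \<and> (b \<longrightarrow> tab M j p + (if ev I T x \<noteq> 0 then e1 else e2) p < W)"
  have e: "eval_exp I M x = ev I T x" using assms M indepD by blast
  show "\<exists>t M'. exec S W I (Cond x c1 c2) M t M' \<and> t \<le> com_size (Cond x c1 c2) * N \<and>
     (\<forall>p. tab M' j p = accum b (tab M j p) ((if ev I T x \<noteq> 0 then e1 else e2) p)) \<and>
     agr (insert j R) M' T"
  proof (cases "ev I T x = 0")
    case True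
    obtain t1 M1 where 1: "exec S W I c2 M t1 M1" "t1 \<le> com_size c2 * N"
      "\<And>p. tab M1 j p = accum b (tab M j p) (e2 p)" "agr (insert j R) M1 T"
      by (rule addsD[OF assms(3)[OF True] M]) (use bd True in auto)
    have "1 + exp_cost x + t1 \<le> com_size (Cond x c1 c2) * N"
    proof -
      have "(1 + exp_cost x) * 1 \<le> (1 + exp_cost x) * N" using assms(4) by (intro mult_le_mono) auto
      moreover have "0 \<le> com_size c1 * N" by simp
      ultimately show ?thesis using 1(2) by (simp add: algebra_simps)
    qed
    moreover have "exec S W I (Cond x c1 c2) M (1 + exp_cost x + t1) M1"
      using exec_Cond_False[OF _ 1(1)] True e by simp
    ultimately show ?thesis using 1(3,4) True by auto
  next
    case False
    obtain t1 M1 where 1: "exec S W I c1 M t1 M1" "t1 \<le> com_size c1 * N"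
      "\<And>p. tab M1 j p = accum b (tab M j p) (e1 p)" "agr (insert j R) M1 T"
      by (rule addsD[OF assms(2)[OF False] M]) (use bd False in auto)
    have "1 + exp_cost x + t1 \<le> com_size (Cond x c1 c2) * N"
    proof -
      have "(1 + exp_cost x) * 1 \<le> (1 + exp_cost x) * N" using assms(4) by (intro mult_le_mono) auto
      then show ?thesis using 1(2) by (simp add: algebra_simps)
    qed
    moreover have "exec S W I (Cond x c1 c2) M (1 + exp_cost x + t1) M1"
      using exec_Cond_True[OF _ 1(1)] False e by simp
    ultimately show ?thesis using 1(3,4) False by auto
  qed
qed

text \<open>Increments are additive, so the effect of a loop is the sum of the effects of its
  iterations. The body has to work for arbitrary contents of tables \<open>i\<close> and
  \<open>z\<close> beyond entry 0, which the loop does not control. The summand 1 in the bound for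
  \<open>N\<close> pays for the initialization and the last test.\<close>

lemma adds_loop:
  fixes xs :: "nat list"
  assumes ij: "i < 64" "z < 64" "i \<noteq> z" "i \<notin> R" "z \<notin> R" "j \<noteq> i" "j \<noteq> z" "64 \<le> S"
    and len: "indep I (insert j (insert i (insert z R))) len" "ev I T len = length xs"
    and el: "indep I (insert j (insert z R)) el"
      "\<And>k f. k < length xs \<Longrightarrow> f 0 = k \<Longrightarrow> ev I (T(i := f)) el = xs ! k"
    and body: "\<And>k f g. k < length xs \<Longrightarrow> f 0 = xs ! k \<Longrightarrow>
      adds S W I b c (T(i := g, z := f)) R j (Nb (xs ! k)) (eb (xs ! k))"
    and bds: "length xs < W" "\<And>x. x \<in> set xs \<Longrightarrow> x < W"
    and Nb: "\<And>x. x \<in> set xs \<Longrightarrow> Nb x \<ge> 1" and N: "N \<ge> 1 + (\<Sum>x\<leftarrow>xs. Nb x)"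
  shows "adds S W I b (loop i z len el c) T (insert i (insert z R)) j N (\<lambda>p. \<Sum>x\<leftarrow>xs. eb x p)"
proof -
  let ?R = "insert j (insert i (insert z R))"
  let ?w = "Seq (Store (cell z (Num 0)) el)
      (Seq c (Store (cell i (Num 0)) (Add (var i) (Num 1))))"
  let ?W = "While (Lt (var i) len) ?w"
  let ?K = "com_size ?W"
  have main: "k \<le> length xs \<Longrightarrow> agr ?R M T \<Longrightarrow> tab M i 0 = k \<Longrightarrow>
      (\<And>p. tab M j p < W) \<Longrightarrow> (\<And>p. b \<Longrightarrow> tab M j p + (\<Sum>x\<leftarrow>drop k xs. eb x p) < W) \<Longrightarrow>
      \<exists>t M'. exec S W I ?W M t M' \<and> t \<le> ?K * (1 + (\<Sum>x\<leftarrow>drop k xs. Nb x)) \<and>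
       (\<forall>p. tab M' j p = accum b (tab M j p) (\<Sum>x\<leftarrow>drop k xs. eb x p)) \<and> agr ?R M' T" for k M
  proof (induction "length xs - k" arbitrary: k M)
    case 0
    have l: "eval_exp I M len = length xs" using len indepD[OF len(1) 0(3)] by simp
    from 0 have k: "k = length xs" by simp
    have "eval_exp I M (Lt (var i) len) = 0" using l 0(4) k by simp
    from exec_While_False[OF this] k 0(3) show ?case by fastforce
  next
    case (Suc d)
    then have k: "k < length xs" by simp
    let ?x = "xs ! k"
    have dr: "drop k xs = ?x # drop (Suc k) xs" using k by (simp add: Cons_nth_drop_Suc)
    have l: "eval_exp I M len = length xs" using len indepD[OF len(1) Suc(4)] by simp
    have ct: "eval_exp I M (Lt (var i) len) \<noteq> 0" using l Suc(5) k by simp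
    have ag0: "agr (insert j (insert z R)) M (T(i := tab M i))"
      using Suc(4) by (auto simp: agr_def)
    have x: "eval_exp I M el = ?x"
      using indepD[OF el(1) ag0] el(2)[OF k, of "tab M i"] Suc(5) by simp
    let ?M1 = "M(z := ?x)"
    have z0: "?M1 = M(0 * 64 + z := ?x)" by simp
    have s1: "exec S W I (Store (cell z (Num 0)) el) M (1 + exp_cost (cell z (Num 0)) + exp_cost el) ?M1"
      using exec_Store[of I M "cell z (Num 0)" S el W] x ij bds(2) k by simp
    have t1: "m < 64 \<Longrightarrow> tab ?M1 m = (if m = z then (tab M z)(0 := ?x) else tab M m)" for m
      unfolding z0 using tab_upd ij(2) by blast
    let ?f = "(tab M z)(0 := ?x)"
    have ag1: "agr (insert j R) ?M1 (T(i := tab M i, z := ?f))"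
      using Suc(4) t1 ij by (auto simp: agr_def)
    have j1: "tab ?M1 j p = tab M j p" for p
      using ij tab_def by (cases "j < 64") (simp add: t1, simp add: tab_def)
    have Wx: "b \<Longrightarrow> tab M j p + eb ?x p < W" for p
      using Suc(7)[of p] dr by simp
    obtain t2 M2 where M2: "exec S W I c ?M1 t2 M2" "t2 \<le> com_size c * Nb ?x"
      "\<And>p. tab M2 j p = accum b (tab ?M1 j p) (eb ?x p)"
      "agr (insert j R) M2 (T(i := tab M i, z := ?f))"
      using addsD[OF body[OF k, of ?f "tab M i"] ag1] Suc(6) Wx j1 by auto
    have i2: "tab M2 i = tab M i" using M2(4) ij by (auto simp: agr_def)
    let ?M3 = "M2(i := Suc k)"
    have i0: "?M3 = M2(0 * 64 + i := Suc k)" by simp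
    have s3: "exec S W I (Store (cell i (Num 0)) (Add (var i) (Num 1))) M2
        (1 + exp_cost (cell i (Num 0)) + exp_cost (Add (var i) (Num 1))) ?M3"
      using exec_Store[of I M2 "cell i (Num 0)" S "Add (var i) (Num 1)" W] ij bds k i2 Suc(5) by simp
    have t3: "m < 64 \<Longrightarrow> tab ?M3 m = (if m = i then (tab M2 i)(0 := Suc k) else tab M2 m)" for m
      unfolding i0 using tab_upd ij(1) by blast
    have ag3: "agr ?R ?M3 T" using M2(4) t3 ij by (auto simp: agr_def)
    have i3: "tab ?M3 i 0 = Suc k" using t3 ij by simp
    have j3: "tab ?M3 j p = accum b (tab M j p) (eb ?x p)" for p
      using M2(3) j1 ij by (cases "j < 64") (simp add: t3, simp add: tab_def)
    have W3: "tab ?M3 j p < W" "b \<Longrightarrow> tab ?M3 j p + (\<Sum>x\<leftarrow>drop (Suc k) xs. eb x p) < W" for p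
      using Suc(6)[of p] Suc(7)[of p] Wx[of p] unfolding j3 dr accum_def by (auto simp: less_imp_diff_less)
    have d: "d = length xs - Suc k" "Suc k \<le> length xs" using Suc(2) k by auto
    obtain t4 M4 where M4: "exec S W I ?W ?M3 t4 M4" "t4 \<le> ?K * (1 + (\<Sum>x\<leftarrow>drop (Suc k) xs. Nb x))"
      "\<And>p. tab M4 j p = accum b (tab ?M3 j p) (\<Sum>x\<leftarrow>drop (Suc k) xs. eb x p)" "agr ?R M4 T"
      using Suc(1)[OF d ag3 i3 W3] by blast
    have ex: "exec S W I ?W M (1 + exp_cost (Lt (var i) len) + ((1 + exp_cost (cell z (Num 0)) + exp_cost el)
       + (t2 + (1 + exp_cost (cell i (Num 0)) + exp_cost (Add (var i) (Num 1))))) + t4) M4"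
      by (rule exec_While_True[OF ct exec_Seq[OF s1 exec_Seq[OF M2(1) s3]] M4(1)])
    let ?c0 = "1 + exp_cost (Lt (var i) len) + (1 + exp_cost (cell z (Num 0)) + exp_cost el)
       + (1 + exp_cost (cell i (Num 0)) + exp_cost (Add (var i) (Num 1)))"
    have K: "?K = ?c0 + com_size c" by simp
    \<comment> \<open>The overhead \<open>?c0\<close> of one iteration is absorbed because every
      iteration is charged at least 1.\<close>
    have "?c0 * 1 \<le> ?c0 * Nb ?x" using Nb[of ?x] k by (intro mult_le_mono) auto
    then have "?c0 + t2 \<le> ?K * Nb ?x" unfolding K using M2(2) by (simp only: algebra_simps)
    then have "1 + exp_cost (Lt (var i) len) + ((1 + exp_cost (cell z (Num 0)) + exp_cost el)
       + (t2 + (1 + exp_cost (cell i (Num 0)) + exp_cost (Add (var i) (Num 1))))) + t4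
       \<le> ?K * Nb ?x + ?K * (1 + (\<Sum>x\<leftarrow>drop (Suc k) xs. Nb x))" using M4(2) by linarith
    also have "\<dots> = ?K * (1 + (\<Sum>x\<leftarrow>drop k xs. Nb x))" unfolding dr by (simp only: list.map sum_list.Cons algebra_simps)
    finally show ?case using ex M4(3,4) unfolding j3 dr
      by (intro exI conjI) (auto simp: accum_accum)
  qed
  show ?thesis
    unfolding adds_def
  proof (intro allI impI)
    fix M
    assume M: "agr ?R M T"
      and bd: "\<forall>p. tab M j p < W \<and> (b \<longrightarrow> tab M j p + (\<Sum>x\<leftarrow>xs. eb x p) < W)"
    let ?M1 = "M(i := 0)"
    have i0: "?M1 = M(0 * 64 + i := 0)" by simp
    have t1: "m < 64 \<Longrightarrow> tab ?M1 m = (if m = i then (tab M i)(0 := 0) else tab M m)" for m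
      unfolding i0 using tab_upd ij(1) by blast
    have s1: "exec S W I (Store (cell i (Num 0)) (Num 0)) M
        (1 + exp_cost (cell i (Num 0)) + exp_cost (Num 0)) ?M1"
      using exec_Store[of I M "cell i (Num 0)" S "Num 0" W] ij bds(1) by simp
    have ag: "agr ?R ?M1 T" using M t1 by (auto simp: agr_def)
    have j1: "tab ?M1 j p = tab M j p" for p
      using ij by (cases "j < 64") (simp add: t1, simp add: tab_def)
    have i1: "tab ?M1 i 0 = 0" using t1[of i] ij by simp
    have bd1: "tab ?M1 j p < W" "b \<Longrightarrow> tab ?M1 j p + (\<Sum>x\<leftarrow>drop 0 xs. eb x p) < W" for p
      using bd unfolding j1 by auto
    obtain t M' where M': "exec S W I ?W ?M1 t M'" "t \<le> ?K * (1 + (\<Sum>x\<leftarrow>xs. Nb x))"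
      "\<forall>p. tab M' j p = accum b (tab ?M1 j p) (\<Sum>x\<leftarrow>xs. eb x p)" "agr ?R M' T"
      using main[OF _ ag i1 bd1, simplified drop_0] by blast
    have "?K * (1 + (\<Sum>x\<leftarrow>xs. Nb x)) \<le> ?K * N" using N by (intro mult_le_mono) auto
    moreover have "(1 + exp_cost (cell i (Num 0)) + exp_cost (Num 0)) * 1
        \<le> (1 + exp_cost (cell i (Num 0)) + exp_cost (Num 0)) * N" using N by (intro mult_le_mono) auto
    ultimately have "1 + exp_cost (cell i (Num 0)) + exp_cost (Num 0) + t \<le> com_size (loop i z len el c) * N"
      using M'(2) unfolding loop_def com_size.simps by (simp only: add_mult_distrib)
    then show "\<exists>t M'. exec S W I (loop i z len el c) M t M' \<and> t \<le> com_size (loop i z len el c) * N \<and>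
       (\<forall>p. tab M' j p = accum b (tab M j p) (\<Sum>x\<leftarrow>xs. eb x p)) \<and> agr ?R M' T"
      using exec_Seq[OF s1 M'(1)] M'(3,4) j1 unfolding loop_def by metis
  qed
qed

section \<open>Straight-line steps and loops over neighbours\<close>

lemma indep_ev: "indep I R e \<Longrightarrow> (\<And>k. k < 64 \<Longrightarrow> k \<notin> R \<Longrightarrow> T k = T' k) \<Longrightarrow> ev I T e = ev I T' e"
  unfolding indep_def ev_def[of I T] by (simp add: agr_def)

lemma indep_mono: "indep I R' e \<Longrightarrow> R \<subseteq> R' \<Longrightarrow> indep I R e"
  unfolding indep_def using agr_mono by blast

lemma adds_upd_of_bool:
  assumes "j < 64" "indep I (insert j R) x" "indep I (insert j R) p" "indep I (insert j R) v"
    and "ev I T p * 64 + j < S" "b \<longleftrightarrow> ev I T x \<noteq> 0" "N \<ge> 1"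
  shows "adds S W I b (upd x j p v) T R j N (\<lambda>q. of_bool (q = ev I T p) * ev I T v)"
  by (rule adds_mono[OF adds_upd[OF assms] order_refl]) simp

lemma agr_insert_upd [simp]: "agr (insert j R) M (T(j := f)) = agr (insert j R) M T"
  by (auto simp: agr_def)

lemma adds_same_table [simp]: "adds S W I b c (T(j := f)) R j N e = adds S W I b c T R j N e"
  by (simp add: adds_def)

definition scratch :: "nat set" where
  "scratch = {14, 15, 16, 17}"

text \<open>\<open>adds\<close> describes an increment and can be iterated; \<open>steps\<close>
  describes an exact transition of the tables and can be chained. The same \<open>N\<close> serves
  both halves of a sequence, since \<open>com_size\<close> is additive.\<close>

definition steps :: "nat \<Rightarrow> nat \<Rightarrow> inputs \<Rightarrow> com \<Rightarrow> (nat \<Rightarrow> nat \<Rightarrow> nat) \<Rightarrow> nat \<Rightarrow> (nat \<Rightarrow> nat \<Rightarrow> nat)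
    \<Rightarrow> bool" where
  "steps S W I c T N T' \<longleftrightarrow> (\<forall>M. agr scratch M T \<longrightarrow>
     (\<exists>t M'. exec S W I c M t M' \<and> t \<le> com_size c * N \<and> agr scratch M' T'))"

lemma steps_mono: "steps S W I c T N T' \<Longrightarrow> N \<le> N' \<Longrightarrow> steps S W I c T N' T'"
  unfolding steps_def by (meson le_trans mult_le_mono2)

lemma steps_Skip: "N \<ge> 1 \<Longrightarrow> steps S W I Skip T N T"
  unfolding steps_def by (fastforce intro: exec_Skip)

lemma steps_Seq:
  assumes "steps S W I c1 T N T1" "steps S W I c2 T1 N T2"
  shows "steps S W I (Seq c1 c2) T N T2"
  unfolding steps_def
proof (intro allI impI)
  fix M assume "agr scratch M T"
  then obtain t1 M1 where 1: "exec S W I c1 M t1 M1" "t1 \<le> com_size c1 * N" "agr scratch M1 T1"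
    using assms(1) unfolding steps_def by blast
  then obtain t2 M2 where 2: "exec S W I c2 M1 t2 M2" "t2 \<le> com_size c2 * N" "agr scratch M2 T2"
    using assms(2) unfolding steps_def by blast
  show "\<exists>t M'. exec S W I (Seq c1 c2) M t M' \<and> t \<le> com_size (Seq c1 c2) * N \<and> agr scratch M' T2"
    using exec_Seq[OF 1(1) 2(1)] 1(2) 2(2,3)
    by (intro exI[of _ "t1 + t2"] exI[of _ M2]) (simp add: add_mult_distrib)
qed

lemma steps_Cond:
  assumes "indep I scratch x" "N \<ge> 1"
    and "ev I T x \<noteq> 0 \<Longrightarrow> steps S W I c1 T N T'" "ev I T x = 0 \<Longrightarrow> steps S W I c2 T N T'"
  shows "steps S W I (Cond x c1 c2) T N T'"
  unfolding steps_def
proof (intro allI impI)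
  fix M assume M: "agr scratch M T"
  have e: "eval_exp I M x = ev I T x" using assms(1) M indepD by blast
  have N: "(1 + exp_cost x) * 1 \<le> (1 + exp_cost x) * N" using assms(2) by (intro mult_le_mono) auto
  show "\<exists>t M'. exec S W I (Cond x c1 c2) M t M' \<and> t \<le> com_size (Cond x c1 c2) * N \<and> agr scratch M' T'"
  proof (cases "ev I T x = 0")
    case True
    then obtain t1 M1 where 1: "exec S W I c2 M t1 M1" "t1 \<le> com_size c2 * N" "agr scratch M1 T'"
      using assms(4) M unfolding steps_def by blast
    have "exec S W I (Cond x c1 c2) M (1 + exp_cost x + t1) M1"
      using exec_Cond_False[OF _ 1(1)] True e by simp
    moreover have "1 + exp_cost x + t1 \<le> com_size (Cond x c1 c2) * N"
      using N 1(2) by (simp add: algebra_simps)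
    ultimately show ?thesis using 1(3) by blast
  next
    case False
    then obtain t1 M1 where 1: "exec S W I c1 M t1 M1" "t1 \<le> com_size c1 * N" "agr scratch M1 T'"
      using assms(3) M unfolding steps_def by blast
    have "exec S W I (Cond x c1 c2) M (1 + exp_cost x + t1) M1"
      using exec_Cond_True[OF _ 1(1)] False e by simp
    moreover have "1 + exp_cost x + t1 \<le> com_size (Cond x c1 c2) * N"
      using N 1(2) by (simp add: algebra_simps)
    ultimately show ?thesis using 1(3) by blast
  qed
qed

lemma steps_Store:
  assumes "j < 64" "j \<notin> scratch" "indep I scratch p" "indep I scratch v" "N \<ge> 1"
    and "ev I T p * 64 + j < S" "ev I T v < W"
  shows "steps S W I (Store (cell j p) v) T N (T(j := (T j)(ev I T p := ev I T v)))"
  unfolding steps_def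
proof (intro allI impI)
  fix M assume M: "agr scratch M T"
  have e: "eval_exp I M p = ev I T p" "eval_exp I M v = ev I T v" using assms M indepD by blast+
  have "exec S W I (Store (cell j p) v) M (1 + exp_cost (cell j p) + exp_cost v)
      (M(ev I T p * 64 + j := ev I T v))"
    using exec_Store[of I M "cell j p" S v W] e assms by simp
  moreover have "1 + exp_cost (cell j p) + exp_cost v \<le> com_size (Store (cell j p) v) * N"
    using assms(5) by (metis com_size.simps(2) mult.right_neutral mult_le_mono2)
  moreover have "agr scratch (M(ev I T p * 64 + j := ev I T v)) (T(j := (T j)(ev I T p := ev I T v)))"
    using M assms(1,2) by (simp add: agr_def tab_upd)
  ultimately show "\<exists>t M'. exec S W I (Store (cell j p) v) M t M' \<and>
      t \<le> com_size (Store (cell j p) v) * N \<and> agr scratch M' (T(j := (T j)(ev I T p := ev I T v)))"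
    by blast
qed

lemma steps_adds:
  assumes "adds S W I b c T scratch j N e" "j \<notin> scratch" "j < 64"
    and "\<And>q. T j q < W" "\<And>q. b \<Longrightarrow> T j q + e q < W"
  shows "steps S W I c T N (T(j := (\<lambda>q. accum b (T j q) (e q))))"
  unfolding steps_def
proof (intro allI impI)
  fix M assume M: "agr scratch M T"
  have jM: "tab M j = T j" using M assms(2,3) by (auto simp: agr_def)
  have ag: "agr (insert j scratch) M T" using M by (auto simp: agr_def)
  obtain t M' where M': "exec S W I c M t M'" "t \<le> com_size c * N"
    "\<And>p. tab M' j p = accum b (tab M j p) (e p)" "agr (insert j scratch) M' T"
    by (rule addsD[OF assms(1) ag]) (use assms(4,5) jM in auto)
  have "agr scratch M' (T(j := \<lambda>q. accum b (T j q) (e q)))"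
    using M'(3,4) jM by (auto simp: agr_def)
  then show "\<exists>t M'. exec S W I c M t M' \<and> t \<le> com_size c * N \<and>
      agr scratch M' (T(j := \<lambda>q. accum b (T j q) (e q)))"
    using M'(1,2) by blast
qed

definition pick :: "bool \<Rightarrow> 'a \<Rightarrow> 'a \<Rightarrow> 'a" where
  "pick b x y = (if b then x else y)"

text \<open>One specification for both directions: \<open>old\<close> and \<open>new\<close> are the
  contents without and with the toggled item. A bound for \<open>new\<close> suffices, as
  \<open>old\<close> lies below it.\<close>

lemma steps_toggle:
  assumes "adds S W I b c T scratch j N e" "j \<notin> scratch" "j < 64"
    and "T j = pick b old new" "\<And>q. new q = old q + e q" "\<And>q. new q < W"
  shows "steps S W I c T N (T(j := pick b new old))"
proof -
  have "T j q < W" for q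
    using assms(4) assms(5,6)[of q] by (auto simp: pick_def)
  moreover have "b \<Longrightarrow> T j q + e q < W" for q
    using assms(4) assms(5,6)[of q] by (auto simp: pick_def)
  ultimately have "steps S W I c T N (T(j := (\<lambda>q. accum b (T j q) (e q))))"
    by (rule steps_adds[OF assms(1-3)])
  moreover have "(\<lambda>q. accum b (T j q) (e q)) = pick b new old"
    using assms(4,5) by (auto simp: pick_def accum_def)
  ultimately show ?thesis by simp
qed

text \<open>Only entry 0 of a table that serves as a variable is ever used.\<close>

definition scalar :: "nat \<Rightarrow> nat \<Rightarrow> nat" where
  "scalar v q = of_bool (q = 0) * v"

lemma scalar_0 [simp]: "scalar v 0 = v"
  by (simp add: scalar_def)

text \<open>With zeros beyond entry 0, overwriting entry 0 alone turns the whole table into a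
  \<open>scalar\<close>, so the content of a variable is known exactly.\<close>

definition vars_ok :: "(nat \<Rightarrow> nat \<Rightarrow> nat) \<Rightarrow> bool" where
  "vars_ok T \<longleftrightarrow> (\<forall>j. 20 \<le> j \<longrightarrow> j < 32 \<longrightarrow> (\<forall>q. q \<noteq> 0 \<longrightarrow> T j q = 0))"

lemma vars_ok_upd [simp]:
  assumes "j < 20 \<or> 32 \<le> j"
  shows "vars_ok (T(j := f)) = vars_ok T"
proof -
  have "(T(j := f)) k = T k" if "20 \<le> k" "k < 32" for k
    using that assms by (cases "k = j") auto
  then show ?thesis by (simp add: vars_ok_def)
qed

lemma vars_ok_scalar [simp]: "vars_ok T \<Longrightarrow> vars_ok (T(j := scalar v))"
  by (auto simp: vars_ok_def scalar_def)

definition gather :: "nat \<Rightarrow> com \<Rightarrow> com" where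
  "gather j c = Seq (Store (cell j (Num 0)) (Num 0)) c"

lemma steps_gather:
  assumes "adds S W I True c T scratch j N e" "20 \<le> j" "j < 32" "N \<ge> 1" "64 \<le> S"
    and "vars_ok T" "\<And>q. e q = scalar v q" "v < W"
  shows "steps S W I (gather j c) T N (T(j := scalar v))"
proof -
  have j: "j < 64" "j \<notin> scratch" using assms by (auto simp: scratch_def)
  have "(T j)(0 := 0) = scalar 0"
    using assms(2,3,6) by (auto simp: vars_ok_def scalar_def)
  then have "steps S W I (Store (cell j (Num 0)) (Num 0)) T N (T(j := scalar 0))"
    using steps_Store[of j I "Num 0" "Num 0" N T S W] j assms by simp
  moreover have "steps S W I c (T(j := scalar 0)) N (T(j := scalar v))"
  proof -
    have "adds S W I True c (T(j := scalar 0)) scratch j N e" using assms(1) by simp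
    then have "steps S W I c (T(j := scalar 0)) N
        ((T(j := scalar 0))(j := (\<lambda>q. accum True ((T(j := scalar 0)) j q) (e q))))"
      by (rule steps_adds) (use assms j in \<open>auto simp: scalar_def\<close>)
    moreover have "(\<lambda>q. accum True ((T(j := scalar 0)) j q) (e q)) = scalar v"
      using assms(7) by (auto simp: accum_def scalar_def)
    ultimately show ?thesis by simp
  qed
  ultimately show ?thesis unfolding gather_def by (rule steps_Seq)
qed

section \<open>Expressions that hide the toggled edge or mark\<close>

definition notE :: "exp \<Rightarrow> exp" where "notE a = Equal a (Num 0)"
definition adjE :: "exp \<Rightarrow> exp \<Rightarrow> exp" where
  "adjE a b = Mul (Adjacent a b) (Mul (notE (Equal a Source)) (Mul (notE (Equal b Source))
     (Mul (notE (Mul (Equal a (var 2)) (Equal b (var 3))))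
          (notE (Mul (Equal a (var 3)) (Equal b (var 2)))))))"
definition selE :: "exp \<Rightarrow> exp" where
  "selE a = Mul (Adjacent Source a) (notE (Equal a (var 4)))"
definition degE :: "exp \<Rightarrow> exp" where
  "degE a = Sub (Degree a) (Adjacent a Source)"
definition heavyE :: "exp \<Rightarrow> exp" where
  "heavyE a = ld 10 a"
definition lightE :: "exp \<Rightarrow> exp" where
  "lightE a = notE (ld 10 a)"
definition idxE :: "exp \<Rightarrow> exp \<Rightarrow> exp" where
  "idxE a b = Add (Mul a Num_Vertices) b"

text \<open>The toggled edge \<open>{x, y}\<close> or the toggled neighbour \<open>w\<close> of the source is ignored, so both
  functions describe the graph without it, no matter whether it was just inserted or deleted.\<close>

definition adjf :: "inputs \<Rightarrow> nat \<Rightarrow> nat \<Rightarrow> nat \<Rightarrow> nat \<Rightarrow> nat" where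
  "adjf I x y u v = of_bool (v \<in> set (in_nbs I u) \<and> u \<noteq> in_s I \<and> v \<noteq> in_s I \<and>
     \<not> (u = x \<and> v = y) \<and> \<not> (u = y \<and> v = x))"
definition self :: "inputs \<Rightarrow> nat \<Rightarrow> nat \<Rightarrow> nat" where
  "self I w u = of_bool (u \<in> set (in_nbs I (in_s I)) \<and> u \<noteq> w)"

lemma ev_macros [simp]:
  "ev I T (notE a) = of_bool (ev I T a = 0)"
  "ev I T (adjE a b) = adjf I (T 2 0) (T 3 0) (ev I T a) (ev I T b)"
  "ev I T (selE a) = self I (T 4 0) (ev I T a)"
  "ev I T (degE a) = length (in_nbs I (ev I T a)) - of_bool (in_s I \<in> set (in_nbs I (ev I T a)))"
  "ev I T (heavyE a) = T 10 (ev I T a)"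
  "ev I T (lightE a) = of_bool (T 10 (ev I T a) = 0)"
  "ev I T (idxE a b) = ev I T a * in_n I + ev I T b"
  by (auto simp: notE_def adjE_def selE_def degE_def heavyE_def lightE_def idxE_def adjf_def self_def)

lemma indep_macros [simp]:
  "indep I R a \<Longrightarrow> indep I R (notE a)"
  "indep I R a \<Longrightarrow> indep I R b \<Longrightarrow> 2 \<notin> R \<Longrightarrow> 3 \<notin> R \<Longrightarrow> indep I R (adjE a b)"
  "indep I R a \<Longrightarrow> 4 \<notin> R \<Longrightarrow> indep I R (selE a)"
  "indep I R a \<Longrightarrow> indep I R (degE a)"
  "indep I R a \<Longrightarrow> 10 \<notin> R \<Longrightarrow> indep I R (heavyE a)"
  "indep I R a \<Longrightarrow> 10 \<notin> R \<Longrightarrow> indep I R (lightE a)"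
  "indep I R a \<Longrightarrow> indep I R b \<Longrightarrow> indep I R (idxE a b)"
  by (auto simp: notE_def adjE_def selE_def degE_def heavyE_def lightE_def idxE_def)

section \<open>Loops over neighbourhoods and over the heavy list\<close>

definition loop_nbs :: "nat \<Rightarrow> nat \<Rightarrow> exp \<Rightarrow> com \<Rightarrow> com" where
  "loop_nbs i z x c = loop i z (Degree x) (Neighbour x (var i)) c"
definition loop_heavy :: "com \<Rightarrow> com" where
  "loop_heavy c = loop 14 15 (var 8) (ld 9 (var 14)) c"

definition heavy_list :: "nat set \<Rightarrow> (nat \<Rightarrow> nat \<Rightarrow> nat) \<Rightarrow> bool" where
  "heavy_list H T \<longleftrightarrow> bij_betw (T 9) {..<T 8 0} H \<and> (\<forall>v. T 10 v = of_bool (v \<in> H))"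

lemma heavy_list_upd [simp]:
  "j \<noteq> 8 \<Longrightarrow> j \<noteq> 9 \<Longrightarrow> j \<noteq> 10 \<Longrightarrow> heavy_list H (T(j := f)) = heavy_list H T"
  by (simp add: heavy_list_def)

text \<open>The word bound leaves room for all sums that are kept, which are at most
  \<open>n * (n * n)\<close>, and for the counts themselves, which turn out to be at most
  \<open>4 * (n + 1) ^ 4\<close>.\<close>

locale machine =
  fixes S W :: nat and I :: inputs
  assumes S64: "64 \<le> S" and W_big: "64 * (in_n I + 1) ^ 4 < W"
    and nbs_distinct: "distinct (in_nbs I v)"
    and nbs_sym: "u \<in> set (in_nbs I v) \<longleftrightarrow> v \<in> set (in_nbs I u)"
    and nbs_irrefl: "v \<notin> set (in_nbs I v)"
    and nbs_less: "u \<in> set (in_nbs I v) \<Longrightarrow> u < in_n I"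
    and source_less: "in_s I < in_n I"
begin

abbreviation "n \<equiv> in_n I"
abbreviation "nbs \<equiv> in_nbs I"
abbreviation "adds' \<equiv> adds S W I"
abbreviation "steps' \<equiv> steps S W I"

lemma W_pow: "n < W" "n + 1 < W"
proof -
  have "n + 1 \<le> (n + 1) ^ 4" by (rule self_le_power) auto
  then show "n + 1 < W" using W_big by linarith
  then show "n < W" by simp
qed

lemma length_nbs: "length (nbs v) \<le> n"
proof -
  have "set (nbs v) \<subseteq> {..<n}" using nbs_less by auto
  then have "card (set (nbs v)) \<le> n" using card_mono[of "{..<n}"] by fastforce
  then show ?thesis using distinct_card[OF nbs_distinct] by simp
qed

text \<open>Adjacency lists are distinct, so the sum over the list is a sum over the neighbourhood,
  and the unspecified order of the list disappears.\<close>

lemma adds_loop_nbs: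
  assumes "i < 64" "z < 64" "i \<noteq> z" "i \<notin> R" "z \<notin> R" "j \<noteq> i" "j \<noteq> z"
    and x: "indep I (insert j (insert i (insert z R))) x" "ev I T x = u"
    and body: "\<And>w f g. w \<in> set (nbs u) \<Longrightarrow> f 0 = w \<Longrightarrow>
      adds' b c (T(i := g, z := f)) R j (Nb w) (eb w)"
    and Nb: "\<And>w. w \<in> set (nbs u) \<Longrightarrow> Nb w \<ge> 1" and N: "N \<ge> 1 + (\<Sum>w\<in>set (nbs u). Nb w)"
    and R: "R' = insert i (insert z R)"
  shows "adds' b (loop_nbs i z x c) T R' j N (\<lambda>p. \<Sum>w\<in>set (nbs u). eb w p)"
proof -
  have el: "indep I (insert j (insert z R)) (Neighbour x (var i))"
  proof -
    have "indep I (insert j (insert z R)) x"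
      by (rule indep_mono[OF x(1)]) auto
    then show ?thesis using assms(1-7) by simp
  qed
  have xi: "ev I (T(i := f)) x = u" for f
    using indep_ev[OF x(1), of "T(i := f)" T] x(2) by simp
  have "adds' b (loop_nbs i z x c) T (insert i (insert z R)) j N (\<lambda>p. \<Sum>w\<leftarrow>nbs u. eb w p)"
    unfolding loop_nbs_def
  proof (rule adds_loop[where Nb = Nb])
    show "adds' b c (T(i := g, z := f)) R j (Nb (nbs u ! k)) (eb (nbs u ! k))"
      if "k < length (nbs u)" "f 0 = nbs u ! k" for k f g
      using body[of "nbs u ! k" f g] that by simp
    show "ev I (T(i := f)) (Neighbour x (var i)) = nbs u ! k" if "k < length (nbs u)" "f 0 = k" for k f
      using that xi assms(1) by (simp add: ev_Neighbour)
    show "length (nbs u) < W" using length_nbs[of u] W_pow by simp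
    show "x' < W" if "x' \<in> set (nbs u)" for x' using nbs_less[OF that] W_pow by simp
    show "1 + sum_list (map Nb (nbs u)) \<le> N"
      using N sum_list_distinct_conv_sum_set[OF nbs_distinct, of Nb u] by simp
    show "indep I (insert j (insert i (insert z R))) (Degree x)" using x by simp
    show "ev I T (Degree x) = length (nbs u)" using x by simp
  qed (use assms(1-7) el S64 Nb in blast)+
  then show ?thesis
    unfolding R by (simp add: sum_list_distinct_conv_sum_set[OF nbs_distinct])
qed

lemma adds_loop_heavy:
  assumes "j \<notin> scratch" "j \<noteq> 8" "j \<noteq> 9" "j < 64" and H: "heavy_list H T" "H \<subseteq> {..<n}"
    and body: "\<And>w f g. w \<in> H \<Longrightarrow> f 0 = w \<Longrightarrow>
      adds' b c (T(14 := g, 15 := f)) {16, 17} j 1 (eb w)"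
    and N: "N \<ge> 1 + card H"
  shows "adds' b (loop_heavy c) T scratch j N (\<lambda>p. \<Sum>w\<in>H. eb w p)"
proof -
  let ?xs = "map (T 9) [0..<T 8 0]"
  have b: "bij_betw (T 9) {..<T 8 0} H" using H unfolding heavy_list_def by auto
  have fin: "finite H" using H(2) finite_subset by blast
  have d: "distinct ?xs" using b by (auto simp: distinct_map bij_betw_def lessThan_atLeast0)
  have st: "set ?xs = H" using b by (auto simp: bij_betw_def lessThan_atLeast0)
  have len: "length ?xs = card H" using d st distinct_card by metis
  have cH: "card H \<le> n" using card_mono[OF _ H(2)] by simp
  have "adds' b (loop_heavy c) T (insert 14 (insert 15 {16, 17})) j N (\<lambda>p. \<Sum>w\<leftarrow>?xs. eb w p)"
    unfolding loop_heavy_def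
  proof (rule adds_loop[where Nb = "\<lambda>_. 1"])
    show "adds' b c (T(14 := g, 15 := f)) {16, 17} j 1 (eb (?xs ! k))"
      if "k < length ?xs" "f 0 = ?xs ! k" for k f g
      using body[of "?xs ! k" f g] that st nth_mem by metis
    show "length ?xs < W" using len cH W_pow by linarith
    show "x' < W" if "x' \<in> set ?xs" for x' using that H(2) W_pow unfolding st by auto
    show "1 + sum_list (map (\<lambda>_. 1) ?xs) \<le> N"
      using N len sum_list_triv[of "1::nat" ?xs] by simp
  qed (use assms(1-4) S64 in \<open>auto simp: scratch_def\<close>)
  then show ?thesis
    unfolding sum_list_distinct_conv_sum_set[OF d] st scratch_def by simp
qed

text \<open>\<open>P\<close> tells which entry is changed on behalf of a neighbour, so the same rule
  covers a sum into one entry and an update of a whole row or column. Summing over all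
  \<open>w < n\<close> fits the algebraic identities for the tables; the added terms vanish by
  assumption.\<close>

lemma scatter_nbs:
  assumes j: "j \<notin> scratch" "j < 64"
    and x: "indep I (insert j scratch) x" "ev I T x = u"
    and i: "indep I (insert j {16, 17}) sg" "indep I (insert j {16, 17}) p" "indep I (insert j {16, 17}) v"
    and e: "\<And>w f g. w \<in> set (nbs u) \<Longrightarrow> w < n \<Longrightarrow> f 0 = w \<Longrightarrow> ev I (T(14 := g, 15 := f)) p = P w"
      "\<And>w f g. w \<in> set (nbs u) \<Longrightarrow> w < n \<Longrightarrow> f 0 = w \<Longrightarrow> ev I (T(14 := g, 15 := f)) v = V w"
      "\<And>w f g. b \<longleftrightarrow> ev I (T(14 := g, 15 := f)) sg \<noteq> 0"
    and a: "\<And>w. w < n \<Longrightarrow> P w * 64 + 64 \<le> S" "\<And>w. w < n \<Longrightarrow> w \<notin> set (nbs u) \<Longrightarrow> V w = 0"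
    and N: "N \<ge> 1 + length (nbs u)"
  shows "adds' b (loop_nbs 14 15 x (upd sg j p v)) T scratch j N (\<lambda>q. \<Sum>w<n. of_bool (q = P w) * V w)"
proof -
  have "adds' b (loop_nbs 14 15 x (upd sg j p v)) T scratch j N
      (\<lambda>q. \<Sum>w\<in>set (nbs u). of_bool (q = P w) * V w)"
  proof (rule adds_loop_nbs[where Nb = "\<lambda>_. 1" and R = "{16, 17}"])
    fix w and f g :: "nat \<Rightarrow> nat" assume w: "w \<in> set (nbs u)" "f 0 = w"
    have n: "w < n" using w nbs_less by auto
    have "ev I (T(14 := g, 15 := f)) p * 64 + j < S"
      unfolding e(1)[of w f g, OF w(1) n w(2)] using a(1)[OF n] j by linarith
    from adds_upd_of_bool[OF j(2) i this e(3)[of g f], of 1] e(1,2)[of w f g, OF w(1) n w(2)]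
    show "adds' b (upd sg j p v) (T(14 := g, 15 := f)) {16, 17} j 1 (\<lambda>q. of_bool (q = P w) * V w)" by simp
  qed (use j x N nbs_distinct[of u] in \<open>auto simp: scratch_def distinct_card\<close>)
  then show ?thesis
  proof (rule adds_mono)
    fix q
    show "(\<Sum>w\<in>set (nbs u). of_bool (q = P w) * V w) = (\<Sum>w<n. of_bool (q = P w) * V w)"
      by (rule sum.mono_neutral_left) (use nbs_less a(2) in auto)
  qed simp
qed

lemma scatter_pairs:
  assumes j: "j \<notin> scratch" "j < 64"
    and x: "indep I (insert j scratch) x" "ev I T x = u"
    and i: "indep I {j} sg" "indep I {j} p" "indep I {j} v"
    and e: "\<And>w1 w2 f g f' g'. w1 \<in> set (nbs u) \<Longrightarrow> w2 \<in> set (nbs u) \<Longrightarrow> w1 < n \<Longrightarrow> w2 < n \<Longrightarrow>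
        f 0 = w1 \<Longrightarrow> f' 0 = w2 \<Longrightarrow> ev I (T(14 := g, 15 := f, 16 := g', 17 := f')) p = P w1 w2"
      "\<And>w1 w2 f g f' g'. w1 \<in> set (nbs u) \<Longrightarrow> w2 \<in> set (nbs u) \<Longrightarrow> w1 < n \<Longrightarrow> w2 < n \<Longrightarrow>
        f 0 = w1 \<Longrightarrow> f' 0 = w2 \<Longrightarrow> ev I (T(14 := g, 15 := f, 16 := g', 17 := f')) v = V w1 w2"
      "\<And>f g f' g'. b \<longleftrightarrow> ev I (T(14 := g, 15 := f, 16 := g', 17 := f')) sg \<noteq> 0"
    and a: "\<And>w1 w2. w1 < n \<Longrightarrow> w2 < n \<Longrightarrow> P w1 w2 * 64 + 64 \<le> S"
      "\<And>w1 w2. w1 \<notin> set (nbs u) \<or> w2 \<notin> set (nbs u) \<Longrightarrow> V w1 w2 = 0"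
    and N: "N \<ge> (1 + length (nbs u))\<^sup>2"
  shows "adds' b (loop_nbs 14 15 x (loop_nbs 16 17 x (upd sg j p v))) T scratch j N
    (\<lambda>q. \<Sum>w1<n. \<Sum>w2<n. of_bool (q = P w1 w2) * V w1 w2)"
proof -
  have xi: "indep I (insert j {16, 17}) x"
    by (rule indep_mono[OF x(1)]) (auto simp: scratch_def)
  have "adds' b (loop_nbs 14 15 x (loop_nbs 16 17 x (upd sg j p v))) T scratch j N
    (\<lambda>q. \<Sum>w1\<in>set (nbs u). \<Sum>w2\<in>set (nbs u). of_bool (q = P w1 w2) * V w1 w2)"
  proof (rule adds_loop_nbs[where Nb = "\<lambda>_. 1 + length (nbs u)" and R = "{16, 17}"])
    fix w1 and f g :: "nat \<Rightarrow> nat" assume w1: "w1 \<in> set (nbs u)" "f 0 = w1"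
    have n1: "w1 < n" using w1 nbs_less by auto
    show "adds' b (loop_nbs 16 17 x (upd sg j p v)) (T(14 := g, 15 := f)) {16, 17} j (1 + length (nbs u))
       (\<lambda>q. \<Sum>w2\<in>set (nbs u). of_bool (q = P w1 w2) * V w1 w2)"
    proof (rule adds_loop_nbs[where Nb = "\<lambda>_. 1" and R = "{}"])
      show "ev I (T(14 := g, 15 := f)) x = u"
        using indep_ev[OF x(1), of "T(14 := g, 15 := f)" T] x(2) by (simp add: scratch_def)
      fix w2 and f' g' :: "nat \<Rightarrow> nat" assume w2: "w2 \<in> set (nbs u)" "f' 0 = w2"
      have n2: "w2 < n" using w2 nbs_less by auto
      note e' = e(1,2)[of w1 w2 f f' g g', OF w1(1) w2(1) n1 n2 w1(2) w2(2)]
      have "ev I (T(14 := g, 15 := f, 16 := g', 17 := f')) p * 64 + j < S"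
        unfolding e' using a(1)[OF n1 n2] j by linarith
      from adds_upd_of_bool[OF j(2) i this e(3)[of g f g' f'], of 1] e'
      show "adds' b (upd sg j p v) (T(14 := g, 15 := f, 16 := g', 17 := f')) {} j 1
        (\<lambda>q. of_bool (q = P w1 w2) * V w1 w2)" by simp
    qed (use j xi nbs_distinct[of u] in \<open>auto simp: scratch_def distinct_card\<close>)
  next
    have "1 + (\<Sum>w\<in>set (nbs u). 1 + length (nbs u)) \<le> (1 + length (nbs u))\<^sup>2"
      using nbs_distinct[of u] by (simp add: distinct_card power2_eq_square)
    then show "1 + (\<Sum>w\<in>set (nbs u). 1 + length (nbs u)) \<le> N" using N by linarith
  qed (use j x in \<open>auto simp: scratch_def\<close>)
  then show ?thesis
  proof (rule adds_mono)
    fix q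
    have "(\<Sum>w1\<in>set (nbs u). \<Sum>w2\<in>set (nbs u). of_bool (q = P w1 w2) * V w1 w2)
        = (\<Sum>w1\<in>set (nbs u). \<Sum>w2<n. of_bool (q = P w1 w2) * V w1 w2)"
      by (intro sum.cong sum.mono_neutral_left refl) (use nbs_less a(2) in auto)
    also have "\<dots> = (\<Sum>w1<n. \<Sum>w2<n. of_bool (q = P w1 w2) * V w1 w2)"
      by (rule sum.mono_neutral_left) (use nbs_less a(2) in auto)
    finally show "(\<Sum>w1\<in>set (nbs u). \<Sum>w2\<in>set (nbs u). of_bool (q = P w1 w2) * V w1 w2)
       = (\<Sum>w1<n. \<Sum>w2<n. of_bool (q = P w1 w2) * V w1 w2)" .
  qed simp
qed

lemma scatter_heavy:
  assumes j: "j \<notin> scratch" "j < 64" "j \<noteq> 8" "j \<noteq> 9" and H: "heavy_list H T" "H \<subseteq> {..<n}"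
    and i: "indep I (insert j {16, 17}) sg" "indep I (insert j {16, 17}) p" "indep I (insert j {16, 17}) v"
    and e: "\<And>w f g. w \<in> H \<Longrightarrow> w < n \<Longrightarrow> f 0 = w \<Longrightarrow> ev I (T(14 := g, 15 := f)) p = P w"
      "\<And>w f g. w \<in> H \<Longrightarrow> w < n \<Longrightarrow> f 0 = w \<Longrightarrow> ev I (T(14 := g, 15 := f)) v = V w"
      "\<And>w f g. b \<longleftrightarrow> ev I (T(14 := g, 15 := f)) sg \<noteq> 0"
    and a: "\<And>w. w < n \<Longrightarrow> P w * 64 + 64 \<le> S"
    and N: "N \<ge> 1 + card H"
  shows "adds' b (loop_heavy (upd sg j p v)) T scratch j N
     (\<lambda>q. \<Sum>w<n. of_bool (w \<in> H) * (of_bool (q = P w) * V w))"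
proof -
  have "adds' b (loop_heavy (upd sg j p v)) T scratch j N
      (\<lambda>q. \<Sum>w\<in>H. of_bool (q = P w) * V w)"
  proof (rule adds_loop_heavy)
    fix w and f g :: "nat \<Rightarrow> nat" assume w: "w \<in> H" "f 0 = w"
    have n: "w < n" using w H by auto
    have "ev I (T(14 := g, 15 := f)) p * 64 + j < S"
      unfolding e(1)[of w f g, OF w(1) n w(2)] using a(1)[OF n] j by linarith
    from adds_upd_of_bool[OF j(2) i this e(3)[of g f], of 1] e(1,2)[of w f g, OF w(1) n w(2)]
    show "adds' b (upd sg j p v) (T(14 := g, 15 := f)) {16, 17} j 1 (\<lambda>q. of_bool (q = P w) * V w)" by simp
  qed (use j H N in auto)
  then show ?thesis
  proof (rule adds_mono)
    fix q
    have "(\<Sum>w\<in>H. of_bool (q = P w) * V w) = (\<Sum>w\<in>H. of_bool (w \<in> H) * (of_bool (q = P w) * V w))"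
      by (rule sum.cong) auto
    also have "\<dots> = (\<Sum>w<n. of_bool (w \<in> H) * (of_bool (q = P w) * V w))"
      by (rule sum.mono_neutral_left) (use H in auto)
    finally show "(\<Sum>w\<in>H. of_bool (q = P w) * V w)
        = (\<Sum>w<n. of_bool (w \<in> H) * (of_bool (q = P w) * V w))" .
  qed simp
qed

end

section \<open>Sums over a graph with a toggled edge\<close>

definition ed :: "nat \<Rightarrow> nat \<Rightarrow> nat \<Rightarrow> nat \<Rightarrow> nat" where
  "ed x y p q = of_bool (p = x) * of_bool (q = y) + of_bool (p = y) * of_bool (q = x)"

definition add_edge :: "nat \<Rightarrow> nat \<Rightarrow> (nat \<Rightarrow> nat \<Rightarrow> nat) \<Rightarrow> nat \<Rightarrow> nat \<Rightarrow> nat" where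
  "add_edge x y a p q = a p q + ed x y p q"

definition add_mark :: "nat \<Rightarrow> (nat \<Rightarrow> nat) \<Rightarrow> nat \<Rightarrow> nat" where
  "add_mark v s u = s u + of_bool (u = v)"

definition heavy :: "nat set \<Rightarrow> nat \<Rightarrow> nat" where "heavy H u = of_bool (u \<in> H)"
definition light :: "nat set \<Rightarrow> nat \<Rightarrow> nat" where "light H u = of_bool (u \<notin> H)"
definition every :: "nat \<Rightarrow> nat" where "every u = 1"

text \<open>\<open>a\<close> is the 0/1 adjacency matrix of the graph without the source, \<open>s\<close> is the indicator of the
  neighbourhood of the source.\<close>

definition dg :: "nat \<Rightarrow> (nat \<Rightarrow> nat \<Rightarrow> nat) \<Rightarrow> nat \<Rightarrow> nat" where
  "dg n a b = (\<Sum>u<n. a u b)"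
definition cn :: "nat \<Rightarrow> (nat \<Rightarrow> nat \<Rightarrow> nat) \<Rightarrow> (nat \<Rightarrow> nat) \<Rightarrow> nat \<Rightarrow> nat" where
  "cn n a s b = (\<Sum>u<n. s u * a u b)"
text \<open>The codegree: common neighbours of \<open>x\<close> and \<open>y\<close>, weighted by
  \<open>X\<close>. The weights are indicators of marked, light or all vertices, or products of
  these.\<close>

definition cod :: "nat \<Rightarrow> (nat \<Rightarrow> nat \<Rightarrow> nat) \<Rightarrow> (nat \<Rightarrow> nat) \<Rightarrow> nat \<Rightarrow> nat \<Rightarrow> nat" where
  "cod n a X x y = (\<Sum>b<n. X b * a b x * a b y)"
text \<open>Triangles at \<open>v\<close>, once for each order of the other two vertices, the first
  of which carries the weight.\<close>

definition tri :: "nat \<Rightarrow> (nat \<Rightarrow> nat \<Rightarrow> nat) \<Rightarrow> (nat \<Rightarrow> nat) \<Rightarrow> nat \<Rightarrow> nat" where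
  "tri n a X v = (\<Sum>u<n. X u * a u v * cod n a every u v)"
text \<open>Walks of two edges from \<open>v\<close> through a weighted middle vertex to a marked
  one; returning to \<open>v\<close> is allowed.\<close>

definition wlk :: "nat \<Rightarrow> (nat \<Rightarrow> nat \<Rightarrow> nat) \<Rightarrow> (nat \<Rightarrow> nat) \<Rightarrow> (nat \<Rightarrow> nat) \<Rightarrow> nat \<Rightarrow> nat" where
  "wlk n a s X v = (\<Sum>b<n. X b * a b v * cn n a s b)"
text \<open>Walks of two edges from \<open>v\<close> through a weighted middle vertex, returning
  ones included.\<close>

definition nbdeg :: "nat \<Rightarrow> (nat \<Rightarrow> nat \<Rightarrow> nat) \<Rightarrow> (nat \<Rightarrow> nat) \<Rightarrow> nat \<Rightarrow> nat" where
  "nbdeg n a X v = (\<Sum>b<n. X b * a b v * dg n a b)"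

text \<open>Seen from the source with \<open>X = every\<close>: \<open>gT\<close> counts closed
  walks of three edges, \<open>gQ\<close> closed walks of four edges whose middle vertex is not the
  source, and \<open>gD\<close> and \<open>gB\<close> walks of two and three edges that do not
  return to the source. \<open>gR\<close> sums the squared degrees of the marked vertices,
  \<open>gY\<close> counts ordered triangles at marked vertices, and \<open>gC\<close> ordered
  triangles of marked vertices. The weight \<open>s\<close> in place of \<open>every\<close> forces
  one more vertex to be a neighbour of the source.\<close>

definition gT where "gT n a s = (\<Sum>u<n. s u * cn n a s u)"
definition gD where "gD n a s = (\<Sum>u<n. s u * dg n a u)"
definition gB where "gB n a X s = (\<Sum>u<n. X u * cn n a s u * dg n a u)"
definition gY where "gY n a X s = (\<Sum>u<n. s u * tri n a X u)"
definition gQ where "gQ n a X s = (\<Sum>u<n. X u * cn n a s u * cn n a s u)"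
definition gR where "gR n a s = (\<Sum>u<n. s u * dg n a u * dg n a u)"
definition gC where "gC n a s = (\<Sum>u<n. s u * (\<Sum>v<n. s v * a v u * cod n a s u v))"

locale wgraph =
  fixes n :: nat and a :: "nat \<Rightarrow> nat \<Rightarrow> nat"
  assumes a_sym: "a u v = a v u" and a_irr: "a u u = 0" and a_le: "a u v \<le> 1"
    and a_out: "n \<le> u \<Longrightarrow> a u v = 0"
begin

lemma a_out2: "n \<le> v \<Longrightarrow> a u v = 0"
  using a_out a_sym by metis

lemma a_sq: "a u v * a u v = a u v"
  using a_le[of u v] by (cases "a u v = 0") (auto simp: le_Suc_eq)

lemma cod_sym: "cod n a X x y = cod n a X y x"
  unfolding cod_def by (simp add: ac_simps)

lemma cod_diag: "cod n a s x x = cn n a s x"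
  unfolding cod_def cn_def by (simp add: mult.assoc a_sq)

lemma cod_every_diag: "cod n a every x x = dg n a x"
  unfolding cod_def dg_def every_def by (simp add: a_sq)

end

section \<open>Sums that pick an entry, a row or a column of a matrix stored row by row\<close>

lemma sum_point: "(\<Sum>w<n::nat. of_bool (q = w) * V w) = of_bool (q < n) * (V q :: nat)"
proof -
  have "(\<Sum>w<n. of_bool (q = w) * V w) = (\<Sum>w<n. if w = q then V w else 0)"
    by (rule sum.cong) auto
  also have "\<dots> = of_bool (q < n) * V q" by (simp add: sum.delta)
  finally show ?thesis .
qed

lemma sum_point': "(\<Sum>w<n::nat. of_bool (w = q) * V w) = of_bool (q < n) * (V q :: nat)"
  using sum_point[of q V n] by (simp add: eq_commute)

lemma idx_eq: "w < n \<Longrightarrow> q = y * n + w \<longleftrightarrow> q div n = y \<and> q mod n = (w::nat)"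
  by (metis add.commute add.right_neutral div_less div_mult_self1 less_nat_zero_code
      mod_div_trivial mod_less mod_mult_self3 mult.commute mult_div_mod_eq)

lemma sum_row: "(n::nat) > 0 \<Longrightarrow> (\<Sum>w<n. of_bool (q = y * n + w) * V w) = of_bool (q div n = y) * (V (q mod n) :: nat)"
proof -
  assume n: "n > 0"
  have "(\<Sum>w<n. of_bool (q = y * n + w) * V w) = (\<Sum>w<n. of_bool (q mod n = w) * (of_bool (q div n = y) * V w))"
  proof (rule sum.cong)
    fix w assume "w \<in> {..<n}"
    then have "(q = y * n + w) = (q div n = y \<and> q mod n = w)" by (intro idx_eq) simp
    then show "of_bool (q = y * n + w) * V w = of_bool (q mod n = w) * (of_bool (q div n = y) * V w)"
      by (simp only: of_bool_conj mult_ac)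
  qed simp
  then show ?thesis using n by (simp add: sum_point)
qed

lemma sum_col: "y < (n::nat) \<Longrightarrow> (\<Sum>w<n. of_bool (q = w * n + y) * V w)
    = of_bool (q div n < n) * (of_bool (q mod n = y) * (V (q div n) :: nat))"
proof -
  assume n: "y < n"
  have "(\<Sum>w<n. of_bool (q = w * n + y) * V w) = (\<Sum>w<n. of_bool (q div n = w) * (of_bool (q mod n = y) * V w))"
  proof (rule sum.cong)
    fix w
    have "(q = w * n + y) = (q div n = w \<and> q mod n = y)" using n by (rule idx_eq)
    then show "of_bool (q = w * n + y) * V w = of_bool (q div n = w) * (of_bool (q mod n = y) * V w)"
      by (simp only: of_bool_conj mult_ac)
  qed simp
  then show ?thesis using n by (simp add: sum_point)
qed

lemma sum_matrix: "(n::nat) > 0 \<Longrightarrow> (\<Sum>w1<n. \<Sum>w2<n. of_bool (q = w1 * n + w2) * V w1 w2)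
    = of_bool (q div n < n) * (V (q div n) (q mod n) :: nat)"
proof -
  assume n: "n > 0"
  have "(\<Sum>w1<n. \<Sum>w2<n. of_bool (q = w1 * n + w2) * V w1 w2)
      = (\<Sum>w1<n. of_bool (q div n = w1) * V w1 (q mod n))"
    by (simp add: sum_row[OF n])
  then show ?thesis by (simp add: sum_point)
qed

section \<open>Change of the sums under a toggled edge\<close>

locale edge_toggle = wgraph +
  fixes x y :: nat
  assumes xy: "x < n" "y < n" "x \<noteq> y" "a x y = 0"
begin

abbreviation "a' \<equiv> add_edge x y a"

lemma yx: "a y x = 0" using xy a_sym by metis

lemma ed_sym: "ed x y p q = ed x y q p"
  by (simp add: ed_def mult.commute add.commute)

lemma sum_ed: "(\<Sum>b<n. F b * ed x y b q) = F x * of_bool (q = y) + F y * of_bool (q = x)"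
proof -
  have "(\<Sum>b<n. F b * ed x y b q)
     = (\<Sum>b<n. of_bool (b = x) * (F b * of_bool (q = y))) + (\<Sum>b<n. of_bool (b = y) * (F b * of_bool (q = x)))"
    unfolding sum.distrib[symmetric] by (rule sum.cong) (simp_all only: ed_def algebra_simps)
  then show ?thesis using xy by (simp add: sum_point')
qed

lemma wgraph': "wgraph n a'"
proof
  fix u v
  show "a' u v = a' v u" using a_sym[of u v] ed_sym[of u v] by (simp add: add_edge_def)
  show "a' u u = 0" using a_irr xy by (auto simp: add_edge_def ed_def)
  show "a' u v \<le> 1" using a_le[of u v] xy yx by (auto simp: add_edge_def ed_def)
  show "a' u v = 0" if "n \<le> u" using that a_out xy by (auto simp: add_edge_def ed_def)
qed

lemma dg': "dg n a' b = dg n a b + of_bool (b = x) + of_bool (b = y)"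
  unfolding dg_def add_edge_def sum.distrib using sum_ed[of "\<lambda>_. 1" b] by simp

lemma cn': "cn n a' s b = cn n a s b + of_bool (b = x) * s y + of_bool (b = y) * s x"
  unfolding cn_def add_edge_def by (simp add: distrib_left sum.distrib sum_ed)

text \<open>A walk \<open>p - b - q\<close> with distinct ends uses the new edge at most once. The
  products of two indicators account for the walk that uses it back and forth, which exists only for
  \<open>p = q\<close>.\<close>

lemma cod': "cod n a' X p q = cod n a X p q
    + X x * (of_bool (p = y) * a x q + of_bool (q = y) * a x p + of_bool (p = y) * of_bool (q = y))
    + X y * (of_bool (p = x) * a y q + of_bool (q = x) * a y p + of_bool (p = x) * of_bool (q = x))"
proof -
  have "cod n a' X p q = (\<Sum>b<n. X b * a b p * a b q + X b * a b p * ed x y b q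
      + (X b * a b q) * ed x y b p + (X b * ed x y b p) * ed x y b q)"
    unfolding cod_def add_edge_def by (simp add: algebra_simps)
  also have "\<dots> = cod n a X p q + (X x * a x p * of_bool (q = y) + X y * a y p * of_bool (q = x))
      + (X x * a x q * of_bool (p = y) + X y * a y q * of_bool (p = x))
      + (X x * ed x y x p * of_bool (q = y) + X y * ed x y y p * of_bool (q = x))"
    unfolding sum.distrib sum_ed cod_def ..
  also have "ed x y x p = of_bool (p = y)" using xy by (simp add: ed_def)
  also have "ed x y y p = of_bool (p = x)" using xy by (simp add: ed_def)
  finally show ?thesis by (simp add: algebra_simps)
qed

text \<open>In a new triangle at \<open>v\<close> the new edge is either opposite to
  \<open>v\<close> or incident with it; these are the second summand and the last two. No triangle
  uses the edge twice.\<close>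

lemma tri': "tri n a' X v = tri n a X v + a x v * a y v * (X x + X y)
    + of_bool (v = x) * (X y * cod n a every x y + cod n a X x y)
    + of_bool (v = y) * (X x * cod n a every x y + cod n a X x y)"
proof -
  \<comment> \<open>If \<open>u\<close> and \<open>v\<close> are not the new edge, only their
    codegree changes. If they are, \<open>a u v = 0\<close>, and their codegree does not see the
    edge between them.\<close>
  have c: "a' u v * cod n a' every u v = a u v * cod n a every u v
     + a u v * (of_bool (u = y) * a x v + of_bool (u = x) * a y v
         + of_bool (v = y) * a x u + of_bool (v = x) * a y u)
     + ed x y u v * cod n a every x y" for u
  proof (cases "ed x y u v = 0")
    case True
    then have "(u = y \<longrightarrow> v \<noteq> x) \<and> (u = x \<longrightarrow> v \<noteq> y)" by (auto simp: ed_def split: if_splits)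
    then have e: "of_bool (u = y) * of_bool (v = y) * a u v = 0" "of_bool (u = x) * of_bool (v = x) * a u v = 0"
      using a_irr by auto
    have "a' u v = a u v" using True by (simp add: add_edge_def)
    then show ?thesis using True e unfolding cod' by (simp add: every_def algebra_simps)
  next
    case False
    then have "u = x \<and> v = y \<or> u = y \<and> v = x" by (auto simp: ed_def split: if_splits)
    then show ?thesis
      using xy yx a_irr cod_sym[of every x y] unfolding cod'
      by (auto simp: every_def add_edge_def ed_def)
  qed
  have "tri n a' X v = (\<Sum>u<n. X u * (a' u v * cod n a' every u v))"
    unfolding tri_def by (simp add: mult.assoc)
  also have "\<dots> = (\<Sum>u<n. X u * a u v * cod n a every u v + of_bool (u = y) * (X u * a u v * a x v)
     + of_bool (u = x) * (X u * a u v * a y v) + of_bool (v = y) * (X u * a u v * a x u)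
     + of_bool (v = x) * (X u * a u v * a y u) + (X u * cod n a every x y) * ed x y u v)"
    unfolding c by (simp add: algebra_simps)
  also have "\<dots> = tri n a X v + X y * a y v * a x v + X x * a x v * a y v
      + of_bool (v = y) * (\<Sum>u<n. X u * a u v * a x u) + of_bool (v = x) * (\<Sum>u<n. X u * a u v * a y u)
      + (X x * cod n a every x y * of_bool (v = y) + X y * cod n a every x y * of_bool (v = x))"
    unfolding sum.distrib sum_ed sum_point' tri_def sum_distrib_left[symmetric] using xy by simp
  also have "of_bool (v = y) * (\<Sum>u<n. X u * a u v * a x u) = of_bool (v = y) * cod n a X x y"
    unfolding cod_def by (auto simp: a_sym[of x] algebra_simps)
  also have "of_bool (v = x) * (\<Sum>u<n. X u * a u v * a y u) = of_bool (v = x) * cod n a X x y"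
    unfolding cod_def by (auto simp: a_sym[of y] algebra_simps)
  finally show ?thesis by (simp add: algebra_simps)
qed

lemma wlk': "wlk n a' s X v = wlk n a s X v
    + X x * (of_bool (v = y) * (cn n a s x + s y) + a x v * s y)
    + X y * (of_bool (v = x) * (cn n a s y + s x) + a y v * s x)"
proof -
  have "wlk n a' s X v = (\<Sum>b<n. X b * a b v * cn n a s b + of_bool (b = x) * (X b * a b v * s y)
      + of_bool (b = y) * (X b * a b v * s x)
      + (X b * (cn n a s b + of_bool (b = x) * s y + of_bool (b = y) * s x)) * ed x y b v)"
    unfolding wlk_def cn' by (simp add: add_edge_def algebra_simps)
  then show ?thesis
    unfolding sum.distrib sum_ed sum_point' wlk_def using xy by (simp add: algebra_simps)
qed

lemma nbdeg': "nbdeg n a' X v = nbdeg n a X v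
    + X x * (of_bool (v = y) * (dg n a x + 1) + a x v)
    + X y * (of_bool (v = x) * (dg n a y + 1) + a y v)"
proof -
  have "nbdeg n a' X v = (\<Sum>b<n. X b * a b v * dg n a b + of_bool (b = x) * (X b * a b v)
      + of_bool (b = y) * (X b * a b v)
      + (X b * (dg n a b + of_bool (b = x) + of_bool (b = y))) * ed x y b v)"
    unfolding nbdeg_def dg' by (simp add: add_edge_def algebra_simps)
  then show ?thesis
    unfolding sum.distrib sum_ed sum_point' nbdeg_def using xy by (simp add: algebra_simps)
qed

lemma gT': "gT n a' s = gT n a s + 2 * s x * s y"
proof -
  have "gT n a' s = (\<Sum>u<n. s u * cn n a s u + of_bool (u = x) * (s u * s y) + of_bool (u = y) * (s u * s x))"
    unfolding gT_def cn' by (simp add: algebra_simps)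
  then show ?thesis unfolding sum.distrib sum_point' gT_def using xy by simp
qed

lemma gD': "gD n a' s = gD n a s + s x + s y"
proof -
  have "gD n a' s = (\<Sum>u<n. s u * dg n a u + of_bool (u = x) * s u + of_bool (u = y) * s u)"
    unfolding gD_def dg' by (simp add: algebra_simps)
  then show ?thesis unfolding sum.distrib sum_point' gD_def using xy by simp
qed

lemma gB': "gB n a' X s = gB n a X s + X x * (cn n a s x + s y * (dg n a x + 1))
    + X y * (cn n a s y + s x * (dg n a y + 1))"
proof -
  have "gB n a' X s = (\<Sum>u<n. X u * cn n a s u * dg n a u
      + of_bool (u = x) * (X u * (cn n a s u + s y * (dg n a u + 1)))
      + of_bool (u = y) * (X u * (cn n a s u + s x * (dg n a u + 1))))"
    unfolding gB_def cn' dg' using xy by (intro sum.cong) (auto simp: algebra_simps)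
  then show ?thesis unfolding sum.distrib sum_point' gB_def using xy by simp
qed

lemma gQ': "gQ n a' X s = gQ n a X s + X x * (2 * cn n a s x * s y + s y * s y)
    + X y * (2 * cn n a s y * s x + s x * s x)"
proof -
  have "gQ n a' X s = (\<Sum>u<n. X u * cn n a s u * cn n a s u
      + of_bool (u = x) * (X u * (2 * cn n a s u * s y + s y * s y))
      + of_bool (u = y) * (X u * (2 * cn n a s u * s x + s x * s x)))"
    unfolding gQ_def cn' using xy by (intro sum.cong) (auto simp: algebra_simps)
  then show ?thesis unfolding sum.distrib sum_point' gQ_def using xy by simp
qed

lemma gR': "gR n a' s = gR n a s + s x * (2 * dg n a x + 1) + s y * (2 * dg n a y + 1)"
proof -
  have "gR n a' s = (\<Sum>u<n. s u * dg n a u * dg n a u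
      + of_bool (u = x) * (s u * (2 * dg n a u + 1)) + of_bool (u = y) * (s u * (2 * dg n a u + 1)))"
    unfolding gR_def dg' using xy by (intro sum.cong) (auto simp: algebra_simps)
  then show ?thesis unfolding sum.distrib sum_point' gR_def using xy by simp
qed

lemma gY': "gY n a' X s = gY n a X s + cod n a s x y * (X x + X y)
    + s x * (X y * cod n a every x y + cod n a X x y)
    + s y * (X x * cod n a every x y + cod n a X x y)"
proof -
  have "gY n a' X s = (\<Sum>u<n. s u * tri n a X u + s u * a u x * a u y * (X x + X y)
     + of_bool (u = x) * (s u * (X y * cod n a every x y + cod n a X x y))
     + of_bool (u = y) * (s u * (X x * cod n a every x y + cod n a X x y)))"
    unfolding gY_def tri' by (simp add: algebra_simps a_sym[of x] a_sym[of y])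
  then show ?thesis unfolding sum.distrib sum_point' sum_distrib_right[symmetric] gY_def cod_def
    using xy by simp
qed

text \<open>A new triangle of marked vertices consists of \<open>x\<close>, \<open>y\<close> and a
  common marked neighbour, and it is counted in all 6 orders.\<close>

lemma gC': "gC n a' s = gC n a s + 6 * s x * s y * cod n a s x y"
proof -
  have c: "a' v u * cod n a' s u v = a v u * cod n a s u v
     + a v u * (s x * (of_bool (u = y) * a x v + of_bool (v = y) * a x u)
         + s y * (of_bool (u = x) * a y v + of_bool (v = x) * a y u))
     + ed x y v u * cod n a s x y" for u v
  proof (cases "ed x y v u = 0")
    case True
    have e: "of_bool (u = y) * of_bool (v = y) * a v u = 0" "of_bool (u = x) * of_bool (v = x) * a v u = 0"
      using a_irr by auto
    have "a' v u = a v u" using True by (simp add: add_edge_def)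
    then show ?thesis using True e unfolding cod' by (simp add: algebra_simps)
  next
    case False
    then have "u = x \<and> v = y \<or> u = y \<and> v = x" by (auto simp: ed_def split: if_splits)
    then show ?thesis
      using xy yx a_irr cod_sym[of s x y] unfolding cod' by (auto simp: add_edge_def ed_def)
  qed
  have i: "(\<Sum>v<n. s v * (a' v u * cod n a' s u v)) = (\<Sum>v<n. s v * a v u * cod n a s u v)
      + s x * of_bool (u = y) * cod n a s x y + of_bool (u < n) * s y * s x * a y u * a x u
      + s y * of_bool (u = x) * cod n a s x y + s x * s y * a x u * a y u
      + (s x * of_bool (u = y) + s y * of_bool (u = x)) * cod n a s x y" for u
  proof -
    have "(\<Sum>v<n. s v * (a' v u * cod n a' s u v)) = (\<Sum>v<n. s v * a v u * cod n a s u v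
      + (s x * of_bool (u = y)) * (s v * a v u * a x v) + of_bool (v = y) * (s x * a x u * s v * a v u)
      + (s y * of_bool (u = x)) * (s v * a v u * a y v) + of_bool (v = x) * (s y * a y u * s v * a v u)
      + (s v * cod n a s x y) * ed x y v u)"
      unfolding c by (simp add: algebra_simps)
    also have "\<dots> = (\<Sum>v<n. s v * a v u * cod n a s u v)
      + (s x * of_bool (u = y)) * (\<Sum>v<n. s v * a v u * a x v) + s x * a x u * s y * a y u
      + (s y * of_bool (u = x)) * (\<Sum>v<n. s v * a v u * a y v) + s y * a y u * s x * a x u
      + (s x * cod n a s x y * of_bool (u = y) + s y * cod n a s x y * of_bool (u = x))"
      unfolding sum.distrib sum_ed sum_point' sum_distrib_left[symmetric] using xy by simp
    also have "(s x * of_bool (u = y)) * (\<Sum>v<n. s v * a v u * a x v) = s x * of_bool (u = y) * cod n a s x y"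
      unfolding cod_def by (auto simp: a_sym[of x] algebra_simps)
    also have "(s y * of_bool (u = x)) * (\<Sum>v<n. s v * a v u * a y v) = s y * of_bool (u = x) * cod n a s x y"
      unfolding cod_def by (auto simp: a_sym[of y] algebra_simps)
    finally show ?thesis using a_out2 by (cases "u < n") (simp_all add: algebra_simps)
  qed
  have "gC n a' s = (\<Sum>u<n. s u * (\<Sum>v<n. s v * (a' v u * cod n a' s u v)))"
    unfolding gC_def by (simp add: mult.assoc)
  also have "\<dots> = (\<Sum>u<n. s u * (\<Sum>v<n. s v * a v u * cod n a s u v)
      + of_bool (u = y) * (2 * s u * s x * cod n a s x y)
      + of_bool (u = x) * (2 * s u * s y * cod n a s x y) + (2 * s x * s y) * (s u * a u x * a u y))"
    unfolding i by (intro sum.cong) (auto simp: algebra_simps a_sym[of x] a_sym[of y])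
  also have "\<dots> = gC n a s + 6 * s x * s y * cod n a s x y"
    unfolding sum.distrib sum_point' sum_distrib_left[symmetric] gC_def[symmetric] cod_def[symmetric]
    using xy by simp
  finally show ?thesis .
qed

end

section \<open>Change of the sums under a toggled mark\<close>

locale mark_toggle = wgraph +
  fixes s :: "nat \<Rightarrow> nat" and v :: nat
  assumes v: "v < n" "s v = 0"
begin

abbreviation "s' \<equiv> add_mark v s"

lemma m_cn: "cn n a s' b = cn n a s b + a v b"
  unfolding cn_def add_mark_def by (simp add: add_mult_distrib sum.distrib sum_point' v)

lemma m_cod: "cod n a s' p q = cod n a s p q + a v p * a v q"
  unfolding cod_def add_mark_def by (simp add: add_mult_distrib sum.distrib sum_point' v mult.assoc)

lemma m_tri: "tri n a s' w = tri n a s w + a v w * cod n a every v w"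
  unfolding tri_def add_mark_def by (simp add: add_mult_distrib sum.distrib sum_point' v mult.assoc)

lemma m_wlk: "wlk n a s' X w = wlk n a s X w + cod n a X w v"
  unfolding wlk_def m_cn cod_def by (simp add: distrib_left sum.distrib a_sym[of v])

lemma sum_s_a: "(\<Sum>u<n. s u * a v u) = cn n a s v"
  unfolding cn_def by (simp add: a_sym[of v])

lemma m_gT: "gT n a s' = gT n a s + 2 * cn n a s v"
proof -
  have "gT n a s' = (\<Sum>u<n. s u * cn n a s u + s u * a v u + of_bool (u = v) * (cn n a s u + a v u))"
    unfolding gT_def m_cn by (simp add: add_mark_def algebra_simps)
  then show ?thesis unfolding sum.distrib sum_point' sum_s_a gT_def using v a_irr by simp
qed

lemma m_gD: "gD n a s' = gD n a s + dg n a v"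
  unfolding gD_def add_mark_def by (simp add: add_mult_distrib sum.distrib sum_point' v)

lemma m_gB: "gB n a X s' = gB n a X s + nbdeg n a X v"
  unfolding gB_def m_cn nbdeg_def by (simp add: algebra_simps sum.distrib a_sym[of v])

text \<open>The mark occurs both as the start of a walk and as a weight. The two roles are changed
  one after the other, and the first change is \<open>m_gB\<close>. The lemmas \<open>m_gQ_s\<close>
  and \<open>m_gY_s\<close> proceed in the same way.\<close>

lemma m_gB_s: "gB n a s' s' = gB n a s s + nbdeg n a s v + cn n a s v * dg n a v"
proof -
  have "gB n a s' s' = gB n a s s' + (\<Sum>u<n. of_bool (u = v) * (cn n a s' u * dg n a u))"
    unfolding gB_def by (simp add: add_mark_def algebra_simps sum.distrib)
  then show ?thesis unfolding sum_point' m_gB using v a_irr by (simp add: m_cn)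
qed

lemma m_gQ: "gQ n a X s' = gQ n a X s + 2 * wlk n a s X v + cod n a X v v"
proof -
  have "gQ n a X s' = (\<Sum>u<n. X u * cn n a s u * cn n a s u + 2 * (X u * a u v * cn n a s u) + X u * a u v * a u v)"
    unfolding gQ_def m_cn by (simp add: algebra_simps mult_2 a_sym[of v])
  then show ?thesis unfolding sum.distrib sum_distrib_left[symmetric] gQ_def wlk_def cod_def by simp
qed

lemma m_gQ_s: "gQ n a s' s' = gQ n a s s + 2 * wlk n a s s v + cn n a s v + cn n a s v * cn n a s v"
proof -
  have "gQ n a s' s' = gQ n a s s' + (\<Sum>u<n. of_bool (u = v) * (cn n a s' u * cn n a s' u))"
    unfolding gQ_def by (simp add: add_mark_def algebra_simps sum.distrib)
  then show ?thesis unfolding sum_point' m_gQ using v a_irr by (simp add: m_cn cod_diag)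
qed

lemma m_gR: "gR n a s' = gR n a s + dg n a v * dg n a v"
  unfolding gR_def add_mark_def by (simp add: add_mult_distrib sum.distrib sum_point' v mult.assoc)

lemma m_gY: "gY n a X s' = gY n a X s + tri n a X v"
  unfolding gY_def add_mark_def by (simp add: add_mult_distrib sum.distrib sum_point' v)

lemma sum_s_a_cod: "(\<Sum>u<n. s u * (a v u * cod n a X v u)) = (\<Sum>u<n. s u * a u v * cod n a X u v)"
  by (simp add: a_sym[of v] cod_sym[of X v] mult.assoc)

lemma m_gY_s: "gY n a s' s' = gY n a s s + 2 * tri n a s v"
proof -
  have "gY n a s s' = gY n a s s + tri n a s v" by (rule m_gY)
  moreover have "gY n a s' s' = gY n a s s' + (\<Sum>u<n. s u * (a v u * cod n a every v u))
      + (\<Sum>u<n. of_bool (u = v) * (a v u * cod n a every v u))"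
    unfolding gY_def m_tri by (simp add: add_mark_def algebra_simps sum.distrib)
  ultimately show ?thesis unfolding sum_s_a_cod sum_point' using a_irr by (simp add: tri_def)
qed

text \<open>The new mark may take any of the 3 positions in an ordered triangle; the sum counts the
  orders of the other two vertices.\<close>

lemma m_gC: "gC n a s' = gC n a s + 3 * (\<Sum>u<n. s u * a u v * cod n a s u v)"
proof -
  let ?z = "\<Sum>u<n. s u * a u v * cod n a s u v"
  let ?f = "\<lambda>s u. \<Sum>w<n. s w * a w u * cod n a s u w"
  have fv: "?f s v = ?z" by (simp add: cod_sym[of s v])
  have f: "?f s' u = ?f s u + a v u * cn n a s v * 0 + a v u * cod n a s u v + a v u * cod n a s u v" for u
  proof -
    have "?f s' u = (\<Sum>w<n. s w * a w u * cod n a s u w + a v u * (s w * a w u * a w v)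
        + of_bool (w = v) * (a w u * (cod n a s u w + a v u * a v w)))"
      unfolding m_cod by (simp add: add_mark_def algebra_simps a_sym[of v])
    then show ?thesis unfolding sum.distrib sum_point' sum_distrib_left[symmetric] cod_def[of _ _ _ u v]
      using v a_irr by simp
  qed
  have "gC n a s' = (\<Sum>u<n. s u * ?f s u + 2 * (s u * (a v u * cod n a s u v))
      + of_bool (u = v) * (?f s u + a v u * cod n a s u v * 2))"
    unfolding gC_def f by (simp add: add_mark_def algebra_simps mult_2)
  also have "\<dots> = gC n a s + 2 * (\<Sum>u<n. s u * (a v u * cod n a s u v)) + ?f s v"
    unfolding sum.distrib sum_point' sum_distrib_left[symmetric] gC_def using v a_irr by simp
  also have "(\<Sum>u<n. s u * (a v u * cod n a s u v)) = ?z"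
    by (simp add: a_sym[of v] mult.assoc)
  finally show ?thesis unfolding fv by simp
qed

end

section \<open>Specifications of table updates\<close>

definition ctl :: "bool \<Rightarrow> nat \<Rightarrow> nat \<Rightarrow> nat \<Rightarrow> nat \<Rightarrow> nat \<Rightarrow> (nat \<Rightarrow> nat \<Rightarrow> nat) \<Rightarrow> bool" where
  "ctl b x y w dx dy T \<longleftrightarrow> T 1 0 = of_bool b \<and> T 2 0 = x \<and> T 3 0 = y \<and> T 4 0 = w \<and>
     T 5 0 = dx \<and> T 6 0 = dy"

lemma ctl_upd [simp]: "7 \<le> j \<Longrightarrow> ctl b x y w dx dy (T(j := f)) = ctl b x y w dx dy T"
  by (auto simp: ctl_def)

lemma heavy_listD: "heavy_list H T \<Longrightarrow> T 10 v = heavy H v"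
  by (simp add: heavy_list_def heavy_def)

lemma light_eq: "of_bool (heavy H v = 0) = light H v"
  by (simp add: heavy_def light_def)

lemma heavy_simps [simp]: "heavy H v = 0 \<longleftrightarrow> v \<notin> H" "0 < heavy H v \<longleftrightarrow> v \<in> H" "heavy H v \<le> Suc 0" "light H v \<le> Suc 0" "v \<in> H \<Longrightarrow> heavy H v = 1" "v \<notin> H \<Longrightarrow> heavy H v = 0"
  "v \<in> H \<Longrightarrow> light H v = 0" "v \<notin> H \<Longrightarrow> light H v = 1"
  by (auto simp: heavy_def light_def)

lemma sum_le_mult: "(\<And>b. b < n \<Longrightarrow> F b \<le> (c::nat)) \<Longrightarrow> (\<Sum>b<n. F b) \<le> n * c"
  using sum_bounded_above[of "{..<n}" F c] by simp

lemma mult_le_one: "p \<le> 1 \<Longrightarrow> q \<le> c \<Longrightarrow> p * q \<le> (c::nat)"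
  using mult_le_mono by fastforce

context wgraph
begin

lemma dg_le: "dg n a b \<le> n"
  unfolding dg_def using sum_le_mult[of n "\<lambda>u. a u b" 1] a_le by simp

lemma cn_le: "(\<And>u. s u \<le> 1) \<Longrightarrow> cn n a s b \<le> n"
  unfolding cn_def using sum_le_mult[of n "\<lambda>u. s u * a u b" 1] a_le mult_le_one by simp

lemma cod_le: "(\<And>u. X u \<le> 1) \<Longrightarrow> cod n a X p q \<le> n"
  unfolding cod_def using sum_le_mult[of n "\<lambda>u. X u * a u p * a u q" 1] a_le mult_le_one
  by (simp add: mult.assoc)

lemma tri_le: "(\<And>u. X u \<le> 1) \<Longrightarrow> tri n a X q \<le> n * n"
  unfolding tri_def mult.assoc
  by (intro sum_le_mult mult_le_one a_le cod_le) (auto simp: every_def)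

lemma wlk_le: "(\<And>u. s u \<le> 1) \<Longrightarrow> (\<And>u. X u \<le> 1) \<Longrightarrow> wlk n a s X q \<le> n * n"
  unfolding wlk_def mult.assoc
  by (intro sum_le_mult mult_le_one a_le cn_le) auto

lemma nbdeg_le: "(\<And>u. X u \<le> 1) \<Longrightarrow> nbdeg n a X q \<le> n * n"
  unfolding nbdeg_def mult.assoc
  by (intro sum_le_mult mult_le_one a_le dg_le) auto

lemma aggregate_le:
  assumes "\<And>u. s u \<le> 1" "\<And>u. X u \<le> 1"
  shows "gT n a s \<le> n * (n * n)" "gD n a s \<le> n * (n * n)" "gB n a X s \<le> n * (n * n)"
    "gY n a X s \<le> n * (n * n)" "gQ n a X s \<le> n * (n * n)" "gR n a s \<le> n * (n * n)"
    "gC n a s \<le> n * (n * n)"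
proof -
  have 0: "n \<le> n * n" by simp
  show "gT n a s \<le> n * (n * n)" "gD n a s \<le> n * (n * n)"
    unfolding gT_def gD_def using 0
    by (intro sum_le_mult mult_le_one order.trans[OF cn_le 0] order.trans[OF dg_le 0] assms)+
  show "gB n a X s \<le> n * (n * n)" "gQ n a X s \<le> n * (n * n)" "gR n a s \<le> n * (n * n)"
    unfolding gB_def gQ_def gR_def mult.assoc
    by (intro sum_le_mult mult_le_one mult_le_mono cn_le dg_le assms)+
  show "gY n a X s \<le> n * (n * n)" unfolding gY_def
    by (intro sum_le_mult mult_le_one tri_le assms)
  show "gC n a s \<le> n * (n * n)" unfolding gC_def mult.assoc
    by (intro sum_le_mult mult_le_one cod_le a_le assms)
qed

end

context machine
begin

lemma W_bound: "v \<le> n * (n * n) \<Longrightarrow> v < W" "v \<le> n * n \<Longrightarrow> v < W" "v \<le> n \<Longrightarrow> v < W"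
proof -
  have 1: "1 \<le> n + 1" by simp
  have "n * (n * n) \<le> (n + 1) * ((n + 1) * (n + 1))" by (intro mult_le_mono) auto
  also have "\<dots> = (n + 1) ^ 3" by (simp only: power3_eq_cube mult.assoc)
  also have "\<dots> \<le> (n + 1) ^ 4" by (rule power_increasing) auto
  finally have 3: "n * (n * n) < W" using W_big by linarith
  show "v \<le> n * (n * n) \<Longrightarrow> v < W" using 3 by linarith
  moreover have "n * n \<le> n * (n * n)" by simp
  ultimately show "v \<le> n * n \<Longrightarrow> v < W" by linarith
  show "v \<le> n \<Longrightarrow> v < W" using W_pow by linarith
qed

lemma adjf_out: "v \<notin> set (nbs u) \<Longrightarrow> adjf I x y u v = 0"
  by (simp add: adjf_def)

lemma wgraph_adjf: "wgraph n (adjf I x y)"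
proof
  fix u v
  show "adjf I x y u v = adjf I x y v u" using nbs_sym[of u v] by (auto simp: adjf_def)
  show "adjf I x y u u = 0" using nbs_irrefl by (auto simp: adjf_def)
  show "adjf I x y u v \<le> 1" by (simp add: adjf_def)
  show "adjf I x y u v = 0" if "n \<le> u" using that nbs_less[of u v] nbs_sym[of u v] by (auto simp: adjf_def)
qed

lemma self_le: "self I w u \<le> 1"
  by (simp add: self_def)

end

lemma (in machine) steps_scalar:
  assumes "T (Suc 0) 0 = of_bool b" "32 \<le> j" "j < 64" "indep I (insert j scratch) e" "N \<ge> 1"
    "T j = scalar (pick b old new)" "new = old + ev I T e" "new < W"
  shows "steps' (upd (var 1) j (Num 0) e) T N (T(j := scalar (pick b new old)))"
proof -
  have j: "j \<notin> scratch" using assms(2) by (auto simp: scratch_def)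
  have "adds' b (upd (var 1) j (Num 0) e) T scratch j N (\<lambda>q. of_bool (q = ev I T (Num 0)) * ev I T e)"
    by (rule adds_upd_of_bool) (use assms j S64 in \<open>auto simp: scratch_def\<close>)
  then have "steps' (upd (var 1) j (Num 0) e) T N (T(j := pick b (scalar new) (scalar old)))"
    by (rule steps_toggle) (use assms j in \<open>auto simp: scalar_def pick_def\<close>)
  moreover have "pick b (scalar new) (scalar old) = scalar (pick b new old)" by (simp add: pick_def)
  ultimately show ?thesis by simp
qed

locale machine1 = machine +
  assumes S1: "64 * in_n I \<le> S"
begin

lemma addr1: "w < n \<Longrightarrow> w * 64 + 64 \<le> S"
  using S1 by linarith

lemma addr1': "w < n \<Longrightarrow> j < 64 \<Longrightarrow> w * 64 + j < S"
  using S1 by linarith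

end

text \<open>The factor \<open>heavy H q\<close> makes the table a function of the graph and
  \<open>H\<close> alone, with zeros at light vertices. Hence an update of the graph changes heavy
  entries only.\<close>

definition tC where "tC n a s H q = heavy H q * cn n a s q"
definition tD where "tD n a H q = heavy H q * nbdeg n a every q"

lemma every_1 [simp]: "every u = 1" by (simp add: every_def)

context edge_toggle
begin

lemma tC': "tC n a' s H q = tC n a s H q + (of_bool (q = x) * (heavy H x * s y) + of_bool (q = y) * (heavy H y * s x))"
  unfolding tC_def cn' by (auto simp: algebra_simps)

lemma tD': "tD n a' H q = tD n a H q + ((\<Sum>w<n. of_bool (w \<in> H) * (of_bool (q = w) * (a x w + a y w)))
   + (of_bool (q = x) * (heavy H x * (dg n a y + 1)) + of_bool (q = y) * (heavy H y * (dg n a x + 1))))"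
proof -
  have "(\<Sum>w<n. of_bool (w \<in> H) * (of_bool (q = w) * (a x w + a y w)))
      = (\<Sum>w<n. of_bool (q = w) * (heavy H w * (a x w + a y w)))"
    by (simp add: heavy_def mult.left_commute)
  also have "\<dots> = of_bool (q < n) * (heavy H q * (a x q + a y q))" by (rule sum_point)
  also have "\<dots> = heavy H q * (a x q + a y q)" using a_out2[of q] by (cases "q < n") auto
  finally show ?thesis unfolding tD_def nbdeg' by (auto simp: algebra_simps)
qed

end

context mark_toggle
begin

lemma m_tC: "tC n a s' H q = tC n a s H q + (\<Sum>w<n. of_bool (w \<in> H) * (of_bool (q = w) * a v w))"
proof -
  have "(\<Sum>w<n. of_bool (w \<in> H) * (of_bool (q = w) * a v w)) = (\<Sum>w<n. of_bool (q = w) * (heavy H w * a v w))"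
    by (simp add: heavy_def mult.left_commute)
  also have "\<dots> = of_bool (q < n) * (heavy H q * a v q)" by (rule sum_point)
  also have "\<dots> = heavy H q * a v q" using a_out2[of q] by (cases "q < n") auto
  finally show ?thesis unfolding tC_def m_cn by (auto simp: algebra_simps)
qed

end

lemma heavy_insert: "x \<notin> H \<Longrightarrow> heavy (insert x H) u = heavy H u + of_bool (u = x)"
  by (auto simp: heavy_def)

lemma light_insert: "x \<notin> H \<Longrightarrow> light H u = light (insert x H) u + of_bool (u = x)"
  by (auto simp: light_def)

lemma tC_insert: "x \<notin> H \<Longrightarrow> tC n a s (insert x H) q = tC n a s H q + of_bool (q = x) * cn n a s x"
  by (auto simp: tC_def heavy_insert algebra_simps)

lemma tD_insert: "x \<notin> H \<Longrightarrow> tD n a (insert x H) q = tD n a H q + of_bool (q = x) * nbdeg n a every x"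
  by (auto simp: tD_def heavy_insert algebra_simps)

section \<open>Contracts for the three kinds of table updates\<close>

definition env :: "bool \<Rightarrow> nat \<Rightarrow> nat \<Rightarrow> nat \<Rightarrow> nat \<Rightarrow> nat \<Rightarrow> nat set \<Rightarrow> (nat \<Rightarrow> nat \<Rightarrow> nat) \<Rightarrow> bool" where
  "env b x y w dx dy H T \<longleftrightarrow> ctl b x y w dx dy T \<and> heavy_list H T \<and> vars_ok T"

lemma envD:
  assumes "env b x y w dx dy H T"
  shows "T (Suc 0) 0 = of_bool b" "T 2 0 = x" "T 3 0 = y" "T 4 0 = w" "T 5 0 = dx" "T 6 0 = dy"
    "T 10 v = heavy H v" "heavy_list H T" "vars_ok T"
  using assms by (auto simp: env_def ctl_def heavy_listD)

lemma env_upd [simp]: "32 \<le> j \<Longrightarrow> env b x y w dx dy H (T(j := f)) = env b x y w dx dy H T"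
  by (simp add: env_def)

lemma env_scalar [simp]: "20 \<le> j \<Longrightarrow> env b x y w dx dy H T \<Longrightarrow> env b x y w dx dy H (T(j := scalar v))"
  by (simp add: env_def)

lemma pick_simps [simp]: "pick True u v = u" "pick False u v = v"
  by (simp_all add: pick_def)

lemma steps_Cond_bool:
  assumes "T 1 0 = of_bool b" "N \<ge> 1"
    and "b \<Longrightarrow> steps S W I c1 T N T'" "\<not> b \<Longrightarrow> steps S W I c2 T N T'"
  shows "steps S W I (Cond (var 1) c1 c2) T N T'"
  by (rule steps_Cond) (use assms in \<open>auto simp: scratch_def split: if_splits\<close>)

lemma one_var [simp]: "ev I T (var 1) = T 1 0" "ev I T (var (Suc 0)) = T (Suc 0) 0"
  by simp_all

text \<open>The number of \<open>(p - 1)\<close>-tuples of neighbours up to the summand 1, charged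
  at light endpoints only; heavy ones are served from tables.\<close>

definition light_cost :: "nat \<Rightarrow> inputs \<Rightarrow> nat set \<Rightarrow> nat \<Rightarrow> nat" where
  "light_cost p I H u = of_bool (u \<notin> H) * (1 + length (in_nbs I u)) ^ (p - 1)"

text \<open>The contract for toggling an edge away from the source. \<open>b\<close> selects the
  direction between the tables without and with the edge, \<open>lc\<close> is the charge at an
  endpoint, and tables below 20 are kept so that the control data and the heavy list
  survive.\<close>

definition edge_ok where
  "edge_ok lc Mc Good ec \<longleftrightarrow> (\<forall>S W I b x y H T N a s. Mc S W I \<and> x < in_n I \<and> y < in_n I \<and> x \<noteq> y \<and>
     a = adjf I x y \<and> s = self I (in_s I) \<and>
     x \<noteq> in_s I \<and> y \<noteq> in_s I \<and> H \<subseteq> {..<in_n I} \<and> heavy_list H T \<and> vars_ok T \<and>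
     ctl b x y (in_s I) (dg (in_n I) a x) (dg (in_n I) a y) T \<and>
     Good (in_n I) (pick b a (add_edge x y a)) s H T \<and>
     N \<ge> 1 + card H + lc I H x + lc I H y \<longrightarrow>
     (\<exists>T'. steps S W I ec T N T' \<and> Good (in_n I) (pick b (add_edge x y a) a) s H T' \<and>
        (\<forall>j<20. T' j = T j) \<and> vars_ok T'))"

text \<open>The ignored pair is \<open>x\<close> and the source. As \<open>adjf\<close> excludes the
  source anyway, no edge is hidden from \<open>a\<close>; what is hidden is the neighbour
  \<open>x\<close> of the source.\<close>

definition mark_ok where
  "mark_ok lc Mc Good mc \<longleftrightarrow> (\<forall>S W I b x H T N a s dy. Mc S W I \<and> x < in_n I \<and> x \<noteq> in_s I \<and>
     a = adjf I x (in_s I) \<and> s = self I x \<and>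
     H \<subseteq> {..<in_n I} \<and> heavy_list H T \<and> vars_ok T \<and>
     ctl b x (in_s I) x (dg (in_n I) a x) dy T \<and>
     Good (in_n I) a (pick b s (add_mark x s)) H T \<and>
     N \<ge> 1 + card H + lc I H x \<longrightarrow>
     (\<exists>T'. steps S W I mc T N T' \<and> Good (in_n I) a (pick b (add_mark x s) s) H T' \<and>
        (\<forall>j<20. T' j = T j) \<and> vars_ok T'))"

text \<open>\<open>H\<close> is the heavy set without \<open>x\<close> in both directions. Only a
  promotion may walk through the heavy list: an update promotes at most two vertices but may drop
  many, so a dropped vertex has to be handled in terms of its own degree.\<close>

definition status_ok where
  "status_ok p Mc Good sc \<longleftrightarrow> (\<forall>S W I b x H T N a s dy. Mc S W I \<and> x < in_n I \<and> x \<noteq> in_s I \<and>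
     a = adjf I x (in_s I) \<and> s = self I (in_s I) \<and> x \<notin> H \<and>
     H \<subseteq> {..<in_n I} \<and> heavy_list H T \<and> vars_ok T \<and>
     ctl b x (in_s I) (in_s I) (dg (in_n I) a x) dy T \<and>
     Good (in_n I) a s (pick b H (insert x H)) T \<and>
     N \<ge> of_bool b * (1 + card H) + (1 + length (in_nbs I x)) ^ (p - 1) \<longrightarrow>
     (\<exists>T'. steps S W I sc T N T' \<and> Good (in_n I) a s (pick b (insert x H) H) T' \<and>
        (\<forall>j<20. T' j = T j) \<and> vars_ok T'))"

locale edge_ctx0 = machine +
  fixes b :: bool and x y :: nat and H :: "nat set" and a :: "nat \<Rightarrow> nat \<Rightarrow> nat" and s :: "nat \<Rightarrow> nat"
  assumes a_eq: "a = adjf I x y" and s_eq: "s = self I (in_s I)"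
    and xyn: "x < in_n I" "y < in_n I" "x \<noteq> y" "x \<noteq> in_s I" "y \<noteq> in_s I" and Hn: "H \<subseteq> {..<in_n I}"
begin

sublocale edge_toggle n a x y
proof -
  interpret wgraph n a unfolding a_eq by (rule wgraph_adjf)
  show "edge_toggle n a x y"
    by unfold_locales (use xyn in \<open>auto simp: a_eq adjf_def\<close>)
qed

lemma s_le: "s u \<le> 1" unfolding s_eq by (rule self_le)

lemma a_nbs: "v \<notin> set (nbs u) \<Longrightarrow> a u v = 0" unfolding a_eq by (rule adjf_out)

lemma ev_e [simp]: "adjf I x y = a" "self I (in_s I) = s"
  using a_eq s_eq by auto

abbreviation "env' \<equiv> env b x y (in_s I) (dg n a x) (dg n a y) H"

end

locale edge_ctx = edge_ctx0 + machine1

locale mark_ctx0 = machine +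
  fixes b :: bool and x :: nat and H :: "nat set" and a :: "nat \<Rightarrow> nat \<Rightarrow> nat" and s :: "nat \<Rightarrow> nat"
  assumes a_eq: "a = adjf I x (in_s I)" and s_eq: "s = self I x"
    and xn: "x < in_n I" "x \<noteq> in_s I" and Hn: "H \<subseteq> {..<in_n I}"
begin

sublocale mark_toggle n a s x
proof -
  interpret wgraph n a unfolding a_eq by (rule wgraph_adjf)
  show "mark_toggle n a s x"
    by unfold_locales (use xn in \<open>auto simp: s_eq self_def\<close>)
qed

lemma s_le: "s u \<le> 1" unfolding s_eq by (rule self_le)

lemma s_le': "add_mark x s u \<le> 1" using s_le[of u] v by (auto simp: add_mark_def)

lemma a_nbs: "v \<notin> set (nbs u) \<Longrightarrow> a u v = 0" unfolding a_eq by (rule adjf_out)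

lemma ev_e [simp]: "adjf I x (in_s I) = a" "self I x = s"
  using a_eq s_eq by auto

end

locale mark_ctx = mark_ctx0 + machine1

locale status_ctx = machine1 +
  fixes b :: bool and x :: nat and H :: "nat set" and a :: "nat \<Rightarrow> nat \<Rightarrow> nat" and s :: "nat \<Rightarrow> nat"
  assumes a_eq: "a = adjf I x (in_s I)" and s_eq: "s = self I (in_s I)"
    and xn: "x < in_n I" "x \<noteq> in_s I" "x \<notin> H" and Hn: "H \<subseteq> {..<in_n I}"
begin

sublocale wgraph n a unfolding a_eq by (rule wgraph_adjf)

lemma s_le: "s u \<le> 1" unfolding s_eq by (rule self_le)

lemma a_nbs: "v \<notin> set (nbs u) \<Longrightarrow> a u v = 0" unfolding a_eq by (rule adjf_out)

end

lemma edge_okI: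
  assumes "\<And>S W I. Mc S W I \<Longrightarrow> machine S W I"
    and "\<And>S W I b x y H T N a s. Mc S W I \<Longrightarrow> edge_ctx0 S W I x y H a s \<Longrightarrow>
      env b x y (in_s I) (dg (in_n I) a x) (dg (in_n I) a y) H T \<Longrightarrow>
      Good (in_n I) (pick b a (add_edge x y a)) s H T \<Longrightarrow> N \<ge> 1 + card H + lc I H x + lc I H y \<Longrightarrow>
      \<exists>T'. steps S W I ec T N T' \<and> Good (in_n I) (pick b (add_edge x y a) a) s H T' \<and> (\<forall>j<20. T' j = T j) \<and> vars_ok T'"
  shows "edge_ok lc Mc Good ec"
  unfolding edge_ok_def
  by (intro allI impI, elim conjE, rule assms(2))
    (auto simp: env_def intro!: edge_ctx0.intro edge_ctx0_axioms.intro assms(1))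

lemma mark_okI:
  assumes "\<And>S W I. Mc S W I \<Longrightarrow> machine S W I"
    and "\<And>S W I b x H T N a s dy. Mc S W I \<Longrightarrow> mark_ctx0 S W I x H a s \<Longrightarrow>
      env b x (in_s I) x (dg (in_n I) a x) dy H T \<Longrightarrow>
      Good (in_n I) a (pick b s (add_mark x s)) H T \<Longrightarrow> N \<ge> 1 + card H + lc I H x \<Longrightarrow>
      \<exists>T'. steps S W I mc T N T' \<and> Good (in_n I) a (pick b (add_mark x s) s) H T' \<and> (\<forall>j<20. T' j = T j) \<and> vars_ok T'"
  shows "mark_ok lc Mc Good mc"
  unfolding mark_ok_def
  by (intro allI impI, elim conjE, rule assms(2))
    (auto simp: env_def intro!: mark_ctx0.intro mark_ctx0_axioms.intro assms(1))

lemma status_okI: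
  assumes "\<And>S W I. Mc S W I \<Longrightarrow> machine1 S W I"
    and "\<And>S W I b x H T N a s dy. Mc S W I \<Longrightarrow> status_ctx S W I x H a s \<Longrightarrow>
      env b x (in_s I) (in_s I) (dg (in_n I) a x) dy H T \<Longrightarrow>
      Good (in_n I) a s (pick b H (insert x H)) T \<Longrightarrow>
      N \<ge> of_bool b * (1 + card H) + (1 + length (in_nbs I x)) ^ (p - 1) \<Longrightarrow>
      \<exists>T'. steps S W I sc T N T' \<and> Good (in_n I) a s (pick b (insert x H) H) T' \<and> (\<forall>j<20. T' j = T j) \<and> vars_ok T'"
  shows "status_ok p Mc Good sc"
  unfolding status_ok_def
  by (intro allI impI, elim conjE, rule assms(2))
    (auto simp: env_def intro!: status_ctx.intro status_ctx_axioms.intro assms(1))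

lemma (in machine) dg_adjf:
  assumes "u \<noteq> in_s I"
  shows "dg n (adjf I x (in_s I)) u = length (nbs u) - of_bool (in_s I \<in> set (nbs u))"
proof -
  have "dg n (adjf I x (in_s I)) u = (\<Sum>w<n. of_bool (w \<in> set (nbs u) - {in_s I}))"
    unfolding dg_def
  proof (rule sum.cong)
    fix w
    show "adjf I x (in_s I) w u = of_bool (w \<in> set (nbs u) - {in_s I})"
      using assms nbs_sym[of u w] by (auto simp: adjf_def)
  qed simp
  also have "\<dots> = card ({..<n} \<inter> {w. w \<in> set (nbs u) - {in_s I}})"
    by (simp only: sum_of_bool_eq finite_lessThan of_nat_id)
  also have "{..<n} \<inter> {w. w \<in> set (nbs u) - {in_s I}} = set (nbs u) - {in_s I}" using nbs_less by auto
  also have "card (set (nbs u) - {in_s I}) = length (nbs u) - of_bool (in_s I \<in> set (nbs u))"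
    using distinct_card[OF nbs_distinct, of u] by (simp add: card_Diff_singleton_if)
  finally show ?thesis .
qed

section \<open>Tables for update time sqrt m\<close>

definition cgather2 :: "nat \<Rightarrow> exp \<Rightarrow> com" where
  "cgather2 j x = gather j (Cond (heavyE x) (upd (Num 1) j (Num 0) (ld 34 x))
     (loop_nbs 14 15 x (upd (Num 1) j (Num 0) (Mul (adjE x (var 15)) (selE (var 15))))))"

definition dgather2 :: "nat \<Rightarrow> exp \<Rightarrow> com" where
  "dgather2 j x = gather j (Cond (heavyE x) (upd (Num 1) j (Num 0) (ld 48 x))
     (loop_nbs 14 15 x (upd (Num 1) j (Num 0) (Mul (adjE x (var 15)) (degE (var 15))))))"

definition sqrt_tables where
  "sqrt_tables n a s H T \<longleftrightarrow> T 34 = tC n a s H \<and> T 48 = tD n a H \<and> T 41 = scalar (gT n a s) \<and>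
     T 42 = scalar (gD n a s) \<and> T 49 = scalar (gB n a every s)"

definition e34 where "e34 = Seq (upd (var 1) 34 (var 2) (Mul (heavyE (var 2)) (selE (var 3))))
    (upd (var 1) 34 (var 3) (Mul (heavyE (var 3)) (selE (var 2))))"
definition e48 where "e48 = Seq (loop_heavy (upd (var 1) 48 (var 15) (Add (adjE (var 2) (var 15)) (adjE (var 3) (var 15)))))
    (Seq (upd (var 1) 48 (var 2) (Mul (heavyE (var 2)) (Add (var 6) (Num 1))))
      (upd (var 1) 48 (var 3) (Mul (heavyE (var 3)) (Add (var 5) (Num 1)))))"
definition e41 where "e41 = upd (var 1) 41 (Num 0) (Mul (Mul (Num 2) (selE (var 2))) (selE (var 3)))"
definition e42 where "e42 = upd (var 1) 42 (Num 0) (Add (selE (var 2)) (selE (var 3)))"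
definition e49 where "e49 = upd (var 1) 49 (Num 0)
    (Add (Add (var 22) (Mul (selE (var 3)) (Add (var 5) (Num 1))))
         (Add (var 23) (Mul (selE (var 2)) (Add (var 6) (Num 1)))))"

text \<open>Among the persistent tables only table 34 is read here, so it alone has to be corrected
  first on a deletion and last on an insertion.\<close>

definition edge2 where
  "edge2 = Seq (Cond (var 1) Skip e34) (Seq (cgather2 22 (var 2)) (Seq (cgather2 23 (var 3))
     (Seq e48 (Seq e41 (Seq e42 (Seq e49 (Cond (var 1) e34 Skip)))))))"

definition m34 where "m34 = loop_heavy (upd (var 1) 34 (var 15) (adjE (var 2) (var 15)))"
definition m41 where "m41 = upd (var 1) 41 (Num 0) (Mul (Num 2) (var 22))"
definition m42 where "m42 = upd (var 1) 42 (Num 0) (var 5)"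
definition m49 where "m49 = upd (var 1) 49 (Num 0) (var 23)"

definition mark2 where
  "mark2 = Seq (cgather2 22 (var 2)) (Seq (dgather2 23 (var 2)) (Seq m34 (Seq m41 (Seq m42 m49))))"

definition st34 where "st34 = upd (var 1) 34 (var 2) (var 22)"
definition st48 where "st48 = upd (var 1) 48 (var 2) (var 23)"

definition status2 where
  "status2 = Seq (cgather2 22 (var 2)) (Seq (dgather2 23 (var 2)) (Seq st34 st48))"

context machine1
begin

lemma steps_cgather2:
  assumes "vars_ok T" "heavy_list H T" and u: "T k 0 = u" "k = 2 \<or> k = 3"
    and j: "20 \<le> j" "j < 32" and a: "adjf I (T 2 0) (T 3 0) = a" "self I (T 4 0) = s"
    and C: "u \<in> H \<Longrightarrow> T 34 u = cn n a s u"
    and N: "N \<ge> 1" "u \<notin> H \<Longrightarrow> N \<ge> 1 + length (nbs u)"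
  shows "steps' (cgather2 j (var k)) T N (T(j := scalar (cn n a s u)))"
proof -
  interpret wgraph n a unfolding a[symmetric] by (rule wgraph_adjf)
  have k': "k < 64" "k \<notin> scratch" "k \<noteq> j" "\<And>f g. (T(14 := g, 15 := f)) k 0 = u" using u j by (auto simp: scratch_def)
  have j': "j \<notin> scratch" "j < 64" using j by (auto simp: scratch_def)
  have a_nbs: "w \<notin> set (nbs u) \<Longrightarrow> a u w = 0" for w unfolding a[symmetric] by (rule adjf_out)
  have s_le: "s w \<le> 1" for w unfolding a[symmetric] by (rule self_le)
  show ?thesis
    unfolding cgather2_def
  proof (rule steps_gather)
    let ?e1 = "\<lambda>q. of_bool (q = ev I T (Num 0)) * ev I T (ld 34 (var k))"
    let ?e2 = "\<lambda>q. \<Sum>w<n. of_bool (q = 0) * (a u w * s w)"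
    show "adds' True (Cond (heavyE (var k)) (upd (Num 1) j (Num 0) (ld 34 (var k)))
     (loop_nbs 14 15 (var k) (upd (Num 1) j (Num 0) (Mul (adjE (var k) (var 15)) (selE (var 15)))))) T scratch j N
      (if ev I T (heavyE (var k)) \<noteq> 0 then ?e1 else ?e2)"
    proof (rule adds_cond)
      show "adds' True (upd (Num 1) j (Num 0) (ld 34 (var k))) T scratch j N ?e1"
        by (rule adds_upd_of_bool) (use j k' N S64 in \<open>auto simp: scratch_def\<close>)
      assume "ev I T (heavyE (var k)) = 0"
      then have uH: "u \<notin> H" using k' u heavy_listD[OF assms(2)] by simp
      show "adds' True (loop_nbs 14 15 (var k) (upd (Num 1) j (Num 0) (Mul (adjE (var k) (var 15)) (selE (var 15)))))
        T scratch j N ?e2"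
        by (rule scatter_nbs[where u = u])
          (use j j' k' u N(2)[OF uH] S64 a_nbs a in \<open>auto simp: scratch_def\<close>)
    qed (use j k' N in \<open>auto simp: scratch_def\<close>)
    fix q
    show "(if ev I T (heavyE (var k)) \<noteq> 0 then ?e1 else ?e2) q = scalar (cn n a s u) q"
    proof (cases "u \<in> H")
      case True
      then show ?thesis using k' u heavy_listD[OF assms(2)] C by (simp add: scalar_def)
    next
      case False
      have "?e2 q = scalar (cn n a s u) q"
        unfolding scalar_def cn_def sum_distrib_left by (simp add: a_sym[of u] mult.commute)
      then show ?thesis using False k' u heavy_listD[OF assms(2)] by simp
    qed
  qed (use assms j S64 W_bound(3)[OF cn_le] s_le in auto)
qed

lemma steps_dgather2:
  assumes "vars_ok T" "heavy_list H T" and u: "T 2 0 = u" "u \<noteq> in_s I"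
    and j: "20 \<le> j" "j < 32" and a: "adjf I (T 2 0) (T 3 0) = a" "T 3 0 = in_s I"
    and C: "u \<in> H \<Longrightarrow> T 48 u = nbdeg n a every u"
    and N: "N \<ge> 1" "u \<notin> H \<Longrightarrow> N \<ge> 1 + length (nbs u)"
  shows "steps' (dgather2 j (var 2)) T N (T(j := scalar (nbdeg n a every u)))"
proof -
  interpret wgraph n a unfolding a[symmetric] by (rule wgraph_adjf)
  have j': "j \<notin> scratch" "j < 64" using j by (auto simp: scratch_def)
  have a_nbs: "w \<notin> set (nbs u) \<Longrightarrow> a u w = 0" for w unfolding a(1)[symmetric] by (rule adjf_out)
  \<comment> \<open>For \<open>w\<close> equal to the source the two degrees may differ, but then
    the factor \<open>a u w\<close> is 0.\<close>
  have d: "a u w * (length (nbs w) - of_bool (in_s I \<in> set (nbs w))) = a u w * dg n a w" for w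
  proof (cases "w = in_s I")
    case True
    then have "a u w = 0" unfolding a(1)[symmetric] by (simp add: adjf_def)
    then show ?thesis by simp
  next
    case False
    then show ?thesis using dg_adjf[OF False, of u] a u by simp
  qed
  show ?thesis
    unfolding dgather2_def
  proof (rule steps_gather)
    let ?e1 = "\<lambda>q. of_bool (q = ev I T (Num 0)) * ev I T (ld 48 (var 2))"
    let ?e2 = "\<lambda>q. \<Sum>w<n. of_bool (q = 0) * (a u w * (length (nbs w) - of_bool (in_s I \<in> set (nbs w))))"
    show "adds' True (Cond (heavyE (var 2)) (upd (Num 1) j (Num 0) (ld 48 (var 2)))
     (loop_nbs 14 15 (var 2) (upd (Num 1) j (Num 0) (Mul (adjE (var 2) (var 15)) (degE (var 15)))))) T scratch j N
      (if ev I T (heavyE (var 2)) \<noteq> 0 then ?e1 else ?e2)"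
    proof (rule adds_cond)
      show "adds' True (upd (Num 1) j (Num 0) (ld 48 (var 2))) T scratch j N ?e1"
        by (rule adds_upd_of_bool) (use j N S64 in \<open>auto simp: scratch_def\<close>)
      assume "ev I T (heavyE (var 2)) = 0"
      then have uH: "u \<notin> H" using u heavy_listD[OF assms(2)] by simp
      show "adds' True (loop_nbs 14 15 (var 2) (upd (Num 1) j (Num 0) (Mul (adjE (var 2) (var 15)) (degE (var 15)))))
        T scratch j N ?e2"
        by (rule scatter_nbs[where u = u])
          (use j j' u N(2)[OF uH] S64 a_nbs a in \<open>auto simp: scratch_def\<close>)
    qed (use j N in \<open>auto simp: scratch_def\<close>)
    fix q
    show "(if ev I T (heavyE (var 2)) \<noteq> 0 then ?e1 else ?e2) q = scalar (nbdeg n a every u) q"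
    proof (cases "u \<in> H")
      case True
      then show ?thesis using u heavy_listD[OF assms(2)] C by (simp add: scalar_def)
    next
      case False
      have "?e2 q = scalar (nbdeg n a every u) q"
        unfolding d scalar_def nbdeg_def sum_distrib_left by (simp add: a_sym[of u])
      then show ?thesis using False u heavy_listD[OF assms(2)] by simp
    qed
  qed (use assms j S64 W_bound(2)[OF nbdeg_le] in auto)
qed

end

context edge_ctx
begin

lemma steps_e34:
  assumes "env' T" "T 34 = pick b (tC n a s H) (tC n a' s H)" "N \<ge> 1"
  shows "steps' e34 T N (T(34 := pick b (tC n a' s H) (tC n a s H)))"
proof (rule steps_toggle)
  show "adds' b e34 T scratch 34 N (\<lambda>q. of_bool (q = ev I T (var 2)) * ev I T (Mul (heavyE (var 2)) (selE (var 3)))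
     + of_bool (q = ev I T (var 3)) * ev I T (Mul (heavyE (var 3)) (selE (var 2))))"
    unfolding e34_def
    by (intro adds_seq adds_upd_of_bool)
      (use assms(3) xyn in \<open>auto simp: envD[OF assms(1)] scratch_def addr1'\<close>)
  show "tC n a' s H q < W" for q
    unfolding tC_def
    by (intro W_bound(3) mult_le_one wgraph.cn_le[OF wgraph'] s_le) (simp add: heavy_def)
qed (use assms tC' in \<open>auto simp: envD[OF assms(1)] scratch_def\<close>)

lemma steps_e48:
  assumes "env' T" "T 48 = pick b (tD n a H) (tD n a' H)" "N \<ge> 1 + card H"
  shows "steps' e48 T N (T(48 := pick b (tD n a' H) (tD n a H)))"
proof (rule steps_toggle)
  show "adds' b e48 T scratch 48 N (\<lambda>q. (\<Sum>w<n. of_bool (w \<in> H) * (of_bool (q = w) * (a x w + a y w)))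
    + (of_bool (q = ev I T (var 2)) * ev I T (Mul (heavyE (var 2)) (Add (var 6) (Num 1)))
     + of_bool (q = ev I T (var 3)) * ev I T (Mul (heavyE (var 3)) (Add (var 5) (Num 1)))))"
    unfolding e48_def
    by (intro adds_seq adds_upd_of_bool scatter_heavy)
      (use assms(3) xyn Hn addr1 in \<open>auto simp: envD[OF assms(1)] scratch_def addr1'\<close>)
  show "tD n a' H q < W" for q
    unfolding tD_def
    by (intro W_bound(2) mult_le_one wgraph.nbdeg_le[OF wgraph']) (simp_all add: heavy_def)
qed (use assms tD' in \<open>auto simp: envD[OF assms(1)] scratch_def\<close>)

lemma steps_edge2:
  assumes "env' T" "sqrt_tables n (pick b a a') s H T"
    and N: "N \<ge> 1 + card H + light_cost 2 I H x + light_cost 2 I H y"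
  shows "\<exists>T'. steps' edge2 T N T' \<and> sqrt_tables n (pick b a' a) s H T' \<and> (\<forall>j<20. T' j = T j) \<and> vars_ok T'"
proof -
  have N1: "N \<ge> 1" "N \<ge> 1 + card H" "x \<notin> H \<Longrightarrow> N \<ge> 1 + length (nbs x)" "y \<notin> H \<Longrightarrow> N \<ge> 1 + length (nbs y)"
    using N by (auto simp: light_cost_def)
  have G: "T 34 = pick b (tC n a s H) (tC n a' s H)" "T 48 = pick b (tD n a H) (tD n a' H)"
    "T 41 = scalar (pick b (gT n a s) (gT n a' s))" "T 42 = scalar (pick b (gD n a s) (gD n a' s))"
    "T 49 = scalar (pick b (gB n a every s) (gB n a' every s))"
    using assms(2) by (cases b; simp add: sqrt_tables_def)+
  have tc: "u \<in> H \<Longrightarrow> tC n a s H u = cn n a s u" for u by (simp add: tC_def)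
  note ag = wgraph.aggregate_le[OF wgraph', of s every, OF s_le, THEN W_bound(1)]
  define T1 where "T1 = T(34 := tC n a s H)"
  define T2 where "T2 = T1(22 := scalar (cn n a s x))"
  define T3 where "T3 = T2(23 := scalar (cn n a s y))"
  define T4 where "T4 = T3(48 := pick b (tD n a' H) (tD n a H))"
  define T5 where "T5 = T4(41 := scalar (pick b (gT n a' s) (gT n a s)))"
  define T6 where "T6 = T5(42 := scalar (pick b (gD n a' s) (gD n a s)))"
  define T7 where "T7 = T6(49 := scalar (pick b (gB n a' every s) (gB n a every s)))"
  define T8 where "T8 = T7(34 := pick b (tC n a' s H) (tC n a s H))"
  note df = T1_def T2_def T3_def T4_def T5_def T6_def T7_def T8_def
  have e1: "env' T1" "env' T2" "env' T3" "env' T4" "env' T5" "env' T6" "env' T7"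
    using assms(1) by (auto simp: df)
  have "steps' (Cond (var 1) Skip e34) T N T1"
  proof (rule steps_Cond_bool[where b = b])
    assume b
    then have "T1 = T" using G(1) by (simp add: T1_def fun_upd_idem)
    then show "steps' Skip T N T1" using steps_Skip N1 by metis
  next
    assume "\<not> b"
    then show "steps' e34 T N T1" using steps_e34[OF assms(1) G(1) N1(1)] by (simp add: T1_def)
  qed (use N1 envD[OF assms(1)] in auto)
  moreover have "steps' (cgather2 22 (var 2)) T1 N T2"
    unfolding T2_def by (rule steps_cgather2[where H = H])
      (use N1 envD[OF e1(1)] in \<open>auto simp: T1_def tc\<close>)
  moreover have "steps' (cgather2 23 (var 3)) T2 N T3"
    unfolding T3_def by (rule steps_cgather2[where H = H])
      (use N1 envD[OF e1(2)] in \<open>auto simp: T1_def T2_def tc\<close>)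
  moreover have "steps' e48 T3 N T4"
    unfolding T4_def by (rule steps_e48) (use N1 e1 G in \<open>auto simp: df\<close>)
  moreover have "steps' e41 T4 N T5"
    unfolding T5_def e41_def
    by (rule steps_scalar[OF _ _ _ _ _ _ _ ag(1)]) (use N1 in \<open>auto simp: envD[OF assms(1)] G gT' T1_def T2_def T3_def T4_def scratch_def\<close>)
  moreover have "steps' e42 T5 N T6"
    unfolding T6_def e42_def
    by (rule steps_scalar[OF _ _ _ _ _ _ _ ag(2)]) (use N1 in \<open>auto simp: envD[OF assms(1)] G gD' T1_def T2_def T3_def T4_def T5_def scratch_def\<close>)
  moreover have "steps' e49 T6 N T7"
  proof -
    have v: "T6 22 0 = cn n a s x" "T6 23 0 = cn n a s y" by (simp_all add: df)
    show ?thesis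
    unfolding T7_def e49_def
    by (rule steps_scalar[OF _ _ _ _ _ _ _ ag(3)]) (use N1 in \<open>auto simp: envD[OF assms(1)] G gB'[of every s] v T1_def T2_def T3_def T4_def T5_def T6_def scratch_def\<close>)
  qed
  moreover have "steps' (Cond (var 1) e34 Skip) T7 N T8"
  proof (rule steps_Cond_bool[where b = b])
    assume "\<not> b"
    then have "T8 = T7" unfolding T8_def by (intro fun_upd_idem) (simp add: df)
    then show "steps' Skip T7 N T8" using steps_Skip N1 by metis
  next
    assume b
    then show "steps' e34 T7 N T8" unfolding T8_def
      by (intro steps_e34) (use e1 N1 in \<open>auto simp: df\<close>)
  qed (use N1 envD[OF e1(7)] in auto)
  ultimately have "steps' edge2 T N T8"
    unfolding edge2_def by (intro steps_Seq)
  moreover have "sqrt_tables n (pick b a' a) s H T8"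
    by (cases b) (simp_all add: df sqrt_tables_def)
  moreover have "\<forall>j<20. T8 j = T j" by (auto simp: df)
  moreover have "vars_ok T8" using envD(9)[OF e1(7)] by (simp add: T8_def)
  ultimately show ?thesis by blast
qed

end

lemma edge2_ok: "edge_ok (light_cost 2) machine1 sqrt_tables edge2"
  by (rule edge_okI[OF machine1.axioms(1)], assumption) (rule edge_ctx.steps_edge2; (assumption | rule edge_ctx.intro)+)

context mark_ctx
begin

lemma steps_m34:
  assumes "env b x (in_s I) x (dg n a x) dy H T" "T 34 = pick b (tC n a s H) (tC n a s' H)" "N \<ge> 1 + card H"
  shows "steps' m34 T N (T(34 := pick b (tC n a s' H) (tC n a s H)))"
proof (rule steps_toggle)
  show "adds' b m34 T scratch 34 N (\<lambda>q. \<Sum>w<n. of_bool (w \<in> H) * (of_bool (q = w) * a x w))"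
    unfolding m34_def
    by (intro scatter_heavy) (use assms(3) xn Hn addr1 in \<open>auto simp: envD[OF assms(1)] scratch_def\<close>)
  show "tC n a s' H q < W" for q
    unfolding tC_def by (intro W_bound(3) mult_le_one cn_le s_le') simp
qed (use assms m_tC in \<open>auto simp: scratch_def\<close>)

lemma steps_mark2:
  assumes e0: "env b x (in_s I) x (dg n a x) dy H T" and "sqrt_tables n a (pick b s s') H T"
    and N: "N \<ge> 1 + card H + light_cost 2 I H x"
  shows "\<exists>T'. steps' mark2 T N T' \<and> sqrt_tables n a (pick b s' s) H T' \<and> (\<forall>j<20. T' j = T j) \<and> vars_ok T'"
proof -
  have N1: "N \<ge> 1" "N \<ge> 1 + card H" "x \<notin> H \<Longrightarrow> N \<ge> 1 + length (nbs x)"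
    using N by (auto simp: light_cost_def)
  have G: "T 34 = pick b (tC n a s H) (tC n a s' H)" "T 48 = tD n a H"
    "T 41 = scalar (pick b (gT n a s) (gT n a s'))" "T 42 = scalar (pick b (gD n a s) (gD n a s'))"
    "T 49 = scalar (pick b (gB n a every s) (gB n a every s'))"
    using assms(2) by (cases b; simp add: sqrt_tables_def)+
  \<comment> \<open>As \<open>a x x = 0\<close>, the entry at \<open>x\<close> does not depend on
    the toggled mark. So table 34 can be read before its update for insertions and deletions
    alike.\<close>
  have tc: "T 34 x = cn n a s x" "T 48 x = nbdeg n a every x" if "x \<in> H"
    using that by (cases b; simp add: G tC_def m_cn a_irr tD_def)+
  note ag = aggregate_le[of s' every, OF s_le', THEN W_bound(1)]
  define T1 where "T1 = T(22 := scalar (cn n a s x))"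
  define T2 where "T2 = T1(23 := scalar (nbdeg n a every x))"
  define T3 where "T3 = T2(34 := pick b (tC n a s' H) (tC n a s H))"
  define T4 where "T4 = T3(41 := scalar (pick b (gT n a s') (gT n a s)))"
  define T5 where "T5 = T4(42 := scalar (pick b (gD n a s') (gD n a s)))"
  define T6 where "T6 = T5(49 := scalar (pick b (gB n a every s') (gB n a every s)))"
  note df = T1_def T2_def T3_def T4_def T5_def T6_def
  have e1: "env b x (in_s I) x (dg n a x) dy H T1" "env b x (in_s I) x (dg n a x) dy H T2"
    "env b x (in_s I) x (dg n a x) dy H T3" "env b x (in_s I) x (dg n a x) dy H T4"
    "env b x (in_s I) x (dg n a x) dy H T5" "env b x (in_s I) x (dg n a x) dy H T6"
    using e0 by (auto simp: df)
  have "steps' (cgather2 22 (var 2)) T N T1"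
    unfolding T1_def by (rule steps_cgather2[where H = H])
      (use N1 envD[OF e0] tc in \<open>auto\<close>)
  moreover have "steps' (dgather2 23 (var 2)) T1 N T2"
    unfolding T2_def by (rule steps_dgather2[where H = H])
      (use N1 envD[OF e1(1)] xn tc in \<open>auto simp: T1_def\<close>)
  moreover have "steps' m34 T2 N T3"
    unfolding T3_def by (rule steps_m34[OF e1(2)]) (use N1 G in \<open>auto simp: df\<close>)
  moreover have "steps' m41 T3 N T4"
    unfolding T4_def m41_def
    by (rule steps_scalar[OF _ _ _ _ _ _ _ ag(1)]) (use N1 in \<open>auto simp: envD[OF e0] G m_gT T1_def T2_def T3_def scratch_def\<close>)
  moreover have "steps' m42 T4 N T5"
    unfolding T5_def m42_def
    by (rule steps_scalar[OF _ _ _ _ _ _ _ ag(2)]) (use N1 in \<open>auto simp: envD[OF e0] G m_gD T1_def T2_def T3_def T4_def scratch_def\<close>)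
  moreover have "steps' m49 T5 N T6"
    unfolding T6_def m49_def
    by (rule steps_scalar[OF _ _ _ _ _ _ _ ag(3)]) (use N1 in \<open>auto simp: envD[OF e0] G m_gB[of every] T1_def T2_def T3_def T4_def T5_def scratch_def\<close>)
  ultimately have "steps' mark2 T N T6"
    unfolding mark2_def by (intro steps_Seq)
  moreover have "sqrt_tables n a (pick b s' s) H T6"
    by (cases b) (simp_all add: df sqrt_tables_def G)
  moreover have "\<forall>j<20. T6 j = T j" by (auto simp: df)
  ultimately show ?thesis using envD(9)[OF e1(6)] by blast
qed

end

lemma mark2_ok: "mark_ok (light_cost 2) machine1 sqrt_tables mark2"
  by (rule mark_okI[OF machine1.axioms(1)], assumption) (rule mark_ctx.steps_mark2; (assumption | rule mark_ctx.intro)+)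

context status_ctx
begin

lemma ev_e [simp]: "adjf I x (in_s I) = a" "self I (in_s I) = s"
  using a_eq s_eq by auto

lemma steps_status2:
  assumes e0: "env b x (in_s I) (in_s I) (dg n a x) dy H T" and "sqrt_tables n a s (pick b H (insert x H)) T"
    and N: "N \<ge> 1 + length (nbs x)"
  shows "\<exists>T'. steps' status2 T N T' \<and> sqrt_tables n a s (pick b (insert x H) H) T' \<and> (\<forall>j<20. T' j = T j) \<and> vars_ok T'"
proof -
  have N1: "N \<ge> 1" using N by simp
  have G: "T 34 = pick b (tC n a s H) (tC n a s (insert x H))" "T 48 = pick b (tD n a H) (tD n a (insert x H))"
    "T 41 = scalar (gT n a s)" "T 42 = scalar (gD n a s)" "T 49 = scalar (gB n a every s)"
    using assms(2) by (cases b; simp add: sqrt_tables_def)+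
  define T1 where "T1 = T(22 := scalar (cn n a s x))"
  define T2 where "T2 = T1(23 := scalar (nbdeg n a every x))"
  define T3 where "T3 = T2(34 := pick b (tC n a s (insert x H)) (tC n a s H))"
  define T4 where "T4 = T3(48 := pick b (tD n a (insert x H)) (tD n a H))"
  note df = T1_def T2_def T3_def T4_def
  have e1: "env b x (in_s I) (in_s I) (dg n a x) dy H T1" "env b x (in_s I) (in_s I) (dg n a x) dy H T2"
    "env b x (in_s I) (in_s I) (dg n a x) dy H T3" "env b x (in_s I) (in_s I) (dg n a x) dy H T4"
    using e0 by (auto simp: df)
  have "steps' (cgather2 22 (var 2)) T N T1"
    unfolding T1_def by (rule steps_cgather2[where H = H])
      (use N envD[OF e0] xn in \<open>auto\<close>)
  moreover have "steps' (dgather2 23 (var 2)) T1 N T2"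
    unfolding T2_def by (rule steps_dgather2[where H = H])
      (use N envD[OF e1(1)] xn in \<open>auto simp: T1_def\<close>)
  moreover have "steps' st34 T2 N T3"
    unfolding T3_def
  proof (rule steps_toggle)
    show "adds' b st34 T2 scratch 34 N (\<lambda>q. of_bool (q = ev I T2 (var 2)) * ev I T2 (var 22))"
      unfolding st34_def
      by (intro adds_upd_of_bool) (use N1 xn in \<open>auto simp: envD[OF e1(2)] scratch_def addr1'\<close>)
    show "tC n a s (insert x H) q < W" for q
      unfolding tC_def by (intro W_bound(3) mult_le_one cn_le s_le) simp
  qed (use tC_insert[OF xn(3)] in \<open>auto simp: T1_def T2_def G scratch_def envD[OF e0]\<close>)
  moreover have "steps' st48 T3 N T4"
    unfolding T4_def
  proof (rule steps_toggle)
    show "adds' b st48 T3 scratch 48 N (\<lambda>q. of_bool (q = ev I T3 (var 2)) * ev I T3 (var 23))"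
      unfolding st48_def
      by (intro adds_upd_of_bool) (use N1 xn in \<open>auto simp: envD[OF e1(3)] scratch_def addr1'\<close>)
    show "tD n a (insert x H) q < W" for q
      unfolding tD_def by (intro W_bound(2) mult_le_one nbdeg_le) simp_all
  qed (use tD_insert[OF xn(3)] in \<open>auto simp: T1_def T2_def T3_def G scratch_def envD[OF e0]\<close>)
  ultimately have "steps' status2 T N T4"
    unfolding status2_def by (intro steps_Seq)
  moreover have "sqrt_tables n a s (pick b (insert x H) H) T4"
    by (cases b) (simp_all add: df sqrt_tables_def G)
  moreover have "\<forall>j<20. T4 j = T j" by (auto simp: df)
  ultimately show ?thesis using envD(9)[OF e1(4)] by blast
qed

end

lemma status2_ok: "status_ok 2 machine1 sqrt_tables status2"
  by (rule status_okI, assumption) (rule status_ctx.steps_status2, simp_all)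

section \<open>Processing one update\<close>

lemma steps_While_False:
  assumes "indep I scratch b" "ev I T b = 0" "N \<ge> 1"
  shows "steps S W I (While b c) T N T"
  unfolding steps_def
proof (intro allI impI)
  fix M assume M: "agr scratch M T"
  have "eval_exp I M b = 0" using assms M indepD by metis
  from exec_While_False[OF this] have "exec S W I (While b c) M (1 + exp_cost b) M" .
  moreover have "1 + exp_cost b \<le> com_size (While b c) * N"
  proof -
    have "1 + exp_cost b \<le> com_size (While b c) * 1" by simp
    also have "\<dots> \<le> com_size (While b c) * N" using assms(3) by (rule mult_le_mono2)
    finally show ?thesis .
  qed
  ultimately show "\<exists>t M'. exec S W I (While b c) M t M' \<and> t \<le> com_size (While b c) * N \<and> agr scratch M' T"
    using M by blast
qed

lemma steps_While_True:
  assumes "indep I scratch b" "ev I T b \<noteq> 0" "N1 \<ge> 1"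
    and "steps S W I c T N1 T1" "steps S W I (While b c) T1 N2 T2"
  shows "steps S W I (While b c) T (N1 + N2) T2"
  unfolding steps_def
proof (intro allI impI)
  fix M assume M: "agr scratch M T"
  have e: "eval_exp I M b \<noteq> 0" using assms M indepD by metis
  obtain t1 M1 where 1: "exec S W I c M t1 M1" "t1 \<le> com_size c * N1" "agr scratch M1 T1"
    using assms(4) M unfolding steps_def by blast
  obtain t2 M2 where 2: "exec S W I (While b c) M1 t2 M2" "t2 \<le> com_size (While b c) * N2" "agr scratch M2 T2"
    using assms(5) 1(3) unfolding steps_def by blast
  have "(1 + exp_cost b) * 1 \<le> (1 + exp_cost b) * N1" using assms(3) by (intro mult_le_mono) auto
  then have "1 + exp_cost b + t1 + t2 \<le> com_size (While b c) * (N1 + N2)"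
    using 1(2) 2(2) by (simp add: algebra_simps)
  then show "\<exists>t M'. exec S W I (While b c) M t M' \<and> t \<le> com_size (While b c) * (N1 + N2) \<and> agr scratch M' T2"
    using exec_While_True[OF e 1(1) 2(1)] 2(3) by blast
qed

definition amat :: "nat \<Rightarrow> nat set set \<Rightarrow> nat \<Rightarrow> nat \<Rightarrow> nat" where
  "amat s E u v = of_bool ({u, v} \<in> E \<and> u \<noteq> s \<and> v \<noteq> s)"
definition smark :: "nat \<Rightarrow> nat set set \<Rightarrow> nat \<Rightarrow> nat" where
  "smark s E u = of_bool ({s, u} \<in> E)"

definition simple_edges :: "nat \<Rightarrow> nat set set \<Rightarrow> bool" where
  "simple_edges n E \<longleftrightarrow> (\<forall>e\<in>E. e \<subseteq> {..<n} \<and> card e = 2)"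

lemma simple_edgesD: "simple_edges n E \<Longrightarrow> {u, v} \<in> E \<Longrightarrow> u < n \<and> v < n \<and> u \<noteq> v"
  unfolding simple_edges_def by (metis card_2_iff doubleton_eq_iff insert_subset lessThan_iff)

lemma simple_edges_single: "simple_edges n E \<Longrightarrow> {v} \<notin> E"
  using simple_edgesD[of n E v v] by auto

lemma finite_edges: "simple_edges n E \<Longrightarrow> finite E"
  unfolding simple_edges_def by (rule finite_subset[of _ "Pow {..<n}"]) auto

fun upd_u :: "update \<Rightarrow> nat" where
  "upd_u (Insert_Edge u v) = u" | "upd_u (Delete_Edge u v) = u"
fun upd_v :: "update \<Rightarrow> nat" where
  "upd_v (Insert_Edge u v) = v" | "upd_v (Delete_Edge u v) = v"
fun is_ins :: "update \<Rightarrow> bool" where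
  "is_ins (Insert_Edge u v) = True" | "is_ins (Delete_Edge u v) = False"

lemma update_inputs_sel [simp]:
  "in_n (update_inputs n s x L) = n" "in_s (update_inputs n s x L) = s"
  "in_u (update_inputs n s x L) = upd_u x" "in_v (update_inputs n s x L) = upd_v x"
  "in_ins (update_inputs n s x L) = is_ins x" "in_nbs (update_inputs n s x L) = L"
  by (cases x; simp)+

lemma apply_update_eq: "apply_update x E = (if is_ins x then insert {upd_u x, upd_v x} E else E - {{upd_u x, upd_v x}})"
  by (cases x) auto

lemma valid_updateD:
  assumes "valid_update n E x" "simple_edges n E"
  shows "upd_u x < n" "upd_v x < n" "upd_u x \<noteq> upd_v x" "{upd_u x, upd_v x} \<in> E \<longleftrightarrow> \<not> is_ins x"
    "simple_edges n (apply_update x E)"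
    "card (apply_update x E) = (if is_ins x then card E + 1 else card E - 1)"
    "\<not> is_ins x \<Longrightarrow> card E \<ge> 1"
proof -
  show u: "upd_u x < n" "upd_v x < n" "upd_u x \<noteq> upd_v x"
    using assms simple_edgesD by (cases x; auto)+
  show i: "{upd_u x, upd_v x} \<in> E \<longleftrightarrow> \<not> is_ins x" using assms by (cases x) auto
  show "simple_edges n (apply_update x E)"
    using assms(2) u unfolding simple_edges_def apply_update_eq by auto
  show "card (apply_update x E) = (if is_ins x then card E + 1 else card E - 1)"
    using i finite_edges[OF assms(2)] unfolding apply_update_eq by auto
  show "\<not> is_ins x \<Longrightarrow> card E \<ge> 1"
    using i finite_edges[OF assms(2)] by (metis One_nat_def Suc_leI card_gt_0_iff empty_iff)
qed

text \<open>The sum of both arguments minus the source is the endpoint other than the source,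
  whichever argument that is. Stored degrees refer to the graph without the toggled edge, hence the
  subtraction of \<open>Is_Insertion\<close>; an edge at the source is excluded by
  \<open>degE\<close> already.\<close>

definition dispatch :: "com \<Rightarrow> com \<Rightarrow> com" where
  "dispatch ec mc = Seq (Store (cell 1 (Num 0)) Is_Insertion)
     (Cond (Add (Equal Arg_U Source) (Equal Arg_V Source))
       (Seq (Store (cell 2 (Num 0)) (Sub (Add Arg_U Arg_V) Source))
        (Seq (Store (cell 3 (Num 0)) Source) (Seq (Store (cell 4 (Num 0)) (var 2))
        (Seq (Store (cell 5 (Num 0)) (degE (var 2))) mc))))
       (Seq (Store (cell 2 (Num 0)) Arg_U) (Seq (Store (cell 3 (Num 0)) Arg_V)
        (Seq (Store (cell 4 (Num 0)) Source)
        (Seq (Store (cell 5 (Num 0)) (Sub (degE (var 2)) Is_Insertion))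
        (Seq (Store (cell 6 (Num 0)) (Sub (degE (var 3)) Is_Insertion)) ec))))))"

lemma (in machine) steps_set:
  assumes "j < 14" "indep I scratch e" "ev I T e = v" "v < W" "N \<ge> 1"
  shows "steps' (Store (cell j (Num 0)) e) T N (T(j := (T j)(0 := v)))"
  using steps_Store[of j I "Num 0" e N T S W] assms S64 by (simp add: scratch_def)

lemma machineI:
  assumes "64 \<le> S" "64 * (n + 1) ^ 4 < W" "s < n" "adjacency_lists E L" "simple_edges n E"
    "in_n I = n" "in_s I = s" "in_nbs I = L"
  shows "machine S W I"
proof
  have L: "set (L v) = {w. {v, w} \<in> E}" "distinct (L v)" for v
    using assms(4) by (auto simp: adjacency_lists_def)
  show "distinct (in_nbs I v)" for v using L assms by simp
  show "u \<in> set (in_nbs I v) \<longleftrightarrow> v \<in> set (in_nbs I u)" for u v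
    using L assms by (simp add: insert_commute)
  show "v \<notin> set (in_nbs I v)" for v using L assms simple_edges_single by auto
  show "u \<in> set (in_nbs I v) \<Longrightarrow> u < in_n I" for u v using L assms simple_edgesD by auto
qed (use assms in auto)

locale update_step =
  fixes S W n s :: nat and E :: "nat set set" and x :: update and L :: "nat \<Rightarrow> nat list"
  assumes E: "simple_edges n E" and vx: "valid_update n E x"
    and L: "adjacency_lists (apply_update x E) L"
    and s: "s < n" and size: "64 \<le> S" "64 * (n + 1) ^ 4 < W"
begin

abbreviation "I \<equiv> update_inputs n s x L"
abbreviation "E' \<equiv> apply_update x E"
abbreviation "u \<equiv> upd_u x"
abbreviation "v \<equiv> upd_v x"
abbreviation "b \<equiv> is_ins x"

lemmas vd = valid_updateD[OF vx E]

sublocale M: machine S W I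
  by (rule machineI[OF size s L vd(5)]) auto

lemma set_L: "set (L w) = {z. {w, z} \<in> E'}"
  using L by (simp add: adjacency_lists_def)

lemma set_nbs: "set (in_nbs I w) = {z. {w, z} \<in> E'}"
  using set_L by simp

lemma in_E': "e \<in> E' \<longleftrightarrow> (if e = {u, v} then b else e \<in> E)"
  by (auto simp: apply_update_eq)

lemma in_E: "{u, v} \<in> E \<longleftrightarrow> \<not> b" by (rule vd(4))

lemma adjf_status: "adjf I w s = amat s E'"
  by (auto simp: adjf_def amat_def set_L fun_eq_iff)

lemma self_status: "self I s = smark s E'"
  using simple_edges_single[OF vd(5)] by (auto simp: self_def smark_def set_L fun_eq_iff)

text \<open>On an insertion \<open>E\<close> is the graph without the toggled edge and
  \<open>E'\<close> the one with it; on a deletion the roles are exchanged. This is what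
  \<open>pick b\<close> expresses, and it links the contracts to the actual update.\<close>

lemma edge_cases:
  assumes "u \<noteq> s" "v \<noteq> s"
  shows "pick b (adjf I u v) (add_edge u v (adjf I u v)) = amat s E"
    "pick b (add_edge u v (adjf I u v)) (adjf I u v) = amat s E'"
    "self I s = smark s E" "self I s = smark s E'"
    "dg n (adjf I u v) u = length (L u) - of_bool (s \<in> set (L u)) - of_bool b"
    "dg n (adjf I u v) v = length (L v) - of_bool (s \<in> set (L v)) - of_bool b"
proof -
  have e: "{p, q} = {u, v} \<longleftrightarrow> p = u \<and> q = v \<or> p = v \<and> q = u" for p q
    by (auto simp: doubleton_eq_iff)
  have n0: "adjf I u v p q = of_bool ({p, q} \<in> E' \<and> p \<noteq> s \<and> q \<noteq> s \<and> {p, q} \<noteq> {u, v})" for p q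
    unfolding adjf_def set_nbs using e by (auto)
  have n1: "add_edge u v (adjf I u v) p q = of_bool (({p, q} \<in> E' \<or> {p, q} = {u, v}) \<and> p \<noteq> s \<and> q \<noteq> s)" for p q
  proof (cases "{p, q} = {u, v}")
    case True
    then have "ed u v p q = 1" using e vd(3) by (auto simp: ed_def)
    then show ?thesis using True assms e unfolding add_edge_def n0 by auto
  next
    case False
    then have "ed u v p q = 0" using e by (auto simp: ed_def)
    then show ?thesis using False unfolding add_edge_def n0 by simp
  qed
  show "pick b (adjf I u v) (add_edge u v (adjf I u v)) = amat s E"
    using in_E in_E' by (cases b) (auto simp: fun_eq_iff n0 n1 amat_def)
  show "pick b (add_edge u v (adjf I u v)) (adjf I u v) = amat s E'"
    using in_E in_E' by (cases b) (auto simp: fun_eq_iff n0 n1 amat_def)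
  show 1: "self I s = smark s E'" by (rule self_status)
  have "{s, p} \<noteq> {u, v}" for p using assms by (auto simp: doubleton_eq_iff)
  then show "self I s = smark s E" unfolding 1 using in_E' by (auto simp: smark_def fun_eq_iff)
  interpret et: edge_toggle n "adjf I u v" u v
  proof -
    interpret wgraph n "adjf I u v" using M.wgraph_adjf[of u v] by simp
    show "edge_toggle n (adjf I u v) u v"
      by unfold_locales (use vd in \<open>auto simp: adjf_def\<close>)
  qed
  have d: "dg n (amat s E') w = length (L w) - of_bool (s \<in> set (L w))" if "w \<noteq> s" for w
    using M.dg_adjf[of w s] that adjf_status by simp
  have "dg n (adjf I u v) w = length (L w) - of_bool (s \<in> set (L w)) - of_bool b" if w: "w = u \<or> w = v" for w
  proof (cases b)
    case True
    then have "add_edge u v (adjf I u v) = amat s E'"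
      using \<open>pick b (add_edge u v (adjf I u v)) (adjf I u v) = amat s E'\<close> by simp
    then have "dg n (amat s E') w = dg n (adjf I u v) w + of_bool (w = u) + of_bool (w = v)"
      using et.dg' by metis
    then show ?thesis using d[of w] assms w vd(3) True by auto
  next
    case False
    then have "adjf I u v = amat s E'"
      using \<open>pick b (add_edge u v (adjf I u v)) (adjf I u v) = amat s E'\<close> by simp
    then show ?thesis using d[of w] assms w False by auto
  qed
  then show "dg n (adjf I u v) u = length (L u) - of_bool (s \<in> set (L u)) - of_bool b"
    "dg n (adjf I u v) v = length (L v) - of_bool (s \<in> set (L v)) - of_bool b" by auto
qed

lemma mark_cases:
  assumes "u = s \<or> v = s" and w: "w = u + v - s"
  shows "w \<noteq> s" "w < n" "{u, v} = {s, w}" "adjf I w s = amat s E" "adjf I w s = amat s E'"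
    "pick b (self I w) (add_mark w (self I w)) = smark s E"
    "pick b (add_mark w (self I w)) (self I w) = smark s E'"
    "dg n (adjf I w s) w = length (L w) - of_bool (s \<in> set (L w))"
proof -
  show w1: "w \<noteq> s" "w < n" "{u, v} = {s, w}" using assms vd by auto
  show a: "adjf I w s = amat s E'" by (rule adjf_status)
  have "{p, q} \<noteq> {s, w}" if "p \<noteq> s" "q \<noteq> s" for p q using that by (auto simp: doubleton_eq_iff)
  then show "adjf I w s = amat s E" unfolding a using in_E' w1 by (auto simp: amat_def fun_eq_iff)
  have q: "{s, p} = {s, w} \<longleftrightarrow> p = w" for p by (auto simp: doubleton_eq_iff)
  have n0: "self I w p = of_bool ({s, p} \<in> E' \<and> {s, p} \<noteq> {s, w})" for p
    unfolding self_def set_nbs q by simp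
  have n1: "add_mark w (self I w) p = of_bool ({s, p} \<in> E' \<or> {s, p} = {s, w})" for p
    unfolding add_mark_def n0 q by auto
  show "pick b (self I w) (add_mark w (self I w)) = smark s E"
    using in_E in_E' w1(3) by (cases b) (auto simp: fun_eq_iff n0 n1 smark_def q)
  show "pick b (add_mark w (self I w)) (self I w) = smark s E'"
    using in_E in_E' w1(3) by (cases b) (auto simp: fun_eq_iff n0 n1 smark_def q)
  show "dg n (adjf I w s) w = length (L w) - of_bool (s \<in> set (L w))"
    using M.dg_adjf[of w w] w1 by simp
qed

lemma length_L_W: "length (L w) < W"
  using M.length_nbs[of w] M.W_pow by simp

lemma small_W: "1 < W" "s < W" "u < W" "v < W" "w < n \<Longrightarrow> w < W"
  using M.W_pow s vd by auto

definition touched :: "nat set" where "touched = {u, v} - {s}"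

lemma steps_dispatch:
  assumes ec: "edge_ok lc Mc Good ec" and mc: "mark_ok lc Mc Good mc" and Mc: "Mc S W I"
    and H: "H \<subseteq> {..<n}" "heavy_list H T" "vars_ok T"
    and Gc: "\<And>a s H T T'. Good n a s H T \<Longrightarrow> (\<And>j. 32 \<le> j \<Longrightarrow> T' j = T j) \<Longrightarrow> Good n a s H T'"
    and G: "Good n (amat s E) (smark s E) H T"
    and N: "N \<ge> 1 + card H + (\<Sum>w\<in>touched. lc I H w)"
  shows "\<exists>T'. steps S W I (dispatch ec mc) T N T' \<and> Good n (amat s E') (smark s E') H T' \<and>
     (\<forall>j. 7 \<le> j \<longrightarrow> j < 20 \<longrightarrow> T' j = T j) \<and> vars_ok T'"
proof -
  have N1: "N \<ge> 1" using N by simp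
  note st = M.steps_set[where N = N, OF _ _ _ _ N1]
  define T1 where "T1 = T(1 := (T 1)(0 := of_bool b))"
  have s1: "steps S W I (Store (cell 1 (Num 0)) Is_Insertion) T N T1"
    unfolding T1_def by (rule st) (use small_W in auto)
  show ?thesis
  proof (cases "u = s \<or> v = s")
    case True
    define w where "w = u + v - s"
    note mk = mark_cases[OF True w_def]
    define T2 where "T2 = T1(2 := (T1 2)(0 := w))"
    define T3 where "T3 = T2(3 := (T2 3)(0 := s))"
    define T4 where "T4 = T3(4 := (T3 4)(0 := w))"
    define T5 where "T5 = T4(5 := (T4 5)(0 := dg n (adjf I w s) w))"
    note df = T1_def T2_def T3_def T4_def T5_def
    have "\<exists>T'. steps S W I mc T5 N T' \<and> Good n (adjf I w s) (pick b (add_mark w (self I w)) (self I w)) H T' \<and>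
        (\<forall>j<20. T' j = T5 j) \<and> vars_ok T'"
    proof -
      have t: "touched = {w}" using True mk by (auto simp: touched_def w_def)
      have G5: "Good n (adjf I w s) (pick b (self I w) (add_mark w (self I w))) H T5"
        unfolding mk by (rule Gc[OF G]) (simp add: df)
      have "ctl b w s w (dg n (adjf I w s) w) (T5 6 0) T5" by (simp add: df ctl_def)
      moreover have "heavy_list H T5" "vars_ok T5" using H by (simp_all add: df)
      ultimately have "Mc S W I \<and> w < in_n I \<and> w \<noteq> in_s I \<and> adjf I w s = adjf I w (in_s I) \<and>
        self I w = self I w \<and> H \<subseteq> {..<in_n I} \<and> heavy_list H T5 \<and> vars_ok T5 \<and>
        ctl b w (in_s I) w (dg (in_n I) (adjf I w s) w) (T5 6 0) T5 \<and>
        Good (in_n I) (adjf I w s) (pick b (self I w) (add_mark w (self I w))) H T5 \<and>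
        N \<ge> 1 + card H + lc I H w"
        using Mc mk(1,2) H N t G5 by simp
      from mc[unfolded mark_ok_def, rule_format, OF this] show ?thesis by simp
    qed
    then obtain T6 where 6: "steps S W I mc T5 N T6" "Good n (amat s E') (smark s E') H T6"
      "\<forall>j<20. T6 j = T5 j" "vars_ok T6"
      unfolding mk(5,7) by blast
    have "steps S W I (Store (cell 2 (Num 0)) (Sub (Add Arg_U Arg_V) Source)) T1 N T2"
      unfolding T2_def by (rule st) (use small_W mk in \<open>auto simp: w_def\<close>)
    moreover have "steps S W I (Store (cell 3 (Num 0)) Source) T2 N T3"
      unfolding T3_def by (rule st) (use small_W in auto)
    moreover have "steps S W I (Store (cell 4 (Num 0)) (var 2)) T3 N T4"
      unfolding T4_def by (rule st) (use small_W mk in \<open>auto simp: df scratch_def\<close>)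
    moreover have "steps S W I (Store (cell 5 (Num 0)) (degE (var 2))) T4 N T5"
    proof -
      have "length (L w) - of_bool (s \<in> set (L w)) < W" using length_L_W[of w] by linarith
      moreover have "T4 2 0 = w" by (simp add: df)
      ultimately show ?thesis
        unfolding T5_def by (intro st) (use mk(8) in \<open>simp_all add: scratch_def\<close>)
    qed
    ultimately have "steps S W I (Cond (Add (Equal Arg_U Source) (Equal Arg_V Source))
       (Seq (Store (cell 2 (Num 0)) (Sub (Add Arg_U Arg_V) Source))
        (Seq (Store (cell 3 (Num 0)) Source) (Seq (Store (cell 4 (Num 0)) (var 2))
        (Seq (Store (cell 5 (Num 0)) (degE (var 2))) mc))))
       (Seq (Store (cell 2 (Num 0)) Arg_U) (Seq (Store (cell 3 (Num 0)) Arg_V)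
        (Seq (Store (cell 4 (Num 0)) Source)
        (Seq (Store (cell 5 (Num 0)) (Sub (degE (var 2)) Is_Insertion))
        (Seq (Store (cell 6 (Num 0)) (Sub (degE (var 3)) Is_Insertion)) ec)))))) T1 N T6"
      using True N1 6(1) by (intro steps_Cond) (auto intro!: steps_Seq)
    with s1 have "steps S W I (dispatch ec mc) T N T6"
      unfolding dispatch_def by (rule steps_Seq)
    moreover have "\<forall>j. 7 \<le> j \<longrightarrow> j < 20 \<longrightarrow> T6 j = T j" using 6(3) by (auto simp: df)
    ultimately show ?thesis using 6 by blast
  next
    case False
    then have uv: "u \<noteq> s" "v \<noteq> s" by auto
    note ec' = edge_cases[OF uv]
    define T2 where "T2 = T1(2 := (T1 2)(0 := u))"
    define T3 where "T3 = T2(3 := (T2 3)(0 := v))"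
    define T4 where "T4 = T3(4 := (T3 4)(0 := s))"
    define T5 where "T5 = T4(5 := (T4 5)(0 := dg n (adjf I u v) u))"
    define T6 where "T6 = T5(6 := (T5 6)(0 := dg n (adjf I u v) v))"
    note df = T1_def T2_def T3_def T4_def T5_def T6_def
    have "\<exists>T'. steps S W I ec T6 N T' \<and> Good n (pick b (add_edge u v (adjf I u v)) (adjf I u v)) (self I s) H T' \<and>
        (\<forall>j<20. T' j = T6 j) \<and> vars_ok T'"
    proof -
      have t: "(\<Sum>w\<in>touched. lc I H w) = lc I H u + lc I H v"
        using uv vd by (simp add: touched_def)
      have G6: "Good n (pick b (adjf I u v) (add_edge u v (adjf I u v))) (self I s) H T6"
        unfolding ec'(1,3) by (rule Gc[OF G]) (simp add: df)
      have "ctl b u v s (dg n (adjf I u v) u) (dg n (adjf I u v) v) T6" by (simp add: df ctl_def)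
      moreover have "heavy_list H T6" "vars_ok T6" using H by (simp_all add: df)
      ultimately have "Mc S W I \<and> u < in_n I \<and> v < in_n I \<and> u \<noteq> v \<and> adjf I u v = adjf I u v \<and>
        self I s = self I (in_s I) \<and> u \<noteq> in_s I \<and> v \<noteq> in_s I \<and> H \<subseteq> {..<in_n I} \<and>
        heavy_list H T6 \<and> vars_ok T6 \<and>
        ctl b u v (in_s I) (dg (in_n I) (adjf I u v) u) (dg (in_n I) (adjf I u v) v) T6 \<and>
        Good (in_n I) (pick b (adjf I u v) (add_edge u v (adjf I u v))) (self I s) H T6 \<and>
        N \<ge> 1 + card H + lc I H u + lc I H v"
        using Mc uv vd(1-3) H N t G6 by simp
      from ec[unfolded edge_ok_def, rule_format, OF this] show ?thesis by simp
    qed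
    then obtain T7 where 7: "steps S W I ec T6 N T7" "Good n (amat s E') (smark s E') H T7"
      "\<forall>j<20. T7 j = T6 j" "vars_ok T7"
      unfolding ec'(2,4) by blast
    have "steps S W I (Store (cell 2 (Num 0)) Arg_U) T1 N T2"
      unfolding T2_def by (rule st) (use small_W in auto)
    moreover have "steps S W I (Store (cell 3 (Num 0)) Arg_V) T2 N T3"
      unfolding T3_def by (rule st) (use small_W in auto)
    moreover have "steps S W I (Store (cell 4 (Num 0)) Source) T3 N T4"
      unfolding T4_def by (rule st) (use small_W in auto)
    moreover have "steps S W I (Store (cell 5 (Num 0)) (Sub (degE (var 2)) Is_Insertion)) T4 N T5"
    proof -
      have "length (L u) - of_bool (s \<in> set (L u)) - of_bool b < W" using length_L_W[of u] by linarith
      moreover have "T4 2 0 = u" by (simp add: df)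
      ultimately show ?thesis
        unfolding T5_def ec'(5) by (intro st) (simp_all add: scratch_def)
    qed
    moreover have "steps S W I (Store (cell 6 (Num 0)) (Sub (degE (var 3)) Is_Insertion)) T5 N T6"
    proof -
      have "length (L v) - of_bool (s \<in> set (L v)) - of_bool b < W" using length_L_W[of v] by linarith
      moreover have "T5 3 0 = v" by (simp add: df)
      ultimately show ?thesis
        unfolding T6_def ec'(6) by (intro st) (simp_all add: scratch_def)
    qed
    ultimately have "steps S W I (Cond (Add (Equal Arg_U Source) (Equal Arg_V Source))
       (Seq (Store (cell 2 (Num 0)) (Sub (Add Arg_U Arg_V) Source))
        (Seq (Store (cell 3 (Num 0)) Source) (Seq (Store (cell 4 (Num 0)) (var 2))
        (Seq (Store (cell 5 (Num 0)) (degE (var 2))) mc))))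
       (Seq (Store (cell 2 (Num 0)) Arg_U) (Seq (Store (cell 3 (Num 0)) Arg_V)
        (Seq (Store (cell 4 (Num 0)) Source)
        (Seq (Store (cell 5 (Num 0)) (Sub (degE (var 2)) Is_Insertion))
        (Seq (Store (cell 6 (Num 0)) (Sub (degE (var 3)) Is_Insertion)) ec)))))) T1 N T7"
      using False N1 7(1) by (intro steps_Cond) (auto intro!: steps_Seq)
    with s1 have "steps S W I (dispatch ec mc) T N T7"
      unfolding dispatch_def by (rule steps_Seq)
    moreover have "\<forall>j. 7 \<le> j \<longrightarrow> j < 20 \<longrightarrow> T7 j = T j" using 7(3) by (auto simp: df)
    ultimately show ?thesis using 7 by blast
  qed
qed

end

section \<open>Maintaining the heavy vertices\<close>

text \<open>Deletion from an unordered list in constant time: the last entry moves to the freed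
  position.\<close>

lemma bij_betw_swap_out:
  assumes f: "bij_betw f {..<c} H" and k: "k < (c::nat)"
  shows "bij_betw (f(k := f (c - 1))) {..<c - 1} (H - {f k})"
proof -
  let ?m = "\<lambda>i. if i = k then c - 1 else i"
  have "bij_betw ?m {..<c - 1} ({..<c} - {k})"
    using k by (intro bij_betw_byWitness[where f' = "\<lambda>i. if i = c - 1 then k else i"]) (auto split: if_splits)
  moreover have "bij_betw f ({..<c} - {k}) (H - {f k})"
    using f k by (intro bij_betw_DiffI) (auto simp: bij_betw_def)
  ultimately have "bij_betw (f \<circ> ?m) {..<c - 1} (H - {f k})" by (rule bij_betw_trans)
  moreover have "f \<circ> ?m = f(k := f (c - 1))" by auto
  ultimately show ?thesis by simp
qed

lemma heavy_list_remove:
  assumes "heavy_list H T" "k < T 8 0" "h = T 9 k"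
  shows "heavy_list (H - {h}) (T(8 := (T 8)(0 := T 8 0 - 1), 9 := (T 9)(k := T 9 (T 8 0 - 1)), 10 := (T 10)(h := 0)))"
  using assms bij_betw_swap_out[of "T 9" "T 8 0" H k] by (auto simp: heavy_list_def)

lemma heavy_list_insert:
  assumes "heavy_list H T" "h \<notin> H"
  shows "heavy_list (insert h H) (T(9 := (T 9)(T 8 0 := h), 8 := (T 8)(0 := T 8 0 + 1), 10 := (T 10)(h := 1)))"
proof -
  have f: "bij_betw (T 9) {..<T 8 0} H" using assms by (simp add: heavy_list_def)
  have "bij_betw ((T 9)(T 8 0 := h)) {..<T 8 0} H"
    using f by (subst bij_betw_cong[of _ _ "T 9"]) auto
  then have "bij_betw ((T 9)(T 8 0 := h)) ({..<T 8 0} \<union> {T 8 0}) (H \<union> {((T 9)(T 8 0 := h)) (T 8 0)})"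
    using assms by (subst notIn_Un_bij_betw3[symmetric]) auto
  moreover have "{..<T 8 0} \<union> {T 8 0} = {..<Suc (T 8 0)}" by auto
  ultimately show ?thesis using assms by (auto simp: heavy_list_def)
qed

lemma heavy_list_card: "heavy_list H T \<Longrightarrow> T 8 0 = card H"
  unfolding heavy_list_def by (metis bij_betw_same_card card_lessThan)

fun powE :: "nat \<Rightarrow> exp \<Rightarrow> exp" where
  "powE 0 e = Num 1"
| "powE (Suc k) e = Mul e (powE k e)"

lemma ev_powE [simp]: "ev I T (powE p e) = ev I T e ^ p"
  by (induction p) auto

lemma indep_powE [simp]: "indep I R e \<Longrightarrow> indep I R (powE p e)"
  by (induction p) auto

definition bigE :: "nat \<Rightarrow> exp \<Rightarrow> exp" where
  "bigE p w = Lt (var 7) (powE p (Degree w))"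

text \<open>Naming the source both as the ignored endpoint and as the ignored neighbour hides
  nothing, so a change of status is computed in the current graph.\<close>

definition ctx_com :: "exp \<Rightarrow> com" where
  "ctx_com e = Seq (Store (cell 2 (Num 0)) e) (Seq (Store (cell 3 (Num 0)) Source)
     (Seq (Store (cell 4 (Num 0)) Source) (Store (cell 5 (Num 0)) (degE (var 2)))))"

text \<open>The vertex leaves the list and the flags before \<open>sc\<close> runs, whereas
  \<open>touch_com\<close> enters it afterwards. In both cases \<open>sc\<close> meets the heavy set
  without the vertex, as its contract demands.\<close>

definition drop_com :: "com \<Rightarrow> com" where
  "drop_com sc = Seq (Store (cell 8 (Num 0)) (Sub (var 8) (Num 1)))
     (Seq (Store (cell 9 (var 11)) (ld 9 (var 8))) (Seq (Store (cell 10 (var 12)) (Num 0))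
     (Seq (ctx_com (var 12)) (Seq (Store (cell 1 (Num 0)) (Num 0)) sc))))"

text \<open>The index runs downwards. A dropped entry is replaced by the last one, which has been
  examined by then, so no entry is missed.\<close>

definition scan_loop :: "nat \<Rightarrow> com \<Rightarrow> com" where
  "scan_loop p sc = While (Lt (Num 0) (var 11))
     (Seq (Store (cell 11 (Num 0)) (Sub (var 11) (Num 1)))
     (Seq (Store (cell 12 (Num 0)) (ld 9 (var 11))) (Cond (bigE p (var 12)) Skip (drop_com sc))))"

definition scan_com :: "nat \<Rightarrow> com \<Rightarrow> com" where
  "scan_com p sc = Seq (Store (cell 11 (Num 0)) (var 8)) (scan_loop p sc)"

definition touch_com :: "nat \<Rightarrow> com \<Rightarrow> exp \<Rightarrow> com" where
  "touch_com p sc w = Cond (Mul (notE (Equal w Source)) (Mul (notE (ld 10 w)) (bigE p w)))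
     (Seq (ctx_com w) (Seq (Store (cell 1 (Num 0)) (Num 1)) (Seq sc
     (Seq (Store (cell 9 (var 8)) w) (Seq (Store (cell 8 (Num 0)) (Add (var 8) (Num 1)))
       (Store (cell 10 w) (Num 1))))))) Skip"

text \<open>The scan over all heavy vertices is needed because an insertion anywhere raises the threshold.\<close>

definition heavy_update :: "nat \<Rightarrow> com \<Rightarrow> com \<Rightarrow> com \<Rightarrow> com" where
  "heavy_update p ec mc sc = Seq (Store (cell 7 (Num 0)) (Sub (Add (var 7) Is_Insertion) (notE Is_Insertion)))
     (Seq (dispatch ec mc) (Seq (scan_com p sc) (Seq (touch_com p sc Arg_U) (touch_com p sc Arg_V))))"

locale heavy_step = update_step +
  fixes p :: nat and Mc :: "nat \<Rightarrow> nat \<Rightarrow> inputs \<Rightarrow> bool"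
    and Good :: "nat \<Rightarrow> (nat \<Rightarrow> nat \<Rightarrow> nat) \<Rightarrow> (nat \<Rightarrow> nat) \<Rightarrow> nat set \<Rightarrow> (nat \<Rightarrow> nat \<Rightarrow> nat) \<Rightarrow> bool"
    and ec mc sc :: com
  assumes ec: "edge_ok (light_cost p) Mc Good ec" and mc: "mark_ok (light_cost p) Mc Good mc" and sc: "status_ok p Mc Good sc"
    and Mc: "Mc S W I"
    and Gc: "\<And>a s H T T'. Good n a s H T \<Longrightarrow> (\<And>j. 32 \<le> j \<Longrightarrow> T' j = T j) \<Longrightarrow> Good n a s H T'"
    and S1: "64 * n \<le> S"
begin

abbreviation "len w \<equiv> length (L w)"
abbreviation "big w \<equiv> card E' < len w ^ p"
abbreviation "cost w \<equiv> (1 + len w) ^ (p - 1)"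
abbreviation "good \<equiv> Good n (amat s E') (smark s E')"

lemma ev_bigE: "ev I T (bigE p e) = of_bool (T 7 0 < len (ev I T e) ^ p)"
  by (simp add: bigE_def)

lemma indep_bigE [simp]: "indep I scratch e \<Longrightarrow> indep I scratch (bigE p e)"
  by (simp add: bigE_def scratch_def)

lemma addr: "w < n \<Longrightarrow> j < 64 \<Longrightarrow> w * 64 + j < S"
  using S1 by linarith

lemma steps_ctx_com:
  assumes "indep I scratch e" "ev I T e = w" "w < n" "w \<noteq> s" "N \<ge> 1"
  shows "steps S W I (ctx_com e) T N (T(2 := (T 2)(0 := w), 3 := (T 3)(0 := s), 4 := (T 4)(0 := s),
     5 := (T 5)(0 := dg n (amat s E') w)))" (is "steps _ _ _ _ _ _ ?t")
proof -
  note st = M.steps_set[where N = N, OF _ _ _ _ assms(5)]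
  define T2 where "T2 = T(2 := (T 2)(0 := w))"
  define T3 where "T3 = T2(3 := (T2 3)(0 := s))"
  define T4 where "T4 = T3(4 := (T3 4)(0 := s))"
  define T5 where "T5 = T4(5 := (T4 5)(0 := dg n (amat s E') w))"
  note df = T2_def T3_def T4_def T5_def
  have "steps S W I (Store (cell 2 (Num 0)) e) T N T2"
    unfolding T2_def by (rule st) (use assms small_W in auto)
  moreover have "steps S W I (Store (cell 3 (Num 0)) Source) T2 N T3"
    unfolding T3_def by (rule st) (use small_W in auto)
  moreover have "steps S W I (Store (cell 4 (Num 0)) Source) T3 N T4"
    unfolding T4_def by (rule st) (use small_W in auto)
  moreover have "steps S W I (Store (cell 5 (Num 0)) (degE (var 2))) T4 N T5"
  proof -
    have d: "dg n (amat s E') w = length (L w) - of_bool (s \<in> set (L w))"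
      using M.dg_adjf[of w w] assms(4) adjf_status by simp
    have "length (L w) - of_bool (s \<in> set (L w)) < W" using length_L_W[of w] by linarith
    moreover have "T4 2 0 = w" by (simp add: df)
    ultimately show ?thesis
      unfolding T5_def d by (intro st) (simp_all add: scratch_def)
  qed
  moreover have "T5 = ?t" by (simp add: df)
  ultimately show ?thesis unfolding ctx_com_def by (metis steps_Seq)
qed

lemma steps_status:
  assumes "w < n" "w \<noteq> s" "w \<notin> H" "H \<subseteq> {..<n}" "heavy_list H T" "vars_ok T"
    "T 1 0 = of_bool d" "T 2 0 = w" "T 3 0 = s" "T 4 0 = s" "T 5 0 = dg n (amat s E') w"
    "good (pick d H (insert w H)) T" "N \<ge> of_bool d * (1 + card H) + cost w"
  shows "\<exists>T'. steps S W I sc T N T' \<and> good (pick d (insert w H) H) T' \<and> (\<forall>j<20. T' j = T j) \<and> vars_ok T'"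
proof -
  have "ctl d w s s (dg n (adjf I w s) w) (T 6 0) T" using assms adjf_status by (simp add: ctl_def)
  then have "Mc S W I \<and> w < in_n I \<and> w \<noteq> in_s I \<and> adjf I w s = adjf I w (in_s I) \<and>
     self I s = self I (in_s I) \<and> w \<notin> H \<and> H \<subseteq> {..<in_n I} \<and> heavy_list H T \<and> vars_ok T \<and>
     ctl d w (in_s I) (in_s I) (dg (in_n I) (adjf I w s) w) (T 6 0) T \<and>
     Good (in_n I) (adjf I w s) (self I s) (pick d H (insert w H)) T \<and>
     N \<ge> of_bool d * (1 + card H) + (1 + length (in_nbs I w)) ^ (p - 1)"
    using Mc assms adjf_status self_status by simp
  from sc[unfolded status_ok_def, rule_format, OF this] show ?thesis
    using adjf_status self_status by simp
qed

lemma steps_drop: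
  assumes H: "heavy_list H T" "H \<subseteq> {..<n} - {s}" "vars_ok T" and k: "T 11 0 = k" "k < card H"
    and h: "h = T 9 k" "T 12 0 = h" and G: "good H T" and N: "N \<ge> cost h" "N \<ge> 1"
  shows "\<exists>T'. steps S W I (drop_com sc) T N T' \<and> good (H - {h}) T' \<and> heavy_list (H - {h}) T' \<and>
    vars_ok T' \<and> T' 7 = T 7 \<and> T' 11 = T 11 \<and> T' 9 = (T 9)(k := T 9 (card H - 1))"
proof -
  note st = M.steps_set[where N = N, OF _ _ _ _ N(2)]
  have c: "T 8 0 = card H" using H heavy_list_card by blast
  have hH: "h \<in> H" using H(1) k h unfolding heavy_list_def c bij_betw_def by auto
  then have hn: "h < n" "h \<noteq> s" using H by auto
  have cn: "card H \<le> n" using card_mono[of "{..<n}" H] H(2) by auto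
  have lst: "T 9 i < n" if "i < card H" for i
    using H(1,2) that unfolding heavy_list_def c bij_betw_def by auto
  define T1 where "T1 = T(8 := (T 8)(0 := card H - 1))"
  define T2 where "T2 = T1(9 := (T1 9)(k := T 9 (card H - 1)))"
  define T3 where "T3 = T2(10 := (T2 10)(h := 0))"
  define T4 where "T4 = T3(2 := (T3 2)(0 := h), 3 := (T3 3)(0 := s), 4 := (T3 4)(0 := s),
     5 := (T3 5)(0 := dg n (amat s E') h))"
  define T5 where "T5 = T4(1 := (T4 1)(0 := 0))"
  note df = T1_def T2_def T3_def T4_def T5_def
  have "steps S W I (Store (cell 8 (Num 0)) (Sub (var 8) (Num 1))) T N T1"
    unfolding T1_def by (rule st) (use c cn M.W_pow in \<open>auto simp: scratch_def\<close>)
  moreover have "steps S W I (Store (cell 9 (var 11)) (ld 9 (var 8))) T1 N T2"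
  proof -
    have "T1 11 0 = k" "T1 8 0 = card H - 1" "T1 9 (card H - 1) = T 9 (card H - 1)" using k by (simp_all add: T1_def)
    then show ?thesis
      using steps_Store[of 9 I "var 11" "ld 9 (var 8)" N T1 S W] N k cn lst[of "card H - 1"] small_W(5) addr[of k 9]
      unfolding T2_def by (simp add: scratch_def)
  qed
  moreover have "steps S W I (Store (cell 10 (var 12)) (Num 0)) T2 N T3"
  proof -
    have "T2 12 0 = h" using h by (simp add: df)
    then show ?thesis
      using steps_Store[of 10 I "var 12" "Num 0" N T2 S W] N hn small_W addr[of h 10]
      unfolding T3_def by (simp add: scratch_def)
  qed
  moreover have "steps S W I (ctx_com (var 12)) T3 N T4"
    unfolding T4_def by (rule steps_ctx_com) (use h hn N in \<open>auto simp: scratch_def df\<close>)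
  moreover have "steps S W I (Store (cell 1 (Num 0)) (Num 0)) T4 N T5"
    unfolding T5_def by (rule st) (use small_W in auto)
  moreover have "\<exists>T'. steps S W I sc T5 N T' \<and> good (pick False (insert h (H - {h})) (H - {h})) T' \<and>
      (\<forall>j<20. T' j = T5 j) \<and> vars_ok T'"
  proof (rule steps_status)
    have e: "T3 = T(8 := (T 8)(0 := T 8 0 - 1), 9 := (T 9)(k := T 9 (T 8 0 - 1)), 10 := (T 10)(h := 0))"
      using c by (simp add: df)
    have "heavy_list (H - {h}) T3" unfolding e
      by (rule heavy_list_remove[OF H(1)]) (use k c h in auto)
    then show "heavy_list (H - {h}) T5" by (simp add: T4_def T5_def)
    show "good (pick False (H - {h}) (insert h (H - {h}))) T5"
      using Gc[OF G, of T5] hH by (simp add: df insert_absorb)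
    show "vars_ok T5" using H by (simp add: df)
  qed (use hn H N in \<open>auto simp: df\<close>)
  ultimately obtain T' where "steps S W I (drop_com sc) T N T'" and t: "good (H - {h}) T'" "\<forall>j<20. T' j = T5 j" "vars_ok T'"
    unfolding drop_com_def by (fastforce intro: steps_Seq)
  moreover have "T' 7 = T 7" "T' 11 = T 11" "T' 9 = (T 9)(k := T 9 (card H - 1))"
    using t(2) by (simp_all add: df)
  moreover have "heavy_list (H - {h}) T'"
  proof -
    have "heavy_list (H - {h}) (T(8 := (T 8)(0 := T 8 0 - 1), 9 := (T 9)(k := T 9 (T 8 0 - 1)), 10 := (T 10)(h := 0)))"
      by (rule heavy_list_remove[OF H(1)]) (use k c h in auto)
    moreover have "T' 8 = T5 8" "T' 9 = T5 9" "T' 10 = T5 10" using t(2) by auto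
    ultimately show ?thesis using c by (simp add: heavy_list_def df)
  qed
  ultimately show ?thesis by blast
qed

text \<open>The invariant is that all entries from position \<open>k\<close> on exceed the
  threshold. A vertex that stays costs a constant, a dropped one the recomputation of its table
  entries.\<close>

lemma steps_scan_loop:
  assumes "heavy_list H T" "H \<subseteq> {..<n} - {s}" "vars_ok T" "T 11 0 = k" "k \<le> card H" "good H T"
    "T 7 0 = card E'" "\<And>i. k \<le> i \<Longrightarrow> i < card H \<Longrightarrow> big (T 9 i)"
  shows "\<exists>T'. steps S W I (scan_loop p sc) T (1 + k + (\<Sum>h\<in>{h\<in>H. \<not> big h}. cost h)) T' \<and>
    good {h\<in>H. big h} T' \<and> heavy_list {h\<in>H. big h} T' \<and> vars_ok T' \<and> T' 7 0 = card E'"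
  using assms
proof (induction k arbitrary: H T)
  case 0
  have c: "T 8 0 = card H" using 0 heavy_list_card by blast
  have "{h\<in>H. big h} = H"
  proof -
    have "T 9 ` {..<card H} = H" using 0(1) unfolding heavy_list_def c bij_betw_def by simp
    moreover have "big h" if "h \<in> T 9 ` {..<card H}" for h using that 0(8) by auto
    ultimately show ?thesis by blast
  qed
  moreover have "steps S W I (scan_loop p sc) T (1 + 0 + (\<Sum>h\<in>{h\<in>H. \<not> big h}. cost h)) T"
    unfolding scan_loop_def by (rule steps_While_False) (use 0 in \<open>auto simp: scratch_def\<close>)
  ultimately show ?case using 0 by auto
next
  case (Suc k)
  have c: "T 8 0 = card H" using Suc heavy_list_card by blast
  define h where "h = T 9 k"
  have hH: "h \<in> H" using Suc.prems(1,5) unfolding heavy_list_def c bij_betw_def h_def by auto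
  have hn: "h < n" "h \<noteq> s" using hH Suc.prems by auto
  have fin: "finite H" using Suc.prems(2) finite_subset by blast
  have cn: "card H \<le> n" using card_mono[of "{..<n}" H] Suc.prems(2) by auto
  have kW: "k < W" using Suc.prems(5) cn small_W(5)[of k] by simp
  define N1 where "N1 = (if big h then 1 else cost h)"
  have N1: "N1 \<ge> 1" by (simp add: N1_def)
  note st = M.steps_set[where N = N1, OF _ _ _ _ N1]
  define T1 where "T1 = T(11 := (T 11)(0 := k))"
  define T2 where "T2 = T1(12 := (T1 12)(0 := h))"
  note df = T1_def T2_def
  have p2: "heavy_list H T2" "vars_ok T2" "T2 11 0 = k" "T2 7 0 = card E'" "T2 12 0 = h" "T2 9 = T 9"
    using Suc.prems by (simp_all add: df)
  have pk: "k \<le> card H" "k < card H" using Suc.prems(5) by simp_all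
  let ?c = "Seq (Store (cell 11 (Num 0)) (Sub (var 11) (Num 1)))
     (Seq (Store (cell 12 (Num 0)) (ld 9 (var 11))) (Cond (bigE p (var 12)) Skip (drop_com sc)))"
  have s1: "steps S W I (Store (cell 11 (Num 0)) (Sub (var 11) (Num 1))) T N1 T1"
    unfolding T1_def by (rule st) (use Suc.prems kW in \<open>auto simp: scratch_def\<close>)
  have s2: "steps S W I (Store (cell 12 (Num 0)) (ld 9 (var 11))) T1 N1 T2"
    unfolding T2_def by (rule st) (use hn small_W in \<open>auto simp: T1_def scratch_def h_def\<close>)
  have i: "indep I scratch (Lt (Num 0) (var 11))" by (simp add: scratch_def)
  have ct: "ev I T (Lt (Num 0) (var 11)) \<noteq> 0" using Suc.prems(4) by simp
  have ib: "indep I scratch (bigE p (var 12))" by (rule indep_bigE) (simp add: scratch_def)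
  have evb: "ev I T2 (bigE p (var 12)) \<noteq> 0 \<longleftrightarrow> big h"
    using Suc.prems(7) by (simp add: ev_bigE df)
  show ?case
  proof (cases "big h")
    case True
    have "steps S W I (Cond (bigE p (var 12)) Skip (drop_com sc)) T2 N1 T2"
      by (rule steps_Cond[OF ib N1]) (use evb True N1 steps_Skip in auto)
    then have sb: "steps S W I ?c T N1 T2" using s1 s2 by (blast intro: steps_Seq)
    have "\<exists>T'. steps S W I (scan_loop p sc) T2 (1 + k + (\<Sum>h\<in>{h\<in>H. \<not> big h}. cost h)) T' \<and>
        good {h\<in>H. big h} T' \<and> heavy_list {h\<in>H. big h} T' \<and> vars_ok T' \<and> T' 7 0 = card E'"
    proof (rule Suc.IH)
      show "good H T2" using Gc[OF Suc.prems(6), of T2] by (simp add: df)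
      fix i assume "k \<le> i" "i < card H"
      then show "big (T2 9 i)" using Suc.prems(8)[of i] True by (cases "i = k") (auto simp: df h_def)
    qed (use Suc.prems(2) p2 pk in auto)
    then obtain T' where t: "steps S W I (scan_loop p sc) T2 (1 + k + (\<Sum>h\<in>{h\<in>H. \<not> big h}. cost h)) T'"
      "good {h\<in>H. big h} T'" "heavy_list {h\<in>H. big h} T'" "vars_ok T'" "T' 7 0 = card E'" by blast
    have "steps S W I (scan_loop p sc) T (N1 + (1 + k + (\<Sum>h\<in>{h\<in>H. \<not> big h}. cost h))) T'"
      unfolding scan_loop_def
      by (rule steps_While_True[OF i ct N1 sb t(1)[unfolded scan_loop_def]])
    moreover have "N1 + (1 + k + (\<Sum>h\<in>{h\<in>H. \<not> big h}. cost h)) = 1 + Suc k + (\<Sum>h\<in>{h\<in>H. \<not> big h}. cost h)"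
      using True by (simp add: N1_def)
    ultimately show ?thesis using t by auto
  next
    case False
    have "\<exists>T'. steps S W I (drop_com sc) T2 N1 T' \<and> good (H - {h}) T' \<and> heavy_list (H - {h}) T' \<and>
      vars_ok T' \<and> T' 7 = T2 7 \<and> T' 11 = T2 11 \<and> T' 9 = (T2 9)(k := T2 9 (card H - 1))"
    proof (rule steps_drop)
      show "good H T2" using Gc[OF Suc.prems(6), of T2] by (simp add: df)
    qed (use Suc.prems(2) False p2 pk in \<open>auto simp: N1_def h_def\<close>)
    then obtain T3 where 3: "steps S W I (drop_com sc) T2 N1 T3" "good (H - {h}) T3" "heavy_list (H - {h}) T3"
      "vars_ok T3" "T3 7 = T2 7" "T3 11 = T2 11" "T3 9 = (T2 9)(k := T2 9 (card H - 1))" by blast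
    have "steps S W I (Cond (bigE p (var 12)) Skip (drop_com sc)) T2 N1 T3"
      by (rule steps_Cond[OF ib N1]) (use evb False 3 in auto)
    then have sb: "steps S W I ?c T N1 T3" using s1 s2 by (blast intro: steps_Seq)
    have cH: "card (H - {h}) = card H - 1" using hH by simp
    let ?H = "H - {h}"
    have "\<exists>T'. steps S W I (scan_loop p sc) T3 (1 + k + (\<Sum>h\<in>{h\<in>?H. \<not> big h}. cost h)) T' \<and>
        good {h\<in>?H. big h} T' \<and> heavy_list {h\<in>?H. big h} T' \<and> vars_ok T' \<and> T' 7 0 = card E'"
    proof (rule Suc.IH)
      fix i assume i: "k \<le> i" "i < card ?H"
      \<comment> \<open>The entry that moves to position \<open>k\<close> was the last one, hence
        already known to be big.\<close>
      have "T3 9 i = T 9 (if i = k then card H - 1 else i)" using 3(7) by (simp add: df)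
      then show "big (T3 9 i)" using Suc.prems(8)[of "if i = k then card H - 1 else i"] i cH by auto
    qed (use Suc.prems(2) 3 cH pk p2 in auto)
    then obtain T' where t: "steps S W I (scan_loop p sc) T3 (1 + k + (\<Sum>h\<in>{h\<in>?H. \<not> big h}. cost h)) T'"
      "good {h\<in>?H. big h} T'" "heavy_list {h\<in>?H. big h} T'" "vars_ok T'" "T' 7 0 = card E'" by blast
    have e1: "{h\<in>?H. big h} = {h\<in>H. big h}" using False by auto
    have e2: "{h\<in>H. \<not> big h} = insert h {h\<in>?H. \<not> big h}" using False hH by auto
    have e3: "(\<Sum>h\<in>{h\<in>H. \<not> big h}. cost h) = cost h + (\<Sum>h\<in>{h\<in>?H. \<not> big h}. cost h)"
      unfolding e2 using fin by (subst sum.insert) auto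
    have "steps S W I (scan_loop p sc) T (N1 + (1 + k + (\<Sum>h\<in>{h\<in>?H. \<not> big h}. cost h))) T'"
      unfolding scan_loop_def
      by (rule steps_While_True[OF i ct N1 sb t(1)[unfolded scan_loop_def]])
    then have "steps S W I (scan_loop p sc) T (1 + Suc k + (\<Sum>h\<in>{h\<in>H. \<not> big h}. cost h)) T'"
      by (rule steps_mono) (use False e3 in \<open>simp add: N1_def\<close>)
    then show ?thesis using t unfolding e1 by blast
  qed
qed

lemma steps_touch:
  assumes H: "heavy_list H T" "H \<subseteq> {..<n} - {s}" "vars_ok T" and G: "good H T"
    and m: "T 7 0 = card E'" and w: "indep I scratch e" "\<And>T. ev I T e = w" "w < n"
    and N: "N \<ge> 1" "w \<noteq> s \<Longrightarrow> w \<notin> H \<Longrightarrow> N \<ge> 1 + card H + cost w"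
  shows "\<exists>T'. steps S W I (touch_com p sc e) T N T' \<and>
    good (H \<union> {w. w = ev I T e \<and> w \<noteq> s \<and> big w}) T' \<and>
    heavy_list (H \<union> {w. w = ev I T e \<and> w \<noteq> s \<and> big w}) T' \<and> vars_ok T' \<and> T' 7 0 = card E'"
proof -
  note st = M.steps_set[where N = N, OF _ _ _ _ N(1)]
  let ?t = "Mul (notE (Equal e Source)) (Mul (notE (ld 10 e)) (bigE p e))"
  have it: "indep I scratch ?t" using w(1) by (simp add: scratch_def bigE_def)
  have et: "ev I T ?t \<noteq> 0 \<longleftrightarrow> w \<noteq> s \<and> w \<notin> H \<and> big w"
    using w H(1) m by (simp add: ev_bigE heavy_listD)
  show ?thesis
  proof (cases "w \<noteq> s \<and> w \<notin> H \<and> big w")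
    case False
    have "H \<union> {z. z = ev I T e \<and> z \<noteq> s \<and> big z} = H" using False w by auto
    moreover have "steps S W I (touch_com p sc e) T N T"
      unfolding touch_com_def by (rule steps_Cond[OF it N(1)]) (use et False N steps_Skip in auto)
    ultimately show ?thesis using H G m by metis
  next
    case True
    have c: "T 8 0 = card H" using H heavy_list_card by blast
    \<comment> \<open>The source is never heavy, so a new entry still fits into the first
      \<open>n\<close> positions of the list.\<close>
    have cn: "card H < n"
      using psubset_card_mono[of "{..<n}" H] H(2) s by auto
    define T1 where "T1 = T(2 := (T 2)(0 := w), 3 := (T 3)(0 := s), 4 := (T 4)(0 := s),
       5 := (T 5)(0 := dg n (amat s E') w))"
    define T2 where "T2 = T1(1 := (T1 1)(0 := 1))"
    have s1: "steps S W I (ctx_com e) T N T1"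
      unfolding T1_def by (rule steps_ctx_com) (use w True N in auto)
    have s2: "steps S W I (Store (cell 1 (Num 0)) (Num 1)) T1 N T2"
      unfolding T2_def by (rule st) (use small_W in auto)
    have "\<exists>T'. steps S W I sc T2 N T' \<and> good (pick True (insert w H) H) T' \<and>
        (\<forall>j<20. T' j = T2 j) \<and> vars_ok T'"
    proof (rule steps_status)
      show "good (pick True H (insert w H)) T2"
        using Gc[OF G, of T2] by (simp add: T1_def T2_def)
    qed (use w H True N in \<open>auto simp: T1_def T2_def\<close>)
    then obtain T3 where 3: "steps S W I sc T2 N T3" "good (insert w H) T3" "\<forall>j<20. T3 j = T2 j" "vars_ok T3"
      by auto
    have H3: "heavy_list H T3" using H(1) 3(3) by (simp add: heavy_list_def T1_def T2_def)
    have c3: "T3 8 0 = card H" using H3 heavy_list_card by blast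
    define T4 where "T4 = T3(9 := (T3 9)(card H := w))"
    define T5 where "T5 = T4(8 := (T4 8)(0 := card H + 1))"
    define T6 where "T6 = T5(10 := (T5 10)(w := 1))"
    have s4: "steps S W I (Store (cell 9 (var 8)) e) T3 N T4"
      using steps_Store[of 9 I "var 8" e N T3 S W] w N(1) c3 addr[OF cn, of 9] small_W
      unfolding T4_def by (simp add: scratch_def)
    have s5: "steps S W I (Store (cell 8 (Num 0)) (Add (var 8) (Num 1))) T4 N T5"
      unfolding T5_def by (rule st) (use c3 cn M.W_pow in \<open>auto simp: scratch_def T4_def\<close>)
    have s6: "steps S W I (Store (cell 10 e) (Num 1)) T5 N T6"
      using steps_Store[of 10 I e "Num 1" N T5 S W] w N(1) addr[OF w(3), of 10] small_W
      unfolding T6_def by (simp add: scratch_def)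
    have "steps S W I (touch_com p sc e) T N T6"
      unfolding touch_com_def
    proof (rule steps_Cond[OF it N(1)])
      show "steps S W I (Seq (ctx_com e) (Seq (Store (cell 1 (Num 0)) (Num 1)) (Seq sc
       (Seq (Store (cell 9 (var 8)) e) (Seq (Store (cell 8 (Num 0)) (Add (var 8) (Num 1)))
         (Store (cell 10 e) (Num 1))))))) T N T6"
        using s1 s2 3(1) s4 s5 s6 by (blast intro: steps_Seq)
    qed (use et True in blast)
    moreover have HH: "H \<union> {z. z = ev I T e \<and> z \<noteq> s \<and> big z} = insert w H" using True w by auto
    moreover have "heavy_list (insert w H) T6"
      using heavy_list_insert[OF H3, of w] True c3 by (simp add: T4_def T5_def T6_def)
    moreover have "good (insert w H) T6" using Gc[OF 3(2), of T6] by (simp add: T4_def T5_def T6_def)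
    moreover have "vars_ok T6" using 3(4) by (simp add: T4_def T5_def T6_def)
    moreover have "T6 7 0 = card E'" using 3(3) m by (simp add: T1_def T2_def T4_def T5_def T6_def)
    ultimately show ?thesis by metis
  qed
qed

text \<open>\<open>N\<close> collects the passes over the heavy list, the enumeration at light
  endpoints and the recomputation at dropped vertices. The phases share this bound instead of adding
  up their own ones; the number of phases is hidden in \<open>com_size\<close>.\<close>

lemma steps_heavy_update:
  assumes H: "heavy_list H T" "H \<subseteq> {..<n} - {s}" "vars_ok T" and G: "Good n (amat s E) (smark s E) H T"
    and m: "T 7 0 = card E"
    and N: "N = 3 + card H + (\<Sum>w\<in>touched - H. cost w) + (\<Sum>h\<in>{h\<in>H. \<not> big h}. cost h)"
    and H': "H' = {h \<in> H \<union> touched. big h}"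
  shows "\<exists>T'. steps S W I (heavy_update p ec mc sc) T N T' \<and> good H' T' \<and> heavy_list H' T' \<and>
    vars_ok T' \<and> T' 7 0 = card E'"
proof -
  have N1: "N \<ge> 1" using N by simp
  note st = M.steps_set[where N = N, OF _ _ _ _ N1]
  have fH: "finite H" using H(2) finite_subset by blast
  have lc: "(\<Sum>w\<in>touched. light_cost p I H w) = (\<Sum>w\<in>touched - H. cost w)"
    by (rule sum.mono_neutral_cong_right) (auto simp: touched_def light_cost_def)
  have eW: "card E' < W"
  proof -
    have "E' \<subseteq> {e. e \<subseteq> {..<n} \<and> card e = 2}" using vd(5) by (auto simp: simple_edges_def)
    then have "card E' \<le> n choose 2"
      using card_mono[of "{e. e \<subseteq> {..<n} \<and> card e = 2}" E'] n_subsets[of "{..<n}" 2]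
      by (auto simp: finite_subset[of _ "Pow {..<n}"])
    also have "n choose 2 \<le> n * n" by (simp add: choose_two) (metis diff_le_self div_le_dividend le_trans mult_le_mono2)
    finally show ?thesis using M.W_bound(2)[of "card E'"] by simp
  qed
  define T1 where "T1 = T(7 := (T 7)(0 := card E'))"
  have s1: "steps S W I (Store (cell 7 (Num 0)) (Sub (Add (var 7) Is_Insertion) (notE Is_Insertion))) T N T1"
    unfolding T1_def by (rule st) (use m eW vd(6) in \<open>auto simp: scratch_def\<close>)
  have "\<exists>T'. steps S W I (dispatch ec mc) T1 N T' \<and> good H T' \<and>
     (\<forall>j. 7 \<le> j \<longrightarrow> j < 20 \<longrightarrow> T' j = T1 j) \<and> vars_ok T'"
  proof (rule steps_dispatch[OF ec mc Mc])
    show "Good n (amat s E) (smark s E) H T1" by (rule Gc[OF G]) (simp add: T1_def)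
    show "1 + card H + (\<Sum>w\<in>touched. light_cost p I H w) \<le> N" unfolding lc N by simp
  qed (use H Gc in \<open>auto simp: T1_def\<close>)
  then obtain T2 where 2: "steps S W I (dispatch ec mc) T1 N T2" "good H T2"
    "\<forall>j. 7 \<le> j \<longrightarrow> j < 20 \<longrightarrow> T2 j = T1 j" "vars_ok T2" by blast
  have H2: "heavy_list H T2" using H(1) 2(3) by (simp add: heavy_list_def T1_def)
  have c2: "T2 8 0 = card H" using H2 heavy_list_card by blast
  have cn: "card H \<le> n" using card_mono[of "{..<n}" H] H(2) by auto
  define T3 where "T3 = T2(11 := (T2 11)(0 := card H))"
  have s3: "steps S W I (Store (cell 11 (Num 0)) (var 8)) T2 N T3"
    unfolding T3_def by (rule st) (use c2 cn M.W_pow in \<open>auto simp: scratch_def\<close>)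
  let ?H = "{h\<in>H. big h}"
  have "\<exists>T'. steps S W I (scan_loop p sc) T3 (1 + card H + (\<Sum>h\<in>{h\<in>H. \<not> big h}. cost h)) T' \<and>
    good ?H T' \<and> heavy_list ?H T' \<and> vars_ok T' \<and> T' 7 0 = card E'"
  proof (rule steps_scan_loop)
    show "good H T3" using Gc[OF 2(2), of T3] by (simp add: T3_def)
  qed (use H H2 2 in \<open>auto simp: T3_def T1_def\<close>)
  then obtain T4 where 4: "steps S W I (scan_loop p sc) T3 (1 + card H + (\<Sum>h\<in>{h\<in>H. \<not> big h}. cost h)) T4"
    "good ?H T4" "heavy_list ?H T4" "vars_ok T4" "T4 7 0 = card E'" by blast
  have s4: "steps S W I (scan_com p sc) T2 N T4"
    unfolding scan_com_def by (rule steps_Seq[OF s3 steps_mono[OF 4(1)]]) (simp add: N)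
  have cH: "card ?H \<le> card H" using fH by (intro card_mono) auto
  have ct: "cost w \<le> (\<Sum>w\<in>touched - H. cost w)" if "w \<in> touched" "w \<notin> H" for w
    using that by (intro member_le_sum) (auto simp: touched_def)
  have nb: "w \<in> H \<Longrightarrow> w \<notin> ?H \<Longrightarrow> cost w \<le> (\<Sum>h\<in>{h\<in>H. \<not> big h}. cost h)" for w
    using fH by (intro member_le_sum) auto
  \<comment> \<open>A touched vertex that is not heavy after the scan either was light before, and
    the first sum in \<open>N\<close> pays, or has just been dropped, and the second one pays. The
    extra 1 allows for the promotion of the other endpoint.\<close>
  have Nw: "1 + (1 + card ?H) + cost w \<le> N" if "w \<in> touched" "w \<notin> ?H" for w
    using ct[OF that(1)] nb[OF _ that(2)] cH unfolding N by (cases "w \<in> H") auto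
  let ?H5 = "?H \<union> {w. w = ev I T4 Arg_U \<and> w \<noteq> s \<and> big w}"
  have cH5: "card ?H5 \<le> 1 + card ?H"
  proof -
    have "?H5 \<subseteq> insert u ?H" by auto
    then have "card ?H5 \<le> card (insert u ?H)" using fH by (intro card_mono) auto
    also have "\<dots> \<le> Suc (card ?H)" by (rule card_insert_le_m1) auto
    finally show ?thesis by simp
  qed
  have "\<exists>T'. steps S W I (touch_com p sc Arg_U) T4 N T' \<and> good ?H5 T' \<and> heavy_list ?H5 T' \<and> vars_ok T' \<and> T' 7 0 = card E'"
  proof (rule steps_touch[where w = u])
    assume "u \<noteq> s" "u \<notin> ?H"
    then show "1 + card ?H + cost u \<le> N" using Nw[of u] by (auto simp: touched_def)
  qed (use H 4 vd N1 in auto)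
  then obtain T5 where 5: "steps S W I (touch_com p sc Arg_U) T4 N T5" "good ?H5 T5" "heavy_list ?H5 T5"
    "vars_ok T5" "T5 7 0 = card E'" by blast
  let ?H6 = "?H5 \<union> {w. w = ev I T5 Arg_V \<and> w \<noteq> s \<and> big w}"
  have "\<exists>T'. steps S W I (touch_com p sc Arg_V) T5 N T' \<and> good ?H6 T' \<and> heavy_list ?H6 T' \<and> vars_ok T' \<and> T' 7 0 = card E'"
  proof (rule steps_touch[where w = v])
    assume "v \<noteq> s" "v \<notin> ?H5"
    then show "1 + card ?H5 + cost v \<le> N" using Nw[of v] cH5 by (auto simp: touched_def)
  qed (use H 5 vd N1 in auto)
  then obtain T6 where 6: "steps S W I (touch_com p sc Arg_V) T5 N T6" "good ?H6 T6" "heavy_list ?H6 T6"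
    "vars_ok T6" "T6 7 0 = card E'" by blast
  have e: "?H6 = H'" unfolding H' touched_def by auto
  have "steps S W I (heavy_update p ec mc sc) T N T6"
    unfolding heavy_update_def using s1 2(1) s4 5(1) 6(1) by (blast intro: steps_Seq)
  then show ?thesis using 6 unfolding e by blast
qed

end

section \<open>Amortized cost\<close>

definition deg :: "nat set set \<Rightarrow> nat \<Rightarrow> nat" where
  "deg E v = card {w. {v, w} \<in> E}"

lemma deg_eq:
  assumes "simple_edges n E"
  shows "deg E v = card {e \<in> E. v \<in> e}"
  unfolding deg_def
proof (rule bij_betw_same_card[of "\<lambda>w. {v, w}"], unfold bij_betw_def, intro conjI)
  show "inj_on (\<lambda>w. {v, w}) {w. {v, w} \<in> E}" by (auto simp: inj_on_def doubleton_eq_iff)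
  show "(\<lambda>w. {v, w}) ` {w. {v, w} \<in> E} = {e \<in> E. v \<in> e}"
  proof (intro equalityI subsetI)
    fix e assume e: "e \<in> {e \<in> E. v \<in> e}"
    then have "card e = 2" using assms by (auto simp: simple_edges_def)
    then obtain p q where "e = {p, q}" by (meson card_2_iff)
    then show "e \<in> (\<lambda>w. {v, w}) ` {w. {v, w} \<in> E}" using e by (auto simp: insert_commute)
  qed auto
qed

lemma handshake:
  assumes "simple_edges n E"
  shows "(\<Sum>v<n. deg E v) = 2 * card E"
proof -
  note fin = finite_edges[OF assms]
  have "(\<Sum>v<n. deg E v) = (\<Sum>v<n. \<Sum>e\<in>E. of_bool (v \<in> e))"
    unfolding deg_eq[OF assms] using fin by (simp add: Int_def conj_commute)
  also have "\<dots> = (\<Sum>e\<in>E. \<Sum>v<n. of_bool (v \<in> e))" by (rule sum.swap)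
  also have "\<dots> = (\<Sum>e\<in>E. 2)"
  proof (rule sum.cong)
    fix e assume "e \<in> E"
    then have e: "e \<subseteq> {..<n}" "card e = 2" using assms by (auto simp: simple_edges_def)
    then have "{..<n} \<inter> {v. v \<in> e} = e" by auto
    then show "(\<Sum>v<n. of_bool (v \<in> e)) = (2::nat)" using e by simp
  qed simp
  finally show ?thesis by simp
qed

text \<open>Concavity of the power for exponents in the unit interval. An update changes the number
  of edges by one, hence it shifts the threshold \<open>m powr q\<close> by at most 1.\<close>

lemma powr_le_add_one:
  assumes "0 \<le> q" "q \<le> 1" "x \<le> y + 1" "(0::real) \<le> x" "0 \<le> y"
  shows "x powr q \<le> y powr q + 1"
proof -
  have "x powr q \<le> (y + 1) powr q" using assms by (intro powr_mono2) auto
  also have "\<dots> \<le> y powr q + 1"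
  proof (cases "y = 0")
    case False
    then have y: "y > 0" using assms by simp
    \<comment> \<open>The remaining exponent \<open>q - 1\<close> is not positive, so both resulting
      terms can be bounded by lowering the base: to \<open>y\<close> in the first and to 1 in the
      second.\<close>
    have "(y + 1) powr q = (y + 1) * (y + 1) powr (q - 1)"
      using y by (simp add: powr_diff)
    also have "\<dots> = y * (y + 1) powr (q - 1) + (y + 1) powr (q - 1)" by (simp add: algebra_simps)
    also have "\<dots> \<le> y * y powr (q - 1) + 1"
    proof (rule add_mono)
      show "y * (y + 1) powr (q - 1) \<le> y * y powr (q - 1)"
        using y assms by (intro mult_left_mono powr_mono2') auto
      have "(y + 1) powr (q - 1) \<le> (y + 1) powr 0" using y assms by (intro powr_mono) auto
      then show "(y + 1) powr (q - 1) \<le> 1" using y by simp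
    qed
    also have "y * y powr (q - 1) = y powr q" using y by (simp add: powr_diff)
    finally show ?thesis .
  qed simp
  finally show ?thesis .
qed

section \<open>Threshold and potential\<close>

locale exponent =
  fixes p :: nat and q :: real
  assumes p: "p \<ge> 2" and q: "q = 1 - 1 / real p"
begin

lemma q01: "0 \<le> q" "q \<le> 1" "0 < q"
  using p by (auto simp: q)

lemma pow_q: "real (d ^ (p - 1)) = real (d ^ p) powr q"
proof (cases "d = 0")
  case False
  then have "real (d ^ p) powr q = real d powr (real p * q)"
    by (simp add: powr_powr powr_realpow[symmetric])
  also have "real p * q = real (p - 1)" using p by (simp add: q field_simps of_nat_diff)
  also have "real d powr real (p - 1) = real (d ^ (p - 1))" using False by (simp add: powr_realpow)
  finally show ?thesis by simp
qed (use p in \<open>auto simp: power_0_left\<close>)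

text \<open>The program tests \<open>m < d ^ p\<close> in integers, while the analysis compares the
  cost \<open>d ^ (p - 1)\<close> with \<open>m powr q\<close>. Both are the same test, because
  \<open>p * q = p - 1\<close>.\<close>

lemma pow_less: "real (d ^ (p - 1)) > real m powr q \<longleftrightarrow> m < d ^ p"
proof -
  have "real (d ^ (p - 1)) > real m powr q \<longleftrightarrow> real m powr q < real (d ^ p) powr q" by (simp only: pow_q)
  also have "\<dots> \<longleftrightarrow> real m < real (d ^ p)"
    using q01 powr_less_mono2[of q "real m" "real (d ^ p)"] powr_mono2[of q "real (d ^ p)" "real m"]
    by (metis linorder_not_less of_nat_0_le_iff)
  finally show ?thesis by (simp only: of_nat_less_iff)
qed

text \<open>Each vertex of \<open>B\<close> contributes at least \<open>m powr (1 / p)\<close> to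
  the total degree \<open>2 * m\<close>.\<close>

lemma count_big:
  assumes "simple_edges n E" "B \<subseteq> {..<n}" "\<And>v. v \<in> B \<Longrightarrow> card E < deg E v ^ p"
  shows "real (card B) \<le> 2 * real (card E) powr q"
proof (cases "card E = 0")
  case True
  have "E = {}" using True finite_edges[OF assms(1)] by simp
  then have "deg E v = 0" for v by (simp add: deg_def)
  then have "B = {}" using assms(3) p by (auto simp: power_0_left)
  then show ?thesis by simp
next
  case False
  let ?m = "real (card E)"
  have m: "?m > 0" using False by simp
  have fB: "finite B" using assms(2) finite_subset by blast
  have d: "?m powr (1 / real p) \<le> real (deg E v)" if "v \<in> B" for v
  proof -
    have "?m powr (1 / real p) \<le> real (deg E v ^ p) powr (1 / real p)"
      using assms(3)[OF that] by (intro powr_mono2) (auto simp: less_imp_le simp flip: of_nat_power)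
    also have "\<dots> = real (deg E v)"
    proof (cases "deg E v = 0")
      case False
      then show ?thesis using p by (simp add: powr_powr powr_realpow[symmetric])
    qed (use p in \<open>auto simp: power_0_left\<close>)
    finally show ?thesis .
  qed
  have "real (card B) * ?m powr (1 / real p) = (\<Sum>v\<in>B. ?m powr (1 / real p))" by simp
  also have "\<dots> \<le> (\<Sum>v\<in>B. real (deg E v))" by (rule sum_mono) (rule d)
  also have "\<dots> \<le> (\<Sum>v<n. real (deg E v))" using assms(2) by (intro sum_mono2) auto
  also have "\<dots> = real (\<Sum>v<n. deg E v)" by simp
  also have "\<dots> = 2 * ?m" unfolding handshake[OF assms(1)] by simp
  also have "\<dots> = (2 * ?m powr q) * ?m powr (1 / real p)"
    using m by (simp add: powr_add[symmetric] q)
  finally show ?thesis using m by (simp add: mult_le_cancel_right)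
qed

definition pot :: "nat \<Rightarrow> nat \<Rightarrow> nat set set \<Rightarrow> nat set \<Rightarrow> real" where
  "pot n s E H = (\<Sum>v\<in>{..<n} - {s} - H. max 0 (real (deg E v ^ (p - 1)) - real (card E) powr q))
     + real (card H) * real (card E) powr q"

lemma pot_nonneg: "0 \<le> pot n s E H"
  unfolding pot_def by (intro add_nonneg_nonneg sum_nonneg) auto

lemma pot_empty: "pot n s {} {} = 0"
  unfolding pot_def using p by (simp add: deg_def power_0_left)

text \<open>From \<open>c + d \<le> (c + 1) * max 1 d\<close>. The case \<open>c = 2\<close> is the
  source of the factor \<open>3 ^ (p - 1)\<close>: one unit for the growth of a degree and one for
  the summand 1 in the cost.\<close>

lemma pow_add_le: "real ((c + d) ^ (p - 1)) \<le> (real c + 1) ^ (p - 1) * (1 + real (d ^ (p - 1)))"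
proof -
  have "real (c + d) \<le> (real c + 1) * max 1 (real d)"
  proof (cases "d = 0")
    case False
    then have "real c \<le> real c * real d" by (simp add: mult_le_cancel_left1)
    then show ?thesis using False by (simp add: algebra_simps)
  qed simp
  then have "real (c + d) ^ (p - 1) \<le> ((real c + 1) * max 1 (real d)) ^ (p - 1)"
    by (intro power_mono) auto
  also have "\<dots> = (real c + 1) ^ (p - 1) * max 1 (real d) ^ (p - 1)" by (simp add: power_mult_distrib)
  also have "max 1 (real d) ^ (p - 1) \<le> 1 + real (d ^ (p - 1))"
    by (cases "d = 0") (auto simp: max_def power_0_left)
  finally show ?thesis by (simp add: mult_left_mono)
qed

end

section \<open>Amortized bound for one update\<close>

context update_step
begin

lemma deg_untouched: "w \<notin> {u, v} \<Longrightarrow> deg E' w = deg E w"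
proof -
  assume w: "w \<notin> {u, v}"
  then have "{w, z} \<in> E' \<longleftrightarrow> {w, z} \<in> E" for z using in_E'[of "{w, z}"] by (auto simp: doubleton_eq_iff)
  then show ?thesis by (simp add: deg_def)
qed

lemma deg_step: "deg E' w \<le> deg E w + 1"
proof -
  have fin: "finite E" using finite_edges[OF E] .
  have "{e \<in> E'. w \<in> e} \<subseteq> insert {u, v} {e \<in> E. w \<in> e}" using in_E' by auto
  then have "card {e \<in> E'. w \<in> e} \<le> card (insert {u, v} {e \<in> E. w \<in> e})"
    using fin by (intro card_mono) auto
  also have "\<dots> \<le> Suc (card {e \<in> E. w \<in> e})" by (rule card_insert_le_m1) auto
  finally show ?thesis unfolding deg_eq[OF E] deg_eq[OF vd(5)] by simp
qed

lemma length_deg: "length (L w) = deg E' w"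
proof -
  have "distinct (L w)" using L by (simp add: adjacency_lists_def)
  then have "length (L w) = card (set (L w))" by (simp add: distinct_card)
  then show ?thesis using set_L by (simp add: deg_def)
qed

text \<open>Two expenses may be large. The enumeration at touched light vertices is paid by their
  excess, which vanishes from the potential since afterwards they are heavy or below the threshold.
  The recomputation at dropped vertices is paid by their threshold charges. The rest is a multiple
  of \<open>F\<close>, with \<open>29 = 7 + 10 + 12\<close>: fact 8 contributes 7 and 10, and the
  growth of the potential in fact 5 contributes 12.\<close>

lemma amortize:
  assumes "exponent p q" and H: "H \<subseteq> {..<n} - {s}" "\<And>h. h \<in> H \<Longrightarrow> card E < deg E h ^ p"
    and H': "H' = {h \<in> H \<union> touched. card E' < deg E' h ^ p}"
    and N: "N = 3 + card H + (\<Sum>w\<in>touched - H. (1 + deg E' w) ^ (p - 1))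
      + (\<Sum>h\<in>{h\<in>H. \<not> card E' < deg E' h ^ p}. (1 + deg E' h) ^ (p - 1))"
  shows "real N + 3 ^ (p - 1) * exponent.pot p q n s E' H'
    \<le> 3 ^ (p - 1) * exponent.pot p q n s E H + 29 * 3 ^ (p - 1) * real (max 1 (card E')) powr q"
proof -
  interpret exponent p q by fact
  define F where "F = real (max 1 (card E')) powr q"
  define m where "m = real (card E) powr q"
  define m' where "m' = real (card E') powr q"
  define K where "K = (3::real) ^ (p - 1)"
  define D where "D = {h\<in>H. \<not> card E' < deg E' h ^ p}"
  define T where "T = touched - H"
  define pw where "pw d = real (d ^ (p - 1))" for d
  have "card E \<le> card E' + 1" "card E' \<le> card E + 1" using vd(6) by (cases b; simp)+
  then have cE: "real (card E) \<le> real (card E') + 1" "real (card E') \<le> real (card E) + 1" by linarith+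
  have F1: "1 \<le> F" unfolding F_def using q01 by (intro ge_one_powr_ge_zero) auto
  have m0: "0 \<le> m" "0 \<le> m'" by (auto simp: m_def m'_def)
  have m'F: "m' \<le> F" unfolding m'_def F_def using q01 by (intro powr_mono2) auto
  have mm: "m \<le> m' + 1" "m' \<le> m + 1"
    unfolding m_def m'_def using cE q01 by (intro powr_le_add_one; simp)+
  have m2F: "m \<le> 2 * F" using mm m'F F1 by linarith
  have K1: "1 \<le> K" by (simp add: K_def)
  have fH: "finite H" using H(1) finite_subset by blast
  have tn: "touched \<subseteq> {..<n} - {s}" using vd by (auto simp: touched_def)
  have ft: "finite touched" by (simp add: touched_def)
  have ct: "card touched \<le> 2"
  proof -
    have "card touched \<le> card {u, v}" unfolding touched_def by (rule card_mono) auto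
    then show ?thesis using card_insert_le_m1[of 2 "{v}" u] by simp
  qed
  have cT: "card T \<le> 2" using ct card_mono[OF ft, of T] by (auto simp: T_def)
  have cH: "real (card H) \<le> 4 * F"
  proof -
    have "real (card H) \<le> 2 * m" unfolding m_def by (rule count_big[OF E]) (use H in auto)
    then show ?thesis using m2F by linarith
  qed
  \<comment> \<open>The light vertices that carry an excess after the update. They are untouched, so
    each excess grows only by the shift of the threshold, which is at most 1, and there are at most
    \<open>2 * F\<close> of them.\<close>
  define B where "B = {w \<in> {..<n} - {s} - H'. card E' < deg E' w ^ p}"
  have cB: "real (card B) \<le> 2 * F"
  proof -
    have "real (card B) \<le> 2 * m'" unfolding m'_def by (rule count_big[OF vd(5)]) (auto simp: B_def)
    then show ?thesis using m'F by linarith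
  qed
  have BH: "w \<notin> H" "w \<notin> touched" "deg E' w = deg E w" "w \<noteq> s" "w < n" if "w \<in> B" for w
  proof -
    show 1: "w \<notin> H" "w \<notin> touched" "w \<noteq> s" "w < n" using that by (auto simp: B_def H')
    then show "deg E' w = deg E w" by (intro deg_untouched) (auto simp: touched_def)
  qed
  have fB: "finite B" by (simp add: B_def)
  have "(\<Sum>w\<in>{..<n} - {s} - H'. max 0 (pw (deg E' w) - m')) = (\<Sum>w\<in>B. max 0 (pw (deg E' w) - m'))"
  proof (rule sum.mono_neutral_right)
    show "\<forall>w\<in>{..<n} - {s} - H' - B. max 0 (pw (deg E' w) - m') = 0"
    proof
      fix w assume "w \<in> {..<n} - {s} - H' - B"
      then have "\<not> card E' < deg E' w ^ p" by (auto simp: B_def)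
      then have "\<not> m' < pw (deg E' w)" unfolding pw_def m'_def pow_less .
      then show "max 0 (pw (deg E' w) - m') = 0" by simp
    qed
  qed (auto simp: B_def)
  also have "\<dots> \<le> (\<Sum>w\<in>B. max 0 (pw (deg E w) - m) + 1)"
    using BH(3) mm by (intro sum_mono) (auto simp: max_def)
  also have "\<dots> = (\<Sum>w\<in>B. max 0 (pw (deg E w) - m)) + real (card B)" by (simp add: sum.distrib)
  finally have 1: "(\<Sum>w\<in>{..<n} - {s} - H'. max 0 (pw (deg E' w) - m'))
      \<le> (\<Sum>w\<in>B. max 0 (pw (deg E w) - m)) + 2 * F" using cB by linarith
  \<comment> \<open>\<open>B\<close> and \<open>T\<close> are disjoint, so the old excess of
    \<open>T\<close> is still available for payment after the excess of \<open>B\<close> has been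
    accounted for.\<close>
  have "(\<Sum>w\<in>B. max 0 (pw (deg E w) - m)) + (\<Sum>w\<in>T. max 0 (pw (deg E w) - m))
      = (\<Sum>w\<in>B \<union> T. max 0 (pw (deg E w) - m))"
    using BH(2) fB ft by (intro sum.union_disjoint[symmetric]) (auto simp: T_def)
  also have "\<dots> \<le> (\<Sum>w\<in>{..<n} - {s} - H. max 0 (pw (deg E w) - m))"
    using BH tn by (intro sum_mono2) (auto simp: T_def)
  finally have 2: "(\<Sum>w\<in>B. max 0 (pw (deg E w) - m)) + (\<Sum>w\<in>T. max 0 (pw (deg E w) - m))
     \<le> (\<Sum>w\<in>{..<n} - {s} - H. max 0 (pw (deg E w) - m))" .
  have "(\<Sum>w\<in>T. pw (deg E w)) - real (card T) * m = (\<Sum>w\<in>T. pw (deg E w) - m)"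
    by (simp add: sum_subtractf)
  also have "\<dots> \<le> (\<Sum>w\<in>T. max 0 (pw (deg E w) - m))" by (rule sum_mono) simp
  finally have "(\<Sum>w\<in>T. pw (deg E w)) - real (card T) * m \<le> (\<Sum>w\<in>T. max 0 (pw (deg E w) - m))" .
  moreover have "real (card T) * m \<le> 2 * m" using cT m0 by (intro mult_right_mono) auto
  ultimately have 3: "(\<Sum>w\<in>T. pw (deg E w)) - 4 * F \<le> (\<Sum>w\<in>T. max 0 (pw (deg E w) - m))"
    using m2F by linarith
  have DH: "D \<subseteq> H" by (auto simp: D_def)
  have cD: "real (card D) \<le> real (card H)" using card_mono[OF fH DH] by simp
  have "card H' \<le> card (H - D) + card touched"
  proof -
    have "H' \<subseteq> (H - D) \<union> touched" by (auto simp: H' D_def)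
    then have "card H' \<le> card ((H - D) \<union> touched)" using fH ft by (intro card_mono) auto
    then show ?thesis using card_Un_le[of "H - D" touched] by linarith
  qed
  then have "real (card H') \<le> real (card H) - real (card D) + 2"
    using ct card_Diff_subset[OF finite_subset[OF DH fH] DH] card_mono[OF fH DH] by linarith
  then have "real (card H') * m' \<le> (real (card H) - real (card D) + 2) * m'"
    using m0 by (intro mult_right_mono) auto
  also have "\<dots> = (real (card H) - real (card D)) * m' + 2 * m'" by (simp add: algebra_simps)
  also have "\<dots> \<le> (real (card H) - real (card D)) * (m + 1) + 2 * F"
    using cD mm m'F by (intro add_mono mult_left_mono) auto
  also have "\<dots> = real (card H) * m - real (card D) * m + real (card H) - real (card D) + 2 * F"
    by (simp add: algebra_simps)
  finally have 4: "real (card H') * m' \<le> real (card H) * m - real (card D) * m + 6 * F"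
    using cH by simp
  have P: "pot n s E H = (\<Sum>w\<in>{..<n} - {s} - H. max 0 (pw (deg E w) - m)) + real (card H) * m"
    "pot n s E' H' = (\<Sum>w\<in>{..<n} - {s} - H'. max 0 (pw (deg E' w) - m')) + real (card H') * m'"
    by (simp_all only: pot_def pw_def m_def m'_def)
  \<comment> \<open>The constant is \<open>12 = 2 + 4 + 6\<close>, from facts 1, 3 and 4.\<close>
  have 5: "pot n s E' H' - pot n s E H \<le> 12 * F - (\<Sum>w\<in>T. pw (deg E w)) - real (card D) * m"
    unfolding P using 1 2 3 4 by linarith
  have 6: "(\<Sum>w\<in>T. pw (1 + deg E' w)) \<le> K * (2 * F + (\<Sum>w\<in>T. pw (deg E w)))"
  proof -
    have "pw (1 + deg E' w) \<le> K * (1 + pw (deg E w))" for w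
    proof -
      have "pw (1 + deg E' w) \<le> pw (2 + deg E w)"
        unfolding pw_def of_nat_le_iff using deg_step[of w] by (intro power_mono) auto
      also have "\<dots> \<le> K * (1 + pw (deg E w))"
        unfolding pw_def K_def using pow_add_le[of 2 "deg E w"] by simp
      finally show ?thesis .
    qed
    then have "(\<Sum>w\<in>T. pw (1 + deg E' w)) \<le> (\<Sum>w\<in>T. K * (1 + pw (deg E w)))" by (intro sum_mono)
    also have "\<dots> = K * (real (card T) + (\<Sum>w\<in>T. pw (deg E w)))"
      by (simp add: sum_distrib_left[symmetric] sum.distrib)
    also have "\<dots> \<le> K * (2 * F + (\<Sum>w\<in>T. pw (deg E w)))"
      using K1 cT F1 by (intro mult_left_mono add_mono) auto
    finally show ?thesis .
  qed
  \<comment> \<open>A dropped vertex has a degree at or below the new threshold, so its cost is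
    within a constant factor of the charge that it releases.\<close>
  have 7: "(\<Sum>w\<in>D. pw (1 + deg E' w)) \<le> K * (8 * F + real (card D) * m)"
  proof -
    have "pw (1 + deg E' w) \<le> K * (2 + m)" if "w \<in> D" for w
    proof -
      have "\<not> card E' < deg E' w ^ p" using that by (simp add: D_def)
      then have "\<not> m' < pw (deg E' w)" unfolding pw_def m'_def pow_less .
      then have "pw (deg E' w) \<le> m'" by simp
      then have "1 + pw (deg E' w) \<le> 2 + m" using mm by linarith
      have "pw (1 + deg E' w) \<le> 2 ^ (p - 1) * (1 + pw (deg E' w))"
        unfolding pw_def using pow_add_le[of 1 "deg E' w"] by simp
      also have "\<dots> \<le> K * (2 + m)"
        unfolding K_def using \<open>1 + pw (deg E' w) \<le> 2 + m\<close>
        by (intro mult_mono power_mono) (auto simp: pw_def)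
      finally show ?thesis .
    qed
    then have "(\<Sum>w\<in>D. pw (1 + deg E' w)) \<le> (\<Sum>w\<in>D. K * (2 + m))" by (intro sum_mono) auto
    also have "\<dots> = K * (2 * real (card D) + real (card D) * m)" by (simp add: algebra_simps)
    also have "\<dots> \<le> K * (8 * F + real (card D) * m)"
      using K1 cD cH by (intro mult_left_mono add_mono) auto
    finally show ?thesis .
  qed
  have "real N = 3 + real (card H) + (\<Sum>w\<in>T. pw (1 + deg E' w)) + (\<Sum>w\<in>D. pw (1 + deg E' w))"
    unfolding N T_def D_def pw_def by simp
  also have "\<dots> \<le> 7 * F + K * (2 * F + (\<Sum>w\<in>T. pw (deg E w))) + K * (8 * F + real (card D) * m)"
    using 6 7 cH F1 by linarith
  also have "\<dots> = 7 * F + 10 * (K * F) + K * ((\<Sum>w\<in>T. pw (deg E w)) + real (card D) * m)"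
    by (simp add: algebra_simps)
  finally have 8: "real N \<le> 7 * F + 10 * (K * F) + K * ((\<Sum>w\<in>T. pw (deg E w)) + real (card D) * m)" .
  have "K * (pot n s E' H' - pot n s E H) \<le> K * (12 * F - (\<Sum>w\<in>T. pw (deg E w)) - real (card D) * m)"
    using 5 K1 by (intro mult_left_mono) auto
  then have "K * pot n s E' H' - K * pot n s E H
      \<le> 12 * (K * F) - K * ((\<Sum>w\<in>T. pw (deg E w)) + real (card D) * m)"
    by (simp add: algebra_simps)
  moreover have "7 * F \<le> 7 * (K * F)" using K1 F1 by (simp add: mult_le_cancel_right1)
  ultimately have "real N + K * pot n s E' H' \<le> K * pot n s E H + 29 * (K * F)" using 8 by linarith
  then show ?thesis by (simp add: K_def F_def)
qed

end

section \<open>Tables for update time m to the 2/3\<close>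

definition lw :: "nat set \<Rightarrow> (nat \<Rightarrow> nat) \<Rightarrow> nat \<Rightarrow> nat" where
  "lw H X b = light H b * X b"

text \<open>In \<open>tK\<close>, \<open>tP\<close> and \<open>tG\<close> the middle vertex is
  light, and the share of the heavy ones is added on reading. \<open>tP\<close>, \<open>tF\<close>
  and \<open>tA\<close> have nonzero entries at heavy indices only. \<open>tA\<close>, the codegrees
  of adjacent heavy pairs, makes the update of \<open>tF\<close> cheap when a heavy vertex gains or
  loses its mark.\<close>

definition tK where "tK n a X H q = cod n a (lw H X) (q div n) (q mod n)"
definition tP where "tP n a s X H q = heavy H q * wlk n a s (lw H X) q"
definition tF where "tF n a X H q = heavy H q * tri n a X q"
definition tA where "tA n a H q = heavy H (q div n) * heavy H (q mod n) * (a (q div n) (q mod n)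
   * cod n a every (q div n) (q mod n))"
definition tG where "tG n a s H q = nbdeg n a (lw H s) q"

lemma lw_insert: "x \<notin> H \<Longrightarrow> lw H X b = lw (insert x H) X b + of_bool (b = x) * X b"
  by (simp add: lw_def light_insert algebra_simps)

lemma lw_le: "(\<And>b. X b \<le> 1) \<Longrightarrow> lw H X b \<le> 1"
  unfolding lw_def by (intro mult_le_one) simp_all

lemma sum_heavy_point: "(\<Sum>w<n::nat. of_bool (w \<in> H) * (of_bool (q = w) * V w)) = of_bool (q < n) * (heavy H q * V q)"
proof -
  have "(\<Sum>w<n. of_bool (w \<in> H) * (of_bool (q = w) * V w)) = (\<Sum>w<n. of_bool (q = w) * (heavy H w * V w))"
    by (simp add: heavy_def mult.left_commute)
  then show ?thesis unfolding sum_point .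
qed

lemma sum_heavy_row: "n > 0 \<Longrightarrow> (\<Sum>w<n::nat. of_bool (w \<in> H) * (of_bool (q = y * n + w) * V w))
    = of_bool (q div n = y) * (heavy H (q mod n) * V (q mod n))"
proof -
  assume n: "n > 0"
  have "(\<Sum>w<n. of_bool (w \<in> H) * (of_bool (q = y * n + w) * V w)) = (\<Sum>w<n. of_bool (q = y * n + w) * (heavy H w * V w))"
    by (simp add: heavy_def mult.left_commute)
  then show ?thesis unfolding sum_row[OF n] .
qed

lemma sum_heavy_col: "y < n \<Longrightarrow> (\<Sum>w<n::nat. of_bool (w \<in> H) * (of_bool (q = w * n + y) * V w))
    = of_bool (q div n < n) * (of_bool (q mod n = y) * (heavy H (q div n) * V (q div n)))"
proof -
  assume n: "y < n"
  have "(\<Sum>w<n. of_bool (w \<in> H) * (of_bool (q = w * n + y) * V w)) = (\<Sum>w<n. of_bool (q = w * n + y) * (heavy H w * V w))"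
    by (simp add: heavy_def mult.left_commute)
  then show ?thesis unfolding sum_col[OF n] .
qed

lemma idx_point: "y < n \<Longrightarrow> of_bool (q = x * n + y) = of_bool (q div n = x) * (of_bool (q mod n = (y::nat)) :: nat)"
  by (simp only: idx_eq of_bool_conj)

section \<open>Separation of light and heavy middle vertices\<close>

context wgraph
begin

lemma cod_split: "cod n a (lw H X) x y + (\<Sum>w<n. of_bool (w \<in> H) * (X w * a w x * a w y)) = cod n a X x y"
  unfolding cod_def sum.distrib[symmetric] lw_def light_def by (rule sum.cong) auto

lemma wlk_split: "wlk n a s (lw H X) v + (\<Sum>w<n. of_bool (w \<in> H) * (X w * a v w * cn n a s w)) = wlk n a s X v"
  unfolding wlk_def sum.distrib[symmetric] lw_def light_def by (rule sum.cong) (auto simp: a_sym[of v])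

lemma nbdeg_split: "nbdeg n a (lw H X) v + (\<Sum>w<n. of_bool (w \<in> H) * (X w * a v w * dg n a w)) = nbdeg n a X v"
  unfolding nbdeg_def sum.distrib[symmetric] lw_def light_def by (rule sum.cong) (auto simp: a_sym[of v])

text \<open>Walks \<open>v - b - w\<close> with \<open>b\<close> light and \<open>w\<close> marked.
  The light ends \<open>w\<close> are counted at \<open>b\<close> by a diagonal codegree; each heavy
  end \<open>w\<close> is reached along the common light neighbours of \<open>w\<close> and
  \<open>v\<close>, which is a codegree again. So for a light \<open>v\<close> the neighbours of
  \<open>v\<close> and the heavy list suffice for the evaluation.\<close>

lemma wlk_light:
  "wlk n a s (lw H X) v = (\<Sum>w<n. light H w * X w * a v w * cod n a (lw H s) w w)
    + (\<Sum>w<n. of_bool (w \<in> H) * (s w * cod n a (lw H X) w v))"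
proof -
  have c: "cn n a s b = cod n a (lw H s) b b + (\<Sum>w<n. of_bool (w \<in> H) * (s w * a w b))" for b
  proof -
    have "cod n a s b b = cod n a (lw H s) b b + (\<Sum>w<n. of_bool (w \<in> H) * (s w * a w b * a w b))"
      using cod_split[of H s b b] by simp
    then show ?thesis by (simp add: cod_diag mult.assoc a_sq)
  qed
  have "wlk n a s (lw H X) v = (\<Sum>b<n. lw H X b * a b v * cod n a (lw H s) b b)
     + (\<Sum>b<n. \<Sum>w<n. of_bool (w \<in> H) * (s w * (lw H X b * a b w * a b v)))"
    unfolding wlk_def c distrib_left sum.distrib sum_distrib_left
    by (intro arg_cong2[where f = "(+)"] sum.cong refl) (simp add: ac_simps a_sym)
  also have "(\<Sum>b<n. \<Sum>w<n. of_bool (w \<in> H) * (s w * (lw H X b * a b w * a b v)))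
      = (\<Sum>w<n. of_bool (w \<in> H) * (s w * cod n a (lw H X) w v))"
    unfolding cod_def sum_distrib_left by (rule sum.swap)
  also have "(\<Sum>b<n. lw H X b * a b v * cod n a (lw H s) b b) = (\<Sum>w<n. light H w * X w * a v w * cod n a (lw H s) w w)"
    by (simp add: lw_def a_sym[of v])
  finally show ?thesis .
qed

lemma tri_pairs: "(\<Sum>w1<n. \<Sum>w2<n. X w1 * a v w1 * a v w2 * a w1 w2) = tri n a X v"
  unfolding tri_def cod_def sum_distrib_left
  by (intro sum.cong refl) (simp add: ac_simps a_sym[of v] a_sym)

lemma tK_le: "(\<And>b. X b \<le> 1) \<Longrightarrow> tK n a X H q \<le> n"
  unfolding tK_def by (intro cod_le lw_le)

lemma tP_le: "(\<And>b. s b \<le> 1) \<Longrightarrow> (\<And>b. X b \<le> 1) \<Longrightarrow> tP n a s X H q \<le> n * n"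
  unfolding tP_def by (intro mult_le_one wlk_le lw_le) simp_all

lemma tF_le: "(\<And>b. X b \<le> 1) \<Longrightarrow> tF n a X H q \<le> n * n"
  unfolding tF_def by (intro mult_le_one tri_le) simp_all

lemma tA_le: "tA n a H q \<le> n"
  unfolding tA_def mult.assoc by (intro mult_le_one cod_le a_le) simp_all

lemma tG_le: "(\<And>b. s b \<le> 1) \<Longrightarrow> tG n a s H q \<le> n * n"
  unfolding tG_def by (intro nbdeg_le lw_le)

end

section \<open>The tables under a toggled edge\<close>

context edge_toggle
begin

lemma n_pos: "0 < n" using xy by simp

lemma acod': "a' u v * cod n a' every u v = a u v * cod n a every u v
     + a u v * (of_bool (u = y) * a x v + of_bool (u = x) * a y v
         + of_bool (v = y) * a x u + of_bool (v = x) * a y u)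
     + ed x y u v * cod n a every x y"
proof (cases "ed x y u v = 0")
  case True
  then have "(u = y \<longrightarrow> v \<noteq> x) \<and> (u = x \<longrightarrow> v \<noteq> y)" by (auto simp: ed_def split: if_splits)
  then have e: "of_bool (u = y) * of_bool (v = y) * a u v = 0" "of_bool (u = x) * of_bool (v = x) * a u v = 0"
    using a_irr by auto
  have "a' u v = a u v" using True by (simp add: add_edge_def)
  then show ?thesis using True e unfolding cod' by (simp add: every_def algebra_simps)
next
  case False
  then have "u = x \<and> v = y \<or> u = y \<and> v = x" by (auto simp: ed_def split: if_splits)
  then show ?thesis
    using xy yx a_irr cod_sym[of every x y] unfolding cod'
    by (auto simp: every_def add_edge_def ed_def)
qed

text \<open>Only a light end of the edge is a tabulated middle vertex. A light \<open>x\<close>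
  gives \<open>y\<close> a new connection to each neighbour of \<open>x\<close>, which changes a row
  and a column, and a walk from \<open>y\<close> to itself, which changes a diagonal entry. So the
  work is proportional to the degree of a light vertex.\<close>

lemma tK': "tK n a' X H q = tK n a X H q
   + (lw H X x * ((\<Sum>w<n. of_bool (q = y * n + w) * a x w) + ((\<Sum>w<n. of_bool (q = w * n + y) * a x w)
       + of_bool (q = y * n + y)))
   + lw H X y * ((\<Sum>w<n. of_bool (q = x * n + w) * a y w) + ((\<Sum>w<n. of_bool (q = w * n + x) * a y w)
       + of_bool (q = x * n + x))))"
proof -
  have o: "of_bool (q div n < n) * (of_bool (q mod n = v) * a u (q div n)) = of_bool (q mod n = v) * a u (q div n)" for u v
    using a_out2[of "q div n" u] by (cases "q div n < n") auto
  show ?thesis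
    unfolding tK_def cod' sum_row[OF n_pos] sum_col[OF xy(1)] sum_col[OF xy(2)] o
    unfolding idx_point[OF xy(1)] idx_point[OF xy(2)]
    by (simp only: add.assoc algebra_simps)
qed

lemma tP': "tP n a' s X H q = tP n a s X H q
   + (lw H X x * ((\<Sum>w<n. of_bool (q = w) * (heavy H w * a x w * s y)) + of_bool (q = y) * (heavy H y * (cn n a s x + s y)))
   + lw H X y * ((\<Sum>w<n. of_bool (q = w) * (heavy H w * a y w * s x)) + of_bool (q = x) * (heavy H x * (cn n a s y + s x))))"
proof -
  have o: "of_bool (q < n) * (heavy H q * a u q * c) = heavy H q * a u q * c" for u c
    using a_out2[of q u] by (cases "q < n") auto
  have p: "heavy H q * of_bool (q = z) = of_bool (q = z) * heavy H z" for z by auto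
  show ?thesis unfolding tP_def wlk' sum_point o
    by (simp only: distrib_left mult.assoc[symmetric] mult.commute[of _ "heavy H q"] p) (simp add: algebra_simps)
qed

lemma tF': "tF n a' X H q = tF n a X H q
   + ((\<Sum>w<n. of_bool (w \<in> H) * (of_bool (q = w) * (a x w * a y w * (X x + X y))))
   + (of_bool (q = x) * (heavy H x * (X y * cod n a every x y + cod n a X x y))
   + of_bool (q = y) * (heavy H y * (X x * cod n a every x y + cod n a X x y))))"
proof -
  have o: "of_bool (q < n) * (heavy H q * (a x q * a y q * (X x + X y))) = heavy H q * (a x q * a y q * (X x + X y))"
    using a_out2[of q x] by (cases "q < n") auto
  have p: "heavy H q * (of_bool (q = z) * c) = of_bool (q = z) * (heavy H z * c)" for z c by auto
  have t: "heavy H q * (t + A + of_bool (q = x) * c + of_bool (q = y) * d)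
      = heavy H q * t + (heavy H q * A + (of_bool (q = x) * (heavy H x * c) + of_bool (q = y) * (heavy H y * d)))" for t A c d
    unfolding distrib_left p by simp
  show ?thesis unfolding tF_def tri' sum_heavy_point o t ..
qed

text \<open>An entry changes if it belongs to the new edge itself or if it belongs to one end and a
  common heavy neighbour of both ends. A pass over the heavy list finds all of these.\<close>

lemma tA': "tA n a' H q = tA n a H q
   + ((\<Sum>w<n. of_bool (w \<in> H) * (of_bool (q = x * n + w) * (heavy H x * a x w * a y w)))
   + ((\<Sum>w<n. of_bool (w \<in> H) * (of_bool (q = w * n + x) * (heavy H x * a x w * a y w)))
   + ((\<Sum>w<n. of_bool (w \<in> H) * (of_bool (q = y * n + w) * (heavy H y * a x w * a y w)))
   + ((\<Sum>w<n. of_bool (w \<in> H) * (of_bool (q = w * n + y) * (heavy H y * a x w * a y w)))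
   + (of_bool (q = x * n + y) * (heavy H x * heavy H y * cod n a every x y)
   + of_bool (q = y * n + x) * (heavy H x * heavy H y * cod n a every x y))))))"
proof -
  let ?p = "q div n" and ?r = "q mod n"
  have o: "of_bool (?p < n) * (of_bool (?r = v) * (heavy H ?p * (h * a u ?p * c)))
      = of_bool (?r = v) * (heavy H ?p * (h * a u ?p * c))" for h u v c
    using a_out2[of ?p u] by (cases "?p < n") auto
  have 1: "heavy H ?p * heavy H ?r * (a ?p ?r * (of_bool (?p = y) * a x ?r)) = of_bool (?p = y) * (heavy H ?r * (heavy H y * a x ?r * a y ?r))"
    by auto
  have 2: "heavy H ?p * heavy H ?r * (a ?p ?r * (of_bool (?p = x) * a y ?r)) = of_bool (?p = x) * (heavy H ?r * (heavy H x * a x ?r * a y ?r))"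
    by auto
  have 3: "heavy H ?p * heavy H ?r * (a ?p ?r * (of_bool (?r = y) * a x ?p)) = of_bool (?r = y) * (heavy H ?p * (heavy H y * a x ?p * a y ?p))"
    using a_sym[of y ?p] by auto
  have 4: "heavy H ?p * heavy H ?r * (a ?p ?r * (of_bool (?r = x) * a y ?p)) = of_bool (?r = x) * (heavy H ?p * (heavy H x * a x ?p * a y ?p))"
    using a_sym[of x ?p] by auto
  have 5: "heavy H ?p * heavy H ?r * (ed x y ?p ?r * c) = of_bool (?p = x) * of_bool (?r = y) * (heavy H x * heavy H y * c)
      + of_bool (?p = y) * of_bool (?r = x) * (heavy H x * heavy H y * c)" for c
    unfolding ed_def using xy by auto
  show ?thesis
    unfolding tA_def acod' sum_heavy_row[OF n_pos] sum_heavy_col[OF xy(1)] sum_heavy_col[OF xy(2)] o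
    unfolding idx_point[OF xy(1)] idx_point[OF xy(2)] distrib_left 1 2 3 4 5
    by (simp only: ac_simps)
qed

lemma tG': "tG n a' s H q = tG n a s H q
   + (lw H s x * ((\<Sum>w<n. of_bool (q = w) * a x w) + of_bool (q = y) * (dg n a x + 1))
   + lw H s y * ((\<Sum>w<n. of_bool (q = w) * a y w) + of_bool (q = x) * (dg n a y + 1)))"
proof -
  have o: "of_bool (q < n) * a u q = a u q" for u using a_out2[of q u] by (cases "q < n") auto
  show ?thesis unfolding tG_def nbdeg' sum_point o by (simp add: algebra_simps)
qed

end

section \<open>The tables under a toggled mark\<close>

context mark_toggle
begin

lemma n_pos: "0 < n" using v by simp

lemma lw_mark: "lw H s' b = lw H s b + of_bool (b = v) * light H b"
  by (simp add: lw_def add_mark_def algebra_simps)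

lemma m_tK: "tK n a s' H q = tK n a s H q + light H v * (\<Sum>w1<n. \<Sum>w2<n. of_bool (q = w1 * n + w2) * (a v w1 * a v w2))"
proof -
  have o: "of_bool (q div n < n) * (a v (q div n) * a v (q mod n)) = a v (q div n) * a v (q mod n)"
    using a_out2[of "q div n" v] by (cases "q div n < n") auto
  have "tK n a s' H q = (\<Sum>b<n. lw H s b * a b (q div n) * a b (q mod n)
      + of_bool (b = v) * (light H b * a b (q div n) * a b (q mod n)))"
    unfolding tK_def cod_def lw_mark by (simp add: algebra_simps)
  then show ?thesis unfolding sum_matrix[OF n_pos] o sum.distrib sum_point' tK_def cod_def using v by simp
qed

text \<open>The new walks end at the new mark. The entry of a heavy \<open>w\<close> grows by the
  codegree of \<open>w\<close> and \<open>v\<close> through light vertices, which is an entry of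
  \<open>tK\<close>. In \<open>m_tP_s\<close> a light \<open>v\<close> becomes a middle vertex in
  addition.\<close>

lemma m_tP: "tP n a s' X H q = tP n a s X H q
   + (\<Sum>w<n. of_bool (w \<in> H) * (of_bool (q = w) * tK n a X H (w * n + v)))"
proof -
  have k: "tK n a X H (w * n + v) = cod n a (lw H X) w v" for w
    unfolding tK_def using v by simp
  have o: "of_bool (q < n) * (heavy H q * cod n a (lw H X) q v) = heavy H q * cod n a (lw H X) q v"
    using a_out2[of q] by (cases "q < n") (auto simp: cod_def)
  show ?thesis unfolding tP_def m_wlk sum_heavy_point k o by (simp add: algebra_simps)
qed

lemma m_tP_s: "tP n a s' s' H q = tP n a s s H q
   + (\<Sum>w<n. of_bool (w \<in> H) * (of_bool (q = w) * (tK n a s H (w * n + v) + light H v * a v w * cn n a s v)))"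
proof -
  have k: "tK n a s H (w * n + v) = cod n a (lw H s) w v" for w
    unfolding tK_def using v by simp
  have o: "of_bool (q < n) * (heavy H q * (cod n a (lw H s) q v + light H v * a v q * c))
      = heavy H q * (cod n a (lw H s) q v + light H v * a v q * c)" for c
    using a_out2[of q] by (cases "q < n") (auto simp: cod_def)
  have "wlk n a s' (lw H s') q = wlk n a s' (lw H s) q + (\<Sum>b<n. of_bool (b = v) * (light H b * a b q * cn n a s' b))"
    unfolding wlk_def lw_mark by (simp add: algebra_simps sum.distrib)
  then have "wlk n a s' (lw H s') q = wlk n a s (lw H s) q + cod n a (lw H s) q v + light H v * a v q * cn n a s v"
    unfolding sum_point' m_wlk using v a_irr by (simp add: m_cn)
  then show ?thesis unfolding tP_def sum_heavy_point k o by (simp add: algebra_simps)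
qed

lemma m_tF: "tF n a s' H q = tF n a s H q + heavy H q * (a v q * cod n a every v q)"
  unfolding tF_def m_tri by (simp add: algebra_simps)

text \<open>The increment from \<open>m_tF\<close> for a heavy \<open>v\<close>, read from
  \<open>tA\<close> along the heavy list; \<open>m_tF_light\<close> expresses the same increment by
  pairs of neighbours, which are affordable at a light \<open>v\<close>.\<close>

lemma m_tF_heavy: "v \<in> H \<Longrightarrow> heavy H q * (a v q * cod n a every v q)
   = (\<Sum>w<n. of_bool (w \<in> H) * (of_bool (q = w) * (a v w * tA n a H (v * n + w))))"
proof -
  assume vH: "v \<in> H"
  have "(\<Sum>w<n. of_bool (w \<in> H) * (of_bool (q = w) * (a v w * tA n a H (v * n + w))))
     = of_bool (q < n) * (heavy H q * (a v q * tA n a H (v * n + q)))" by (rule sum_heavy_point)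
  also have "\<dots> = heavy H q * (a v q * cod n a every v q)"
  proof (cases "q < n")
    case True
    then have "tA n a H (v * n + q) = heavy H q * (a v q * cod n a every v q)" unfolding tA_def using vH by simp
    then have "of_bool (q < n) * (heavy H q * (a v q * tA n a H (v * n + q)))
        = heavy H q * heavy H q * (a v q * a v q * cod n a every v q)" using True by simp
    also have "heavy H q * heavy H q = heavy H q" by (simp add: heavy_def)
    finally show ?thesis unfolding a_sq .
  next
    case False
    then show ?thesis using a_out2[of q v] by simp
  qed
  finally show ?thesis by simp
qed

lemma m_tF_light: "heavy H q * (a v q * cod n a every v q)
   = (\<Sum>w1<n. \<Sum>w2<n. of_bool (q = w1) * (heavy H w1 * a v w1 * a v w2 * a w1 w2))"
proof -
  have "(\<Sum>w1<n. \<Sum>w2<n. of_bool (q = w1) * (heavy H w1 * a v w1 * a v w2 * a w1 w2))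
      = (\<Sum>w1<n. of_bool (q = w1) * (heavy H w1 * (a v w1 * cod n a every v w1)))"
    unfolding cod_def sum_distrib_left by (intro sum.cong refl) (simp add: ac_simps a_sym[of v] a_sym)
  also have "\<dots> = heavy H q * (a v q * cod n a every v q)"
    unfolding sum_point using a_out2[of q v] by (cases "q < n") auto
  finally show ?thesis by simp
qed

lemma m_tG: "tG n a s' H q = tG n a s H q + light H v * (\<Sum>w<n. of_bool (q = w) * (a v w * dg n a v))"
proof -
  have o: "of_bool (q < n) * (a v q * dg n a v) = a v q * dg n a v" using a_out2[of q v] by (cases "q < n") auto
  have "tG n a s' H q = tG n a s H q + (\<Sum>b<n. of_bool (b = v) * (light H b * a b q * dg n a b))"
    unfolding tG_def nbdeg_def lw_mark by (simp add: algebra_simps sum.distrib)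
  then show ?thesis unfolding sum_point' sum_point o using v by simp
qed

end

section \<open>The tables under a change of status\<close>

context wgraph
begin

text \<open>A vertex that becomes heavy ceases to be a tabulated middle vertex, so this table
  shrinks when \<open>H\<close> grows. The commands for it therefore test the negated direction
  flag.\<close>

lemma tK_insert:
  assumes "x \<notin> H" "x < n"
  shows "tK n a X H q = tK n a X (insert x H) q + X x * (\<Sum>w1<n. \<Sum>w2<n. of_bool (q = w1 * n + w2) * (a x w1 * a x w2))"
proof -
  have n: "0 < n" using assms by simp
  have o: "of_bool (q div n < n) * (a x (q div n) * a x (q mod n)) = a x (q div n) * a x (q mod n)"
    using a_out2[of "q div n" x] by (cases "q div n < n") auto
  have "tK n a X H q = (\<Sum>b<n. lw (insert x H) X b * a b (q div n) * a b (q mod n)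
      + of_bool (b = x) * (X b * a b (q div n) * a b (q mod n)))"
    unfolding tK_def cod_def lw_insert[OF assms(1)] by (simp add: algebra_simps)
  then show ?thesis unfolding sum_matrix[OF n] o sum.distrib sum_point' tK_def cod_def using assms by simp
qed

lemma wlk_insert:
  assumes "x \<notin> H" "x < n"
  shows "wlk n a s (lw H X) q = wlk n a s (lw (insert x H) X) q + X x * a x q * cn n a s x"
proof -
  have "wlk n a s (lw H X) q = (\<Sum>b<n. lw (insert x H) X b * a b q * cn n a s b
      + of_bool (b = x) * (X b * a b q * cn n a s b))"
    unfolding wlk_def lw_insert[OF assms(1)] by (simp add: algebra_simps)
  then show ?thesis unfolding sum.distrib sum_point' wlk_def using assms by simp
qed

text \<open>The intermediate state of \<open>tP\<close>: \<open>x\<close> is no longer a light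
  middle vertex, but its own entry is not present yet. A promotion lowers the other entries and
  raises that of \<open>x\<close>, and a single toggle cannot do both.\<close>

definition "tP0 s X x H q = heavy H q * wlk n a s (lw (insert x H) X) q"

lemma tP_tP0:
  assumes "x \<notin> H" "x < n"
  shows "tP n a s X H q = tP0 s X x H q + (\<Sum>w<n. of_bool (q = w) * (heavy H w * X x * a x w * cn n a s x))"
proof -
  have o: "of_bool (q < n) * (heavy H q * X x * a x q * c) = heavy H q * X x * a x q * c" for c
    using a_out2[of q x] by (cases "q < n") auto
  show ?thesis unfolding tP_def tP0_def wlk_insert[OF assms] sum_point o by (simp add: algebra_simps)
qed

lemma tP0_insert:
  assumes "x \<notin> H" "x < n"
  shows "tP n a s X (insert x H) q = tP0 s X x H q + of_bool (q = x) * wlk n a s (lw H X) x"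
proof -
  have "wlk n a s (lw (insert x H) X) x = wlk n a s (lw H X) x"
    using wlk_insert[OF assms, of s X x] a_irr by simp
  then show ?thesis unfolding tP_def tP0_def heavy_insert[OF assms(1)] by (auto simp: algebra_simps)
qed

lemma tF_insert:
  assumes "x \<notin> H"
  shows "tF n a X (insert x H) q = tF n a X H q + (\<Sum>w1<n. \<Sum>w2<n. of_bool (q = x) * (X w1 * a x w1 * a x w2 * a w1 w2))"
  unfolding sum_distrib_left[symmetric] tri_pairs tF_def heavy_insert[OF assms] by (auto simp: algebra_simps)

lemma tA_insert:
  assumes "x \<notin> H" "x < n"
  shows "tA n a (insert x H) q = tA n a H q
    + ((\<Sum>w1<n. \<Sum>w2<n. of_bool (q = x * n + w1) * (heavy H w1 * a x w1 * a x w2 * a w1 w2))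
    + (\<Sum>w1<n. \<Sum>w2<n. of_bool (q = w1 * n + x) * (heavy H w1 * a x w1 * a x w2 * a w1 w2)))"
proof -
  have n: "0 < n" using assms by simp
  let ?p = "q div n" and ?r = "q mod n"
  have c: "(\<Sum>w2<n. k w1 * (heavy H w1 * a x w1 * a x w2 * a w1 w2)) = k w1 * (heavy H w1 * (a x w1 * cod n a every x w1))" for k w1
    unfolding cod_def sum_distrib_left by (intro sum.cong refl) (simp add: ac_simps a_sym[of x] a_sym)
  have o: "of_bool (?p < n) * (of_bool (?r = x) * (heavy H ?p * (a x ?p * c))) = of_bool (?r = x) * (heavy H ?p * (a x ?p * c))" for c
    using a_out2[of ?p x] by (cases "?p < n") auto
  have "heavy (insert x H) ?p * heavy (insert x H) ?r * (a ?p ?r * cod n a every ?p ?r)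
     = heavy H ?p * heavy H ?r * (a ?p ?r * cod n a every ?p ?r)
     + of_bool (?p = x) * (heavy H ?r * (a x ?r * cod n a every x ?r))
     + of_bool (?r = x) * (heavy H ?p * (a x ?p * cod n a every x ?p))"
    using a_irr[of x] a_sym[of x ?p] cod_sym[of every x ?p] unfolding heavy_insert[OF assms(1)]
    by (auto simp: algebra_simps)
  moreover have "(\<Sum>w1<n. \<Sum>w2<n. of_bool (q = x * n + w1) * (heavy H w1 * a x w1 * a x w2 * a w1 w2))
      = of_bool (?p = x) * (heavy H ?r * (a x ?r * cod n a every x ?r))"
    using c[of "\<lambda>w. of_bool (q = x * n + w)"] sum_row[OF n, of q x "\<lambda>w. heavy H w * (a x w * cod n a every x w)"] by (simp only:)
  moreover have "(\<Sum>w1<n. \<Sum>w2<n. of_bool (q = w1 * n + x) * (heavy H w1 * a x w1 * a x w2 * a w1 w2))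
      = of_bool (?r = x) * (heavy H ?p * (a x ?p * cod n a every x ?p))"
    using c[of "\<lambda>w. of_bool (q = w * n + x)"] sum_col[OF assms(2), of q "\<lambda>w. heavy H w * (a x w * cod n a every x w)"] o by (simp only:)
  ultimately show ?thesis unfolding tA_def by (simp only: add.assoc)
qed

lemma tG_insert:
  assumes "x \<notin> H" "x < n"
  shows "tG n a s H q = tG n a s (insert x H) q + (\<Sum>w<n. of_bool (q = w) * (s x * a x w * dg n a x))"
proof -
  have o: "of_bool (q < n) * (s x * a x q * c) = s x * a x q * c" for c
    using a_out2[of q x] by (cases "q < n") auto
  have "tG n a s H q = (\<Sum>b<n. lw (insert x H) s b * a b q * dg n a b + of_bool (b = x) * (s b * a b q * dg n a b))"
    unfolding tG_def nbdeg_def lw_insert[OF assms(1)] by (simp add: algebra_simps)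
  then show ?thesis unfolding sum_point o sum.distrib sum_point' tG_def nbdeg_def using assms by simp
qed

end

text \<open>Most tables come in two versions: with all middle vertices admitted, or with neighbours of the source only.\<close>

definition wt :: "bool \<Rightarrow> (nat \<Rightarrow> nat) \<Rightarrow> nat \<Rightarrow> nat" where
  "wt m s = (if m then s else every)"
definition selX :: "bool \<Rightarrow> exp \<Rightarrow> exp" where
  "selX m e = (if m then selE e else Num 1)"

definition jK :: "bool \<Rightarrow> nat" where "jK m = (if m then 33 else 32)"
definition jP :: "bool \<Rightarrow> nat" where "jP m = (if m then 36 else 35)"
definition jF :: "bool \<Rightarrow> nat" where "jF m = (if m then 38 else 37)"
definition jY :: "bool \<Rightarrow> nat" where "jY m = (if m then 45 else 44)"
definition jQ :: "bool \<Rightarrow> nat" where "jQ m = (if m then 47 else 46)"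
definition jc :: "bool \<Rightarrow> nat" where "jc m = (if m then 21 else 20)"
definition jw :: "bool \<Rightarrow> nat" where "jw m = (if m then 25 else 24)"
definition jt :: "bool \<Rightarrow> nat" where "jt m = (if m then 27 else 26)"

lemmas jdefs = jK_def jP_def jF_def jY_def jQ_def jc_def jw_def jt_def

lemma ev_selX [simp]: "ev I T (selX m e) = wt m (self I (T 4 0)) (ev I T e)"
  by (simp add: selX_def wt_def)

lemma indep_selX [simp]: "indep I R e \<Longrightarrow> 4 \<notin> R \<Longrightarrow> indep I R (selX m e)"
  by (simp add: selX_def)

lemma wt_le: "(\<And>u. s u \<le> 1) \<Longrightarrow> wt m s u \<le> 1"
  by (simp add: wt_def)

definition two_thirds_tables where
  "two_thirds_tables n a s H T \<longleftrightarrow> (\<forall>m. T (jK m) = tK n a (wt m s) H \<and> T (jP m) = tP n a s (wt m s) H \<and>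
      T (jF m) = tF n a (wt m s) H \<and> T (jY m) = scalar (gY n a (wt m s) s) \<and>
      T (jQ m) = scalar (gQ n a (wt m s) s)) \<and>
     T 34 = tC n a s H \<and> T 39 = tA n a H \<and> T 40 = tG n a s H \<and> T 41 = scalar (gT n a s) \<and>
     T 42 = scalar (gD n a s) \<and> T 43 = scalar (gB n a s s)"

section \<open>Programs for a toggled edge\<close>

definition gcod :: "bool \<Rightarrow> nat \<Rightarrow> nat \<Rightarrow> nat \<Rightarrow> com" where
  "gcod m j k l = gather j (Seq (upd (Num 1) j (Num 0) (ld (jK m) (idxE (var k) (var l))))
     (loop_heavy (upd (Num 1) j (Num 0) (Mul (Mul (selX m (var 15)) (adjE (var 15) (var k))) (adjE (var 15) (var l))))))"

locale machine2 = machine1 +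
  assumes S2: "64 * (in_n I * in_n I) \<le> S"
begin

lemma addr2: "p < n \<Longrightarrow> r < n \<Longrightarrow> (p * n + r) * 64 + 64 \<le> S"
proof -
  assume "p < n" "r < n"
  then have "p * n + r + 1 \<le> (p + 1) * n" by simp
  also have "\<dots> \<le> n * n" using \<open>p < n\<close> by (intro mult_le_mono1) simp
  finally have "64 * (p * n + r + 1) \<le> 64 * (n * n)" by (rule mult_le_mono2)
  moreover have "64 * (p * n + r + 1) = (p * n + r) * 64 + 64" by simp
  ultimately show ?thesis using S2 by linarith
qed

lemma addr2': "p < n \<Longrightarrow> r < n \<Longrightarrow> j < 64 \<Longrightarrow> (p * n + r) * 64 + j < S"
  using addr2[of p r] by linarith

lemma addr2'': "p < n \<Longrightarrow> r < n \<Longrightarrow> j < 64 \<Longrightarrow> p * n * 64 + r * 64 + j < S"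
  "p < n \<Longrightarrow> r < n \<Longrightarrow> p * n * 64 + r * 64 + 64 \<le> S"
  using addr2'[of p r j] addr2[of p r] by (simp_all add: algebra_simps)

lemma adds_when:
  assumes "indep I (insert j R) x" "ev I T x = v" "v \<le> 1" "N \<ge> 1" "v \<noteq> 0 \<Longrightarrow> adds' b c T R j N e"
  shows "adds' b (Cond x c Skip) T R j N (\<lambda>q. v * e q)"
proof -
  have "adds' b (Cond x c Skip) T R j N (if ev I T x \<noteq> 0 then e else (\<lambda>_. 0))"
    by (rule adds_cond) (use assms adds_Skip in auto)
  then show ?thesis by (rule adds_mono) (use assms in \<open>auto simp: le_Suc_eq\<close>)
qed

lemma steps_gcod:
  assumes v: "vars_ok T" "heavy_list H T" "H \<subseteq> {..<n}" and kl: "k = 2 \<or> k = 3" "l = 2 \<or> l = 3"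
    and u: "T k 0 = u" "T l 0 = w" "u < n" "w < n"
    and j: "20 \<le> j" "j < 32" and a: "adjf I (T 2 0) (T 3 0) = a" "self I (T 4 0) = s"
    and K: "T (jK m) (u * n + w) = tK n a (wt m s) H (u * n + w)"
    and N: "N \<ge> 1 + card H"
  shows "steps' (gcod m j k l) T N (T(j := scalar (cod n a (wt m s) u w)))"
proof -
  interpret wgraph n a unfolding a[symmetric] by (rule wgraph_adjf)
  have k': "k < 64" "k \<notin> scratch" "k \<noteq> j" "\<And>f g. (T(14 := g, 15 := f)) k 0 = u"
    "l < 64" "l \<notin> scratch" "l \<noteq> j" "\<And>f g. (T(14 := g, 15 := f)) l 0 = w" using u kl j by (auto simp: scratch_def)
  have j': "j \<notin> scratch" "j < 64" "j \<noteq> 8" "j \<noteq> 9" "j \<noteq> 2" "j \<noteq> 3" "j \<noteq> 4" "j \<noteq> 10" "j \<noteq> 14" "j \<noteq> 15" "j \<noteq> 16" "j \<noteq> 17"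
    using j by (auto simp: scratch_def)
  have s_le: "s z \<le> 1" for z unfolding a[symmetric] by (rule self_le)
  have jm: "jK m < 64" "jK m \<noteq> j" "jK m \<notin> scratch" using j by (auto simp: jdefs scratch_def)
  show ?thesis
    unfolding gcod_def
  proof (rule steps_gather)
    show "adds' True (Seq (upd (Num 1) j (Num 0) (ld (jK m) (idxE (var k) (var l))))
     (loop_heavy (upd (Num 1) j (Num 0) (Mul (Mul (selX m (var 15)) (adjE (var 15) (var k))) (adjE (var 15) (var l))))))
     T scratch j N (\<lambda>q. of_bool (q = ev I T (Num 0)) * ev I T (ld (jK m) (idxE (var k) (var l)))
       + (\<Sum>z<n. of_bool (z \<in> H) * (of_bool (q = 0) * (wt m s z * a z u * a z w))))"
      by (intro adds_seq adds_upd_of_bool scatter_heavy)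
        (use j' k' jm u v N S64 a in \<open>auto simp: scratch_def\<close>)
    fix q :: nat
    have "tK n a (wt m s) H (u * n + w) = cod n a (lw H (wt m s)) u w"
      using u by (simp add: tK_def)
    moreover have "(\<Sum>z<n. of_bool (z \<in> H) * (of_bool (q = 0) * (wt m s z * a z u * a z w)))
        = of_bool (q = 0) * (\<Sum>z<n. of_bool (z \<in> H) * (wt m s z * a z u * a z w))"
      by (simp only: sum_distrib_left mult.left_commute)
    ultimately show "of_bool (q = ev I T (Num 0)) * ev I T (ld (jK m) (idxE (var k) (var l)))
       + (\<Sum>z<n. of_bool (z \<in> H) * (of_bool (q = 0) * (wt m s z * a z u * a z w)))
       = scalar (cod n a (wt m s) u w) q"
      using K u jm k' cod_split[of H "wt m s" u w, symmetric] by (simp add: scalar_def)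
  qed (use v j S64 N W_bound(3)[OF cod_le] wt_le s_le in auto)
qed

end

definition eK where "eK m k l = Cond (Mul (lightE (var k)) (selX m (var k)))
   (Seq (loop_nbs 14 15 (var k) (upd (var 1) (jK m) (idxE (var l) (var 15)) (adjE (var k) (var 15))))
   (Seq (loop_nbs 14 15 (var k) (upd (var 1) (jK m) (idxE (var 15) (var l)) (adjE (var k) (var 15))))
     (upd (var 1) (jK m) (idxE (var l) (var l)) (Num 1)))) Skip"

definition eP where "eP m k l c = Cond (Mul (lightE (var k)) (selX m (var k)))
   (Seq (loop_nbs 14 15 (var k) (upd (var 1) (jP m) (var 15) (Mul (Mul (heavyE (var 15)) (adjE (var k) (var 15))) (selE (var l)))))
     (upd (var 1) (jP m) (var l) (Mul (heavyE (var l)) (Add (var c) (selE (var l)))))) Skip"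

definition eF where "eF m = Seq (loop_heavy (upd (var 1) (jF m) (var 15)
     (Mul (Mul (adjE (var 2) (var 15)) (adjE (var 3) (var 15))) (Add (selX m (var 2)) (selX m (var 3))))))
   (Seq (upd (var 1) (jF m) (var 2) (Mul (heavyE (var 2)) (Add (Mul (selX m (var 3)) (var 20)) (var (jc m)))))
     (upd (var 1) (jF m) (var 3) (Mul (heavyE (var 3)) (Add (Mul (selX m (var 2)) (var 20)) (var (jc m))))))"

definition eA1 where "eA1 k = loop_heavy (upd (var 1) 39 (idxE (var k) (var 15))
    (Mul (Mul (heavyE (var k)) (adjE (var 2) (var 15))) (adjE (var 3) (var 15))))"
definition eA2 where "eA2 k = loop_heavy (upd (var 1) 39 (idxE (var 15) (var k))
    (Mul (Mul (heavyE (var k)) (adjE (var 2) (var 15))) (adjE (var 3) (var 15))))"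
definition eA where "eA = Seq (eA1 2) (Seq (eA2 2) (Seq (eA1 3) (Seq (eA2 3)
   (Seq (upd (var 1) 39 (idxE (var 2) (var 3)) (Mul (Mul (heavyE (var 2)) (heavyE (var 3))) (var 20)))
     (upd (var 1) 39 (idxE (var 3) (var 2)) (Mul (Mul (heavyE (var 2)) (heavyE (var 3))) (var 20)))))))"

definition eG where "eG k l d = Cond (Mul (lightE (var k)) (selE (var k)))
   (Seq (loop_nbs 14 15 (var k) (upd (var 1) 40 (var 15) (adjE (var k) (var 15))))
     (upd (var 1) 40 (var l) (Add (var d) (Num 1)))) Skip"

definition e43 where "e43 = upd (var 1) 43 (Num 0)
    (Add (Mul (selE (var 2)) (Add (var 22) (Mul (selE (var 3)) (Add (var 5) (Num 1)))))
         (Mul (selE (var 3)) (Add (var 23) (Mul (selE (var 2)) (Add (var 6) (Num 1))))))"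
definition eY where "eY m = upd (var 1) (jY m) (Num 0)
    (Add (Mul (var 21) (Add (selX m (var 2)) (selX m (var 3))))
    (Add (Mul (selE (var 2)) (Add (Mul (selX m (var 3)) (var 20)) (var (jc m))))
         (Mul (selE (var 3)) (Add (Mul (selX m (var 2)) (var 20)) (var (jc m))))))"
definition eQ where "eQ m = upd (var 1) (jQ m) (Num 0)
    (Add (Mul (selX m (var 2)) (Add (Mul (Mul (Num 2) (var 22)) (selE (var 3))) (Mul (selE (var 3)) (selE (var 3)))))
         (Mul (selX m (var 3)) (Add (Mul (Mul (Num 2) (var 23)) (selE (var 2))) (Mul (selE (var 2)) (selE (var 2))))))"

locale edge_ctx2 = edge_ctx S W I b x y H a s + machine2 S W I for S W I b x y H a s
begin

lemma lw_01: "light H u * wt m s u \<le> 1" "light H u * s u \<le> 1"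
  by (intro mult_le_one wt_le s_le; simp)+

lemma adds_eK:
  assumes e: "env' T" and k: "k = 2 \<and> l = 3 \<and> u = x \<and> v = y \<or> k = 3 \<and> l = 2 \<and> u = y \<and> v = x"
    and N: "N \<ge> 1" "u \<notin> H \<Longrightarrow> N \<ge> 1 + length (nbs u)"
  shows "adds' b (eK m k l) T scratch (jK m) N
    (\<lambda>q. lw H (wt m s) u * ((\<Sum>w<n. of_bool (q = v * n + w) * a u w) + ((\<Sum>w<n. of_bool (q = w * n + v) * a u w)
       + of_bool (q = v * n + v))))"
proof -
  have k': "k < 64" "k \<notin> scratch" "k \<noteq> jK m" "T k 0 = u" "\<And>f g. (T(14 := g, 15 := f)) k 0 = u" "u < n"
    "l < 64" "l \<notin> scratch" "l \<noteq> jK m" "T l 0 = v" "\<And>f g. (T(14 := g, 15 := f)) l 0 = v" "v < n"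
    using k xyn envD[OF e] by (auto simp: scratch_def jdefs)
  have j: "jK m < 64" "jK m \<notin> scratch" "jK m \<noteq> 1" "jK m \<noteq> Suc 0" "jK m \<noteq> 2" "jK m \<noteq> 3" "jK m \<noteq> 4" "jK m \<noteq> 10"
    "jK m \<noteq> 14" "jK m \<noteq> 15" "jK m \<noteq> 16" "jK m \<noteq> 17"
    by (auto simp: jdefs scratch_def)
  have p: "adds' b (upd (var 1) (jK m) (idxE (var l) (var l)) (Num 1)) T scratch (jK m) N (\<lambda>q. of_bool (q = v * n + v))"
    by (rule adds_mono[OF adds_upd_of_bool order_refl])
      (use j k' N in \<open>auto simp: scratch_def addr2' addr2'' envD[OF e]\<close>)
  show ?thesis
    unfolding eK_def lw_def
  proof (rule adds_when)
    assume "light H u * wt m s u \<noteq> 0"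
    then have uH: "u \<notin> H" by (auto simp: light_def)
    note N' = N(2)[OF uH]
    show "adds' b (Seq (loop_nbs 14 15 (var k) (upd (var 1) (jK m) (idxE (var l) (var 15)) (adjE (var k) (var 15))))
     (Seq (loop_nbs 14 15 (var k) (upd (var 1) (jK m) (idxE (var 15) (var l)) (adjE (var k) (var 15))))
     (upd (var 1) (jK m) (idxE (var l) (var l)) (Num 1)))) T scratch (jK m) N
     (\<lambda>q. (\<Sum>w<n. of_bool (q = v * n + w) * a u w) + ((\<Sum>w<n. of_bool (q = w * n + v) * a u w)
       + of_bool (q = v * n + v)))"
      by (intro adds_seq p scatter_nbs[where u = u])
        (use j k' N' addr2 a_nbs in \<open>auto simp: scratch_def envD[OF e]\<close>)
  qed (use j k' N lw_01 in \<open>auto simp: scratch_def envD[OF e] light_eq\<close>)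
qed

lemma steps_eK:
  assumes e: "env' T" and t: "T (jK m) = pick b (tK n a (wt m s) H) (tK n a' (wt m s) H)"
    and N: "N \<ge> 1" "x \<notin> H \<Longrightarrow> N \<ge> 1 + length (nbs x)" "y \<notin> H \<Longrightarrow> N \<ge> 1 + length (nbs y)"
  shows "steps' (Seq (eK m 2 3) (eK m 3 2)) T N (T(jK m := pick b (tK n a' (wt m s) H) (tK n a (wt m s) H)))"
proof (rule steps_toggle)
  show "adds' b (Seq (eK m 2 3) (eK m 3 2)) T scratch (jK m) N
    (\<lambda>q. lw H (wt m s) x * ((\<Sum>w<n. of_bool (q = y * n + w) * a x w) + ((\<Sum>w<n. of_bool (q = w * n + y) * a x w)
       + of_bool (q = y * n + y)))
     + lw H (wt m s) y * ((\<Sum>w<n. of_bool (q = x * n + w) * a y w) + ((\<Sum>w<n. of_bool (q = w * n + x) * a y w)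
       + of_bool (q = x * n + x))))"
    by (intro adds_seq adds_eK[OF e]) (use N in auto)
  show "tK n a' (wt m s) H q < W" for q
    by (intro W_bound(3) wgraph.tK_le[OF wgraph'] wt_le s_le)
  show "jK m \<notin> scratch" "jK m < 64" by (auto simp: jdefs scratch_def)
qed (rule t, rule tK')

lemma adds_eP:
  assumes e: "env' T" and k: "k = 2 \<and> l = 3 \<and> u = x \<and> v = y \<or> k = 3 \<and> l = 2 \<and> u = y \<and> v = x"
    and c: "T c 0 = cn n a s u" "20 \<le> c" "c < 32"
    and N: "N \<ge> 1" "u \<notin> H \<Longrightarrow> N \<ge> 1 + length (nbs u)"
  shows "adds' b (eP m k l c) T scratch (jP m) N
    (\<lambda>q. lw H (wt m s) u * ((\<Sum>w<n. of_bool (q = w) * (heavy H w * a u w * s v)) + of_bool (q = v) * (heavy H v * (cn n a s u + s v))))"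
proof -
  have k': "k < 64" "k \<notin> scratch" "k \<noteq> jP m" "T k 0 = u" "\<And>f g. (T(14 := g, 15 := f)) k 0 = u" "u < n"
    "l < 64" "l \<notin> scratch" "l \<noteq> jP m" "T l 0 = v" "\<And>f g. (T(14 := g, 15 := f)) l 0 = v" "v < n"
    using k xyn envD[OF e] by (auto simp: scratch_def jdefs)
  have j: "jP m < 64" "jP m \<notin> scratch" "jP m \<noteq> 1" "jP m \<noteq> Suc 0" "jP m \<noteq> 2" "jP m \<noteq> 3" "jP m \<noteq> 4" "jP m \<noteq> 10"
    "jP m \<noteq> 14" "jP m \<noteq> 15" "jP m \<noteq> 16" "jP m \<noteq> 17" "jP m \<noteq> c" "c < 64" "c \<notin> scratch"
    using c by (auto simp: jdefs scratch_def)
  have p: "adds' b (upd (var 1) (jP m) (var l) (Mul (heavyE (var l)) (Add (var c) (selE (var l))))) T scratch (jP m) N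
     (\<lambda>q. of_bool (q = v) * (heavy H v * (cn n a s u + s v)))"
    by (rule adds_mono[OF adds_upd_of_bool order_refl])
      (use j k' N c in \<open>auto simp: scratch_def addr1' envD[OF e]\<close>)
  show ?thesis
    unfolding eP_def lw_def
  proof (rule adds_when)
    assume "light H u * wt m s u \<noteq> 0"
    then have uH: "u \<notin> H" by (auto simp: light_def)
    note N' = N(2)[OF uH]
    show "adds' b (Seq (loop_nbs 14 15 (var k) (upd (var 1) (jP m) (var 15) (Mul (Mul (heavyE (var 15)) (adjE (var k) (var 15))) (selE (var l)))))
     (upd (var 1) (jP m) (var l) (Mul (heavyE (var l)) (Add (var c) (selE (var l)))))) T scratch (jP m) N
     (\<lambda>q. (\<Sum>w<n. of_bool (q = w) * (heavy H w * a u w * s v)) + of_bool (q = v) * (heavy H v * (cn n a s u + s v)))"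
      by (intro adds_seq p scatter_nbs[where u = u])
        (use j k' N' addr1 a_nbs in \<open>auto simp: scratch_def envD[OF e]\<close>)
  qed (use j k' N lw_01 in \<open>auto simp: scratch_def envD[OF e] light_eq\<close>)
qed

lemma steps_eP:
  assumes e: "env' T" and t: "T (jP m) = pick b (tP n a s (wt m s) H) (tP n a' s (wt m s) H)"
    and c: "T 22 0 = cn n a s x" "T 23 0 = cn n a s y"
    and N: "N \<ge> 1" "x \<notin> H \<Longrightarrow> N \<ge> 1 + length (nbs x)" "y \<notin> H \<Longrightarrow> N \<ge> 1 + length (nbs y)"
  shows "steps' (Seq (eP m 2 3 22) (eP m 3 2 23)) T N (T(jP m := pick b (tP n a' s (wt m s) H) (tP n a s (wt m s) H)))"
proof (rule steps_toggle)
  show "adds' b (Seq (eP m 2 3 22) (eP m 3 2 23)) T scratch (jP m) N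
    (\<lambda>q. lw H (wt m s) x * ((\<Sum>w<n. of_bool (q = w) * (heavy H w * a x w * s y)) + of_bool (q = y) * (heavy H y * (cn n a s x + s y)))
     + lw H (wt m s) y * ((\<Sum>w<n. of_bool (q = w) * (heavy H w * a y w * s x)) + of_bool (q = x) * (heavy H x * (cn n a s y + s x))))"
    by (intro adds_seq adds_eP[OF e]) (use N c in auto)
  show "tP n a' s (wt m s) H q < W" for q
    by (intro W_bound(2) wgraph.tP_le[OF wgraph'] wt_le s_le)
  show "jP m \<notin> scratch" "jP m < 64" by (auto simp: jdefs scratch_def)
qed (rule t, rule tP')

lemma steps_eF:
  assumes e: "env' T" and t: "T (jF m) = pick b (tF n a (wt m s) H) (tF n a' (wt m s) H)"
    and c: "T 20 0 = cod n a every x y" "T (jc m) 0 = cod n a (wt m s) x y"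
    and N: "N \<ge> 1 + card H"
  shows "steps' (eF m) T N (T(jF m := pick b (tF n a' (wt m s) H) (tF n a (wt m s) H)))"
proof (rule steps_toggle)
  have j: "jF m < 64" "jF m \<notin> scratch" "jF m \<noteq> 1" "jF m \<noteq> Suc 0" "jF m \<noteq> 2" "jF m \<noteq> 3" "jF m \<noteq> 4" "jF m \<noteq> 10"
    "jF m \<noteq> 14" "jF m \<noteq> 15" "jF m \<noteq> 16" "jF m \<noteq> 17" "jF m \<noteq> 20" "jF m \<noteq> 8" "jF m \<noteq> 9" "jc m \<noteq> jF m" "jc m < 64" "jc m \<notin> scratch"
    by (auto simp: jdefs scratch_def)
  have p: "adds' b (upd (var 1) (jF m) (var k) (Mul (heavyE (var k)) (Add (Mul (selX m (var l)) (var 20)) (var (jc m))))) T scratch (jF m) N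
     (\<lambda>q. of_bool (q = u) * (heavy H u * (wt m s v * cod n a every x y + cod n a (wt m s) x y)))"
    if "k = 2 \<and> l = 3 \<and> u = x \<and> v = y \<or> k = 3 \<and> l = 2 \<and> u = y \<and> v = x" for k l u v
  proof -
    have k': "k < 64" "k \<notin> scratch" "k \<noteq> jF m" "T k 0 = u" "u < n"
      "l < 64" "l \<notin> scratch" "l \<noteq> jF m" "T l 0 = v"
      using that xyn envD[OF e] by (auto simp: scratch_def jdefs)
    show ?thesis
      by (rule adds_mono[OF adds_upd_of_bool order_refl])
        (use k' j c N in \<open>auto simp: scratch_def addr1' envD[OF e]\<close>)
  qed
  show "adds' b (eF m) T scratch (jF m) N
    (\<lambda>q. (\<Sum>w<n. of_bool (w \<in> H) * (of_bool (q = w) * (a x w * a y w * (wt m s x + wt m s y))))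
   + (of_bool (q = x) * (heavy H x * (wt m s y * cod n a every x y + cod n a (wt m s) x y))
   + of_bool (q = y) * (heavy H y * (wt m s x * cod n a every x y + cod n a (wt m s) x y))))"
    unfolding eF_def
    by (intro adds_seq p scatter_heavy)
      (use j N Hn addr1 in \<open>auto simp: scratch_def envD[OF e]\<close>)
  show "tF n a' (wt m s) H q < W" for q
    by (intro W_bound(2) wgraph.tF_le[OF wgraph'] wt_le s_le)
  show "jF m \<notin> scratch" "jF m < 64" by (auto simp: jdefs scratch_def)
qed (rule t, rule tF')

lemma steps_eA:
  assumes e: "env' T" and t: "T 39 = pick b (tA n a H) (tA n a' H)"
    and c: "T 20 0 = cod n a every x y" and N: "N \<ge> 1 + card H"
  shows "steps' eA T N (T(39 := pick b (tA n a' H) (tA n a H)))"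
proof (rule steps_toggle)
  have p: "adds' b (upd (var 1) 39 (idxE (var k) (var l)) (Mul (Mul (heavyE (var 2)) (heavyE (var 3))) (var 20))) T scratch 39 N
     (\<lambda>q. of_bool (q = u * n + v) * (heavy H x * heavy H y * cod n a every x y))"
    if "k = 2 \<and> l = 3 \<and> u = x \<and> v = y \<or> k = 3 \<and> l = 2 \<and> u = y \<and> v = x" for k l u v
    by (rule adds_mono[OF adds_upd_of_bool order_refl])
      (use that c N xyn envD[OF e] in \<open>auto simp: scratch_def addr2' addr2''\<close>)
  have l1: "adds' b (eA1 k) T scratch 39 N
     (\<lambda>q. \<Sum>w<n. of_bool (w \<in> H) * (of_bool (q = u * n + w) * (heavy H u * a x w * a y w)))"
    if "k = 2 \<and> u = x \<or> k = 3 \<and> u = y" for k u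
    unfolding eA1_def
    by (rule scatter_heavy)
      (use that xyn N Hn addr2 envD[OF e] in \<open>auto simp: scratch_def\<close>)
  have l2: "adds' b (eA2 k) T scratch 39 N
     (\<lambda>q. \<Sum>w<n. of_bool (w \<in> H) * (of_bool (q = w * n + u) * (heavy H u * a x w * a y w)))"
    if "k = 2 \<and> u = x \<or> k = 3 \<and> u = y" for k u
    unfolding eA2_def
    by (rule scatter_heavy)
      (use that xyn N Hn addr2 envD[OF e] in \<open>auto simp: scratch_def\<close>)
  show "adds' b eA T scratch 39 N
    (\<lambda>q. (\<Sum>w<n. of_bool (w \<in> H) * (of_bool (q = x * n + w) * (heavy H x * a x w * a y w)))
   + ((\<Sum>w<n. of_bool (w \<in> H) * (of_bool (q = w * n + x) * (heavy H x * a x w * a y w)))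
   + ((\<Sum>w<n. of_bool (w \<in> H) * (of_bool (q = y * n + w) * (heavy H y * a x w * a y w)))
   + ((\<Sum>w<n. of_bool (w \<in> H) * (of_bool (q = w * n + y) * (heavy H y * a x w * a y w)))
   + (of_bool (q = x * n + y) * (heavy H x * heavy H y * cod n a every x y)
   + of_bool (q = y * n + x) * (heavy H x * heavy H y * cod n a every x y))))))"
    unfolding eA_def by (intro adds_seq p l1 l2) auto
  show "tA n a' H q < W" for q
    by (intro W_bound(3) wgraph.tA_le[OF wgraph'])
  show "39 \<notin> scratch" "39 < (64::nat)" by (auto simp: scratch_def)
qed (rule t, rule tA')

lemma steps_eG:
  assumes e: "env' T" and t: "T 40 = pick b (tG n a s H) (tG n a' s H)"
    and N: "N \<ge> 1" "x \<notin> H \<Longrightarrow> N \<ge> 1 + length (nbs x)" "y \<notin> H \<Longrightarrow> N \<ge> 1 + length (nbs y)"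
  shows "steps' (Seq (eG 2 3 5) (eG 3 2 6)) T N (T(40 := pick b (tG n a' s H) (tG n a s H)))"
proof (rule steps_toggle)
  have g: "adds' b (eG k l d) T scratch 40 N
     (\<lambda>q. lw H s u * ((\<Sum>w<n. of_bool (q = w) * a u w) + of_bool (q = v) * (dg n a u + 1)))"
    if k: "k = 2 \<and> l = 3 \<and> u = x \<and> v = y \<and> d = 5 \<or> k = 3 \<and> l = 2 \<and> u = y \<and> v = x \<and> d = 6" for k l u v d
  proof -
    have k': "k < 64" "k \<notin> scratch" "k \<noteq> 40" "T k 0 = u" "\<And>f g. (T(14 := g, 15 := f)) k 0 = u" "u < n"
      "l < 64" "l \<notin> scratch" "l \<noteq> 40" "T l 0 = v" "v < n" "d < 64" "d \<noteq> 40" "d \<notin> scratch" "T d 0 = dg n a u"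
      using k xyn envD[OF e] by (auto simp: scratch_def)
    have N': "u \<notin> H \<Longrightarrow> N \<ge> 1 + length (nbs u)" using N k by auto
    have p: "adds' b (upd (var 1) 40 (var l) (Add (var d) (Num 1))) T scratch 40 N
       (\<lambda>q. of_bool (q = v) * (dg n a u + 1))"
      by (rule adds_mono[OF adds_upd_of_bool order_refl])
        (use k' N in \<open>auto simp: scratch_def addr1' envD[OF e]\<close>)
    show ?thesis
      unfolding eG_def lw_def
    proof (rule adds_when)
      assume "light H u * s u \<noteq> 0"
      then have uH: "u \<notin> H" by (auto simp: light_def)
      show "adds' b (Seq (loop_nbs 14 15 (var k) (upd (var 1) 40 (var 15) (adjE (var k) (var 15))))
         (upd (var 1) 40 (var l) (Add (var d) (Num 1)))) T scratch 40 N
        (\<lambda>q. (\<Sum>w<n. of_bool (q = w) * a u w) + of_bool (q = v) * (dg n a u + 1))"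
        by (intro adds_seq p scatter_nbs[where u = u])
          (use k' N'[OF uH] addr1 a_nbs in \<open>auto simp: scratch_def envD[OF e]\<close>)
    qed (use k' N lw_01 in \<open>auto simp: scratch_def envD[OF e] light_eq\<close>)
  qed
  show "adds' b (Seq (eG 2 3 5) (eG 3 2 6)) T scratch 40 N
    (\<lambda>q. lw H s x * ((\<Sum>w<n. of_bool (q = w) * a x w) + of_bool (q = y) * (dg n a x + 1))
   + lw H s y * ((\<Sum>w<n. of_bool (q = w) * a y w) + of_bool (q = x) * (dg n a y + 1)))"
    by (intro adds_seq g) auto
  show "tG n a' s H q < W" for q
    by (intro W_bound(2) wgraph.tG_le[OF wgraph'] s_le)
  show "40 \<notin> scratch" "40 < (64::nat)" by (auto simp: scratch_def)
qed (rule t, rule tG')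

end

definition eKs where "eKs = Seq (Seq (eK False 2 3) (eK False 3 2)) (Seq (eK True 2 3) (eK True 3 2))"

text \<open>Among the persistent tables only the codegree tables 32 and 33 are read, so they alone
  are corrected first on a deletion and last on an insertion. The numbers of marked neighbours of
  the endpoints are obtained as diagonal codegrees.\<close>

definition edge3 where
  "edge3 = Seq (Cond (var 1) Skip eKs) (Seq (gcod False 20 2 3) (Seq (gcod True 21 2 3) (Seq (gcod True 22 2 2) (Seq (gcod True 23 3 3) (Seq (e34) (Seq (Seq (eP False 2 3 22) (eP False 3 2 23)) (Seq (Seq (eP True 2 3 22) (eP True 3 2 23)) (Seq (eF False) (Seq (eF True) (Seq (eA) (Seq (Seq (eG 2 3 5) (eG 3 2 6)) (Seq (e41) (Seq (e42) (Seq (e43) (Seq (eY False) (Seq (eY True) (Seq (eQ False) (Seq (eQ True) (Cond (var 1) eKs Skip)))))))))))))))))))"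

context edge_ctx2
begin

lemma steps_eKs:
  assumes "env' T" "T 32 = pick b (tK n a (wt False s) H) (tK n a' (wt False s) H)"
    "T 33 = pick b (tK n a (wt True s) H) (tK n a' (wt True s) H)"
    and N: "N \<ge> 1" "x \<notin> H \<Longrightarrow> N \<ge> 1 + length (nbs x)" "y \<notin> H \<Longrightarrow> N \<ge> 1 + length (nbs y)"
  shows "steps' eKs T N (T(32 := pick b (tK n a' (wt False s) H) (tK n a (wt False s) H),
     33 := pick b (tK n a' (wt True s) H) (tK n a (wt True s) H)))"
  unfolding eKs_def
proof (rule steps_Seq)
  show "steps' (Seq (eK False 2 3) (eK False 3 2)) T N
      (T(32 := pick b (tK n a' (wt False s) H) (tK n a (wt False s) H)))"
    using steps_eK[OF assms(1), of False N] assms by (simp add: jK_def)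
  show "steps' (Seq (eK True 2 3) (eK True 3 2)) (T(32 := pick b (tK n a' (wt False s) H) (tK n a (wt False s) H)))
     N (T(32 := pick b (tK n a' (wt False s) H) (tK n a (wt False s) H),
     33 := pick b (tK n a' (wt True s) H) (tK n a (wt True s) H)))"
    using steps_eK[of "T(32 := pick b (tK n a' (wt False s) H) (tK n a (wt False s) H))" True N] assms
    by (simp add: jK_def)
qed

lemma steps_edge3:
  assumes "env' T" "two_thirds_tables n (pick b a a') s H T"
    and N: "N \<ge> 1 + card H + light_cost 3 I H x + light_cost 3 I H y"
  shows "\<exists>T'. steps' edge3 T N T' \<and> two_thirds_tables n (pick b a' a) s H T' \<and> (\<forall>j<20. T' j = T j) \<and> vars_ok T'"
proof -
  have sq: "1 + length (nbs u) \<le> (1 + length (nbs u))\<^sup>2" for u by (simp add: power2_eq_square)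
  have N1: "N \<ge> 1" "N \<ge> 1 + card H" "x \<notin> H \<Longrightarrow> N \<ge> 1 + length (nbs x)" "y \<notin> H \<Longrightarrow> N \<ge> 1 + length (nbs y)"
    using N sq[of x] sq[of y] by (auto simp: light_cost_def)
  have G3: "T (jK m) = pick b (tK n a (wt m s) H) (tK n a' (wt m s) H)"
    "T (jP m) = pick b (tP n a s (wt m s) H) (tP n a' s (wt m s) H)"
    "T (jF m) = pick b (tF n a (wt m s) H) (tF n a' (wt m s) H)"
    "T (jY m) = scalar (pick b (gY n a (wt m s) s) (gY n a' (wt m s) s))"
    "T (jQ m) = scalar (pick b (gQ n a (wt m s) s) (gQ n a' (wt m s) s))"
    "T 34 = pick b (tC n a s H) (tC n a' s H)" "T 39 = pick b (tA n a H) (tA n a' H)"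
    "T 40 = pick b (tG n a s H) (tG n a' s H)"
    "T 41 = scalar (pick b (gT n a s) (gT n a' s))" "T 42 = scalar (pick b (gD n a s) (gD n a' s))"
    "T 43 = scalar (pick b (gB n a s s) (gB n a' s s))" for m
    using assms(2) by (cases b; simp add: two_thirds_tables_def)+
  note G = G3(6-11) G3(1)[of False, unfolded jdefs, simplified] G3(1)[of True, unfolded jdefs, simplified]
    G3(2)[of False, unfolded jdefs, simplified] G3(2)[of True, unfolded jdefs, simplified]
    G3(3)[of False, unfolded jdefs, simplified] G3(3)[of True, unfolded jdefs, simplified]
    G3(4)[of False, unfolded jdefs, simplified] G3(4)[of True, unfolded jdefs, simplified]
    G3(5)[of False, unfolded jdefs, simplified] G3(5)[of True, unfolded jdefs, simplified]
  note ag = wgraph.aggregate_le[OF wgraph', of s s, OF s_le s_le, THEN W_bound(1)]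
  have ev1: "every u \<le> 1" for u by simp
  note ae = wgraph.aggregate_le[OF wgraph', of s every, OF s_le ev1, THEN W_bound(1)]
  have steps_K0: "steps' (Cond (var 1) Skip eKs) T N (T(32 := tK n a (wt False s) H, 33 := tK n a (wt True s) H))"
  proof (rule steps_Cond_bool[where b = b])
    assume b: b
    have "T(32 := tK n a (wt False s) H, 33 := tK n a (wt True s) H) = T"
      using G b by (intro ext) (auto simp: fun_upd_def)
    then show "steps' Skip T N (T(32 := tK n a (wt False s) H, 33 := tK n a (wt True s) H))" using steps_Skip N1 by metis
  next
    assume "\<not> b"
    then show "steps' eKs T N (T(32 := tK n a (wt False s) H, 33 := tK n a (wt True s) H))"
      using steps_eKs[OF assms(1) _ _ N1(1)] N1 G by simp
  qed (use N1 envD[OF assms(1)] in auto)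
  have steps_K1: "steps' (Cond (var 1) eKs Skip) T' N (T'(32 := pick b (tK n a' (wt False s) H) (tK n a (wt False s) H),
     33 := pick b (tK n a' (wt True s) H) (tK n a (wt True s) H)))"
    if "env' T'" "T' 32 = tK n a (wt False s) H" "T' 33 = tK n a (wt True s) H" for T'
  proof (rule steps_Cond_bool[where b = b])
    assume b: "\<not> b"
    have "T'(32 := tK n a (wt False s) H, 33 := tK n a (wt True s) H) = T'"
      using that by (intro ext) (auto simp: fun_upd_def)
    then show "steps' Skip T' N (T'(32 := pick b (tK n a' (wt False s) H) (tK n a (wt False s) H),
     33 := pick b (tK n a' (wt True s) H) (tK n a (wt True s) H)))" using steps_Skip N1 b by simp
  next
    assume b
    then show "steps' eKs T' N (T'(32 := pick b (tK n a' (wt False s) H) (tK n a (wt False s) H),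
     33 := pick b (tK n a' (wt True s) H) (tK n a (wt True s) H)))"
      using steps_eKs[OF that(1) _ _ N1(1)] N1 that by simp
  qed (use N1 envD[OF that(1)] in auto)
  define T1 where "T1 = T(32 := tK n a (wt False s) H, 33 := tK n a (wt True s) H)"
  define T2 where "T2 = T1(20 := scalar (cod n a every x y))"
  define T3 where "T3 = T2(21 := scalar (cod n a s x y))"
  define T4 where "T4 = T3(22 := scalar (cn n a s x))"
  define T5 where "T5 = T4(23 := scalar (cn n a s y))"
  define T6 where "T6 = T5(34 := pick b (tC n a' s H) (tC n a s H))"
  define T7 where "T7 = T6(35 := pick b (tP n a' s (wt False s) H) (tP n a s (wt False s) H))"
  define T8 where "T8 = T7(36 := pick b (tP n a' s (wt True s) H) (tP n a s (wt True s) H))"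
  define T9 where "T9 = T8(37 := pick b (tF n a' (wt False s) H) (tF n a (wt False s) H))"
  define T10 where "T10 = T9(38 := pick b (tF n a' (wt True s) H) (tF n a (wt True s) H))"
  define T11 where "T11 = T10(39 := pick b (tA n a' H) (tA n a H))"
  define T12 where "T12 = T11(40 := pick b (tG n a' s H) (tG n a s H))"
  define T13 where "T13 = T12(41 := scalar (pick b (gT n a' s) (gT n a s)))"
  define T14 where "T14 = T13(42 := scalar (pick b (gD n a' s) (gD n a s)))"
  define T15 where "T15 = T14(43 := scalar (pick b (gB n a' s s) (gB n a s s)))"
  define T16 where "T16 = T15(44 := scalar (pick b (gY n a' every s) (gY n a every s)))"
  define T17 where "T17 = T16(45 := scalar (pick b (gY n a' s s) (gY n a s s)))"
  define T18 where "T18 = T17(46 := scalar (pick b (gQ n a' every s) (gQ n a every s)))"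
  define T19 where "T19 = T18(47 := scalar (pick b (gQ n a' s s) (gQ n a s s)))"
  define T20 where "T20 = T19(32 := pick b (tK n a' (wt False s) H) (tK n a (wt False s) H), 33 := pick b (tK n a' (wt True s) H) (tK n a (wt True s) H))"
  note df = T1_def T2_def T3_def T4_def T5_def T6_def T7_def T8_def T9_def T10_def T11_def T12_def T13_def T14_def T15_def T16_def T17_def T18_def T19_def T20_def
  have e: "env' T1" "env' T2" "env' T3" "env' T4" "env' T5" "env' T6" "env' T7" "env' T8" "env' T9" "env' T10" "env' T11" "env' T12" "env' T13" "env' T14" "env' T15" "env' T16" "env' T17" "env' T18" "env' T19" "env' T20"
    using assms(1) by (simp_all add: df)
  have "steps' (Cond (var 1) Skip eKs) T N T1"
    using steps_K0 unfolding T1_def .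
  moreover have "steps' (gcod False 20 2 3) T1 N T2"
    using steps_gcod[of T1 H 2 3 x y 20 a s False N] N1 xyn Hn unfolding T2_def
      by (simp add: envD[OF e(1)] wt_def jK_def) (simp add: df wt_def)
  moreover have "steps' (gcod True 21 2 3) T2 N T3"
    using steps_gcod[of T2 H 2 3 x y 21 a s True N] N1 xyn Hn unfolding T3_def
      by (simp add: envD[OF e(2)] wt_def jK_def) (simp add: df wt_def)
  moreover have "steps' (gcod True 22 2 2) T3 N T4"
    using steps_gcod[of T3 H 2 2 x x 22 a s True N] N1 xyn Hn unfolding T4_def
      by (simp add: envD[OF e(3)] wt_def jK_def cod_diag) (simp add: df wt_def)
  moreover have "steps' (gcod True 23 3 3) T4 N T5"
    using steps_gcod[of T4 H 3 3 y y 23 a s True N] N1 xyn Hn unfolding T5_def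
      by (simp add: envD[OF e(4)] wt_def jK_def cod_diag) (simp add: df wt_def)
  moreover have "steps' (e34) T5 N T6"
    unfolding T6_def by (rule steps_e34) (use e N1 in \<open>simp_all add: df G wt_def jc_def\<close>)
  moreover have "steps' (Seq (eP False 2 3 22) (eP False 3 2 23)) T6 N T7"
    unfolding T7_def by (rule steps_eP[where m = False, unfolded jP_def, simplified]) (use e N1 in \<open>simp_all add: df G wt_def jc_def\<close>)
  moreover have "steps' (Seq (eP True 2 3 22) (eP True 3 2 23)) T7 N T8"
    unfolding T8_def by (rule steps_eP[where m = True, unfolded jP_def, simplified]) (use e N1 in \<open>simp_all add: df G wt_def jc_def\<close>)
  moreover have "steps' (eF False) T8 N T9"
    unfolding T9_def by (rule steps_eF[where m = False, unfolded jF_def, simplified]) (use e N1 in \<open>simp_all add: df G wt_def jc_def\<close>)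
  moreover have "steps' (eF True) T9 N T10"
    unfolding T10_def by (rule steps_eF[where m = True, unfolded jF_def, simplified]) (use e N1 in \<open>simp_all add: df G wt_def jc_def\<close>)
  moreover have "steps' (eA) T10 N T11"
    unfolding T11_def by (rule steps_eA) (use e N1 in \<open>simp_all add: df G wt_def jc_def\<close>)
  moreover have "steps' (Seq (eG 2 3 5) (eG 3 2 6)) T11 N T12"
    unfolding T12_def by (rule steps_eG) (use e N1 in \<open>simp_all add: df G wt_def jc_def\<close>)
  moreover have "steps' (e41) T12 N T13"
    unfolding T13_def e41_def jdefs if_True if_False
    by (rule steps_scalar[OF _ _ _ _ _ _ _ ag(1)]) (use N1 in \<open>auto simp: df G envD[OF assms(1)] gT' scratch_def wt_def\<close>)
  moreover have "steps' (e42) T13 N T14"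
    unfolding T14_def e42_def jdefs if_True if_False
    by (rule steps_scalar[OF _ _ _ _ _ _ _ ag(2)]) (use N1 in \<open>auto simp: df G envD[OF assms(1)] gD' scratch_def wt_def\<close>)
  moreover have "steps' (e43) T14 N T15"
    unfolding T15_def e43_def jdefs if_True if_False
    by (rule steps_scalar[OF _ _ _ _ _ _ _ ag(3)]) (use N1 in \<open>auto simp: df G envD[OF assms(1)] gB' scratch_def wt_def\<close>)
  moreover have "steps' (eY False) T15 N T16"
    unfolding T16_def eY_def jdefs if_True if_False
    by (rule steps_scalar[OF _ _ _ _ _ _ _ ae(4)]) (use N1 in \<open>auto simp: df G envD[OF assms(1)] gY' scratch_def wt_def\<close>)
  moreover have "steps' (eY True) T16 N T17"
    unfolding T17_def eY_def jdefs if_True if_False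
    by (rule steps_scalar[OF _ _ _ _ _ _ _ ag(4)]) (use N1 in \<open>auto simp: df G envD[OF assms(1)] gY' scratch_def wt_def\<close>)
  moreover have "steps' (eQ False) T17 N T18"
    unfolding T18_def eQ_def jdefs if_True if_False
    by (rule steps_scalar[OF _ _ _ _ _ _ _ ae(5)]) (use N1 in \<open>auto simp: df G envD[OF assms(1)] gQ' scratch_def wt_def\<close>)
  moreover have "steps' (eQ True) T18 N T19"
    unfolding T19_def eQ_def jdefs if_True if_False
    by (rule steps_scalar[OF _ _ _ _ _ _ _ ag(5)]) (use N1 in \<open>auto simp: df G envD[OF assms(1)] gQ' scratch_def wt_def\<close>)
  moreover have "steps' (Cond (var 1) eKs Skip) T19 N T20"
    unfolding T20_def by (rule steps_K1) (use e in \<open>simp_all add: df\<close>)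
  ultimately have "steps' edge3 T N T20"
    unfolding edge3_def by - ((assumption | rule steps_Seq)+)
  moreover have "two_thirds_tables n (pick b a' a) s H T20"
    by (cases b) (auto simp: df two_thirds_tables_def jdefs wt_def)
  moreover have "\<forall>j<20. T20 j = T j" by (auto simp: df)
  ultimately show ?thesis using envD(9)[OF e(20)] by blast
qed

end

lemma edge3_ok: "edge_ok (light_cost 3) machine2 two_thirds_tables edge3"
  by (rule edge_okI[OF machine1.axioms(1)[OF machine2.axioms(1)]], assumption) (rule edge_ctx2.steps_edge3; (assumption | rule edge_ctx2.intro edge_ctx.intro machine2.axioms(1))+)

section \<open>Programs for a toggled mark\<close>

definition glight where "glight m j =
   Seq (loop_nbs 14 15 (var 2) (upd (Num 1) j (Num 0)
       (Mul (Mul (Mul (lightE (var 15)) (selX m (var 15))) (adjE (var 2) (var 15))) (ld 33 (idxE (var 15) (var 15))))))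
     (loop_heavy (upd (Num 1) j (Num 0) (Mul (selE (var 15)) (ld (jK m) (idxE (var 15) (var 2))))))"

definition gwlk where "gwlk m = gather (jw m)
   (Seq (Cond (heavyE (var 2)) (upd (Num 1) (jw m) (Num 0) (ld (jP m) (var 2))) (glight m (jw m)))
     (loop_heavy (upd (Num 1) (jw m) (Num 0) (Mul (Mul (selX m (var 15)) (adjE (var 2) (var 15))) (ld 34 (var 15))))))"

definition tri_pairs_com where "tri_pairs_com sg m j i = loop_nbs 14 15 (var 2) (loop_nbs 16 17 (var 2)
   (upd sg j i (Mul (Mul (Mul (selX m (var 15)) (adjE (var 2) (var 15))) (adjE (var 2) (var 17))) (adjE (var 15) (var 17)))))"

definition gtri where "gtri m = gather (jt m)
   (Cond (heavyE (var 2)) (upd (Num 1) (jt m) (Num 0) (ld (jF m) (var 2))) (tri_pairs_com (Num 1) m (jt m) (Num 0)))"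

definition gnbdeg where "gnbdeg = gather 28 (Seq (upd (Num 1) 28 (Num 0) (ld 40 (var 2)))
   (loop_heavy (upd (Num 1) 28 (Num 0) (Mul (Mul (selE (var 15)) (adjE (var 2) (var 15))) (degE (var 15))))))"

locale vertex_ctx = machine2 +
  fixes x :: nat and H :: "nat set" and a :: "nat \<Rightarrow> nat \<Rightarrow> nat" and s :: "nat \<Rightarrow> nat" and T :: "nat \<Rightarrow> nat \<Rightarrow> nat"
  assumes V: "vars_ok T" "heavy_list H T" "H \<subseteq> {..<in_n I}" "T 2 0 = x" "T 3 0 = in_s I" "x < in_n I" "x \<noteq> in_s I"
    and aV: "adjf I x (in_s I) = a" and sV: "self I (T 4 0) = s"
begin

sublocale wgraph n a unfolding aV[symmetric] by (rule wgraph_adjf)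

lemma s_le: "s z \<le> 1" unfolding sV[symmetric] by (rule self_le)

lemma a_nbs: "z \<notin> set (nbs u) \<Longrightarrow> a u z = 0" unfolding aV[symmetric] by (rule adjf_out)

lemma flag: "T 10 u = heavy H u" using V heavy_listD by blast

lemma jnot: "jw m < 64" "jw m \<notin> scratch" "20 \<le> jw m" "jw m < 32" "jt m < 64" "jt m \<notin> scratch" "20 \<le> jt m" "jt m < 32"
  by (auto simp: jdefs scratch_def)

text \<open>The two loops evaluate the two sums of \<open>wlk_light\<close>.\<close>

lemma adds_glight:
  assumes K: "T 33 = tK n a s H" "T (jK m) = tK n a (wt m s) H"
    and N: "N \<ge> 1 + card H" "N \<ge> 1 + length (nbs x)"
  shows "adds' True (glight m (jw m)) T scratch (jw m) N (scalar (wlk n a s (lw H (wt m s)) x))"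
proof (rule adds_mono)
  show "adds' True (glight m (jw m)) T scratch (jw m) N
    (\<lambda>q. (\<Sum>w<n. of_bool (q = 0) * (light H w * wt m s w * a x w * tK n a s H (w * n + w)))
      + (\<Sum>w<n. of_bool (w \<in> H) * (of_bool (q = 0) * (s w * tK n a (wt m s) H (w * n + x)))))"
    unfolding glight_def
    by (intro adds_seq scatter_nbs[where u = x] scatter_heavy)
      (use V aV sV K N S64 a_nbs jnot in \<open>auto simp: scratch_def flag light_eq jdefs\<close>)
  fix q :: nat
  have t: "w < n \<Longrightarrow> tK n a X H (u * n + w) = cod n a (lw H X) u w" for X u w by (simp add: tK_def)
  have "(\<Sum>w<n. of_bool (q = 0) * (light H w * wt m s w * a x w * tK n a s H (w * n + w)))
     = of_bool (q = 0) * (\<Sum>w<n. light H w * wt m s w * a x w * cod n a (lw H s) w w)"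
    unfolding sum_distrib_left by (intro sum.cong refl) (simp add: t)
  moreover have "(\<Sum>w<n. of_bool (w \<in> H) * (of_bool (q = 0) * (s w * tK n a (wt m s) H (w * n + x))))
     = of_bool (q = 0) * (\<Sum>w<n. of_bool (w \<in> H) * (s w * cod n a (lw H (wt m s)) w x))"
    unfolding sum_distrib_left by (intro sum.cong refl) (simp add: t V)
  ultimately show "(\<Sum>w<n. of_bool (q = 0) * (light H w * wt m s w * a x w * tK n a s H (w * n + w)))
      + (\<Sum>w<n. of_bool (w \<in> H) * (of_bool (q = 0) * (s w * tK n a (wt m s) H (w * n + x))))
      = scalar (wlk n a s (lw H (wt m s)) x) q"
    unfolding scalar_def wlk_light[of s H "wt m s" x] by (simp only: distrib_left)
qed simp

lemma steps_gwlk: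
  assumes K: "T 33 = tK n a s H" "T (jK m) = tK n a (wt m s) H" "T 34 = tC n a s H" "T (jP m) = tP n a s (wt m s) H"
    and N: "N \<ge> 1 + card H" "x \<notin> H \<Longrightarrow> N \<ge> 1 + length (nbs x)"
  shows "steps' (gwlk m) T N (T(jw m := scalar (wlk n a s (wt m s) x)))"
  unfolding gwlk_def
proof (rule steps_gather)
  let ?e1 = "\<lambda>q. of_bool (q = ev I T (Num 0)) * ev I T (ld (jP m) (var 2))"
  let ?e2 = "scalar (wlk n a s (lw H (wt m s)) x)"
  let ?e3 = "\<lambda>q. \<Sum>w<n. of_bool (w \<in> H) * (of_bool (q = 0) * (wt m s w * a x w * tC n a s H w))"
  have "adds' True (Cond (heavyE (var 2)) (upd (Num 1) (jw m) (Num 0) (ld (jP m) (var 2))) (glight m (jw m))) T scratch (jw m) N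
     (if ev I T (heavyE (var 2)) \<noteq> 0 then ?e1 else ?e2)"
  proof (rule adds_cond)
    show "adds' True (upd (Num 1) (jw m) (Num 0) (ld (jP m) (var 2))) T scratch (jw m) N ?e1"
      by (rule adds_upd_of_bool) (use N S64 in \<open>auto simp: scratch_def jdefs\<close>)
    assume "ev I T (heavyE (var 2)) = 0"
    then have "x \<notin> H" using V flag by simp
    then show "adds' True (glight m (jw m)) T scratch (jw m) N ?e2"
      using adds_glight[OF K(1,2) N(1)] N(2) by blast
  qed (use N in \<open>auto simp: scratch_def jdefs\<close>)
  moreover have "adds' True (loop_heavy (upd (Num 1) (jw m) (Num 0) (Mul (Mul (selX m (var 15)) (adjE (var 2) (var 15))) (ld 34 (var 15)))))
      T scratch (jw m) N ?e3"
    by (rule scatter_heavy) (use V aV sV K N S64 in \<open>auto simp: scratch_def jdefs\<close>)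
  ultimately show "adds' True (Seq (Cond (heavyE (var 2)) (upd (Num 1) (jw m) (Num 0) (ld (jP m) (var 2))) (glight m (jw m)))
     (loop_heavy (upd (Num 1) (jw m) (Num 0) (Mul (Mul (selX m (var 15)) (adjE (var 2) (var 15))) (ld 34 (var 15))))))
      T scratch (jw m) N (\<lambda>q. (if ev I T (heavyE (var 2)) \<noteq> 0 then ?e1 else ?e2) q + ?e3 q)"
    by (rule adds_seq)
  fix q :: nat
  have e3: "?e3 q = of_bool (q = 0) * (\<Sum>w<n. of_bool (w \<in> H) * (wt m s w * a x w * cn n a s w))"
    unfolding sum_distrib_left by (intro sum.cong refl) (simp add: tC_def heavy_def)
  have "(if ev I T (heavyE (var 2)) \<noteq> 0 then ?e1 else ?e2) q = of_bool (q = 0) * wlk n a s (lw H (wt m s)) x"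
  proof (cases "x \<in> H")
    case True
    then show ?thesis using V flag K by (simp add: tP_def jdefs split: if_splits)
  next
    case False
    then show ?thesis using V flag by (simp add: scalar_def)
  qed
  then show "(if ev I T (heavyE (var 2)) \<noteq> 0 then ?e1 else ?e2) q + ?e3 q = scalar (wlk n a s (wt m s) x) q"
    unfolding e3 scalar_def wlk_split[of s H "wt m s" x, symmetric] by (simp only: distrib_left)
  show "wlk n a s (wt m s) x < W" by (intro W_bound(2) wlk_le s_le wt_le)
qed (use V N S64 jnot in auto)

lemma adds_tri_pairs:
  assumes i: "indep I {j} i" "indep I {j} sg" and "b \<longleftrightarrow> ev I T sg \<noteq> 0" and j: "20 \<le> j" "j < 64" "j \<noteq> 2"
    and e: "\<And>f g f' g'. ev I (T(14 := g, 15 := f, 16 := g', 17 := f')) i = p"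
      "\<And>f g f' g'. ev I (T(14 := g, 15 := f, 16 := g', 17 := f')) sg = ev I T sg" and p: "p * 64 + 64 \<le> S"
    and N: "N \<ge> (1 + length (nbs x))\<^sup>2"
  shows "adds' b (tri_pairs_com sg m j i) T scratch j N
    (\<lambda>q. \<Sum>w1<n. \<Sum>w2<n. of_bool (q = p) * (wt m s w1 * a x w1 * a x w2 * a w1 w2))"
  unfolding tri_pairs_com_def
  by (rule scatter_pairs[where u = x]) (use assms V aV sV a_nbs in \<open>auto simp: scratch_def\<close>)

lemma steps_gtri:
  assumes K: "T (jF m) = tF n a (wt m s) H"
    and N: "N \<ge> 1" "x \<notin> H \<Longrightarrow> N \<ge> (1 + length (nbs x))\<^sup>2"
  shows "steps' (gtri m) T N (T(jt m := scalar (tri n a (wt m s) x)))"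
  unfolding gtri_def
proof (rule steps_gather)
  let ?e1 = "\<lambda>q. of_bool (q = ev I T (Num 0)) * ev I T (ld (jF m) (var 2))"
  let ?e2 = "\<lambda>q. \<Sum>w1<n. \<Sum>w2<n. of_bool (q = 0) * (wt m s w1 * a x w1 * a x w2 * a w1 w2)"
  show "adds' True (Cond (heavyE (var 2)) (upd (Num 1) (jt m) (Num 0) (ld (jF m) (var 2))) (tri_pairs_com (Num 1) m (jt m) (Num 0)))
     T scratch (jt m) N (if ev I T (heavyE (var 2)) \<noteq> 0 then ?e1 else ?e2)"
  proof (rule adds_cond)
    show "adds' True (upd (Num 1) (jt m) (Num 0) (ld (jF m) (var 2))) T scratch (jt m) N ?e1"
      by (rule adds_upd_of_bool) (use N S64 in \<open>auto simp: scratch_def jdefs\<close>)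
    assume "ev I T (heavyE (var 2)) = 0"
    then have xH: "x \<notin> H" using V flag by simp
    show "adds' True (tri_pairs_com (Num 1) m (jt m) (Num 0)) T scratch (jt m) N ?e2"
      by (rule adds_tri_pairs) (use N(2)[OF xH] S64 in \<open>auto simp: jdefs\<close>)
  qed (use N in \<open>auto simp: scratch_def jdefs\<close>)
  fix q :: nat
  show "(if ev I T (heavyE (var 2)) \<noteq> 0 then ?e1 else ?e2) q = scalar (tri n a (wt m s) x) q"
  proof (cases "x \<in> H")
    case True
    then show ?thesis using V flag K by (simp add: tF_def scalar_def jdefs split: if_splits)
  next
    case False
    have "?e2 q = scalar (tri n a (wt m s) x) q"
      unfolding scalar_def tri_pairs[symmetric] sum_distrib_left ..
    then show ?thesis using False V flag by simp
  qed
  show "tri n a (wt m s) x < W" by (intro W_bound(2) tri_le s_le wt_le)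
qed (use V N S64 jnot in auto)

text \<open>The degree expression may be off at the source, but there \<open>a x w\<close> is
  0.\<close>

lemma deg_eq: "a x w * (length (nbs w) - of_bool (in_s I \<in> set (nbs w))) = a x w * dg n a w"
proof (cases "w = in_s I")
  case True
  then have "a x w = 0" unfolding aV[symmetric] by (simp add: adjf_def)
  then show ?thesis by simp
next
  case False
  then show ?thesis using dg_adjf[OF False, of x] aV by simp
qed

lemma steps_gnbdeg:
  assumes K: "T 40 = tG n a s H" and N: "N \<ge> 1 + card H"
  shows "steps' gnbdeg T N (T(28 := scalar (nbdeg n a s x)))"
  unfolding gnbdeg_def
proof (rule steps_gather)
  show "adds' True (Seq (upd (Num 1) 28 (Num 0) (ld 40 (var 2)))
   (loop_heavy (upd (Num 1) 28 (Num 0) (Mul (Mul (selE (var 15)) (adjE (var 2) (var 15))) (degE (var 15)))))) T scratch 28 N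
   (\<lambda>q. of_bool (q = ev I T (Num 0)) * ev I T (ld 40 (var 2))
     + (\<Sum>w<n. of_bool (w \<in> H) * (of_bool (q = 0) * (s w * a x w * (length (nbs w) - of_bool (in_s I \<in> set (nbs w)))))))"
    by (intro adds_seq adds_upd_of_bool scatter_heavy) (use V aV sV N S64 in \<open>auto simp: scratch_def\<close>)
  fix q :: nat
  have "(\<Sum>w<n. of_bool (w \<in> H) * (of_bool (q = 0) * (s w * a x w * (length (nbs w) - of_bool (in_s I \<in> set (nbs w))))))
     = of_bool (q = 0) * (\<Sum>w<n. of_bool (w \<in> H) * (s w * a x w * dg n a w))"
    unfolding sum_distrib_left mult.assoc deg_eq by (intro sum.cong refl) (simp only: mult.left_commute)
  then show "of_bool (q = ev I T (Num 0)) * ev I T (ld 40 (var 2))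
     + (\<Sum>w<n. of_bool (w \<in> H) * (of_bool (q = 0) * (s w * a x w * (length (nbs w) - of_bool (in_s I \<in> set (nbs w))))))
     = scalar (nbdeg n a s x) q"
    using V K nbdeg_split[of H s x, symmetric] by (simp add: scalar_def tG_def)
  show "nbdeg n a s x < W" by (intro W_bound(2) nbdeg_le s_le)
qed (use V N S64 in auto)

end

definition mK where "mK = Cond (lightE (var 2)) (loop_nbs 14 15 (var 2) (loop_nbs 16 17 (var 2)
   (upd (var 1) 33 (idxE (var 15) (var 17)) (Mul (adjE (var 2) (var 15)) (adjE (var 2) (var 17)))))) Skip"

definition mP where "mP m = loop_heavy (upd (var 1) (jP m) (var 15) (Add (ld (jK m) (idxE (var 15) (var 2)))
    (Mul (Mul (Mul (Num (of_bool m)) (lightE (var 2))) (adjE (var 2) (var 15))) (var 22))))"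

definition mF where "mF = Cond (heavyE (var 2))
   (loop_heavy (upd (var 1) 38 (var 15) (Mul (adjE (var 2) (var 15)) (ld 39 (idxE (var 2) (var 15))))))
   (loop_nbs 14 15 (var 2) (loop_nbs 16 17 (var 2) (upd (var 1) 38 (var 15)
     (Mul (Mul (Mul (heavyE (var 15)) (adjE (var 2) (var 15))) (adjE (var 2) (var 17))) (adjE (var 15) (var 17))))))"

definition mG where "mG = Cond (lightE (var 2))
   (loop_nbs 14 15 (var 2) (upd (var 1) 40 (var 15) (Mul (adjE (var 2) (var 15)) (var 5)))) Skip"

locale mark_ctx2 = mark_ctx S W I b x H a s + machine2 S W I for S W I b x H a s
begin

abbreviation "menv dy \<equiv> env b x (in_s I) x (dg n a x) dy H"

lemma vertex_ctx: "menv dy T \<Longrightarrow> vertex_ctx S W I x H a s T"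
  by unfold_locales (use xn Hn in \<open>auto simp: envD\<close>)

lemma steps_mK:
  assumes e: "menv dy T" and t: "T 33 = pick b (tK n a s H) (tK n a s' H)"
    and N: "N \<ge> 1" "x \<notin> H \<Longrightarrow> N \<ge> (1 + length (nbs x))\<^sup>2"
  shows "steps' mK T N (T(33 := pick b (tK n a s' H) (tK n a s H)))"
proof (rule steps_toggle)
  show "adds' b mK T scratch 33 N
     (\<lambda>q. light H x * (\<Sum>w1<n. \<Sum>w2<n. of_bool (q = w1 * n + w2) * (a x w1 * a x w2)))"
    unfolding mK_def
  proof (rule adds_when)
    assume "light H x \<noteq> 0"
    then have xH: "x \<notin> H" by (auto simp: light_def)
    show "adds' b (loop_nbs 14 15 (var 2) (loop_nbs 16 17 (var 2)
     (upd (var 1) 33 (idxE (var 15) (var 17)) (Mul (adjE (var 2) (var 15)) (adjE (var 2) (var 17)))))) T scratch 33 N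
     (\<lambda>q. \<Sum>w1<n. \<Sum>w2<n. of_bool (q = w1 * n + w2) * (a x w1 * a x w2))"
      by (rule scatter_pairs[where u = x])
        (use N(2)[OF xH] addr2 a_nbs in \<open>auto simp: scratch_def envD[OF e]\<close>)
  qed (use N in \<open>auto simp: scratch_def envD[OF e] light_eq\<close>)
  show "tK n a s' H q < W" for q by (intro W_bound(3) tK_le s_le')
  show "33 \<notin> scratch" "33 < (64::nat)" by (auto simp: scratch_def)
qed (rule t, rule m_tK)

lemma steps_mP:
  assumes e: "menv dy T" and t: "T (jP m) = pick b (tP n a s (wt m s) H) (tP n a s' (wt m s') H)"
    and K: "T (jK m) = tK n a (wt m s) H" "T 22 0 = cn n a s x" and N: "N \<ge> 1 + card H"
  shows "steps' (mP m) T N (T(jP m := pick b (tP n a s' (wt m s') H) (tP n a s (wt m s) H)))"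
proof (rule steps_toggle)
  show "adds' b (mP m) T scratch (jP m) N (\<lambda>q. \<Sum>w<n. of_bool (w \<in> H) * (of_bool (q = w) *
     (tK n a (wt m s) H (w * n + x) + of_bool m * light H x * a x w * cn n a s x)))"
    unfolding mP_def
    by (rule scatter_heavy)
      (use N Hn addr1 K in \<open>auto simp: scratch_def jdefs envD[OF e] light_eq\<close>)
  show "tP n a s' (wt m s') H q < W" for q by (intro W_bound(2) tP_le s_le' wt_le)
  show "jP m \<notin> scratch" "jP m < 64" by (auto simp: scratch_def jdefs)
  fix q
  show "tP n a s' (wt m s') H q = tP n a s (wt m s) H q + (\<Sum>w<n. of_bool (w \<in> H) * (of_bool (q = w) *
     (tK n a (wt m s) H (w * n + x) + of_bool m * light H x * a x w * cn n a s x)))"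
  proof (cases m)
    case True
    then show ?thesis using m_tP_s[of H q] by (simp add: wt_def)
  next
    case False
    then show ?thesis unfolding wt_def m_tP by (simp only: if_False of_bool_eq mult_0 add_0_right)
  qed
qed (rule t)

lemma steps_mF:
  assumes e: "menv dy T" and t: "T 38 = pick b (tF n a s H) (tF n a s' H)"
    and K: "T 39 = tA n a H" and N: "N \<ge> 1 + card H" "x \<notin> H \<Longrightarrow> N \<ge> (1 + length (nbs x))\<^sup>2"
  shows "steps' mF T N (T(38 := pick b (tF n a s' H) (tF n a s H)))"
proof (rule steps_toggle)
  let ?e1 = "\<lambda>q. \<Sum>w<n. of_bool (w \<in> H) * (of_bool (q = w) * (a x w * tA n a H (x * n + w)))"
  let ?e2 = "\<lambda>q. \<Sum>w1<n. \<Sum>w2<n. of_bool (q = w1) * (heavy H w1 * a x w1 * a x w2 * a w1 w2)"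
  show "adds' b mF T scratch 38 N (if ev I T (heavyE (var 2)) \<noteq> 0 then ?e1 else ?e2)"
    unfolding mF_def
  proof (rule adds_cond)
    show "adds' b (loop_heavy (upd (var 1) 38 (var 15) (Mul (adjE (var 2) (var 15)) (ld 39 (idxE (var 2) (var 15))))))
      T scratch 38 N ?e1"
      by (rule scatter_heavy)
        (use N Hn addr1 K in \<open>auto simp: scratch_def envD[OF e]\<close>)
    assume "ev I T (heavyE (var 2)) = 0"
    then have xH: "x \<notin> H" by (simp add: envD[OF e])
    show "adds' b (loop_nbs 14 15 (var 2) (loop_nbs 16 17 (var 2) (upd (var 1) 38 (var 15)
     (Mul (Mul (Mul (heavyE (var 15)) (adjE (var 2) (var 15))) (adjE (var 2) (var 17))) (adjE (var 15) (var 17))))))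
      T scratch 38 N ?e2"
      by (rule scatter_pairs[where u = x])
        (use N(2)[OF xH] addr1 a_nbs in \<open>auto simp: scratch_def envD[OF e]\<close>)
  qed (use N in \<open>auto simp: scratch_def\<close>)
  show "tF n a s' H q < W" for q by (intro W_bound(2) tF_le s_le')
  show "38 \<notin> scratch" "38 < (64::nat)" by (auto simp: scratch_def)
  fix q
  show "tF n a s' H q = tF n a s H q + (if ev I T (heavyE (var 2)) \<noteq> 0 then ?e1 else ?e2) q"
    unfolding m_tF using m_tF_heavy[of H q] m_tF_light[of H q] by (simp add: envD[OF e])
qed (rule t)

lemma steps_mG:
  assumes e: "menv dy T" and t: "T 40 = pick b (tG n a s H) (tG n a s' H)"
    and N: "N \<ge> 1" "x \<notin> H \<Longrightarrow> N \<ge> 1 + length (nbs x)"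
  shows "steps' mG T N (T(40 := pick b (tG n a s' H) (tG n a s H)))"
proof (rule steps_toggle)
  show "adds' b mG T scratch 40 N (\<lambda>q. light H x * (\<Sum>w<n. of_bool (q = w) * (a x w * dg n a x)))"
    unfolding mG_def
  proof (rule adds_when)
    assume "light H x \<noteq> 0"
    then have xH: "x \<notin> H" by (auto simp: light_def)
    show "adds' b (loop_nbs 14 15 (var 2) (upd (var 1) 40 (var 15) (Mul (adjE (var 2) (var 15)) (var 5)))) T scratch 40 N
     (\<lambda>q. \<Sum>w<n. of_bool (q = w) * (a x w * dg n a x))"
      by (rule scatter_nbs[where u = x])
        (use N(2)[OF xH] addr1 a_nbs in \<open>auto simp: scratch_def envD[OF e]\<close>)
  qed (use N in \<open>auto simp: scratch_def envD[OF e] light_eq\<close>)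
  show "tG n a s' H q < W" for q by (intro W_bound(2) tG_le s_le')
  show "40 \<notin> scratch" "40 < (64::nat)" by (auto simp: scratch_def)
qed (rule t, rule m_tG)

end

section \<open>Programs for a change of status\<close>

definition sK where "sK m = Cond (selX m (var 2)) (loop_nbs 14 15 (var 2) (loop_nbs 16 17 (var 2)
   (upd (notE (var 1)) (jK m) (idxE (var 15) (var 17)) (Mul (adjE (var 2) (var 15)) (adjE (var 2) (var 17)))))) Skip"
definition sP where "sP m = loop_nbs 14 15 (var 2) (upd (notE (var 1)) (jP m) (var 15)
   (Mul (Mul (Mul (heavyE (var 15)) (selX m (var 2))) (adjE (var 2) (var 15))) (var 22)))"
text \<open>On a drop the own entry is erased rather than subtracted, since computing it would take
  a pass over the heavy list. Only a promotion computes it, in \<open>sPown\<close>.\<close>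

definition sPclear where "sPclear m = Cond (var 1) Skip (Store (cell (jP m) (var 2)) (Num 0))"
definition sPown where "sPown m = Cond (var 1) (Seq (gather (jw m) (glight m (jw m)))
   (upd (Num 1) (jP m) (var 2) (var (jw m)))) Skip"
definition sA1 where "sA1 = loop_nbs 14 15 (var 2) (loop_nbs 16 17 (var 2) (upd (var 1) 39 (idxE (var 2) (var 15))
   (Mul (Mul (Mul (heavyE (var 15)) (adjE (var 2) (var 15))) (adjE (var 2) (var 17))) (adjE (var 15) (var 17)))))"
definition sA2 where "sA2 = loop_nbs 14 15 (var 2) (loop_nbs 16 17 (var 2) (upd (var 1) 39 (idxE (var 15) (var 2))
   (Mul (Mul (Mul (heavyE (var 15)) (adjE (var 2) (var 15))) (adjE (var 2) (var 17))) (adjE (var 15) (var 17)))))"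
definition sG where "sG = loop_nbs 14 15 (var 2) (upd (notE (var 1)) 40 (var 15)
   (Mul (Mul (selE (var 2)) (adjE (var 2) (var 15))) (var 5)))"

locale status_ctx2 = status_ctx S W I b x H a s + machine2 S W I for S W I b x H a s
begin

abbreviation "senv dy \<equiv> env b x (in_s I) (in_s I) (dg n a x) dy H"

lemma vertex_ctx: "senv dy T \<Longrightarrow> vertex_ctx S W I x H a s T"
  by unfold_locales (use xn Hn in \<open>auto simp: envD\<close>)

abbreviation "H' \<equiv> insert x H"

lemma steps_sK:
  assumes e: "senv dy T" and t: "T (jK m) = pick b (tK n a (wt m s) H) (tK n a (wt m s) H')"
    and N: "N \<ge> (1 + length (nbs x))\<^sup>2"
  shows "steps' (sK m) T N (T(jK m := pick b (tK n a (wt m s) H') (tK n a (wt m s) H)))"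
proof -
  have "steps' (sK m) T N (T(jK m := pick (\<not> b) (tK n a (wt m s) H) (tK n a (wt m s) H')))"
  proof (rule steps_toggle)
    show "adds' (\<not> b) (sK m) T scratch (jK m) N
       (\<lambda>q. wt m s x * (\<Sum>w1<n. \<Sum>w2<n. of_bool (q = w1 * n + w2) * (a x w1 * a x w2)))"
      unfolding sK_def
    proof (rule adds_when)
      show "wt m s x \<le> 1" by (intro wt_le s_le)
      show "adds' (\<not> b) (loop_nbs 14 15 (var 2) (loop_nbs 16 17 (var 2)
       (upd (notE (var 1)) (jK m) (idxE (var 15) (var 17)) (Mul (adjE (var 2) (var 15)) (adjE (var 2) (var 17)))))) T scratch (jK m) N
       (\<lambda>q. \<Sum>w1<n. \<Sum>w2<n. of_bool (q = w1 * n + w2) * (a x w1 * a x w2))"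
        by (rule scatter_pairs[where u = x])
          (use N addr2 a_nbs in \<open>auto simp: scratch_def jdefs envD[OF e]\<close>)
      have "1 \<le> (1 + length (nbs x))\<^sup>2" by simp
      then show "1 \<le> N" using N by linarith
    qed (use N in \<open>auto simp: scratch_def jdefs envD[OF e]\<close>)
    show "tK n a (wt m s) H q < W" for q by (intro W_bound(3) tK_le s_le wt_le)
    show "jK m \<notin> scratch" "jK m < 64" by (auto simp: scratch_def jdefs)
    show "T (jK m) = pick (\<not> b) (tK n a (wt m s) H') (tK n a (wt m s) H)" using t by (cases b) auto
  qed (rule tK_insert[OF xn(3,1)])
  then show ?thesis by (cases b) auto
qed

lemma steps_sG:
  assumes e: "senv dy T" and t: "T 40 = pick b (tG n a s H) (tG n a s H')"
    and N: "N \<ge> 1 + length (nbs x)"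
  shows "steps' sG T N (T(40 := pick b (tG n a s H') (tG n a s H)))"
proof -
  have "steps' sG T N (T(40 := pick (\<not> b) (tG n a s H) (tG n a s H')))"
  proof (rule steps_toggle)
    show "adds' (\<not> b) sG T scratch 40 N (\<lambda>q. \<Sum>w<n. of_bool (q = w) * (s x * a x w * dg n a x))"
      unfolding sG_def
      by (rule scatter_nbs[where u = x])
        (use N addr1 a_nbs in \<open>auto simp: scratch_def envD[OF e]\<close>)
    show "tG n a s H q < W" for q by (intro W_bound(2) tG_le s_le)
    show "40 \<notin> scratch" "40 < (64::nat)" by (auto simp: scratch_def)
    show "T 40 = pick (\<not> b) (tG n a s H') (tG n a s H)" using t by (cases b) auto
  qed (rule tG_insert[OF xn(3,1)])
  then show ?thesis by (cases b) auto
qed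

lemma steps_sF:
  assumes e: "senv dy T" and t: "T (jF m) = pick b (tF n a (wt m s) H) (tF n a (wt m s) H')"
    and N: "N \<ge> (1 + length (nbs x))\<^sup>2"
  shows "steps' (tri_pairs_com (var 1) m (jF m) (var 2)) T N (T(jF m := pick b (tF n a (wt m s) H') (tF n a (wt m s) H)))"
proof (rule steps_toggle)
  interpret v: vertex_ctx S W I x H a s T by (rule vertex_ctx[OF e])
  show "adds' b (tri_pairs_com (var 1) m (jF m) (var 2)) T scratch (jF m) N
    (\<lambda>q. \<Sum>w1<n. \<Sum>w2<n. of_bool (q = x) * (wt m s w1 * a x w1 * a x w2 * a w1 w2))"
  proof (rule v.adds_tri_pairs)
    show "indep I {jF m} (var 2)" "indep I {jF m} (var 1)" "20 \<le> jF m" "jF m < 64" "jF m \<noteq> 2"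
      by (simp_all add: jdefs)
    show "b \<longleftrightarrow> ev I T (var 1) \<noteq> 0" by (simp add: envD[OF e])
    show "ev I (T(14 := g, 15 := f, 16 := g', 17 := f')) (var 2) = x"
      "ev I (T(14 := g, 15 := f, 16 := g', 17 := f')) (var 1) = ev I T (var 1)" for f g f' g'
      by (simp_all add: envD[OF e])
  qed (use N addr1[OF xn(1)] in blast)+
  show "tF n a (wt m s) H' q < W" for q by (intro W_bound(2) tF_le s_le wt_le)
  show "jF m \<notin> scratch" "jF m < 64" by (auto simp: scratch_def jdefs)
qed (rule t, rule tF_insert[OF xn(3)])

lemma steps_sA:
  assumes e: "senv dy T" and t: "T 39 = pick b (tA n a H) (tA n a H')"
    and N: "N \<ge> (1 + length (nbs x))\<^sup>2"
  shows "steps' (Seq sA1 sA2) T N (T(39 := pick b (tA n a H') (tA n a H)))"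
proof (rule steps_toggle)
  have "adds' b sA1 T scratch 39 N
    (\<lambda>q. \<Sum>w1<n. \<Sum>w2<n. of_bool (q = x * n + w1) * (heavy H w1 * a x w1 * a x w2 * a w1 w2))"
    unfolding sA1_def by (rule scatter_pairs[where u = x])
        (use N addr2 xn a_nbs in \<open>auto simp: scratch_def envD[OF e]\<close>)
  moreover have "adds' b sA2 T scratch 39 N
    (\<lambda>q. \<Sum>w1<n. \<Sum>w2<n. of_bool (q = w1 * n + x) * (heavy H w1 * a x w1 * a x w2 * a w1 w2))"
    unfolding sA2_def by (rule scatter_pairs[where u = x])
        (use N addr2 xn a_nbs in \<open>auto simp: scratch_def envD[OF e]\<close>)
  ultimately show "adds' b (Seq sA1 sA2) T scratch 39 N
    (\<lambda>q. (\<Sum>w1<n. \<Sum>w2<n. of_bool (q = x * n + w1) * (heavy H w1 * a x w1 * a x w2 * a w1 w2))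
       + (\<Sum>w1<n. \<Sum>w2<n. of_bool (q = w1 * n + x) * (heavy H w1 * a x w1 * a x w2 * a w1 w2)))"
    by (rule adds_seq)
  show "tA n a H' q < W" for q by (intro W_bound(3) tA_le)
  show "39 \<notin> scratch" "39 < (64::nat)" by (auto simp: scratch_def)
qed (rule t, rule tA_insert[OF xn(3,1)])

lemma steps_sP:
  assumes e: "senv dy T" and t: "T (jP m) = pick b (tP n a s (wt m s) H) (tP0 s (wt m s) x H)"
    and c: "T 22 0 = cn n a s x" and N: "N \<ge> 1 + length (nbs x)"
  shows "steps' (sP m) T N (T(jP m := pick b (tP0 s (wt m s) x H) (tP n a s (wt m s) H)))"
proof -
  have "steps' (sP m) T N (T(jP m := pick (\<not> b) (tP n a s (wt m s) H) (tP0 s (wt m s) x H)))"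
  proof (rule steps_toggle)
    show "adds' (\<not> b) (sP m) T scratch (jP m) N (\<lambda>q. \<Sum>w<n. of_bool (q = w) * (heavy H w * wt m s x * a x w * cn n a s x))"
      unfolding sP_def
      by (rule scatter_nbs[where u = x])
        (use N addr1 a_nbs c in \<open>auto simp: scratch_def jdefs envD[OF e]\<close>)
    show "tP n a s (wt m s) H q < W" for q by (intro W_bound(2) tP_le s_le wt_le)
    show "jP m \<notin> scratch" "jP m < 64" by (auto simp: scratch_def jdefs)
    show "T (jP m) = pick (\<not> b) (tP0 s (wt m s) x H) (tP n a s (wt m s) H)" using t by (cases b) auto
  qed (rule tP_tP0[OF xn(3,1)])
  then show ?thesis by (cases b) auto
qed

lemma steps_sPclear:
  assumes e: "senv dy T" and t: "T (jP m) = pick b (tP n a s (wt m s) H) (tP n a s (wt m s) H')"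
    and N: "N \<ge> 1"
  shows "steps' (sPclear m) T N (T(jP m := pick b (tP n a s (wt m s) H) (tP0 s (wt m s) x H)))"
  unfolding sPclear_def
proof (rule steps_Cond_bool[where b = b])
  assume b
  then have "T(jP m := pick b (tP n a s (wt m s) H) (tP0 s (wt m s) x H)) = T" using t by (auto simp: fun_upd_idem)
  then show "steps' Skip T N (T(jP m := pick b (tP n a s (wt m s) H) (tP0 s (wt m s) x H)))" using N steps_Skip by metis
next
  assume b: "\<not> b"
  have "(T (jP m))(x := 0) = tP0 s (wt m s) x H"
    using t b tP0_insert[OF xn(3,1), of s "wt m s"] xn(3) by (auto simp: fun_eq_iff tP0_def)
  then show "steps' (Store (cell (jP m) (var 2)) (Num 0)) T N (T(jP m := pick b (tP n a s (wt m s) H) (tP0 s (wt m s) x H)))"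
    using steps_Store[of "jP m" I "var 2" "Num 0" N T S W] b N addr1'[OF xn(1)] W_pow
    by (simp add: envD[OF e] scratch_def jdefs)
qed (use N envD[OF e] in auto)

lemma steps_sPown:
  assumes e: "senv dy T" and t: "T (jP m) = pick b (tP0 s (wt m s) x H) (tP n a s (wt m s) H)"
    and K: "b \<Longrightarrow> T 33 = tK n a s H" "b \<Longrightarrow> T (jK m) = tK n a (wt m s) H"
    and N: "N \<ge> of_bool b * (1 + card H)" "N \<ge> 1 + length (nbs x)"
  shows "steps' (sPown m) T N (pick b (T(jw m := scalar (wlk n a s (lw H (wt m s)) x), jP m := tP n a s (wt m s) H')) T)"
  unfolding sPown_def
proof (rule steps_Cond_bool[where b = b])
  assume "\<not> b"
  then show "steps' Skip T N (pick b (T(jw m := scalar (wlk n a s (lw H (wt m s)) x), jP m := tP n a s (wt m s) H')) T)"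
    using N steps_Skip[of N] by simp
next
  assume b: b
  interpret v: vertex_ctx S W I x H a s T by (rule vertex_ctx[OF e])
  let ?t = "T(jw m := scalar (wlk n a s (lw H (wt m s)) x))"
  have "steps' (gather (jw m) (glight m (jw m))) T N ?t"
  proof (rule steps_gather)
    show "adds' True (glight m (jw m)) T scratch (jw m) N (scalar (wlk n a s (lw H (wt m s)) x))"
      by (rule v.adds_glight) (use b K N in auto)
    show "wlk n a s (lw H (wt m s)) x < W" by (intro W_bound(2) wlk_le lw_le s_le wt_le)
  qed (use v.jnot[of m] N S64 envD[OF e] in auto)
  moreover have "steps' (upd (Num 1) (jP m) (var 2) (var (jw m))) ?t N (?t(jP m := pick True (tP n a s (wt m s) H') (tP0 s (wt m s) x H)))"
  proof (rule steps_toggle)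
    show "adds' True (upd (Num 1) (jP m) (var 2) (var (jw m))) ?t scratch (jP m) N
       (\<lambda>q. of_bool (q = ev I ?t (var 2)) * ev I ?t (var (jw m)))"
      by (rule adds_upd_of_bool) (use N addr1'[OF xn(1)] in \<open>auto simp: scratch_def jdefs envD[OF e]\<close>)
    show "?t (jP m) = pick True (tP0 s (wt m s) x H) (tP n a s (wt m s) H')" using t b by (simp add: jdefs split: if_splits)
    show "tP n a s (wt m s) H' q < W" for q by (intro W_bound(2) tP_le s_le wt_le)
    show "jP m \<notin> scratch" "jP m < 64" by (auto simp: scratch_def jdefs)
    fix q
    have "ev I ?t (var 2) = x" "ev I ?t (var (jw m)) = wlk n a s (lw H (wt m s)) x"
      by (auto simp: jdefs envD[OF e])
    then show "tP n a s (wt m s) H' q = tP0 s (wt m s) x H q + of_bool (q = ev I ?t (var 2)) * ev I ?t (var (jw m))"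
      using tP0_insert[OF xn(3,1)] by simp
  qed
  ultimately show "steps' (Seq (gather (jw m) (glight m (jw m))) (upd (Num 1) (jP m) (var 2) (var (jw m)))) T N
     (pick b (T(jw m := scalar (wlk n a s (lw H (wt m s)) x), jP m := tP n a s (wt m s) H')) T)"
    using b steps_Seq by fastforce
qed (use N envD[OF e] in auto)

end

definition gs where "gs = Seq (gwlk False) (Seq (gwlk True) (Seq (gtri False) (Seq (gtri True) gnbdeg)))"
definition m43 where "m43 = upd (var 1) 43 (Num 0) (Add (var 28) (Mul (var 22) (var 5)))"
definition m44 where "m44 = upd (var 1) 44 (Num 0) (var 26)"
definition m45 where "m45 = upd (var 1) 45 (Num 0) (Mul (Num 2) (var 27))"
definition m46 where "m46 = upd (var 1) 46 (Num 0) (Add (Mul (Num 2) (var 24)) (var 5))"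
definition m47 where "m47 = upd (var 1) 47 (Num 0) (Add (Mul (Num 2) (var 25)) (Add (var 22) (Mul (var 22) (var 22))))"

definition mark3 where
  "mark3 = Seq (Cond (var 1) Skip mK) (Seq (gcod True 22 2 2) (Seq (Cond (var 1) gs Skip) (Seq (m34) (Seq (mP False) (Seq (mP True) (Seq (mF) (Seq (mG) (Seq (Cond (var 1) Skip gs) (Seq (m41) (Seq (m42) (Seq (m43) (Seq (m44) (Seq (m45) (Seq (m46) (Seq (m47) (Cond (var 1) mK Skip))))))))))))))))"

text \<open>The codegree tables change last, because the own entry of a promoted vertex is computed
  while the vertex still counts as light in them. The order of \<open>sPclear\<close>,
  \<open>sP\<close> and \<open>sPown\<close> leads through the intermediate state \<open>tP0\<close>
  in either direction.\<close>

definition status3 where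
  "status3 = Seq (cgather2 22 (var 2)) (Seq (st34) (Seq (sPclear False) (Seq (sPclear True) (Seq (sP False) (Seq (sP True) (Seq (sPown False) (Seq (sPown True) (Seq (tri_pairs_com (var 1) False (jF False) (var 2)) (Seq (tri_pairs_com (var 1) True (jF True) (var 2)) (Seq (Seq sA1 sA2) (Seq (sG) (Seq (sK False) (sK True)))))))))))))"

lemma env_pick [simp]: "20 \<le> j \<Longrightarrow> env b x y w dx dy H T \<Longrightarrow> env b x y w dx dy H (T(j := pick c (scalar v) (T j)))"
  by (cases c) simp_all

context mark_ctx2
begin

lemma steps_gs:
  assumes e: "menv dy T"
    and t: "T 32 = tK n a every H" "T 33 = tK n a s H" "T 34 = tC n a s H" "T 35 = tP n a s every H"
      "T 36 = tP n a s s H" "T 37 = tF n a every H" "T 38 = tF n a s H" "T 40 = tG n a s H"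
    and N: "N \<ge> 1 + card H" "x \<notin> H \<Longrightarrow> N \<ge> 1 + length (nbs x)" "x \<notin> H \<Longrightarrow> N \<ge> (1 + length (nbs x))\<^sup>2"
  shows "steps' gs T N (T(24 := scalar (wlk n a s every x), 25 := scalar (wlk n a s s x), 26 := scalar (tri n a every x), 27 := scalar (tri n a s x), 28 := scalar (nbdeg n a s x)))"
proof -
  define T1 where "T1 = T(24 := scalar (wlk n a s every x))"
  define T2 where "T2 = T1(25 := scalar (wlk n a s s x))"
  define T3 where "T3 = T2(26 := scalar (tri n a every x))"
  define T4 where "T4 = T3(27 := scalar (tri n a s x))"
  define T5 where "T5 = T4(28 := scalar (nbdeg n a s x))"
  note df = T1_def T2_def T3_def T4_def T5_def
  have e1: "menv dy T1" "menv dy T2" "menv dy T3" "menv dy T4" using e by (simp_all add: df)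
  have "steps' (gwlk False) T N T1"
    using vertex_ctx.steps_gwlk[OF vertex_ctx[OF e], of False N] N t unfolding T1_def by (simp add: jdefs wt_def)
  moreover have "steps' (gwlk True) T1 N T2"
    using vertex_ctx.steps_gwlk[OF vertex_ctx[OF e1(1)], of True N] N t unfolding T2_def by (simp add: jdefs wt_def T1_def)
  moreover have "steps' (gtri False) T2 N T3"
    using vertex_ctx.steps_gtri[OF vertex_ctx[OF e1(2)], of False N] N t unfolding T3_def by (simp add: jdefs wt_def T1_def T2_def)
  moreover have "steps' (gtri True) T3 N T4"
    using vertex_ctx.steps_gtri[OF vertex_ctx[OF e1(3)], of True N] N t unfolding T4_def
    by (simp add: jdefs wt_def T1_def T2_def T3_def)
  moreover have "steps' gnbdeg T4 N T5"
    using vertex_ctx.steps_gnbdeg[OF vertex_ctx[OF e1(4)], of N] N t unfolding T5_def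
    by (simp add: T1_def T2_def T3_def T4_def)
  ultimately have "steps' gs T N T5" unfolding gs_def by - ((assumption | rule steps_Seq)+)
  then show ?thesis by (simp add: df)
qed

lemma steps_mark3:
  assumes e0: "menv dy T" and "two_thirds_tables n a (pick b s s') H T"
    and N: "N \<ge> 1 + card H + light_cost 3 I H x"
  shows "\<exists>T'. steps' mark3 T N T' \<and> two_thirds_tables n a (pick b s' s) H T' \<and> (\<forall>j<20. T' j = T j) \<and> vars_ok T'"
proof -
  have sq: "1 + length (nbs u) \<le> (1 + length (nbs u))\<^sup>2" for u by (simp add: power2_eq_square)
  have N1: "N \<ge> 1" "N \<ge> 1 + card H" "x \<notin> H \<Longrightarrow> N \<ge> 1 + length (nbs x)" "x \<notin> H \<Longrightarrow> N \<ge> (1 + length (nbs x))\<^sup>2"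
    using N sq[of x] by (auto simp: light_cost_def)
  have G3: "T (jK m) = pick b (tK n a (wt m s) H) (tK n a (wt m s') H)"
    "T (jP m) = pick b (tP n a s (wt m s) H) (tP n a s' (wt m s') H)"
    "T (jF m) = pick b (tF n a (wt m s) H) (tF n a (wt m s') H)"
    "T (jY m) = scalar (pick b (gY n a (wt m s) s) (gY n a (wt m s') s'))"
    "T (jQ m) = scalar (pick b (gQ n a (wt m s) s) (gQ n a (wt m s') s'))"
    "T 34 = pick b (tC n a s H) (tC n a s' H)" "T 39 = tA n a H"
    "T 40 = pick b (tG n a s H) (tG n a s' H)"
    "T 41 = scalar (pick b (gT n a s) (gT n a s'))" "T 42 = scalar (pick b (gD n a s) (gD n a s'))"
    "T 43 = scalar (pick b (gB n a s s) (gB n a s' s'))" for m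
    using assms(2) by (cases b; simp add: two_thirds_tables_def)+
  have pk: "pick b X X = X" for X :: "nat \<Rightarrow> nat" by (simp add: pick_def)
  note G = G3(6-11) G3(1)[of False, unfolded jdefs wt_def, unfolded if_False if_True] G3(1)[of True, unfolded jdefs wt_def, unfolded if_False if_True]
    G3(2)[of False, unfolded jdefs wt_def, unfolded if_False if_True] G3(2)[of True, unfolded jdefs wt_def, unfolded if_False if_True]
    G3(3)[of False, unfolded jdefs wt_def, unfolded if_False if_True] G3(3)[of True, unfolded jdefs wt_def, unfolded if_False if_True]
    G3(4)[of False, unfolded jdefs wt_def, unfolded if_False if_True] G3(4)[of True, unfolded jdefs wt_def, unfolded if_False if_True]
    G3(5)[of False, unfolded jdefs wt_def, unfolded if_False if_True] G3(5)[of True, unfolded jdefs wt_def, unfolded if_False if_True] pk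
  note ag = aggregate_le[of s' s', OF s_le' s_le', THEN W_bound(1)]
  have ev1: "every u \<le> 1" for u by simp
  note ae = aggregate_le[of s' every, OF s_le' ev1, THEN W_bound(1)]
  define T1 where "T1 = T(33 := tK n a s H)"
  define T2 where "T2 = T1(22 := scalar (cn n a s x))"
  \<comment> \<open>On a deletion these variables keep whatever they contain; they are filled in
    \<open>T9\<close>, once the tables they depend on describe the marks without
    \<open>x\<close>.\<close>
  define T3 where "T3 = T2(24 := pick b (scalar (wlk n a s every x)) (T2 24), 25 := pick b (scalar (wlk n a s s x)) (T2 25), 26 := pick b (scalar (tri n a every x)) (T2 26), 27 := pick b (scalar (tri n a s x)) (T2 27), 28 := pick b (scalar (nbdeg n a s x)) (T2 28))"
  define T4 where "T4 = T3(34 := pick b (tC n a s' H) (tC n a s H))"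
  define T5 where "T5 = T4(35 := pick b (tP n a s' every H) (tP n a s every H))"
  define T6 where "T6 = T5(36 := pick b (tP n a s' s' H) (tP n a s s H))"
  define T7 where "T7 = T6(38 := pick b (tF n a s' H) (tF n a s H))"
  define T8 where "T8 = T7(40 := pick b (tG n a s' H) (tG n a s H))"
  define T9 where "T9 = T8(24 := scalar (wlk n a s every x), 25 := scalar (wlk n a s s x), 26 := scalar (tri n a every x), 27 := scalar (tri n a s x), 28 := scalar (nbdeg n a s x))"
  define T10 where "T10 = T9(41 := scalar (pick b (gT n a s') (gT n a s)))"
  define T11 where "T11 = T10(42 := scalar (pick b (gD n a s') (gD n a s)))"
  define T12 where "T12 = T11(43 := scalar (pick b (gB n a s' s') (gB n a s s)))"
  define T13 where "T13 = T12(44 := scalar (pick b (gY n a every s') (gY n a every s)))"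
  define T14 where "T14 = T13(45 := scalar (pick b (gY n a s' s') (gY n a s s)))"
  define T15 where "T15 = T14(46 := scalar (pick b (gQ n a every s') (gQ n a every s)))"
  define T16 where "T16 = T15(47 := scalar (pick b (gQ n a s' s') (gQ n a s s)))"
  define T17 where "T17 = T16(33 := pick b (tK n a s' H) (tK n a s H))"
  note df = T1_def T2_def T3_def T4_def T5_def T6_def T7_def T8_def T9_def T10_def T11_def T12_def T13_def T14_def T15_def T16_def T17_def
  have e1: "menv dy T1" using e0 by (simp add: T1_def)
  have e2: "menv dy T2" using e1 by (simp add: T2_def)
  have e3: "menv dy T3"
  proof (cases b)
    case True
    then show ?thesis using e2 by (simp add: T3_def)
  next
    case False
    then have "T3 = T2" by (simp add: T3_def fun_eq_iff)
    then show ?thesis using e2 by simp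
  qed
  have e4: "menv dy T4" using e3 by (simp add: T4_def)
  have e5: "menv dy T5" using e4 by (simp add: T5_def)
  have e6: "menv dy T6" using e5 by (simp add: T6_def)
  have e7: "menv dy T7" using e6 by (simp add: T7_def)
  have e8: "menv dy T8" using e7 by (simp add: T8_def)
  have e9: "menv dy T9" using e8 by (simp add: T9_def)
  have e10: "menv dy T10" using e9 by (simp add: T10_def)
  have e11: "menv dy T11" using e10 by (simp add: T11_def)
  have e12: "menv dy T12" using e11 by (simp add: T12_def)
  have e13: "menv dy T13" using e12 by (simp add: T13_def)
  have e14: "menv dy T14" using e13 by (simp add: T14_def)
  have e15: "menv dy T15" using e14 by (simp add: T15_def)
  have e16: "menv dy T16" using e15 by (simp add: T16_def)
  have e17: "menv dy T17" using e16 by (simp add: T17_def)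
  note e = e1 e2 e3 e4 e5 e6 e7 e8 e9 e10 e11 e12 e13 e14 e15 e16 e17
  have "steps' (Cond (var 1) Skip mK) T N T1"
    unfolding T1_def
  proof (rule steps_Cond_bool[where b = b])
    assume b
    then have "T(33 := tK n a s H) = T" using G by (simp add: fun_upd_idem)
    then show "steps' Skip T N (T(33 := tK n a s H))" using steps_Skip N1 by metis
  next
    assume "\<not> b"
    then show "steps' mK T N (T(33 := tK n a s H))" using steps_mK[OF e0, of N] N1 G by simp
  qed (use N1 envD[OF e0] in auto)
  moreover have "steps' (gcod True 22 2 2) T1 N T2"
    using steps_gcod[of T1 H 2 2 x x 22 a s True N] N1 xn Hn unfolding T2_def
      by (simp add: envD[OF e(1)] wt_def jK_def cod_diag) (simp add: df)
  moreover have "steps' (Cond (var 1) gs Skip) T2 N T3"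
    unfolding T3_def
  proof (rule steps_Cond_bool[where b = b])
    assume b
    then show "steps' gs T2 N (T2(24 := pick b (scalar (wlk n a s every x)) (T2 24), 25 := pick b (scalar (wlk n a s s x)) (T2 25), 26 := pick b (scalar (tri n a every x)) (T2 26), 27 := pick b (scalar (tri n a s x)) (T2 27), 28 := pick b (scalar (nbdeg n a s x)) (T2 28)))"
      using steps_gs[OF e(2), of N] N1 by (simp add: df G)
  next
    assume "\<not> b"
    then show "steps' Skip T2 N (T2(24 := pick b (scalar (wlk n a s every x)) (T2 24), 25 := pick b (scalar (wlk n a s s x)) (T2 25), 26 := pick b (scalar (tri n a every x)) (T2 26), 27 := pick b (scalar (tri n a s x)) (T2 27), 28 := pick b (scalar (nbdeg n a s x)) (T2 28)))"
      using steps_Skip[OF N1(1)] by simp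
  qed (use N1 envD[OF e(2)] in auto)
  moreover have "steps' (m34) T3 N T4"
    unfolding T4_def by (rule steps_m34) (use e N1 in \<open>simp_all add: df G\<close>)
  moreover have "steps' (mP False) T4 N T5"
    using steps_mP[of dy T4 False N] e N1 unfolding T5_def by (simp add: df G wt_def jP_def jK_def)
  moreover have "steps' (mP True) T5 N T6"
    using steps_mP[of dy T5 True N] e N1 unfolding T6_def by (simp add: df G wt_def jP_def jK_def)
  moreover have "steps' (mF) T6 N T7"
    unfolding T7_def by (rule steps_mF) (use e N1 in \<open>simp_all add: df G\<close>)
  moreover have "steps' (mG) T7 N T8"
    unfolding T8_def by (rule steps_mG) (use e N1 in \<open>simp_all add: df G\<close>)
  moreover have "steps' (Cond (var 1) Skip gs) T8 N T9"
    unfolding T9_def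
  proof (rule steps_Cond_bool[where b = b])
    assume "\<not> b"
    then show "steps' gs T8 N (T8(24 := scalar (wlk n a s every x), 25 := scalar (wlk n a s s x), 26 := scalar (tri n a every x), 27 := scalar (tri n a s x), 28 := scalar (nbdeg n a s x)))"
      using steps_gs[OF e(8), of N] N1 by (simp add: df G)
  next
    assume b
    then have "T8(24 := scalar (wlk n a s every x), 25 := scalar (wlk n a s s x), 26 := scalar (tri n a every x), 27 := scalar (tri n a s x), 28 := scalar (nbdeg n a s x)) = T8"
      by (intro ext) (simp add: df)
    then show "steps' Skip T8 N (T8(24 := scalar (wlk n a s every x), 25 := scalar (wlk n a s s x), 26 := scalar (tri n a every x), 27 := scalar (tri n a s x), 28 := scalar (nbdeg n a s x)))"
      using steps_Skip[OF N1(1)] by metis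
  qed (use N1 envD[OF e(8)] in auto)
  moreover have "steps' (m41) T9 N T10"
    unfolding T10_def m41_def
    by (rule steps_scalar[OF _ _ _ _ _ _ _ ag(1)]) (use N1 in \<open>auto simp: df G envD[OF e0] m_gT scratch_def\<close>)
  moreover have "steps' (m42) T10 N T11"
    unfolding T11_def m42_def
    by (rule steps_scalar[OF _ _ _ _ _ _ _ ag(2)]) (use N1 in \<open>auto simp: df G envD[OF e0] m_gD scratch_def\<close>)
  moreover have "steps' (m43) T11 N T12"
    unfolding T12_def m43_def
    by (rule steps_scalar[OF _ _ _ _ _ _ _ ag(3)]) (use N1 in \<open>auto simp: df G envD[OF e0] m_gB_s scratch_def\<close>)
  moreover have "steps' (m44) T12 N T13"
    unfolding T13_def m44_def
    by (rule steps_scalar[OF _ _ _ _ _ _ _ ae(4)]) (use N1 in \<open>auto simp: df G envD[OF e0] m_gY scratch_def\<close>)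
  moreover have "steps' (m45) T13 N T14"
    unfolding T14_def m45_def
    by (rule steps_scalar[OF _ _ _ _ _ _ _ ag(4)]) (use N1 in \<open>auto simp: df G envD[OF e0] m_gY_s scratch_def\<close>)
  moreover have "steps' (m46) T14 N T15"
    unfolding T15_def m46_def
    by (rule steps_scalar[OF _ _ _ _ _ _ _ ae(5)]) (use N1 in \<open>auto simp: df G envD[OF e0] m_gQ cod_every_diag scratch_def\<close>)
  moreover have "steps' (m47) T15 N T16"
    unfolding T16_def m47_def
    by (rule steps_scalar[OF _ _ _ _ _ _ _ ag(5)]) (use N1 in \<open>auto simp: df G envD[OF e0] m_gQ_s scratch_def\<close>)
  moreover have "steps' (Cond (var 1) mK Skip) T16 N T17"
    unfolding T17_def
  proof (rule steps_Cond_bool[where b = b])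
    assume "\<not> b"
    then have "T16(33 := pick b (tK n a s' H) (tK n a s H)) = T16" by (intro fun_upd_idem) (simp add: df)
    then show "steps' Skip T16 N (T16(33 := pick b (tK n a s' H) (tK n a s H)))" using steps_Skip N1 by metis
  next
    assume b
    then show "steps' mK T16 N (T16(33 := pick b (tK n a s' H) (tK n a s H)))"
      by (intro steps_mK[OF e(16)]) (use N1 in \<open>simp_all add: df G\<close>)
  qed (use N1 envD[OF e(16)] in auto)
  ultimately have "steps' mark3 T N T17"
    unfolding mark3_def by - ((assumption | rule steps_Seq)+)
  moreover have "two_thirds_tables n a (pick b s' s) H T17"
    by (cases b) (auto simp: df two_thirds_tables_def jdefs wt_def G)
  moreover have "\<forall>j<20. T17 j = T j" by (auto simp: df)
  ultimately show ?thesis using envD(9)[OF e(17)] by blast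
qed

end

lemma mark3_ok: "mark_ok (light_cost 3) machine2 two_thirds_tables mark3"
  by (rule mark_okI[OF machine1.axioms(1)[OF machine2.axioms(1)]], assumption) (rule mark_ctx2.steps_mark3; (assumption | rule mark_ctx2.intro mark_ctx.intro machine2.axioms(1))+)

context status_ctx2
begin

lemma steps_status3:
  assumes e0: "senv dy T" and "two_thirds_tables n a s (pick b H H') T"
    and N: "N \<ge> of_bool b * (1 + card H) + (1 + length (nbs x))\<^sup>2"
  shows "\<exists>T'. steps' status3 T N T' \<and> two_thirds_tables n a s (pick b H' H) T' \<and> (\<forall>j<20. T' j = T j) \<and> vars_ok T'"
proof -
  have "1 + length (nbs x) \<le> (1 + length (nbs x))\<^sup>2" by (simp add: power2_eq_square)
  then have N1: "N \<ge> 1" "N \<ge> of_bool b * (1 + card H)" "N \<ge> 1 + length (nbs x)" "N \<ge> (1 + length (nbs x))\<^sup>2"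
    using N by linarith+
  have G3: "T (jK m) = pick b (tK n a (wt m s) H) (tK n a (wt m s) H')"
    "T (jP m) = pick b (tP n a s (wt m s) H) (tP n a s (wt m s) H')"
    "T (jF m) = pick b (tF n a (wt m s) H) (tF n a (wt m s) H')"
    "T (jY m) = scalar (gY n a (wt m s) s)"
    "T (jQ m) = scalar (gQ n a (wt m s) s)"
    "T 34 = pick b (tC n a s H) (tC n a s H')" "T 39 = pick b (tA n a H) (tA n a H')"
    "T 40 = pick b (tG n a s H) (tG n a s H')"
    "T 41 = scalar (gT n a s)" "T 42 = scalar (gD n a s)"
    "T 43 = scalar (gB n a s s)" for m
    using assms(2) by (cases b; simp add: two_thirds_tables_def)+
  note G = G3(6-11) G3(1)[of False, unfolded jdefs wt_def, unfolded if_False if_True] G3(1)[of True, unfolded jdefs wt_def, unfolded if_False if_True]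
    G3(2)[of False, unfolded jdefs wt_def, unfolded if_False if_True] G3(2)[of True, unfolded jdefs wt_def, unfolded if_False if_True]
    G3(3)[of False, unfolded jdefs wt_def, unfolded if_False if_True] G3(3)[of True, unfolded jdefs wt_def, unfolded if_False if_True]
    G3(4)[of False, unfolded jdefs wt_def, unfolded if_False if_True] G3(4)[of True, unfolded jdefs wt_def, unfolded if_False if_True]
    G3(5)[of False, unfolded jdefs wt_def, unfolded if_False if_True] G3(5)[of True, unfolded jdefs wt_def, unfolded if_False if_True]
  define T1 where "T1 = T(22 := scalar (cn n a s x))"
  define T2 where "T2 = T1(34 := pick b (tC n a s H') (tC n a s H))"
  define T3 where "T3 = T2(35 := pick b (tP n a s every H) (tP0 s every x H))"
  define T4 where "T4 = T3(36 := pick b (tP n a s s H) (tP0 s s x H))"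
  define T5 where "T5 = T4(35 := pick b (tP0 s every x H) (tP n a s every H))"
  define T6 where "T6 = T5(36 := pick b (tP0 s s x H) (tP n a s s H))"
  define T7 where "T7 = T6(24 := pick b (scalar (wlk n a s (lw H every) x)) (T6 24), 35 := pick b (tP n a s every H') (tP n a s every H))"
  define T8 where "T8 = T7(25 := pick b (scalar (wlk n a s (lw H s) x)) (T7 25), 36 := pick b (tP n a s s H') (tP n a s s H))"
  define T9 where "T9 = T8(37 := pick b (tF n a every H') (tF n a every H))"
  define T10 where "T10 = T9(38 := pick b (tF n a s H') (tF n a s H))"
  define T11 where "T11 = T10(39 := pick b (tA n a H') (tA n a H))"
  define T12 where "T12 = T11(40 := pick b (tG n a s H') (tG n a s H))"
  define T13 where "T13 = T12(32 := pick b (tK n a every H') (tK n a every H))"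
  define T14 where "T14 = T13(33 := pick b (tK n a s H') (tK n a s H))"
  note df = T1_def T2_def T3_def T4_def T5_def T6_def T7_def T8_def T9_def T10_def T11_def T12_def T13_def T14_def
  have e1: "senv dy T1" using e0 by (simp add: T1_def)
  have e2: "senv dy T2" using e1 by (simp add: T2_def)
  have e3: "senv dy T3" using e2 by (simp add: T3_def)
  have e4: "senv dy T4" using e3 by (simp add: T4_def)
  have e5: "senv dy T5" using e4 by (simp add: T5_def)
  have e6: "senv dy T6" using e5 by (simp add: T6_def)
  have e7: "senv dy T7"
  proof (cases b)
    case True
    then show ?thesis using e6 by (simp add: T7_def)
  next
    case False
    then have "T7 = T6" by (simp add: T7_def fun_eq_iff df G)
    then show ?thesis using e6 by simp
  qed
  have e8: "senv dy T8"
  proof (cases b)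
    case True
    then show ?thesis using e7 by (simp add: T8_def)
  next
    case False
    then have "T8 = T7" by (simp add: T8_def fun_eq_iff df G)
    then show ?thesis using e7 by simp
  qed
  have e9: "senv dy T9" using e8 by (simp add: T9_def)
  have e10: "senv dy T10" using e9 by (simp add: T10_def)
  have e11: "senv dy T11" using e10 by (simp add: T11_def)
  have e12: "senv dy T12" using e11 by (simp add: T12_def)
  have e13: "senv dy T13" using e12 by (simp add: T13_def)
  have e14: "senv dy T14" using e13 by (simp add: T14_def)
  note e = e1 e2 e3 e4 e5 e6 e7 e8 e9 e10 e11 e12 e13 e14
  have "steps' (cgather2 22 (var 2)) T N T1"
    unfolding T1_def by (rule steps_cgather2[where H = H]) (use N1 envD[OF e0] xn in auto)
  moreover have "steps' (st34) T1 N T2"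
    unfolding T2_def
  proof (rule steps_toggle)
    show "adds' b st34 T1 scratch 34 N (\<lambda>q. of_bool (q = ev I T1 (var 2)) * ev I T1 (var 22))"
      unfolding st34_def
      by (intro adds_upd_of_bool) (use N1 xn in \<open>auto simp: envD[OF e(1)] scratch_def addr1'\<close>)
    show "tC n a s H' q < W" for q
      unfolding tC_def by (intro W_bound(3) mult_le_one cn_le s_le) simp
  qed (use tC_insert[OF xn(3)] in \<open>auto simp: df G scratch_def envD[OF e0]\<close>)
  moreover have "steps' (sPclear False) T2 N T3"
    using steps_sPclear[OF e(2), of False N] N1 unfolding T3_def by (simp add: df G wt_def jP_def)
  moreover have "steps' (sPclear True) T3 N T4"
    using steps_sPclear[OF e(3), of True N] N1 unfolding T4_def by (simp add: df G wt_def jP_def)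
  moreover have "steps' (sP False) T4 N T5"
    using steps_sP[OF e(4), of False N] N1 unfolding T5_def by (simp add: df G wt_def jP_def)
  moreover have "steps' (sP True) T5 N T6"
    using steps_sP[OF e(5), of True N] N1 unfolding T6_def by (simp add: df G wt_def jP_def)
  moreover have "steps' (sPown False) T6 N T7"
  proof -
    have "pick b (T6(24 := scalar (wlk n a s (lw H every) x), 35 := tP n a s every H')) T6 = T7"
      unfolding T7_def by (cases b) (auto simp: df fun_eq_iff)
    then show ?thesis
      using steps_sPown[OF e(6), of False N] N1 by (simp add: df G wt_def jP_def jK_def jw_def)
  qed
  moreover have "steps' (sPown True) T7 N T8"
  proof -
    have "pick b (T7(25 := scalar (wlk n a s (lw H s) x), 36 := tP n a s s H')) T7 = T8"
      unfolding T8_def by (cases b) (auto simp: df fun_eq_iff)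
    then show ?thesis
      using steps_sPown[OF e(7), of True N] N1 by (simp add: df G wt_def jP_def jK_def jw_def)
  qed
  moreover have "steps' (tri_pairs_com (var 1) False (jF False) (var 2)) T8 N T9"
    using steps_sF[OF e(8), of False N] N1 unfolding T9_def by (simp add: df G wt_def jF_def)
  moreover have "steps' (tri_pairs_com (var 1) True (jF True) (var 2)) T9 N T10"
    using steps_sF[OF e(9), of True N] N1 unfolding T10_def by (simp add: df G wt_def jF_def)
  moreover have "steps' (Seq sA1 sA2) T10 N T11"
    unfolding T11_def by (rule steps_sA[OF e(10)]) (use N1 in \<open>simp_all add: df G\<close>)
  moreover have "steps' (sG) T11 N T12"
    unfolding T12_def by (rule steps_sG[OF e(11)]) (use N1 in \<open>simp_all add: df G\<close>)
  moreover have "steps' (sK False) T12 N T13"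
    using steps_sK[OF e(12), of False N] N1 unfolding T13_def by (simp add: df G wt_def jK_def)
  moreover have "steps' (sK True) T13 N T14"
    using steps_sK[OF e(13), of True N] N1 unfolding T14_def by (simp add: df G wt_def jK_def)
  ultimately have "steps' status3 T N T14"
    unfolding status3_def by - ((assumption | rule steps_Seq)+)
  moreover have "two_thirds_tables n a s (pick b H' H) T14"
    by (cases b) (auto simp: df two_thirds_tables_def jdefs wt_def G)
  moreover have "\<forall>j<20. T14 j = T j" by (auto simp: df)
  ultimately show ?thesis using envD(9)[OF e(14)] by blast
qed

end

lemma status3_ok: "status_ok 3 machine2 two_thirds_tables status3"
  by (rule status_okI[OF machine2.axioms(1)], assumption) (rule status_ctx2.steps_status3[OF status_ctx2.intro], simp_all)

section \<open>Claw and 4-clique\<close>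

definition claw_tables where
  "claw_tables n a s (H :: nat set) (T :: nat \<Rightarrow> nat \<Rightarrow> nat) \<longleftrightarrow> T 42 = scalar (gD n a s) \<and> T 50 = scalar (gR n a s)"

definition edge_claw where
  "edge_claw = Seq e42 (upd (var 1) 50 (Num 0) (Add (Mul (selE (var 2)) (Add (Mul (Num 2) (var 5)) (Num 1)))
     (Mul (selE (var 3)) (Add (Mul (Num 2) (var 6)) (Num 1)))))"

definition mark_claw where
  "mark_claw = Seq m42 (upd (var 1) 50 (Num 0) (Mul (var 5) (var 5)))"

definition clique4_tables where
  "clique4_tables n a s (H :: nat set) (T :: nat \<Rightarrow> nat \<Rightarrow> nat) \<longleftrightarrow> T 51 = scalar (gC n a s)"

definition edge_clique4 where
  "edge_clique4 = Seq (gather 22 (loop_nbs 14 15 (var 2) (upd (Num 1) 22 (Num 0)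
       (Mul (Mul (selE (var 15)) (adjE (var 15) (var 2))) (adjE (var 15) (var 3))))))
     (upd (var 1) 51 (Num 0) (Mul (Mul (Mul (Num 6) (selE (var 2))) (selE (var 3))) (var 22)))"

definition mark_clique4 where
  "mark_clique4 = Seq (gather 22 (loop_nbs 14 15 (var 2) (loop_nbs 16 17 (var 15) (upd (Num 1) 22 (Num 0)
       (Mul (Mul (selE (var 15)) (adjE (var 15) (var 2)))
         (Mul (Mul (selE (var 17)) (adjE (var 17) (var 15))) (adjE (var 17) (var 2))))))))
     (upd (var 1) 51 (Num 0) (Mul (Num 3) (var 22)))"

definition no_cost :: "inputs \<Rightarrow> nat set \<Rightarrow> nat \<Rightarrow> nat" where
  "no_cost I H w = 0"

text \<open>The cost of walking from \<open>w\<close> along all paths of two edges: one unit for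
  each neighbour and one for each neighbour of a neighbour, with multiplicity.\<close>

definition two_step_cost :: "inputs \<Rightarrow> nat set \<Rightarrow> nat \<Rightarrow> nat" where
  "two_step_cost I H w = (\<Sum>z\<in>set (in_nbs I w). 1 + length (in_nbs I z))"

context edge_ctx0
begin

lemma steps_edge_claw:
  assumes e0: "env' T" and "claw_tables n (pick b a a') s H T" and N: "N \<ge> 1"
  shows "\<exists>T'. steps' edge_claw T N T' \<and> claw_tables n (pick b a' a) s H T' \<and> (\<forall>j<20. T' j = T j) \<and> vars_ok T'"
proof -
  have G: "T 42 = scalar (pick b (gD n a s) (gD n a' s))" "T 50 = scalar (pick b (gR n a s) (gR n a' s))"
    using assms(2) by (cases b; simp add: claw_tables_def)+
  note ag = wgraph.aggregate_le[OF wgraph', of s every, OF s_le, THEN W_bound(1)]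
  define T1 where "T1 = T(42 := scalar (pick b (gD n a' s) (gD n a s)))"
  define T2 where "T2 = T1(50 := scalar (pick b (gR n a' s) (gR n a s)))"
  have "steps' e42 T N T1"
    unfolding T1_def e42_def
    by (rule steps_scalar[OF _ _ _ _ _ _ _ ag(2)]) (use N in \<open>auto simp: envD[OF e0] G gD' scratch_def\<close>)
  moreover have "steps' (upd (var 1) 50 (Num 0) (Add (Mul (selE (var 2)) (Add (Mul (Num 2) (var 5)) (Num 1)))
     (Mul (selE (var 3)) (Add (Mul (Num 2) (var 6)) (Num 1))))) T1 N T2"
    unfolding T2_def
    by (rule steps_scalar[OF _ _ _ _ _ _ _ ag(6)]) (use N in \<open>auto simp: envD[OF e0] G gR' T1_def scratch_def\<close>)
  ultimately have "steps' edge_claw T N T2" unfolding edge_claw_def by (rule steps_Seq)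
  moreover have "claw_tables n (pick b a' a) s H T2" by (cases b) (simp_all add: T1_def T2_def claw_tables_def)
  moreover have "\<forall>j<20. T2 j = T j" "vars_ok T2" using envD(9)[OF e0] by (auto simp: T1_def T2_def)
  ultimately show ?thesis by blast
qed

lemma steps_edge_clique4:
  assumes e0: "env' T" and "clique4_tables n (pick b a a') s H T" and N: "N \<ge> 1 + two_step_cost I H x"
  shows "\<exists>T'. steps' edge_clique4 T N T' \<and> clique4_tables n (pick b a' a) s H T' \<and> (\<forall>j<20. T' j = T j) \<and> vars_ok T'"
proof -
  have G: "T 51 = scalar (pick b (gC n a s) (gC n a' s))"
    using assms(2) by (cases b) (simp_all add: clique4_tables_def)
  have "(\<Sum>z\<in>set (nbs x). 1) \<le> two_step_cost I H x" unfolding two_step_cost_def by (rule sum_mono) simp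
  then have N1: "N \<ge> 1 + length (nbs x)" using N nbs_distinct[of x] by (simp add: distinct_card)
  note ag = wgraph.aggregate_le[OF wgraph', of s every, OF s_le, THEN W_bound(1)]
  define T1 where "T1 = T(22 := scalar (cod n a s x y))"
  define T2 where "T2 = T1(51 := scalar (pick b (gC n a' s) (gC n a s)))"
  have e1: "env' T1" using e0 by (simp add: T1_def)
  have v: "T1 22 0 = cod n a s x y" "T1 51 = T 51" by (simp_all add: T1_def)
  have "steps' (gather 22 (loop_nbs 14 15 (var 2) (upd (Num 1) 22 (Num 0)
       (Mul (Mul (selE (var 15)) (adjE (var 15) (var 2))) (adjE (var 15) (var 3)))))) T N T1"
    unfolding T1_def
  proof (rule steps_gather)
    show "adds' True (loop_nbs 14 15 (var 2) (upd (Num 1) 22 (Num 0)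
       (Mul (Mul (selE (var 15)) (adjE (var 15) (var 2))) (adjE (var 15) (var 3))))) T scratch 22 N
       (\<lambda>q. \<Sum>w<n. of_bool (q = 0) * (s w * a w x * a w y))"
    proof (rule scatter_nbs[where u = x])
      show "s w * a w x * a w y = 0" if "w \<notin> set (nbs x)" for w
        using a_nbs[of w x] a_sym[of w x] that by simp
    qed (use N1 S64 in \<open>auto simp: envD[OF e0] scratch_def\<close>)
    show "(\<Sum>w<n. of_bool (q = 0) * (s w * a w x * a w y)) = scalar (cod n a s x y) q" for q
      unfolding scalar_def cod_def sum_distrib_left ..
  qed (use N S64 envD(9)[OF e0] W_bound(3)[OF cod_le] s_le in auto)
  moreover have "steps' (upd (var 1) 51 (Num 0) (Mul (Mul (Mul (Num 6) (selE (var 2))) (selE (var 3))) (var 22))) T1 N T2"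
    unfolding T2_def
    by (rule steps_scalar[OF _ _ _ _ _ _ _ ag(7)]) (use N in \<open>auto simp: envD[OF e1] v G gC' scratch_def\<close>)
  ultimately have "steps' edge_clique4 T N T2" unfolding edge_clique4_def by (rule steps_Seq)
  moreover have "clique4_tables n (pick b a' a) s H T2" by (cases b) (simp_all add: T2_def clique4_tables_def)
  moreover have "\<forall>j<20. T2 j = T j" "vars_ok T2" using envD(9)[OF e1] by (auto simp: T1_def T2_def)
  ultimately show ?thesis by blast
qed

end

lemma edge_claw_ok: "edge_ok no_cost machine claw_tables edge_claw"
  by (rule edge_okI) (assumption, rule edge_ctx0.steps_edge_claw, simp_all)

lemma edge_clique4_ok: "edge_ok two_step_cost machine clique4_tables edge_clique4"
  by (rule edge_okI) (assumption, rule edge_ctx0.steps_edge_clique4, simp_all)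

context mark_ctx0
begin

lemma steps_mark_claw:
  assumes e0: "env b x (in_s I) x (dg n a x) dy H T" and "claw_tables n a (pick b s s') H T" and N: "N \<ge> 1"
  shows "\<exists>T'. steps' mark_claw T N T' \<and> claw_tables n a (pick b s' s) H T' \<and> (\<forall>j<20. T' j = T j) \<and> vars_ok T'"
proof -
  have G: "T 42 = scalar (pick b (gD n a s) (gD n a s'))" "T 50 = scalar (pick b (gR n a s) (gR n a s'))"
    using assms(2) by (cases b; simp add: claw_tables_def)+
  note ag = aggregate_le[of s' every, OF s_le', THEN W_bound(1)]
  define T1 where "T1 = T(42 := scalar (pick b (gD n a s') (gD n a s)))"
  define T2 where "T2 = T1(50 := scalar (pick b (gR n a s') (gR n a s)))"
  have "steps' m42 T N T1"
    unfolding T1_def m42_def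
    by (rule steps_scalar[OF _ _ _ _ _ _ _ ag(2)]) (use N in \<open>auto simp: envD[OF e0] G m_gD scratch_def\<close>)
  moreover have "steps' (upd (var 1) 50 (Num 0) (Mul (var 5) (var 5))) T1 N T2"
    unfolding T2_def
    by (rule steps_scalar[OF _ _ _ _ _ _ _ ag(6)]) (use N in \<open>auto simp: envD[OF e0] G m_gR T1_def scratch_def\<close>)
  ultimately have "steps' mark_claw T N T2" unfolding mark_claw_def by (rule steps_Seq)
  moreover have "claw_tables n a (pick b s' s) H T2" by (cases b) (simp_all add: T1_def T2_def claw_tables_def)
  moreover have "\<forall>j<20. T2 j = T j" "vars_ok T2" using envD(9)[OF e0] by (auto simp: T1_def T2_def)
  ultimately show ?thesis by blast
qed

lemma adds_two_step:
  assumes e0: "env b x (in_s I) x (dg n a x) dy H T" and N: "N \<ge> 1 + two_step_cost I H x"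
  shows "adds' True (loop_nbs 14 15 (var 2) (loop_nbs 16 17 (var 15) (upd (Num 1) 22 (Num 0)
       (Mul (Mul (selE (var 15)) (adjE (var 15) (var 2)))
         (Mul (Mul (selE (var 17)) (adjE (var 17) (var 15))) (adjE (var 17) (var 2))))))) T scratch 22 N
     (scalar (\<Sum>u<n. s u * a u x * cod n a s u x))" (is "adds' True ?c T scratch 22 N ?e")
proof -
  let ?V = "\<lambda>u z. s u * a u x * (s z * a z u * a z x)"
  have "adds' True ?c T scratch 22 N
    (\<lambda>q. \<Sum>u\<in>set (nbs x). \<Sum>z\<in>set (nbs u). of_bool (q = 0) * ?V u z)"
  proof (rule adds_loop_nbs[where Nb = "\<lambda>w. 1 + length (nbs w)" and R = "{16, 17}" and u = x])
    fix u and f g :: "nat \<Rightarrow> nat" assume u: "u \<in> set (nbs x)" "f 0 = u"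
    show "adds' True (loop_nbs 16 17 (var 15) (upd (Num 1) 22 (Num 0)
       (Mul (Mul (selE (var 15)) (adjE (var 15) (var 2)))
         (Mul (Mul (selE (var 17)) (adjE (var 17) (var 15))) (adjE (var 17) (var 2))))))
       (T(14 := g, 15 := f)) {16, 17} 22 (1 + length (nbs u))
       (\<lambda>q. \<Sum>z\<in>set (nbs u). of_bool (q = 0) * ?V u z)"
    proof (rule adds_loop_nbs[where Nb = "\<lambda>_. 1" and R = "{}" and u = u])
      fix z and f' g' :: "nat \<Rightarrow> nat" assume z: "z \<in> set (nbs u)" "f' 0 = z"
      let ?T = "T(14 := g, 15 := f, 16 := g', 17 := f')"
      let ?v = "Mul (Mul (selE (var 15)) (adjE (var 15) (var 2)))
         (Mul (Mul (selE (var 17)) (adjE (var 17) (var 15))) (adjE (var 17) (var 2)))"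
      have e: "ev I ?T ?v = ?V u z" using u z by (simp add: envD[OF e0])
      have "adds' True (upd (Num 1) 22 (Num 0) ?v) ?T {} 22 1 (\<lambda>q. of_bool (q = ev I ?T (Num 0)) * ev I ?T ?v)"
        by (rule adds_upd_of_bool) (use S64 in auto)
      then show "adds' True (upd (Num 1) 22 (Num 0) ?v) ?T {} 22 1 (\<lambda>q. of_bool (q = 0) * ?V u z)"
        unfolding e by simp
    qed (use u nbs_distinct[of u] in \<open>auto simp: distinct_card\<close>)
  qed (use N in \<open>auto simp: scratch_def two_step_cost_def envD[OF e0]\<close>)
  then show ?thesis
  proof (rule adds_mono)
    fix q :: nat
    have "(\<Sum>z\<in>set (nbs u). of_bool (q = 0) * ?V u z) = (\<Sum>z<n. of_bool (q = 0) * ?V u z)" for u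
    proof (rule sum.mono_neutral_left)
      show "\<forall>z\<in>{..<n} - set (nbs u). of_bool (q = 0) * ?V u z = 0"
        using a_nbs[of _ u] a_sym[of _ u] by simp
    qed (use nbs_less in auto)
    then have "(\<Sum>u\<in>set (nbs x). \<Sum>z\<in>set (nbs u). of_bool (q = 0) * ?V u z) = (\<Sum>u\<in>set (nbs x). \<Sum>z<n. of_bool (q = 0) * ?V u z)"
      by (simp only:)
    also have "\<dots> = (\<Sum>u<n. \<Sum>z<n. of_bool (q = 0) * ?V u z)"
    proof (rule sum.mono_neutral_left)
      show "\<forall>u\<in>{..<n} - set (nbs x). (\<Sum>z<n. of_bool (q = 0) * ?V u z) = 0"
        using a_nbs[of _ x] a_sym[of _ x] by simp
    qed (use nbs_less in auto)
    also have "\<dots> = ?e q" unfolding scalar_def cod_def sum_distrib_left ..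
    finally show "(\<Sum>u\<in>set (nbs x). \<Sum>z\<in>set (nbs u). of_bool (q = 0) * ?V u z) = ?e q" .
  qed simp
qed

lemma steps_mark_clique4:
  assumes e0: "env b x (in_s I) x (dg n a x) dy H T" and "clique4_tables n a (pick b s s') H T"
    and N: "N \<ge> 1 + two_step_cost I H x"
  shows "\<exists>T'. steps' mark_clique4 T N T' \<and> clique4_tables n a (pick b s' s) H T' \<and> (\<forall>j<20. T' j = T j) \<and> vars_ok T'"
proof -
  have G: "T 51 = scalar (pick b (gC n a s) (gC n a s'))"
    using assms(2) by (cases b) (simp_all add: clique4_tables_def)
  have N1: "N \<ge> 1" using N by simp
  note ag = aggregate_le[of s' every, OF s_le', THEN W_bound(1)]
  let ?v = "\<Sum>u<n. s u * a u x * cod n a s u x"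
  have vW: "?v < W"
    by (intro W_bound(2) sum_le_mult) (simp only: mult.assoc, intro mult_le_one s_le a_le cod_le)
  define T1 where "T1 = T(22 := scalar ?v)"
  define T2 where "T2 = T1(51 := scalar (pick b (gC n a s') (gC n a s)))"
  have e1: "env b x (in_s I) x (dg n a x) dy H T1" using e0 by (simp add: T1_def)
  have v: "T1 22 0 = ?v" "T1 51 = T 51" by (simp_all add: T1_def)
  note gt = steps_gather[OF adds_two_step[OF e0 N] _ _ N1 S64 envD(9)[OF e0] refl vW, folded T1_def]
  have "steps' (upd (var 1) 51 (Num 0) (Mul (Num 3) (var 22))) T1 N T2"
    unfolding T2_def
    by (rule steps_scalar[OF _ _ _ _ _ _ _ ag(7)]) (use N1 in \<open>auto simp: envD[OF e1] v G m_gC scratch_def\<close>)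
  then have "steps' mark_clique4 T N T2" unfolding mark_clique4_def by (intro steps_Seq[OF gt]) simp_all
  moreover have "clique4_tables n a (pick b s' s) H T2" by (cases b) (simp_all add: T2_def clique4_tables_def)
  moreover have "\<forall>j<20. T2 j = T j" "vars_ok T2" using envD(9)[OF e1] by (auto simp: T1_def T2_def)
  ultimately show ?thesis by blast
qed

end

lemma mark_claw_ok: "mark_ok no_cost machine claw_tables mark_claw"
  by (rule mark_okI) (assumption, rule mark_ctx0.steps_mark_claw, simp_all)

lemma mark_clique4_ok: "mark_ok two_step_cost machine clique4_tables mark_clique4"
  by (rule mark_okI) (assumption, rule mark_ctx0.steps_mark_clique4, simp_all)

section \<open>Subgraph counts as numbers of embeddings\<close>

lemma isomorphic_graphs_sym:
  assumes "isomorphic_graphs P Q" "simple_graph P"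
  shows "isomorphic_graphs Q P"
proof -
  obtain f where f: "bij_betw f (fst P) (fst Q)" "(\<lambda>e. f ` e) ` snd P = snd Q"
    using assms(1) by (auto simp: isomorphic_graphs_def)
  let ?g = "inv_into (fst P) f"
  have "(\<lambda>e. ?g ` e) ` snd Q = snd P"
  proof -
    have "?g ` f ` e = e" if "e \<in> snd P" for e
      using that assms(2) f(1) inv_into_image_cancel[of f "fst P" e] by (auto simp: simple_graph_def bij_betw_def)
    then have "(\<lambda>e. ?g ` f ` e) ` snd P = snd P" by simp
    then show ?thesis unfolding f(2)[symmetric] by (simp add: image_image)
  qed
  then show ?thesis using bij_betw_inv_into[OF f(1)] by (auto simp: isomorphic_graphs_def)
qed

lemma isomorphic_graphs_trans:
  assumes "isomorphic_graphs P Q" "isomorphic_graphs Q R"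
  shows "isomorphic_graphs P R"
proof -
  obtain f where f: "bij_betw f (fst P) (fst Q)" "(\<lambda>e. f ` e) ` snd P = snd Q"
    using assms(1) unfolding isomorphic_graphs_def by (elim exE conjE)
  obtain g where g: "bij_betw g (fst Q) (fst R)" "(\<lambda>e. g ` e) ` snd Q = snd R"
    using assms(2) unfolding isomorphic_graphs_def by (elim exE conjE)
  have "(\<lambda>e. (g \<circ> f) ` e) ` snd P = (\<lambda>e. g ` e) ` (\<lambda>e. f ` e) ` snd P"
    unfolding image_image[of "\<lambda>e. g ` e"] by (simp only: image_comp[of g f])
  then show ?thesis unfolding isomorphic_graphs_def f(2) g(2)
    by (intro exI[of _ "g \<circ> f"] conjI bij_betw_trans[OF f(1) g(1)])
qed

lemma s_subgraph_count_iso: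
  fixes G :: "'c ugraph"
  assumes "isomorphic_graphs P Q" "simple_graph P"
  shows "s_subgraph_count G P s = s_subgraph_count G Q s"
proof -
  have "isomorphic_graphs H P \<longleftrightarrow> isomorphic_graphs H Q" for H :: "'c ugraph"
    using isomorphic_graphs_trans[OF _ assms(1), of H]
      isomorphic_graphs_trans[OF _ isomorphic_graphs_sym[OF assms], of H] by (rule iffI)
  then show ?thesis by (simp add: s_subgraph_count_def)
qed

section \<open>Embeddings as lists\<close>

definition edges_of :: "(nat \<times> nat) list \<Rightarrow> nat set set" where
  "edges_of es = (\<lambda>(i, j). {i, j}) ` set es"

definition pat :: "nat \<Rightarrow> (nat \<times> nat) list \<Rightarrow> nat ugraph" where
  "pat k es = ({..<k}, edges_of es)"

text \<open>Injective homomorphisms, written as the lists of the images of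
  \<open>0, ..., k - 1\<close>. Non-edges impose no condition, because subgraphs need not be
  induced.\<close>

definition emb :: "nat \<Rightarrow> (nat \<times> nat) list \<Rightarrow> 'a ugraph \<Rightarrow> 'a list set" where
  "emb k es G = {xs. length xs = k \<and> distinct xs \<and> set xs \<subseteq> fst G \<and> (\<forall>(i, j)\<in>set es. {xs ! i, xs ! j} \<in> snd G)}"

lemma finite_emb: "finite (fst G) \<Longrightarrow> finite (emb k es G)"
  by (rule finite_subset[OF _ finite_lists_length_eq[of "fst G" k]]) (auto simp: emb_def)

definition copy :: "(nat \<times> nat) list \<Rightarrow> 'a list \<Rightarrow> 'a ugraph" where
  "copy es xs = (set xs, (\<lambda>(i, j). {xs ! i, xs ! j}) ` set es)"

context
  fixes k :: nat and es :: "(nat \<times> nat) list"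
  assumes es: "\<And>i j. (i, j) \<in> set es \<Longrightarrow> i < k \<and> j < k \<and> i \<noteq> j"
begin

lemma copy_iso:
  assumes "xs \<in> emb k es G"
  shows "isomorphic_graphs (copy es xs) (pat k es)"
proof -
  have xs: "length xs = k" "distinct xs" using assms by (auto simp: emb_def)
  let ?f = "inv_into {..<k} ((!) xs)"
  have b: "bij_betw ((!) xs) {..<k} (set xs)" using bij_betw_nth[OF xs(2) _ refl] xs(1) by simp
  have inj: "inj_on ((!) xs) {..<k}" using b by (simp add: bij_betw_def)
  have fi: "?f (xs ! i) = i" if "i < k" for i using inj that by (simp add: inv_into_f_f)
  have "(\<lambda>e. ?f ` e) ` (\<lambda>(i, j). {xs ! i, xs ! j}) ` set es = edges_of es"
    unfolding edges_of_def image_image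
  proof (rule image_cong)
    fix p assume "p \<in> set es"
    then have "fst p < k" "snd p < k" using es[of "fst p" "snd p"] by auto
    then show "?f ` (case p of (i, j) \<Rightarrow> {xs ! i, xs ! j}) = (case p of (i, j) \<Rightarrow> {i, j})"
      by (simp add: split_def fi)
  qed simp
  then show ?thesis using bij_betw_inv_into[OF b]
    by (auto simp: isomorphic_graphs_def copy_def pat_def)
qed

lemma copy_subgraph:
  assumes "xs \<in> emb k es G" "simple_graph G"
  shows "subgraph_of (copy es xs) G"
proof -
  have xs: "length xs = k" "distinct xs" "set xs \<subseteq> fst G" using assms by (auto simp: emb_def)
  have "{xs ! i, xs ! j} \<subseteq> set xs \<and> card {xs ! i, xs ! j} = 2" if "(i, j) \<in> set es" for i j
    using es[OF that] xs by (auto simp: nth_eq_iff_index_eq)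
  then show ?thesis using assms by (auto simp: subgraph_of_def simple_graph_def copy_def emb_def)
qed

text \<open>An injective map of the finite edge set into itself is onto, so an embedding of the
  pattern into itself is an automorphism.\<close>

lemma emb_pat_copy:
  assumes "xs \<in> emb k es (pat k es)"
  shows "copy es xs = pat k es"
proof -
  have xs: "length xs = k" "distinct xs" "set xs \<subseteq> {..<k}" using assms by (auto simp: emb_def pat_def)
  have s: "set xs = {..<k}"
    using xs distinct_card[OF xs(2)] by (intro card_subset_eq) auto
  let ?F = "\<lambda>e. (!) xs ` e"
  have inj: "inj_on ((!) xs) {..<k}" using xs by (auto simp: inj_on_def nth_eq_iff_index_eq)
  have "inj_on ?F (edges_of es)"
    by (rule inj_on_subset[OF inj_on_image_Pow[OF inj]]) (use es in \<open>auto simp: edges_of_def\<close>)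
  moreover have "?F ` edges_of es \<subseteq> edges_of es"
    using assms by (auto simp: emb_def pat_def edges_of_def)
  ultimately have "?F ` edges_of es = edges_of es"
    by (intro endo_inj_surj) (auto simp: edges_of_def)
  moreover have "?F ` edges_of es = (\<lambda>(i, j). {xs ! i, xs ! j}) ` set es"
    unfolding edges_of_def image_image by (rule image_cong) auto
  ultimately show ?thesis using s by (simp add: copy_def pat_def)
qed

text \<open>With one isomorphism \<open>g\<close> from the pattern onto \<open>H\<close> fixed, the
  embeddings with image \<open>H\<close> are exactly the compositions of \<open>g\<close> with
  automorphisms of the pattern.\<close>

lemma card_fiber:
  assumes H: "isomorphic_graphs H (pat k es)" "subgraph_of H G"
  shows "card {xs \<in> emb k es G. copy es xs = H} = card (emb k es (pat k es))"
proof -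
  obtain f where f: "bij_betw f (fst H) {..<k}" "(\<lambda>e. f ` e) ` snd H = edges_of es"
    using H(1) by (auto simp: isomorphic_graphs_def pat_def)
  define g where "g = inv_into (fst H) f"
  have g: "bij_betw g {..<k} (fst H)" unfolding g_def using bij_betw_inv_into[OF f(1)] .
  have gf: "g (f v) = v" if "v \<in> fst H" for v
    unfolding g_def using f(1) that by (simp add: bij_betw_def)
  have fg: "f (g i) = i" if "i < k" for i
    unfolding g_def using f(1) that by (auto simp: bij_betw_def f_inv_into_f)
  have HV: "e \<subseteq> fst H" if "e \<in> snd H" for e
    using H(2) that by (auto simp: subgraph_of_def simple_graph_def)
  have gE: "(\<lambda>e. g ` e) ` edges_of es = snd H"
  proof -
    have "g ` f ` e = e" if "e \<in> snd H" for e using gf HV[OF that] by force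
    then have "(\<lambda>e. g ` f ` e) ` snd H = snd H" by simp
    then show ?thesis unfolding f(2)[symmetric] by (simp add: image_image)
  qed
  have gm: "map g xs \<in> {xs \<in> emb k es G. copy es xs = H}" if x: "xs \<in> emb k es (pat k es)" for xs
  proof -
    have xs: "length xs = k" "distinct xs" "set xs \<subseteq> {..<k}" using x by (auto simp: emb_def pat_def)
    have c: "set xs = {..<k}" "(\<lambda>(i, j). {xs ! i, xs ! j}) ` set es = edges_of es"
      using emb_pat_copy[OF x] by (auto simp: copy_def pat_def)
    have "(\<lambda>(i, j). {map g xs ! i, map g xs ! j}) ` set es = (\<lambda>e. g ` e) ` (\<lambda>(i, j). {xs ! i, xs ! j}) ` set es"
      unfolding image_image by (rule image_cong) (use es xs(1) in auto)
    then have e: "(\<lambda>(i, j). {map g xs ! i, map g xs ! j}) ` set es = snd H" unfolding c gE .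
    have sg: "set (map g xs) = fst H" using g c by (simp add: bij_betw_def)
    have "distinct (map g xs)" using g xs c by (simp add: distinct_map bij_betw_def)
    moreover have "{map g xs ! i, map g xs ! j} \<in> snd G" if "(i, j) \<in> set es" for i j
      using e that H(2) by (auto simp: subgraph_of_def)
    moreover have "set (map g xs) \<subseteq> fst G" unfolding sg using H(2) by (auto simp: subgraph_of_def)
    ultimately have "map g xs \<in> emb k es G" unfolding emb_def using xs(1) by auto
    moreover have "copy es (map g xs) = H" unfolding copy_def e sg by simp
    ultimately show ?thesis by simp
  qed
  have fm: "map f ys \<in> emb k es (pat k es)" "map g (map f ys) = ys" if y: "ys \<in> {xs \<in> emb k es G. copy es xs = H}" for ys
  proof -
    have ys: "length ys = k" "distinct ys" "set ys = fst H" "(\<lambda>(i, j). {ys ! i, ys ! j}) ` set es = snd H"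
      using y by (auto simp: emb_def copy_def)
    have "distinct (map f ys)" using f(1) ys by (simp add: distinct_map bij_betw_def)
    moreover have "set (map f ys) \<subseteq> {..<k}" using f(1) ys by (simp add: bij_betw_def)
    moreover have "{map f ys ! i, map f ys ! j} \<in> edges_of es" if "(i, j) \<in> set es" for i j
    proof -
      have "{ys ! i, ys ! j} \<in> snd H" using ys(4) that by auto
      then have "f ` {ys ! i, ys ! j} \<in> edges_of es" using f(2) by blast
      then show ?thesis using es[OF that] ys(1) by simp
    qed
    ultimately show "map f ys \<in> emb k es (pat k es)" using ys(1) by (auto simp: emb_def pat_def)
    show "map g (map f ys) = ys" unfolding map_map by (rule map_idI) (simp add: gf ys(3))
  qed
  have "bij_betw (map g) (emb k es (pat k es)) {xs \<in> emb k es G. copy es xs = H}"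
  proof (rule bij_betw_byWitness[where f' = "map f"])
    show "\<forall>xs\<in>emb k es (pat k es). map f (map g xs) = xs"
      using fg by (auto simp: emb_def pat_def intro!: map_idI)
  qed (use gm fm in auto)
  then show ?thesis by (simp add: bij_betw_same_card)
qed

text \<open>The embeddings that meet \<open>s\<close> are partitioned by their images, and all
  classes have the size given by \<open>card_fiber\<close>.\<close>

lemma count_emb:
  assumes G: "simple_graph G"
  shows "card {xs \<in> emb k es G. s \<in> set xs} = card (emb k es (pat k es)) * s_subgraph_count G (pat k es) s"
proof -
  let ?C = "{H. subgraph_of H G \<and> isomorphic_graphs H (pat k es) \<and> s \<in> fst H}"
  have fin: "finite (fst G)" using G by (simp add: simple_graph_def)
  have finC: "finite ?C"
  proof (rule finite_subset)
    have "finite (snd G)" using G finite_subset[of "snd G" "Pow (fst G)"] by (auto simp: simple_graph_def)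
    then show "finite (Pow (fst G) \<times> Pow (snd G))" using fin by simp
  qed (auto simp: subgraph_of_def)
  have "{xs \<in> emb k es G. s \<in> set xs} = (\<Union>H\<in>?C. {xs \<in> emb k es G. copy es xs = H})"
  proof (intro equalityI subsetI)
    fix xs assume "xs \<in> {xs \<in> emb k es G. s \<in> set xs}"
    then show "xs \<in> (\<Union>H\<in>?C. {xs \<in> emb k es G. copy es xs = H})"
      using copy_subgraph[of xs G] copy_iso[of xs G] G by (auto simp: copy_def)
  qed (auto simp: copy_def)
  also have "card \<dots> = (\<Sum>H\<in>?C. card {xs \<in> emb k es G. copy es xs = H})"
    by (rule card_UN_disjoint) (use finC finite_emb[OF fin, of k es] in auto)
  also have "\<dots> = (\<Sum>H\<in>?C. card (emb k es (pat k es)))"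
    by (rule sum.cong[OF refl]) (rule card_fiber, simp_all)
  finally show ?thesis by (simp add: s_subgraph_count_def)
qed

end

text \<open>Turns the number of automorphisms into a filter over an explicit list of tuples, which
  can be evaluated.\<close>

lemma card_aut:
  "card (emb k es (pat k es)) = length (filter (\<lambda>xs. list_all (\<lambda>(i, j). (xs ! i, xs ! j) \<in> set es \<or>
     (xs ! j, xs ! i) \<in> set es) es) (filter distinct (List.n_lists k [0..<k])))"
proof -
  have d: "distinct (filter distinct (List.n_lists k [0..<k]))" by (intro distinct_filter distinct_n_lists) simp
  have "emb k es (pat k es) = set (filter (\<lambda>xs. list_all (\<lambda>(i, j). (xs ! i, xs ! j) \<in> set es \<or>
     (xs ! j, xs ! i) \<in> set es) es) (filter distinct (List.n_lists k [0..<k])))"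
  proof -
    have e: "{i, j} \<in> edges_of es \<longleftrightarrow> (i, j) \<in> set es \<or> (j, i) \<in> set es" for i j
      unfolding edges_of_def by (force simp: doubleton_eq_iff)
    have h: "(\<forall>(i, j)\<in>set es. {xs ! i, xs ! j} \<in> edges_of es) \<longleftrightarrow> list_all (\<lambda>(i, j). (xs ! i, xs ! j) \<in> set es \<or>
     (xs ! j, xs ! i) \<in> set es) es" for xs
      unfolding e list_all_iff ..
    show ?thesis unfolding emb_def pat_def fst_conv snd_conv set_filter set_n_lists h set_upt atLeast0LessThan
      by blast
  qed
  then show ?thesis by (simp only: distinct_card[OF distinct_filter[OF d]])
qed

section \<open>Embeddings through the source as iterated sums\<close>

lemma card_lists4:
  "card {xs. length xs = 4 \<and> set xs \<subseteq> {..<n} \<and> Q (xs ! 0) (xs ! 1) (xs ! 2) (xs ! 3)}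
    = (\<Sum>p<n. \<Sum>q<n. \<Sum>r<n. \<Sum>t<n. of_bool (Q p q r t))" for n :: nat
proof -
  let ?A = "{..<n} \<times> {..<n} \<times> {..<n} \<times> {..<n}"
  have "(\<Sum>p<n. \<Sum>q<n. \<Sum>r<n. \<Sum>t<n. of_bool (Q p q r t)) = (\<Sum>x\<in>?A. of_bool (case x of (p, q, r, t) \<Rightarrow> Q p q r t))"
    by (simp add: sum.cartesian_product split_def)
  also have "\<dots> = card {x \<in> ?A. case x of (p, q, r, t) \<Rightarrow> Q p q r t}"
    by (simp add: Int_def)
  also have "\<dots> = card {xs. length xs = 4 \<and> set xs \<subseteq> {..<n} \<and> Q (xs ! 0) (xs ! 1) (xs ! 2) (xs ! 3)}"
  proof (rule bij_betw_same_card[of "\<lambda>(p, q, r, t). [p, q, r, t]"],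
      rule bij_betw_byWitness[where f' = "\<lambda>xs. (xs ! 0, xs ! 1, xs ! 2, xs ! 3)"])
    show "\<forall>xs\<in>{xs. length xs = 4 \<and> set xs \<subseteq> {..<n} \<and> Q (xs ! 0) (xs ! 1) (xs ! 2) (xs ! 3)}.
       (case (xs ! 0, xs ! 1, xs ! 2, xs ! 3) of (p, q, r, t) \<Rightarrow> [p, q, r, t]) = xs"
      by (auto simp: numeral_eq_Suc length_Suc_conv)
    show "(\<lambda>xs. (xs ! 0, xs ! 1, xs ! 2, xs ! 3)) `
       {xs. length xs = 4 \<and> set xs \<subseteq> {..<n} \<and> Q (xs ! 0) (xs ! 1) (xs ! 2) (xs ! 3)}
       \<subseteq> {x \<in> ?A. case x of (p, q, r, t) \<Rightarrow> Q p q r t}"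
      by (auto simp: numeral_eq_Suc length_Suc_conv)
  qed auto
  finally show ?thesis by simp
qed

lemma card_lists3:
  "card {xs. length xs = 3 \<and> set xs \<subseteq> {..<n} \<and> Q (xs ! 0) (xs ! 1) (xs ! 2)}
    = (\<Sum>p<n. \<Sum>q<n. \<Sum>r<n. of_bool (Q p q r))" for n :: nat
proof -
  let ?A = "{..<n} \<times> {..<n} \<times> {..<n}"
  have "(\<Sum>p<n. \<Sum>q<n. \<Sum>r<n. of_bool (Q p q r)) = (\<Sum>x\<in>?A. of_bool (case x of (p, q, r) \<Rightarrow> Q p q r))"
    by (simp add: sum.cartesian_product split_def)
  also have "\<dots> = card {x \<in> ?A. case x of (p, q, r) \<Rightarrow> Q p q r}"
    by (simp add: Int_def)
  also have "\<dots> = card {xs. length xs = 3 \<and> set xs \<subseteq> {..<n} \<and> Q (xs ! 0) (xs ! 1) (xs ! 2)}"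
  proof (rule bij_betw_same_card[of "\<lambda>(p, q, r). [p, q, r]"],
      rule bij_betw_byWitness[where f' = "\<lambda>xs. (xs ! 0, xs ! 1, xs ! 2)"])
    show "\<forall>xs\<in>{xs. length xs = 3 \<and> set xs \<subseteq> {..<n} \<and> Q (xs ! 0) (xs ! 1) (xs ! 2)}.
       (case (xs ! 0, xs ! 1, xs ! 2) of (p, q, r) \<Rightarrow> [p, q, r]) = xs"
      by (auto simp: numeral_eq_Suc length_Suc_conv)
    show "(\<lambda>xs. (xs ! 0, xs ! 1, xs ! 2)) `
       {xs. length xs = 3 \<and> set xs \<subseteq> {..<n} \<and> Q (xs ! 0) (xs ! 1) (xs ! 2)}
       \<subseteq> {x \<in> ?A. case x of (p, q, r) \<Rightarrow> Q p q r}"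
      by (auto simp: numeral_eq_Suc length_Suc_conv)
  qed auto
  finally show ?thesis by simp
qed

lemma sum_at: "s < n \<Longrightarrow> (\<Sum>p<n::nat. of_bool (p = s) * F p) = (F s :: nat)"
  by (simp add: sum_point')

lemma split_position4:
  fixes s n :: nat and F :: "nat \<Rightarrow> nat \<Rightarrow> nat \<Rightarrow> nat \<Rightarrow> nat"
  assumes "s < n"
  shows "(\<Sum>p<n. \<Sum>q<n. \<Sum>r<n. \<Sum>t<n. (of_bool (p = s) + of_bool (q = s) + of_bool (r = s) + of_bool (t = s)) * F p q r t)
    = (\<Sum>p<n. \<Sum>q<n. \<Sum>r<n. F s p q r) + (\<Sum>p<n. \<Sum>q<n. \<Sum>r<n. F p s q r)
    + (\<Sum>p<n. \<Sum>q<n. \<Sum>r<n. F p q s r) + (\<Sum>p<n. \<Sum>q<n. \<Sum>r<n. F p q r s)"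
proof -
  have "(\<Sum>p<n. \<Sum>q<n. \<Sum>r<n. \<Sum>t<n. of_bool (p = s) * F p q r t) = (\<Sum>p<n. \<Sum>q<n. \<Sum>r<n. F s p q r)"
    unfolding sum_distrib_left[symmetric] by (rule sum_at[OF assms])
  moreover have "(\<Sum>p<n. \<Sum>q<n. \<Sum>r<n. \<Sum>t<n. of_bool (q = s) * F p q r t) = (\<Sum>p<n. \<Sum>q<n. \<Sum>r<n. F p s q r)"
    unfolding sum_distrib_left[symmetric] by (simp only: sum_at[OF assms])
  moreover have "(\<Sum>p<n. \<Sum>q<n. \<Sum>r<n. \<Sum>t<n. of_bool (r = s) * F p q r t) = (\<Sum>p<n. \<Sum>q<n. \<Sum>r<n. F p q s r)"
    unfolding sum_distrib_left[symmetric] by (simp only: sum_at[OF assms])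
  moreover have "(\<Sum>p<n. \<Sum>q<n. \<Sum>r<n. \<Sum>t<n. of_bool (t = s) * F p q r t) = (\<Sum>p<n. \<Sum>q<n. \<Sum>r<n. F p q r s)"
    by (simp only: sum_at[OF assms])
  ultimately show ?thesis by (simp only: add_mult_distrib sum.distrib)
qed

lemma split_position3:
  fixes s n :: nat and F :: "nat \<Rightarrow> nat \<Rightarrow> nat \<Rightarrow> nat"
  assumes "s < n"
  shows "(\<Sum>p<n. \<Sum>q<n. \<Sum>r<n. (of_bool (p = s) + of_bool (q = s) + of_bool (r = s)) * F p q r)
    = (\<Sum>p<n. \<Sum>q<n. F s p q) + (\<Sum>p<n. \<Sum>q<n. F p s q) + (\<Sum>p<n. \<Sum>q<n. F p q s)"
proof -
  have "(\<Sum>p<n. \<Sum>q<n. \<Sum>r<n. of_bool (p = s) * F p q r) = (\<Sum>p<n. \<Sum>q<n. F s p q)"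
    unfolding sum_distrib_left[symmetric] by (rule sum_at[OF assms])
  moreover have "(\<Sum>p<n. \<Sum>q<n. \<Sum>r<n. of_bool (q = s) * F p q r) = (\<Sum>p<n. \<Sum>q<n. F p s q)"
    unfolding sum_distrib_left[symmetric] by (simp only: sum_at[OF assms])
  moreover have "(\<Sum>p<n. \<Sum>q<n. \<Sum>r<n. of_bool (r = s) * F p q r) = (\<Sum>p<n. \<Sum>q<n. F p q s)"
    by (simp only: sum_at[OF assms])
  ultimately show ?thesis by (simp only: add_mult_distrib sum.distrib)
qed

lemma count_pat4:
  assumes E: "simple_edges n E" and s: "s < n" and es: "\<And>i j. (i, j) \<in> set es \<Longrightarrow> i < 4 \<and> j < 4 \<and> i \<noteq> j"
    and Q: "\<And>p q r t. Q p q r t \<longleftrightarrow> distinct [p, q, r, t] \<and> (\<forall>(i, j)\<in>set es. {[p, q, r, t] ! i, [p, q, r, t] ! j} \<in> E)"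
  shows "card (emb 4 es (pat 4 es)) * s_subgraph_count ({..<n}, E) (pat 4 es) s
    = (\<Sum>p<n. \<Sum>q<n. \<Sum>r<n. of_bool (Q s p q r)) + (\<Sum>p<n. \<Sum>q<n. \<Sum>r<n. of_bool (Q p s q r))
    + (\<Sum>p<n. \<Sum>q<n. \<Sum>r<n. of_bool (Q p q s r)) + (\<Sum>p<n. \<Sum>q<n. \<Sum>r<n. of_bool (Q p q r s))"
proof -
  have G: "simple_graph ({..<n}, E)" using E by (auto simp: simple_graph_def simple_edges_def)
  have "{xs \<in> emb 4 es ({..<n}, E). s \<in> set xs} = {xs. length xs = 4 \<and> set xs \<subseteq> {..<n} \<and>
     (Q (xs ! 0) (xs ! 1) (xs ! 2) (xs ! 3) \<and> (xs ! 0 = s \<or> xs ! 1 = s \<or> xs ! 2 = s \<or> xs ! 3 = s))}"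
  proof -
    have l: "xs = [xs ! 0, xs ! 1, xs ! 2, xs ! 3]" if "length xs = 4" for xs :: "nat list"
      using that by (auto simp: numeral_eq_Suc length_Suc_conv)
    have "xs \<in> emb 4 es ({..<n}, E) \<and> s \<in> set xs \<longleftrightarrow> length xs = 4 \<and> set xs \<subseteq> {..<n} \<and>
     (Q (xs ! 0) (xs ! 1) (xs ! 2) (xs ! 3) \<and> (xs ! 0 = s \<or> xs ! 1 = s \<or> xs ! 2 = s \<or> xs ! 3 = s))" for xs
    proof (cases "length xs = 4")
      case True
      have "s \<in> set xs \<longleftrightarrow> xs ! 0 = s \<or> xs ! 1 = s \<or> xs ! 2 = s \<or> xs ! 3 = s"
        by (subst l[OF True]) auto
      then show ?thesis unfolding Q l[OF True, symmetric] emb_def using True by auto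
    qed (simp add: emb_def)
    then show ?thesis by blast
  qed
  then have "card {xs \<in> emb 4 es ({..<n}, E). s \<in> set xs} = (\<Sum>p<n. \<Sum>q<n. \<Sum>r<n. \<Sum>t<n.
     of_bool (Q p q r t \<and> (p = s \<or> q = s \<or> r = s \<or> t = s)))"
    by (simp only: card_lists4[of n "\<lambda>p q r t. Q p q r t \<and> (p = s \<or> q = s \<or> r = s \<or> t = s)"])
  \<comment> \<open>\<open>Q\<close> makes the four vertices distinct, so at most one of them is the
    source and the disjunction becomes a sum.\<close>
  also have "\<dots> = (\<Sum>p<n. \<Sum>q<n. \<Sum>r<n. \<Sum>t<n.
     (of_bool (p = s) + of_bool (q = s) + of_bool (r = s) + of_bool (t = s)) * of_bool (Q p q r t))"
    by (intro sum.cong refl) (auto simp: Q)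
  also have "card {xs \<in> emb 4 es ({..<n}, E). s \<in> set xs}
    = card (emb 4 es (pat 4 es)) * s_subgraph_count ({..<n}, E) (pat 4 es) s"
    by (rule count_emb[OF _ G]) (rule es)
  finally show ?thesis unfolding split_position4[OF s] .
qed

lemma count_pat3:
  assumes E: "simple_edges n E" and s: "s < n" and es: "\<And>i j. (i, j) \<in> set es \<Longrightarrow> i < 3 \<and> j < 3 \<and> i \<noteq> j"
    and Q: "\<And>p q r. Q p q r \<longleftrightarrow> distinct [p, q, r] \<and> (\<forall>(i, j)\<in>set es. {[p, q, r] ! i, [p, q, r] ! j} \<in> E)"
  shows "card (emb 3 es (pat 3 es)) * s_subgraph_count ({..<n}, E) (pat 3 es) s
    = (\<Sum>p<n. \<Sum>q<n. of_bool (Q s p q)) + (\<Sum>p<n. \<Sum>q<n. of_bool (Q p s q)) + (\<Sum>p<n. \<Sum>q<n. of_bool (Q p q s))"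
proof -
  have G: "simple_graph ({..<n}, E)" using E by (auto simp: simple_graph_def simple_edges_def)
  have "{xs \<in> emb 3 es ({..<n}, E). s \<in> set xs} = {xs. length xs = 3 \<and> set xs \<subseteq> {..<n} \<and>
     (Q (xs ! 0) (xs ! 1) (xs ! 2) \<and> (xs ! 0 = s \<or> xs ! 1 = s \<or> xs ! 2 = s))}"
  proof -
    have l: "xs = [xs ! 0, xs ! 1, xs ! 2]" if "length xs = 3" for xs :: "nat list"
      using that by (auto simp: numeral_eq_Suc length_Suc_conv)
    have "xs \<in> emb 3 es ({..<n}, E) \<and> s \<in> set xs \<longleftrightarrow> length xs = 3 \<and> set xs \<subseteq> {..<n} \<and>
     (Q (xs ! 0) (xs ! 1) (xs ! 2) \<and> (xs ! 0 = s \<or> xs ! 1 = s \<or> xs ! 2 = s))" for xs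
    proof (cases "length xs = 3")
      case True
      have "s \<in> set xs \<longleftrightarrow> xs ! 0 = s \<or> xs ! 1 = s \<or> xs ! 2 = s"
        by (subst l[OF True]) auto
      then show ?thesis unfolding Q l[OF True, symmetric] emb_def using True by auto
    qed (simp add: emb_def)
    then show ?thesis by blast
  qed
  then have "card {xs \<in> emb 3 es ({..<n}, E). s \<in> set xs} = (\<Sum>p<n. \<Sum>q<n. \<Sum>r<n.
     of_bool (Q p q r \<and> (p = s \<or> q = s \<or> r = s)))"
    by (simp only: card_lists3[of n "\<lambda>p q r. Q p q r \<and> (p = s \<or> q = s \<or> r = s)"])
  also have "\<dots> = (\<Sum>p<n. \<Sum>q<n. \<Sum>r<n.
     (of_bool (p = s) + of_bool (q = s) + of_bool (r = s)) * of_bool (Q p q r))"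
    by (intro sum.cong refl) (auto simp: Q)
  also have "card {xs \<in> emb 3 es ({..<n}, E). s \<in> set xs}
    = card (emb 3 es (pat 3 es)) * s_subgraph_count ({..<n}, E) (pat 3 es) s"
    by (rule count_emb[OF _ G]) (rule es)
  finally show ?thesis unfolding split_position3[OF s] .
qed

lemma pat_eqs:
  "claw = pat 4 [(0, 1), (0, 2), (0, 3)]"
  "cycle3 = pat 3 [(0, 1), (1, 2), (2, 0)]"
  "path3 = pat 4 [(0, 1), (1, 2), (2, 3)]"
  "paw = pat 4 [(0, 1), (1, 2), (2, 0), (2, 3)]"
  "cycle4 = pat 4 [(0, 1), (1, 2), (2, 3), (3, 0)]"
proof -
  have 4: "{..<4::nat} = {0, 1, 2, 3}" and 3: "{..<3::nat} = {0, 1, 2}" by auto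
  note d = pat_def edges_of_def 3 4
  show "claw = pat 4 [(0, 1), (0, 2), (0, 3)]" "cycle3 = pat 3 [(0, 1), (1, 2), (2, 0)]"
    "path3 = pat 4 [(0, 1), (1, 2), (2, 3)]" "paw = pat 4 [(0, 1), (1, 2), (2, 0), (2, 3)]"
    "cycle4 = pat 4 [(0, 1), (1, 2), (2, 3), (3, 0)]"
    unfolding claw_def cycle3_def path3_def paw_def cycle4_def d by simp_all
qed

lemma pairs4: "{e. e \<subseteq> {0, 1, 2, 3::nat} \<and> card e = 2} = {{0, 1}, {0, 2}, {0, 3}, {1, 2}, {1, 3}, {2, 3}}"
proof (intro equalityI subsetI)
  fix e assume "e \<in> {e. e \<subseteq> {0, 1, 2, 3::nat} \<and> card e = 2}"
  then have e: "e \<subseteq> {0, 1, 2, 3}" "card e = 2" by simp_all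
  obtain i j where ij: "e = {i, j}" "i \<noteq> j" using e(2) unfolding card_2_iff by (elim exE conjE)
  then have "i \<in> {0, 1, 2, 3}" "j \<in> {0, 1, 2, 3}" using e(1) by simp_all
  with ij(2) show "e \<in> {{0, 1}, {0, 2}, {0, 3}, {1, 2}, {1, 3}, {2, 3}}"
    unfolding ij(1) by (elim insertE emptyE) (simp_all add: insert_commute)
qed auto

lemma pat_eqs':
  "clique4 = pat 4 [(0, 1), (0, 2), (0, 3), (1, 2), (1, 3), (2, 3)]"
  "diamond = pat 4 [(0, 1), (0, 2), (0, 3), (1, 2), (1, 3)]"
proof -
  have 4: "{0, 1, 2, 3} = {..<4::nat}" by auto
  have e: "edges_of [(0, 1), (0, 2), (0, 3), (1, 2), (1, 3), (2, 3)] = {{0, 1}, {0, 2}, {0, 3}, {1, 2}, {1, 3}, {2, 3}}"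
    "edges_of [(0, 1), (0, 2), (0, 3), (1, 2), (1, 3)] = {{0, 1}, {0, 2}, {0, 3}, {1, 2}, {1, 3}}"
    by (simp_all add: edges_of_def)
  show c: "clique4 = pat 4 [(0, 1), (0, 2), (0, 3), (1, 2), (1, 3), (2, 3)]"
    unfolding clique4_def pairs4 unfolding pat_def e 4 ..
  have "{{0, 1}, {0, 2}, {0, 3}, {1, 2}, {1, 3}, {2, 3}} - {{2, 3}} = {{0, 1}, {0, 2}, {0, 3}, {1, 2}, {1, 3::nat}}"
    by (simp add: insert_Diff_if doubleton_eq_iff)
  then show "diamond = pat 4 [(0, 1), (0, 2), (0, 3), (1, 2), (1, 3)]"
    unfolding diamond_def c unfolding pat_def e fst_conv snd_conv by (simp only:)
qed

section \<open>Count formulas\<close>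

lemma permutations4: "filter distinct (List.n_lists 4 [0..<4]) =
  [[3, 2, 1, 0], [2, 3, 1, 0], [3, 1, 2, 0], [1, 3, 2, 0], [2, 1, 3, 0], [1, 2, 3, 0], [3, 2, 0, 1], [2, 3, 0, 1],
   [3, 0, 2, 1], [0, 3, 2, 1], [2, 0, 3, 1], [0, 2, 3, 1], [3, 1, 0, 2], [1, 3, 0, 2], [3, 0, 1, 2], [0, 3, 1, 2],
   [1, 0, 3, 2], [0, 1, 3, 2], [2, 1, 0, 3], [1, 2, 0, 3], [2, 0, 1, 3], [0, 2, 1, 3], [1, 0, 2, 3], [0, 1, 2, 3]]"
  by code_simp

lemma permutations3: "filter distinct (List.n_lists 3 [0..<3]) =
  [[2, 1, 0], [1, 2, 0], [2, 0, 1], [0, 2, 1], [1, 0, 2], [0, 1, 2]]"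
  by code_simp

lemma aut_claw: "card (emb 4 [(0, 1), (0, 2), (0, 3)] claw) = 6"
  and aut_cycle3: "card (emb 3 [(0, 1), (1, 2), (2, 0)] cycle3) = 6"
  and aut_path3: "card (emb 4 [(0, 1), (1, 2), (2, 3)] path3) = 2"
  and aut_paw: "card (emb 4 [(0, 1), (1, 2), (2, 0), (2, 3)] paw) = 2"
  and aut_cycle4: "card (emb 4 [(0, 1), (1, 2), (2, 3), (3, 0)] cycle4) = 8"
  and aut_diamond: "card (emb 4 [(0, 1), (0, 2), (0, 3), (1, 2), (1, 3)] diamond) = 4"
  and aut_clique4: "card (emb 4 [(0, 1), (0, 2), (0, 3), (1, 2), (1, 3), (2, 3)] clique4) = 24"
  unfolding pat_eqs pat_eqs' card_aut permutations3 permutations4 by simp_all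

lemma sum_swap13: "(\<Sum>p\<in>A. \<Sum>q\<in>A. \<Sum>r\<in>A. F r q p) = (\<Sum>p\<in>A. \<Sum>q\<in>A. \<Sum>r\<in>A. F p q r :: nat)"
proof -
  have "(\<Sum>p\<in>A. \<Sum>q\<in>A. \<Sum>r\<in>A. F r q p) = (\<Sum>q\<in>A. \<Sum>p\<in>A. \<Sum>r\<in>A. F r q p)" by (rule sum.swap)
  also have "\<dots> = (\<Sum>q\<in>A. \<Sum>r\<in>A. \<Sum>p\<in>A. F r q p)" by (rule sum.cong[OF refl]) (rule sum.swap)
  also have "\<dots> = (\<Sum>r\<in>A. \<Sum>q\<in>A. \<Sum>p\<in>A. F r q p)" by (rule sum.swap)
  finally show ?thesis .
qed

text \<open>This lemma and its variants bring the sum for one position of the source into a common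
  form. The digits in the variants name the order in which the summation variables are passed to
  \<open>R\<close>.\<close>

lemma place:
  assumes "\<And>p q r. Q p q r \<longleftrightarrow> R p q r"
  shows "(\<Sum>p\<in>A. \<Sum>q\<in>A. \<Sum>r\<in>A. of_bool (Q p q r)) = (\<Sum>p\<in>A. \<Sum>q\<in>A. \<Sum>r\<in>A. of_bool (R p q r) :: nat)"
  unfolding assms ..

lemma place_213:
  assumes "\<And>p q r. Q p q r \<longleftrightarrow> R q p r"
  shows "(\<Sum>p\<in>A. \<Sum>q\<in>A. \<Sum>r\<in>A. of_bool (Q p q r)) = (\<Sum>p\<in>A. \<Sum>q\<in>A. \<Sum>r\<in>A. of_bool (R p q r) :: nat)"
  unfolding assms by (rule sum.swap)

lemma place_321:
  assumes "\<And>p q r. Q p q r \<longleftrightarrow> R r q p"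
  shows "(\<Sum>p\<in>A. \<Sum>q\<in>A. \<Sum>r\<in>A. of_bool (Q p q r)) = (\<Sum>p\<in>A. \<Sum>q\<in>A. \<Sum>r\<in>A. of_bool (R p q r) :: nat)"
  unfolding assms by (rule sum_swap13)

lemma place_231:
  assumes "\<And>p q r. Q p q r \<longleftrightarrow> R q r p"
  shows "(\<Sum>p\<in>A. \<Sum>q\<in>A. \<Sum>r\<in>A. of_bool (Q p q r)) = (\<Sum>p\<in>A. \<Sum>q\<in>A. \<Sum>r\<in>A. of_bool (R p q r) :: nat)"
  unfolding assms using place_321[where Q = "\<lambda>p q r. R q r p" and R = "\<lambda>p q r. R q p r" and A = A]
    place_213[where Q = "\<lambda>p q r. R q p r" and R = R and A = A] by simp

lemma sum_remove:
  fixes f :: "nat \<Rightarrow> nat"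
  assumes "x < n"
  shows "(\<Sum>z<n. f z * of_bool (z \<noteq> x)) + f x = (\<Sum>z<n. f z)"
proof -
  have "(\<Sum>z<n. f z * of_bool (z \<noteq> x)) + (\<Sum>z<n. of_bool (z = x) * f z) = (\<Sum>z<n. f z)"
    unfolding sum.distrib[symmetric] by (intro sum.cong) auto
  then show ?thesis unfolding sum_at[OF assms] .
qed

text \<open>Inclusion and exclusion without subtraction: the terms excluded by
  \<open>z \<noteq> x\<close> are added on the left.\<close>

lemma sum_diag3:
  fixes F :: "nat \<Rightarrow> nat \<Rightarrow> nat \<Rightarrow> nat"
  shows "(\<Sum>x<n. \<Sum>y<n. \<Sum>z<n. F x y z * of_bool (z \<noteq> x)) + (\<Sum>x<n. \<Sum>y<n. F x y x) = (\<Sum>x<n. \<Sum>y<n. \<Sum>z<n. F x y z)"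
  unfolding sum.distrib[symmetric] by (intro sum.cong refl sum_remove) auto

text \<open>As \<open>c\<close> vanishes on the diagonal, \<open>z = x\<close> and
  \<open>z = y\<close> exclude each other in every relevant term, and no correction of second order
  arises.\<close>

lemma sum_avoid2:
  fixes c :: "nat \<Rightarrow> nat \<Rightarrow> nat" and f :: "nat \<Rightarrow> nat"
  assumes c: "\<And>x. c x x = 0"
  shows "(\<Sum>x<n. \<Sum>y<n. \<Sum>z<n. c x y * f z * of_bool (z \<noteq> x) * of_bool (z \<noteq> y)) + (\<Sum>x<n. \<Sum>y<n. c x y * f x + c x y * f y)
    = (\<Sum>x<n. \<Sum>y<n. c x y) * (\<Sum>z<n. f z)"
proof -
  have "(\<Sum>z<n. c x y * f z * of_bool (z \<noteq> x) * of_bool (z \<noteq> y)) + (c x y * f x + c x y * f y) = (\<Sum>z<n. c x y * f z)"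
    if xy: "x < n" "y < n" for x y
  proof (cases "x = y")
    case True
    then show ?thesis using c by simp
  next
    case False
    then show ?thesis
      using sum_remove[OF xy(2), of "\<lambda>z. c x y * f z * of_bool (z \<noteq> x)"] sum_remove[OF xy(1), of "\<lambda>z. c x y * f z"]
      by simp
  qed
  then have "(\<Sum>x<n. \<Sum>y<n. (\<Sum>z<n. c x y * f z * of_bool (z \<noteq> x) * of_bool (z \<noteq> y)) + (c x y * f x + c x y * f y))
    = (\<Sum>x<n. \<Sum>y<n. \<Sum>z<n. c x y * f z)"
    by (intro sum.cong refl) auto
  then show ?thesis unfolding sum.distrib by (simp only: sum_distrib_left[symmetric] sum_distrib_right[symmetric])
qed

lemma sum_center:
  fixes X :: "nat \<Rightarrow> nat" and F G :: "nat \<Rightarrow> nat \<Rightarrow> nat"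
  shows "(\<Sum>x<n. \<Sum>y<n. \<Sum>z<n. X y * F x y * G z y) = (\<Sum>y<n. X y * (\<Sum>x<n. F x y) * (\<Sum>z<n. G z y))"
  by (subst sum.swap) (simp only: sum_distrib_left[symmetric] sum_distrib_right[symmetric])

text \<open>\<open>y\<close> and \<open>x\<close> are the numbers of ordered pairs and triples of
  distinct elements out of \<open>d\<close>. Truncated subtraction does no harm: for
  \<open>d < 2\<close> another factor of the product is 0.\<close>

lemma falling_three:
  fixes x y d :: nat
  assumes "x + 2 * y = y * d" "y + d = d * d"
  shows "x = d * (d - 1) * (d - 2)"
proof -
  have y: "y = d * (d - 1)" using assms(2) by (simp add: diff_mult_distrib2)
  have "x = y * d - y * 2" using assms(1) by simp
  then show ?thesis unfolding y by (simp only: diff_mult_distrib2)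
qed

section \<open>Counts at the source\<close>

locale source_graph =
  fixes n s :: nat and E :: "nat set set"
  assumes E: "simple_edges n E" and s: "s < n"
begin

abbreviation "a \<equiv> amat s E"
abbreviation "\<sigma> \<equiv> smark s E"
abbreviation "ds \<equiv> \<Sum>u<n. \<sigma> u"
abbreviation "count P \<equiv> s_subgraph_count ({..<n}, E) P s"

lemma no_loop [simp]: "{x} \<notin> E"
  by (rule simple_edges_single[OF E])

lemma a_sym: "a x y = a y x" by (simp add: amat_def insert_commute conj_ac)
lemma a_irr [simp]: "a x x = 0" by (simp add: amat_def)
lemma sa_idem [simp]: "\<sigma> x * \<sigma> x = \<sigma> x" "a x y * a x y = a x y" "k * \<sigma> x * \<sigma> x = k * \<sigma> x" "k * a x y * a x y = k * a x y"
  by (simp_all add: smark_def amat_def)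

lemma gT_sum: "gT n a \<sigma> = (\<Sum>x<n. \<Sum>y<n. \<sigma> x * \<sigma> y * a x y)"
  unfolding gT_def cn_def sum_distrib_left by (intro sum.cong refl) (simp add: a_sym mult_ac)
lemma gD_sum: "gD n a \<sigma> = (\<Sum>x<n. \<Sum>y<n. \<sigma> x * a x y)"
  unfolding gD_def dg_def sum_distrib_left by (intro sum.cong refl) (simp add: a_sym mult_ac)
lemma gD_sum': "gD n a \<sigma> = (\<Sum>x<n. \<Sum>y<n. \<sigma> y * a x y)"
  unfolding gD_sum by (subst sum.swap) (simp add: a_sym)
lemma gR_sum: "gR n a \<sigma> = (\<Sum>x<n. \<Sum>y<n. \<Sum>z<n. \<sigma> y * a x y * a z y)"
  unfolding gR_def dg_def by (rule sum_center[symmetric])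
lemma gB_sum: "gB n a X \<sigma> = (\<Sum>x<n. \<Sum>y<n. \<Sum>z<n. X y * (\<sigma> x * a x y) * a z y)"
  unfolding gB_def dg_def cn_def by (rule sum_center[symmetric])
lemma gQ_sum: "gQ n a X \<sigma> = (\<Sum>x<n. \<Sum>y<n. \<Sum>z<n. X y * (\<sigma> x * a x y) * (\<sigma> z * a z y))"
  unfolding gQ_def dg_def cn_def by (rule sum_center[symmetric])
lemma gY_sum: "gY n a X \<sigma> = (\<Sum>x<n. \<Sum>y<n. \<Sum>z<n. \<sigma> x * X y * a x y * a x z * a y z)"
  unfolding gY_def tri_def cod_def every_def sum_distrib_left by (intro sum.cong refl) (simp add: a_sym mult_ac)
lemma gC_sum: "gC n a \<sigma> = (\<Sum>x<n. \<Sum>y<n. \<Sum>z<n. \<sigma> x * \<sigma> y * \<sigma> z * a x y * a x z * a y z)"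
  unfolding gC_def cod_def sum_distrib_left by (intro sum.cong refl) (simp add: a_sym mult_ac)

lemmas count4 = count_pat4[OF E s _ refl]
lemmas count3 = count_pat3[OF E s _ refl]
lemmas to_bool = amat_def smark_def of_bool_conj[symmetric]

lemma count_cycle3: "2 * count cycle3 = gT n a \<sigma>"
proof -
  let ?T = "\<Sum>x<n. \<Sum>y<n. \<sigma> x * \<sigma> y * a x y"
  have "card (emb 3 [(0, 1), (1, 2), (2, 0)] cycle3) * count cycle3 = ?T + ?T + ?T"
    unfolding pat_eqs pat_eqs'
    apply (subst count3)
     apply force
    unfolding to_bool
    apply (intro arg_cong2[where f = "(+)"])
    subgoal by (intro sum.cong refl arg_cong[where f = of_bool]) (auto simp: insert_commute)
    subgoal by (intro sum.cong refl arg_cong[where f = of_bool]) (auto simp: insert_commute)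
    subgoal by (intro sum.cong refl arg_cong[where f = of_bool]) (auto simp: insert_commute)
    done
  note 1 = this[unfolded aut_cycle3]
  show ?thesis using 1 unfolding gT_sum by simp
qed

text \<open>\<open>?X\<close> has the source as the centre and counts ordered triples of its
  neighbours. \<open>?Z\<close> has it as a leaf: the centre \<open>y\<close> is a neighbour of the
  source with two further distinct neighbours.\<close>

lemma count_claw: "6 * count claw = ds * (ds - 1) * (ds - 2) + 3 * (gR n a \<sigma> - gD n a \<sigma>)"
proof -
  let ?X = "(\<Sum>x<n. \<Sum>y<n. \<Sum>z<n. \<sigma> x * \<sigma> y * of_bool (x \<noteq> y) * \<sigma> z * of_bool (z \<noteq> x) * of_bool (z \<noteq> y))"
  let ?Z = "(\<Sum>x<n. \<Sum>y<n. \<Sum>z<n. \<sigma> y * a x y * a z y * of_bool (z \<noteq> x))"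
  have "card (emb 4 [(0, 1), (0, 2), (0, 3)] claw) * count claw = ?X + ?Z + ?Z + ?Z"
    unfolding pat_eqs pat_eqs'
    apply (subst count4)
     apply force
    unfolding to_bool every_def mult_1 mult_1_right
    apply (intro arg_cong2[where f = "(+)"])
    subgoal by (rule place) (auto simp: insert_commute)
    subgoal by (rule place_213) (auto simp: insert_commute)
    subgoal by (rule place_213) (auto simp: insert_commute)
    subgoal by (rule place_213) (auto simp: insert_commute)
    done
  note 1 = this[unfolded aut_claw]
  have "?Z + gD n a \<sigma> = gR n a \<sigma>"
  proof -
    have "gD n a \<sigma> = (\<Sum>x<n. \<Sum>y<n. \<sigma> y * a x y * a x y)"
      unfolding gD_sum' by (intro sum.cong refl) (simp add: smark_def amat_def)
    then show ?thesis unfolding gR_sum by (simp only:) (rule sum_diag3)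
  qed
  moreover have "?X = ds * (ds - 1) * (ds - 2)"
  proof -
    let ?Y = "\<Sum>x<n. \<Sum>y<n. \<sigma> x * \<sigma> y * of_bool (x \<noteq> y)"
    have "?X + (\<Sum>x<n. \<Sum>y<n. \<sigma> x * \<sigma> y * of_bool (x \<noteq> y) * \<sigma> x + \<sigma> x * \<sigma> y * of_bool (x \<noteq> y) * \<sigma> y) = ?Y * ds"
      by (rule sum_avoid2) simp
    moreover have "\<sigma> x * \<sigma> y * of_bool (x \<noteq> y) * \<sigma> x + \<sigma> x * \<sigma> y * of_bool (x \<noteq> y) * \<sigma> y = 2 * (\<sigma> x * \<sigma> y * of_bool (x \<noteq> y))" for x y
      by (simp add: smark_def)
    ultimately have 1: "?X + 2 * ?Y = ?Y * ds" by (simp only: sum_distrib_left[symmetric])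
    have "(\<Sum>y<n. \<sigma> x * \<sigma> y * of_bool (x \<noteq> y)) + \<sigma> x = \<sigma> x * ds" if "x < n" for x
      using sum_remove[OF that, of "\<lambda>y. \<sigma> x * \<sigma> y"] by (simp add: sum_distrib_left eq_commute)
    then have "(\<Sum>x<n. (\<Sum>y<n. \<sigma> x * \<sigma> y * of_bool (x \<noteq> y)) + \<sigma> x) = (\<Sum>x<n. \<sigma> x * ds)"
      by (intro sum.cong) auto
    then have "?Y + ds = ds * ds" unfolding sum.distrib sum_distrib_right[symmetric] .
    from 1 this show ?thesis by (rule falling_three)
  qed
  ultimately show ?thesis using 1 by linarith
qed

text \<open>\<open>?U\<close> has the source at an end of the path, and the walks that turn back to
  \<open>x\<close> are removed. \<open>?V\<close> has it inside: a walk \<open>s - x - y\<close> is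
  extended by a second neighbour \<open>z\<close> of the source, and \<open>z = x\<close> and
  \<open>z = y\<close> have to be removed, which gives \<open>gD\<close> and
  \<open>gT\<close>.\<close>

lemma count_path3: "count path3 + 2 * gD n a \<sigma> + gT n a \<sigma> = gB n a every \<sigma> + ds * gD n a \<sigma>"
proof -
  let ?U = "(\<Sum>x<n. \<Sum>y<n. \<Sum>z<n. every y * (\<sigma> x * a x y) * a z y * of_bool (z \<noteq> x))"
  let ?V = "(\<Sum>x<n. \<Sum>y<n. \<Sum>z<n. \<sigma> x * a x y * \<sigma> z * of_bool (z \<noteq> x) * of_bool (z \<noteq> y))"
  have "card (emb 4 [(0, 1), (1, 2), (2, 3)] path3) * count path3 = ?U + ?V + ?V + ?U"
    unfolding pat_eqs pat_eqs'
    apply (subst count4)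
     apply force
    unfolding to_bool every_def mult_1 mult_1_right
    apply (intro arg_cong2[where f = "(+)"])
    subgoal by (rule place) (auto simp: insert_commute)
    subgoal by (rule place_231) (auto simp: insert_commute)
    subgoal by (rule place_213) (auto simp: insert_commute)
    subgoal by (rule place_321) (auto simp: insert_commute)
    done
  note 1 = this[unfolded aut_path3]
  have "?U + gD n a \<sigma> = gB n a every \<sigma>"
  proof -
    have "gD n a \<sigma> = (\<Sum>x<n. \<Sum>y<n. every y * (\<sigma> x * a x y) * a x y)"
      unfolding gD_sum by (intro sum.cong refl) (simp add: every_def smark_def amat_def)
    then show ?thesis unfolding gB_sum by (simp only:) (rule sum_diag3)
  qed
  moreover have "?V + (gD n a \<sigma> + gT n a \<sigma>) = gD n a \<sigma> * ds"
  proof -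
    have "?V + (\<Sum>x<n. \<Sum>y<n. \<sigma> x * a x y * \<sigma> x + \<sigma> x * a x y * \<sigma> y) = gD n a \<sigma> * ds"
      unfolding gD_sum by (rule sum_avoid2) simp
    moreover have "\<sigma> x * a x y * \<sigma> x = \<sigma> x * a x y" "\<sigma> x * a x y * \<sigma> y = \<sigma> x * \<sigma> y * a x y" for x y
      by (simp_all add: smark_def)
    ultimately show ?thesis unfolding sum.distrib gD_sum gT_sum by (simp only:)
  qed
  ultimately show ?thesis using 1 by (simp add: mult.commute)
qed

text \<open>\<open>?U\<close> has the source at a triangle vertex of degree two, with the pendant
  vertex \<open>z\<close> attached at \<open>y\<close>; \<open>?V\<close> at the vertex of degree
  three; \<open>?Y\<close> at the pendant vertex.\<close>

lemma count_paw: "2 * count paw + 4 * gT n a \<sigma> = ds * gT n a \<sigma> + 2 * gB n a \<sigma> \<sigma> + gY n a every \<sigma>"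
proof -
  let ?U = "(\<Sum>x<n. \<Sum>y<n. \<Sum>z<n. \<sigma> y * (\<sigma> x * a x y) * a z y * of_bool (z \<noteq> x))"
  let ?V = "(\<Sum>x<n. \<Sum>y<n. \<Sum>z<n. \<sigma> x * \<sigma> y * a x y * \<sigma> z * of_bool (z \<noteq> x) * of_bool (z \<noteq> y))"
  let ?Y = "(\<Sum>x<n. \<Sum>y<n. \<Sum>z<n. \<sigma> x * every y * a x y * a x z * a y z)"
  have "card (emb 4 [(0, 1), (1, 2), (2, 0), (2, 3)] paw) * count paw = ?U + ?U + ?V + ?Y"
    unfolding pat_eqs pat_eqs'
    apply (subst count4)
     apply force
    unfolding to_bool every_def mult_1 mult_1_right
    apply (intro arg_cong2[where f = "(+)"])
    subgoal by (rule place) (auto simp: insert_commute)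
    subgoal by (rule place) (auto simp: insert_commute)
    subgoal by (rule place) (auto simp: insert_commute)
    subgoal by (rule place_321) (auto simp: insert_commute)
    done
  note 1 = this[unfolded aut_paw]
  have "?U + gT n a \<sigma> = gB n a \<sigma> \<sigma>"
  proof -
    have "gT n a \<sigma> = (\<Sum>x<n. \<Sum>y<n. \<sigma> y * (\<sigma> x * a x y) * a x y)"
      unfolding gT_sum by (intro sum.cong refl) (simp add: every_def smark_def amat_def)
    then show ?thesis unfolding gB_sum by (simp only:) (rule sum_diag3)
  qed
  moreover have "?V + 2 * gT n a \<sigma> = gT n a \<sigma> * ds"
  proof -
    have "?V + (\<Sum>x<n. \<Sum>y<n. \<sigma> x * \<sigma> y * a x y * \<sigma> x + \<sigma> x * \<sigma> y * a x y * \<sigma> y) = gT n a \<sigma> * ds"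
      unfolding gT_sum by (rule sum_avoid2) simp
    moreover have "\<sigma> x * \<sigma> y * a x y * \<sigma> x = \<sigma> x * \<sigma> y * a x y" "\<sigma> x * \<sigma> y * a x y * \<sigma> y = \<sigma> x * \<sigma> y * a x y" for x y
      by (simp_all add: smark_def)
    ultimately show ?thesis unfolding sum.distrib gT_sum by simp
  qed
  ultimately show ?thesis using 1 unfolding gY_sum by (simp add: mult.commute)
qed

text \<open>All positions are alike. The closed walks \<open>s - x - y - z - s\<close> with
  \<open>x = z\<close> are no cycles, and there are \<open>gD\<close> of them.\<close>

lemma count_cycle4: "2 * count cycle4 + gD n a \<sigma> = gQ n a every \<sigma>"
proof -
  let ?Z = "(\<Sum>x<n. \<Sum>y<n. \<Sum>z<n. every y * (\<sigma> x * a x y) * (\<sigma> z * a z y) * of_bool (z \<noteq> x))"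
  have "card (emb 4 [(0, 1), (1, 2), (2, 3), (3, 0)] cycle4) * count cycle4 = ?Z + ?Z + ?Z + ?Z"
    unfolding pat_eqs pat_eqs'
    apply (subst count4)
     apply force
    unfolding to_bool every_def mult_1 mult_1_right
    apply (intro arg_cong2[where f = "(+)"])
    subgoal by (rule place) (auto simp: insert_commute)
    subgoal by (rule place_231) (auto simp: insert_commute)
    subgoal by (rule place_213) (auto simp: insert_commute)
    subgoal by (rule place) (auto simp: insert_commute)
    done
  note 1 = this[unfolded aut_cycle4]
  have "?Z + gD n a \<sigma> = gQ n a every \<sigma>"
  proof -
    have "gD n a \<sigma> = (\<Sum>x<n. \<Sum>y<n. every y * (\<sigma> x * a x y) * (\<sigma> x * a x y))"
      unfolding gD_sum by (intro sum.cong refl) (simp add: every_def smark_def amat_def)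
    then show ?thesis unfolding gQ_sum by (simp only:) (rule sum_diag3)
  qed
  with 1 show ?thesis by simp
qed

text \<open>\<open>?Z\<close> has the source at a vertex of degree three, where \<open>y\<close> is
  the other such vertex. \<open>?Y\<close> has it at a vertex of degree two, opposite to
  \<open>z\<close> across the common edge \<open>x y\<close>.\<close>

lemma count_diamond: "2 * count diamond + gT n a \<sigma> = gQ n a \<sigma> \<sigma> + gY n a \<sigma> \<sigma>"
proof -
  let ?Z = "(\<Sum>x<n. \<Sum>y<n. \<Sum>z<n. \<sigma> y * (\<sigma> x * a x y) * (\<sigma> z * a z y) * of_bool (z \<noteq> x))"
  let ?Y = "(\<Sum>x<n. \<Sum>y<n. \<Sum>z<n. \<sigma> x * \<sigma> y * a x y * a x z * a y z)"
  have "card (emb 4 [(0, 1), (0, 2), (0, 3), (1, 2), (1, 3)] diamond) * count diamond = ?Z + ?Z + ?Y + ?Y"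
    unfolding pat_eqs pat_eqs'
    apply (subst count4)
     apply force
    unfolding to_bool every_def mult_1 mult_1_right
    apply (intro arg_cong2[where f = "(+)"])
    subgoal by (rule place_213) (auto simp: insert_commute)
    subgoal by (rule place_213) (auto simp: insert_commute)
    subgoal by (rule place) (auto simp: insert_commute)
    subgoal by (rule place) (auto simp: insert_commute)
    done
  note 1 = this[unfolded aut_diamond]
  have "?Z + gT n a \<sigma> = gQ n a \<sigma> \<sigma>"
  proof -
    have "gT n a \<sigma> = (\<Sum>x<n. \<Sum>y<n. \<sigma> y * (\<sigma> x * a x y) * (\<sigma> x * a x y))"
      unfolding gT_sum by (intro sum.cong refl) (simp add: every_def smark_def amat_def)
    then show ?thesis unfolding gQ_sum by (simp only:) (rule sum_diag3)
  qed
  with 1 show ?thesis unfolding gY_sum by simp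
qed

lemma count_clique4: "6 * count clique4 = gC n a \<sigma>"
proof -
  let ?C = "(\<Sum>x<n. \<Sum>y<n. \<Sum>z<n. \<sigma> x * \<sigma> y * \<sigma> z * a x y * a x z * a y z)"
  have "card (emb 4 [(0, 1), (0, 2), (0, 3), (1, 2), (1, 3), (2, 3)] clique4) * count clique4 = ?C + ?C + ?C + ?C"
    unfolding pat_eqs pat_eqs'
    apply (subst count4)
     apply force
    unfolding to_bool every_def mult_1 mult_1_right
    apply (intro arg_cong2[where f = "(+)"])
    subgoal by (rule place) (auto simp: insert_commute)
    subgoal by (rule place) (auto simp: insert_commute)
    subgoal by (rule place) (auto simp: insert_commute)
    subgoal by (rule place) (auto simp: insert_commute)
    done
  note 1 = this[unfolded aut_clique4]
  show ?thesis using 1 unfolding gC_sum by simp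
qed

end

section \<open>Maintainability\<close>

text \<open>The amortized argument in the abstract: the invariant carries a potential
  \<open>\<phi>\<close> that is 0 at the start and never negative. A worst-case bound is the special
  case in which the potential is always 0.\<close>

locale maintenance =
  fixes up :: com and qe :: exp and P :: "'b ugraph" and f :: "real \<Rightarrow> real" and g :: "nat \<Rightarrow> nat"
    and Inv :: "nat \<Rightarrow> nat \<Rightarrow> nat set set \<Rightarrow> (nat \<Rightarrow> nat \<Rightarrow> nat) \<Rightarrow> real \<Rightarrow> bool" and C :: real
  assumes init: "s < n \<Longrightarrow> Inv n s {} (\<lambda>_ _. 0) 0"
    and step: "update_step S W n s E x L \<Longrightarrow> 64 * g n \<le> S \<Longrightarrow> Inv n s E T \<phi> \<Longrightarrow>
      \<exists>T' N \<phi>'. steps S W (update_inputs n s x L) up T N T' \<and> Inv n s (apply_update x E) T' \<phi>' \<and>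
        real N + \<phi>' \<le> \<phi> + C * f (real (max 1 (card (apply_update x E))))"
    and nonneg: "Inv n s E T \<phi> \<Longrightarrow> 0 \<le> \<phi>" "0 \<le> C" "0 \<le> f (real (max 1 m))"
    and g_pos: "0 < n \<Longrightarrow> 1 \<le> g n"
    and query: "indep I scratch qe" "source_graph n s E \<Longrightarrow> adjacency_lists E L \<Longrightarrow> Inv n s E T \<phi> \<Longrightarrow>
      ev (query_inputs n s L) T qe = s_subgraph_count ({..<n}, E) P s"
      "source_graph n s E \<Longrightarrow> s_subgraph_count ({..<n}, E) P s \<le> 4 * (n + 1) ^ 4"
begin

abbreviation "K \<equiv> real (com_size up)"

lemma update_exec:
  assumes "update_step S W n s E x L" "64 * g n \<le> S" "agr scratch M T" "Inv n s E T \<phi>"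
  shows "\<exists>t M' T' \<phi>'. exec S W (update_inputs n s x L) up M t M' \<and> agr scratch M' T' \<and>
    Inv n s (apply_update x E) T' \<phi>' \<and> real t + K * \<phi>' \<le> K * \<phi> + K * C * f (real (max 1 (card (apply_update x E))))"
proof -
  obtain T' N \<phi>' where 1: "steps S W (update_inputs n s x L) up T N T'" "Inv n s (apply_update x E) T' \<phi>'"
    "real N + \<phi>' \<le> \<phi> + C * f (real (max 1 (card (apply_update x E))))"
    using step[OF assms(1,2,4)] by (elim exE conjE)
  obtain t M' where 2: "exec S W (update_inputs n s x L) up M t M'" "t \<le> com_size up * N" "agr scratch M' T'"
    using 1(1)[unfolded steps_def, rule_format, OF assms(3)] by (elim exE conjE)
  have "real t \<le> K * real N" using 2(2) of_nat_mono[OF 2(2), where 'a = real] by simp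
  moreover have "K * (real N + \<phi>') \<le> K * (\<phi> + C * f (real (max 1 (card (apply_update x E)))))"
    using 1(3) by (rule mult_left_mono) simp
  ultimately have "real t + K * \<phi>' \<le> K * \<phi> + K * C * f (real (max 1 (card (apply_update x E))))"
    by (simp add: algebra_simps)
  then show ?thesis using 1(2) 2(1,3) by blast
qed

text \<open>The amortized and the worst-case bound are proved in the same induction. Multiplying the
  potential by \<open>K\<close> converts the units in which \<open>N\<close> is measured into
  machine steps.\<close>

lemma run_invariant:
  assumes "run S W n s up E M tr" and s: "s < n" and size: "64 * g n \<le> S" "64 * (n + 1) ^ 4 < W"
  shows "simple_edges n E \<and>
    (\<exists>T \<phi>. agr scratch M T \<and> Inv n s E T \<phi> \<and>
      (\<Sum>(t, m)\<leftarrow>tr. real t) + K * \<phi> \<le> K * C * (\<Sum>(t, m)\<leftarrow>tr. f (real (max 1 m)))) \<and>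
    ((\<forall>E T \<phi>. Inv n s E T \<phi> \<longrightarrow> \<phi> = 0) \<longrightarrow> (\<forall>(t, m)\<in>set tr. real t \<le> K * C * f (real (max 1 m))))"
  using assms(1)
proof induction
  case run_start
  have "agr scratch (\<lambda>_. 0) (\<lambda>_ _. 0)" by (simp add: agr_def tab_def fun_eq_iff)
  moreover have "simple_edges n {}" by (simp add: simple_edges_def)
  ultimately show ?case using init[OF s] by (intro conjI exI[of _ "\<lambda>_ _. 0"] exI[of _ 0]) auto
next
  case (run_update E M tr x L t M')
  then obtain T \<phi> where I: "simple_edges n E" "agr scratch M T" "Inv n s E T \<phi>"
    "(\<Sum>(t, m)\<leftarrow>tr. real t) + K * \<phi> \<le> K * C * (\<Sum>(t, m)\<leftarrow>tr. f (real (max 1 m)))"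
    by (elim conjE exE)
  have "1 \<le> g n" using g_pos s by simp
  then have us: "update_step S W n s E x L"
    using I(1) run_update size s by unfold_locales auto
  obtain t2 M2 T' \<phi>' where 2: "exec S W (update_inputs n s x L) up M t2 M2" "agr scratch M2 T'"
    "Inv n s (apply_update x E) T' \<phi>'"
    "real t2 + K * \<phi>' \<le> K * \<phi> + K * C * f (real (max 1 (card (apply_update x E))))"
    using update_exec[OF us size(1) I(2,3)] by (elim exE conjE)
  \<comment> \<open>The contract only provides some execution; by determinism it is the one in the
    run, so its time bound applies.\<close>
  have t2: "t2 = t" "M2 = M'" using exec_deterministic[OF run_update.hyps(4) 2(1)] by auto
  have w: "real t \<le> K * C * f (real (max 1 (card (apply_update x E))))" if z: "\<forall>E T \<phi>. Inv n s E T \<phi> \<longrightarrow> \<phi> = 0"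
  proof -
    have "\<phi> = 0" "\<phi>' = 0" using z I(3) 2(3) by blast+
    then show ?thesis using 2(4) t2 by simp
  qed
  have "(\<Sum>(t, m)\<leftarrow>tr @ [(t, card (apply_update x E))]. real t) + K * \<phi>'
      \<le> K * C * (\<Sum>(t, m)\<leftarrow>tr @ [(t, card (apply_update x E))]. f (real (max 1 m)))"
    using I(4) 2(4) t2 by (simp add: distrib_left)
  moreover have "simple_edges n (apply_update x E)"
    by (rule valid_updateD(5)[OF run_update.hyps(2) I(1)])
  moreover have "\<forall>(t, m)\<in>set (tr @ [(t, card (apply_update x E))]). real t \<le> K * C * f (real (max 1 m))"
    if z: "\<forall>E T \<phi>. Inv n s E T \<phi> \<longrightarrow> \<phi> = 0"
    using w[OF z] run_update.IH z by auto
  ultimately show ?case using 2(2,3) t2 by blast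
qed

lemma maintains:
  assumes s: "s < n" and size: "64 * g n \<le> S" "64 * (n + 1) ^ 4 < W" and q: "2 + exp_cost qe \<le> q"
  shows "maintains_count S W q n s up (Store (Num 0) qe) P"
  unfolding maintains_count_def
proof (intro allI impI conjI)
  fix E M tr assume r: "run S W n s up E M tr"
  obtain T \<phi> where I: "simple_edges n E" "agr scratch M T" "Inv n s E T \<phi>"
    using run_invariant[OF r s size] by (elim conjE exE)
  have g1: "1 \<le> g n" using g_pos s by simp
  show "\<exists>t M'. exec S W (update_inputs n s x L) up M t M'"
    if "valid_update n E x" "adjacency_lists (apply_update x E) L" for x L
  proof -
    have us: "update_step S W n s E x L" using I(1) that size s g1 by unfold_locales auto
    show ?thesis using update_exec[OF us size(1) I(2,3)] by blast
  qed
  fix L assume L: "adjacency_lists E L"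
  have sg: "source_graph n s E" using I(1) s by unfold_locales
  let ?I = "query_inputs n s L" and ?c = "s_subgraph_count ({..<n}, E) P s"
  have e: "eval_exp ?I M qe = ?c"
    using indepD[OF query(1) I(2)] query(2)[OF sg L I(3)] by metis
  have "4 * (n + 1) ^ 4 \<le> 64 * (n + 1) ^ 4" by simp
  then have "?c < W" using query(3)[OF sg] size(2) by linarith
  then have "exec S W ?I (Store (Num 0) qe) M (1 + exp_cost (Num 0) + exp_cost qe) (M(0 := ?c))"
    using exec_Store[of ?I M "Num 0" S qe W] e g1 size(1) by simp
  then show "\<exists>t M'. exec S W ?I (Store (Num 0) qe) M t M' \<and> t \<le> q \<and> M' 0 = ?c"
    using q by (intro exI[of _ "1 + exp_cost (Num 0) + exp_cost qe"] exI[of _ "M(0 := ?c)"]) simp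
qed

text \<open>A single constant has to serve for the space, the word size, the query time and the
  update time. The value 65 makes the word bound strictly larger than
  \<open>64 * (n + 1) ^ 4\<close>.\<close>

definition k :: nat where "k = max 65 (max (2 + exp_cost qe) (nat \<lceil>K * C\<rceil>))"

lemma k_size:
  shows "64 * g n \<le> k * g n" "64 * (n + 1) ^ 4 < k * (n + 1) ^ k" "2 + exp_cost qe \<le> k" "K * C \<le> real k"
proof -
  have k: "65 \<le> k" "nat \<lceil>K * C\<rceil> \<le> k" unfolding k_def by (rule max.cobounded1, intro max.coboundedI2 order_refl)
  show "64 * g n \<le> k * g n" using k by (intro mult_le_mono) auto
  have "(n + 1) ^ 4 \<le> (n + 1) ^ k" using k by (intro power_increasing) auto
  then have "65 * (n + 1) ^ 4 \<le> k * (n + 1) ^ k" using k by (intro mult_le_mono) auto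
  moreover have "(n + 1) ^ 4 > 0" by simp
  ultimately show "64 * (n + 1) ^ 4 < k * (n + 1) ^ k" by linarith
  show "2 + exp_cost qe \<le> k" unfolding k_def by (intro max.coboundedI2 max.cobounded1)
  show "K * C \<le> real k" using real_nat_ceiling_ge[of "K * C"] of_nat_mono[OF k(2), where 'a = real] by linarith
qed

lemma amortized: "maintainable_amortized P f g"
  unfolding maintainable_amortized_def
proof (rule exI[of _ up], rule exI[of _ "Store (Num 0) qe"], rule exI[of _ k], intro allI impI conjI)
  fix n s :: nat assume s: "s < n"
  show "maintains_count (k * g n) (k * (n + 1) ^ k) k n s up (Store (Num 0) qe) P"
    by (rule maintains[OF s k_size(1-3)])
  fix E M tr assume r: "run (k * g n) (k * (n + 1) ^ k) n s up E M tr"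
  obtain T \<phi> where I: "Inv n s E T \<phi>"
    "(\<Sum>(t, m)\<leftarrow>tr. real t) + K * \<phi> \<le> K * C * (\<Sum>(t, m)\<leftarrow>tr. f (real (max 1 m)))"
    using run_invariant[OF r s k_size(1,2)] by (elim conjE exE)
  have "0 \<le> K * \<phi>" using nonneg(1)[OF I(1)] by simp
  moreover have "0 \<le> (\<Sum>(t, m)\<leftarrow>tr. f (real (max 1 m)))" using nonneg(3) by (intro sum_list_nonneg) auto
  then have "K * C * (\<Sum>(t, m)\<leftarrow>tr. f (real (max 1 m))) \<le> real k * (\<Sum>(t, m)\<leftarrow>tr. f (real (max 1 m)))"
    using k_size(4) by (intro mult_right_mono)
  ultimately show "(\<Sum>(t, m)\<leftarrow>tr. real t) \<le> real k * (\<Sum>(t, m)\<leftarrow>tr. f (real (max 1 m)))" using I(2) by linarith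
qed

lemma worst_case:
  assumes z: "\<And>n s E T \<phi>. Inv n s E T \<phi> \<Longrightarrow> \<phi> = 0"
  shows "maintainable_worst_case P f g"
  unfolding maintainable_worst_case_def
proof (rule exI[of _ up], rule exI[of _ "Store (Num 0) qe"], rule exI[of _ k], intro allI impI conjI)
  fix n s :: nat assume s: "s < n"
  show "maintains_count (k * g n) (k * (n + 1) ^ k) k n s up (Store (Num 0) qe) P"
    by (rule maintains[OF s k_size(1-3)])
  fix E M tr assume r: "run (k * g n) (k * (n + 1) ^ k) n s up E M tr"
  have "\<forall>(t, m)\<in>set tr. real t \<le> K * C * f (real (max 1 m))"
    using run_invariant[OF r s k_size(1,2)] z by blast
  moreover have "K * C * f (real (max 1 m)) \<le> real k * f (real (max 1 m))" for m
    using k_size(4) nonneg(3) by (intro mult_right_mono)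
  ultimately show "\<forall>(t, m)\<in>set tr. real t \<le> real k * f (real (max 1 m))" by (fastforce intro: order.trans)
qed

end

section \<open>Instances with and without heavy vertices\<close>

lemma empty_graph: "amat s {} = (\<lambda>_ _. 0)" "smark s {} = (\<lambda>_. 0)"
  by (simp_all add: amat_def smark_def fun_eq_iff)

lemma heavy_list_empty: "heavy_list {} (\<lambda>_ _. 0)"
  by (simp add: heavy_list_def bij_betw_def)

definition count_query :: "'b ugraph \<Rightarrow> (nat \<Rightarrow> (nat \<Rightarrow> nat \<Rightarrow> nat) \<Rightarrow> (nat \<Rightarrow> nat) \<Rightarrow> nat set \<Rightarrow> (nat \<Rightarrow> nat \<Rightarrow> nat) \<Rightarrow> bool)
    \<Rightarrow> exp \<Rightarrow> bool" where
  "count_query P Good qe \<longleftrightarrow> (\<forall>I. indep I scratch qe) \<and> (\<forall>n s E. source_graph n s E \<longrightarrow>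
     s_subgraph_count ({..<n}, E) P s \<le> 4 * (n + 1) ^ 4 \<and>
     (\<forall>L H T. adjacency_lists E L \<longrightarrow> Good n (amat s E) (smark s E) H T \<longrightarrow>
       ev (query_inputs n s L) T qe = s_subgraph_count ({..<n}, E) P s))"

lemma count_queryD:
  assumes "count_query P Good qe" "source_graph n s E"
  shows "s_subgraph_count ({..<n}, E) P s \<le> 4 * (n + 1) ^ 4"
    "adjacency_lists E L \<Longrightarrow> Good n (amat s E) (smark s E) H T \<Longrightarrow>
       ev (query_inputs n s L) T qe = s_subgraph_count ({..<n}, E) P s"
  using assms by (simp_all add: count_query_def)

definition table_invariant ::
  "(nat \<Rightarrow> (nat \<Rightarrow> nat \<Rightarrow> nat) \<Rightarrow> (nat \<Rightarrow> nat) \<Rightarrow> nat set \<Rightarrow> (nat \<Rightarrow> nat \<Rightarrow> nat) \<Rightarrow> bool) \<Rightarrow> bool" where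
  "table_invariant Good \<longleftrightarrow> (\<forall>n. Good n (\<lambda>_ _. 0) (\<lambda>_. 0) {} (\<lambda>_ _. 0)) \<and>
     (\<forall>n a s H T T'. Good n a s H T \<longrightarrow> (\<forall>j\<ge>32. T' j = T j) \<longrightarrow> Good n a s H T')"

lemma table_invariantD:
  assumes "table_invariant Good"
  shows "Good n (\<lambda>_ _. 0) (\<lambda>_. 0) {} (\<lambda>_ _. 0)"
    "Good n a s H T \<Longrightarrow> \<forall>j\<ge>32. T' j = T j \<Longrightarrow> Good n a s H T'"
  using assms unfolding table_invariant_def by blast+

lemma heavy_maintainable:
  assumes ec: "edge_ok (light_cost p) Mc Good ec" and mc: "mark_ok (light_cost p) Mc Good mc"
    and sc: "status_ok p Mc Good sc" and ti: "table_invariant Good"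
    and Mc: "\<And>S W n s E x L. update_step S W n s E x L \<Longrightarrow> 64 * g n \<le> S \<Longrightarrow> Mc S W (update_inputs n s x L)"
    and g: "\<And>n. n \<le> g n" and ex: "exponent p q" and qu: "count_query P Good qe"
  shows "maintainable_amortized P (\<lambda>m. m powr q) g"
proof -
  define Inv where "Inv n s E T \<phi> \<longleftrightarrow> (\<exists>H. heavy_list H T \<and> H \<subseteq> {..<n} - {s} \<and> vars_ok T \<and> T 7 0 = card E \<and>
     Good n (amat s E) (smark s E) H T \<and> (\<forall>h\<in>H. card E < deg E h ^ p) \<and>
     \<phi> = 3 ^ (p - 1) * exponent.pot p q n s E H)" for n s E T \<phi>
  interpret exponent p q by (rule ex)
  interpret maintenance "heavy_update p ec mc sc" qe P "\<lambda>m. m powr q" g Inv "29 * 3 ^ (p - 1)"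
  proof
    fix n s :: nat assume "s < n"
    have "Good n (amat s {}) (smark s {}) {} (\<lambda>_ _. 0)" unfolding empty_graph by (rule table_invariantD(1)[OF ti])
    then show "Inv n s {} (\<lambda>_ _. 0) 0"
      unfolding Inv_def using heavy_list_empty pot_empty[of n s]
      by (intro exI[of _ "{}"] conjI) (auto simp: vars_ok_def)
  next
    fix S W n s E x L T and \<phi> :: real
    assume us: "update_step S W n s E x L" and S: "64 * g n \<le> S" and I: "Inv n s E T \<phi>"
    interpret update_step S W n s E x L by (rule us)
    have Sn: "64 * n \<le> S" using g[of n] S by linarith
    interpret heavy_step S W n s E x L p Mc Good ec mc sc
    proof
      show "Good n a s H T'" if "Good n a s H T" "\<And>j. 32 \<le> j \<Longrightarrow> T' j = T j" for a s H T T'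
        by (rule table_invariantD(2)[OF ti, OF that(1)]) (intro allI impI, rule that(2))
    qed (use ec mc sc Mc[OF us S] Sn in auto)
    obtain H where H: "heavy_list H T" "H \<subseteq> {..<n} - {s}" "vars_ok T" "T 7 0 = card E"
      "Good n (amat s E) (smark s E) H T" "\<And>h. h \<in> H \<Longrightarrow> card E < deg E h ^ p"
      "\<phi> = 3 ^ (p - 1) * pot n s E H"
      using I unfolding Inv_def by blast
    define H' where "H' = {h \<in> H \<union> touched. big h}"
    define N where "N = 3 + card H + (\<Sum>w\<in>touched - H. cost w) + (\<Sum>h\<in>{h\<in>H. \<not> big h}. cost h)"
    obtain T' where T': "steps S W I (heavy_update p ec mc sc) T N T'" "good H' T'" "heavy_list H' T'"
      "vars_ok T'" "T' 7 0 = card E'"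
      using steps_heavy_update[OF H(1-3,5,4) N_def H'_def] by (elim exE conjE)
    have "H' \<subseteq> {..<n} - {s}" using H(2) vd unfolding H'_def touched_def by auto
    moreover have "\<forall>h\<in>H'. card E' < deg E' h ^ p" unfolding H'_def length_deg by blast
    ultimately have "Inv n s E' T' (3 ^ (p - 1) * pot n s E' H')"
      unfolding Inv_def using T' by blast
    moreover have "real N + 3 ^ (p - 1) * pot n s E' H' \<le> \<phi> + 29 * 3 ^ (p - 1) * real (max 1 (card E')) powr q"
      unfolding H(7) by (rule amortize[OF ex H(2,6)]) (simp_all add: H'_def N_def length_deg)
    ultimately show "\<exists>T' N \<phi>'. steps S W I (heavy_update p ec mc sc) T N T' \<and> Inv n s E' T' \<phi>' \<and>
        real N + \<phi>' \<le> \<phi> + 29 * 3 ^ (p - 1) * real (max 1 (card E')) powr q"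
      using T'(1) by blast
  next
    show "0 \<le> \<phi>" if "Inv n s E T \<phi>" for n s E T \<phi>
      using that pot_nonneg[of n s E] unfolding Inv_def by (elim exE conjE) simp
    show "1 \<le> g n" if "0 < n" for n using g[of n] that by linarith
    show "indep I scratch qe" for I using qu by (simp add: count_query_def)
    fix n s E assume sg: "source_graph n s E"
    show "s_subgraph_count ({..<n}, E) P s \<le> 4 * (n + 1) ^ 4"
      by (rule count_queryD(1)[OF qu sg])
    show "ev (query_inputs n s L) T qe = s_subgraph_count ({..<n}, E) P s"
      if L: "adjacency_lists E L" and I: "Inv n s E T \<phi>" for L T \<phi>
      using I unfolding Inv_def by (elim exE conjE) (rule count_queryD(2)[OF qu, OF sg L])
  qed auto
  show ?thesis by (rule amortized)
qed

text \<open>The same contracts with the empty heavy set and potential 0. No heavy list is stored,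
  which is why constant space suffices.\<close>

lemma direct_maintainable:
  assumes ec: "edge_ok lc machine Good ec" and mc: "mark_ok lc machine Good mc" and ti: "table_invariant Good"
    and lc: "\<And>S W n s E x L w. update_step S W n s E x L \<Longrightarrow>
      lc (update_inputs n s x L) {} w \<le> B (card (apply_update x E))"
    and C: "\<And>m. real (1 + 2 * B m) \<le> C * f (real (max 1 m))" "0 \<le> C" "\<And>m. 0 \<le> f (real (max 1 m))"
    and qu: "count_query P Good qe"
  shows "maintainable_worst_case P f (\<lambda>n. 1)"
proof -
  define Inv where "Inv n s E T \<phi> \<longleftrightarrow> heavy_list {} T \<and> vars_ok T \<and> Good n (amat s E) (smark s E) {} T \<and> \<phi> = 0"
    for n :: nat and s E T and \<phi> :: real
  interpret maintenance "dispatch ec mc" qe P f "\<lambda>n. 1" Inv C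
  proof
    fix n s :: nat assume "s < n"
    have "Good n (amat s {}) (smark s {}) {} (\<lambda>_ _. 0)" unfolding empty_graph by (rule table_invariantD(1)[OF ti])
    then show "Inv n s {} (\<lambda>_ _. 0) 0"
      unfolding Inv_def using heavy_list_empty by (auto simp: vars_ok_def)
  next
    fix S W n s E x L T and \<phi> :: real
    assume us: "update_step S W n s E x L" and S: "64 * 1 \<le> S" and I: "Inv n s E T \<phi>"
    interpret update_step S W n s E x L by (rule us)
    let ?N = "1 + card ({} :: nat set) + (\<Sum>w\<in>touched. lc I {} w)"
    have H: "heavy_list {} T" "vars_ok T" "Good n (amat s E) (smark s E) {} T" "\<phi> = 0"
      using I by (simp_all add: Inv_def)
    have "\<exists>T'. steps S W I (dispatch ec mc) T ?N T' \<and> Good n (amat s E') (smark s E') {} T' \<and>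
     (\<forall>j. 7 \<le> j \<longrightarrow> j < 20 \<longrightarrow> T' j = T j) \<and> vars_ok T'"
    proof (rule steps_dispatch[where Good = Good and H = "{}" and T = T and N = ?N and lc = lc, OF ec mc M.machine_axioms])
      show "heavy_list {} T" "vars_ok T" "Good n (amat s E) (smark s E) {} T" by (fact H)+
      show "Good n a s H T'" if "Good n a s H T" "\<And>j. 32 \<le> j \<Longrightarrow> T' j = T j" for a s H T T'
        by (rule table_invariantD(2)[OF ti, OF that(1)]) (intro allI impI, rule that(2))
    qed simp_all
    then obtain T' where T': "steps S W I (dispatch ec mc) T ?N T'" "Good n (amat s E') (smark s E') {} T'"
      "\<forall>j. 7 \<le> j \<longrightarrow> j < 20 \<longrightarrow> T' j = T j" "vars_ok T'" by (elim exE conjE)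
    have "heavy_list {} T'" using H(1) T'(3) by (simp add: heavy_list_def)
    then have "Inv n s E' T' 0" using T' by (simp add: Inv_def)
    moreover have "real ?N \<le> C * f (real (max 1 (card E')))"
    proof -
      have "card touched \<le> card {u, v}" by (intro card_mono) (auto simp: touched_def)
      also have "\<dots> \<le> 2" by (simp add: card_insert_if)
      finally have t: "card touched \<le> 2" .
      have "(\<Sum>w\<in>touched. lc I {} w) \<le> card touched * B (card E')"
        using sum_bounded_above[of touched "lc I {}" "B (card E')"] lc[OF us] by simp
      also have "\<dots> \<le> 2 * B (card E')" using t by (rule mult_le_mono1)
      finally have "real ?N \<le> real (1 + 2 * B (card E'))" by (intro of_nat_mono) simp
      then show ?thesis using C(1)[of "card E'"] by linarith
    qed
    ultimately show "\<exists>T' N \<phi>'. steps S W I (dispatch ec mc) T N T' \<and> Inv n s E' T' \<phi>' \<and>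
        real N + \<phi>' \<le> \<phi> + C * f (real (max 1 (card E')))"
      using T'(1) H(4) by (intro exI[of _ T'] exI[of _ ?N] exI[of _ 0]) simp
  next
    show "0 \<le> \<phi>" if "Inv n s E T \<phi>" for n s E T \<phi> using that by (simp add: Inv_def)
    show "indep I scratch qe" for I using qu by (simp add: count_query_def)
    fix n s E assume sg: "source_graph n s E"
    show "s_subgraph_count ({..<n}, E) P s \<le> 4 * (n + 1) ^ 4"
      by (rule count_queryD(1)[OF qu sg])
    show "ev (query_inputs n s L) T qe = s_subgraph_count ({..<n}, E) P s"
      if L: "adjacency_lists E L" and I: "Inv n s E T \<phi>" for L T \<phi>
      using I unfolding Inv_def by (elim exE conjE) (rule count_queryD(2)[OF qu, OF sg L])
  qed (use C in auto)
  show ?thesis by (rule worst_case) (simp add: Inv_def)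
qed

lemma table_invariant_Good:
  "table_invariant claw_tables" "table_invariant sqrt_tables" "table_invariant two_thirds_tables" "table_invariant clique4_tables"
proof -
  note d = gT_def gD_def gB_def gY_def gQ_def gR_def gC_def tC_def tD_def tK_def tP_def tF_def tA_def tG_def
    cn_def dg_def cod_def tri_def wlk_def nbdeg_def scalar_def
  have j: "32 \<le> jK m" "32 \<le> jP m" "32 \<le> jF m" "32 \<le> jY m" "32 \<le> jQ m" for m by (simp_all add: jdefs)
  show "table_invariant claw_tables"
    unfolding table_invariant_def
  proof (intro conjI allI impI)
    show "claw_tables n (\<lambda>_ _. 0) (\<lambda>_. 0) {} (\<lambda>_ _. 0)" for n by (simp add: claw_tables_def d fun_eq_iff)
  qed (simp add: claw_tables_def)
  show "table_invariant sqrt_tables"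
    unfolding table_invariant_def
  proof (intro conjI allI impI)
    show "sqrt_tables n (\<lambda>_ _. 0) (\<lambda>_. 0) {} (\<lambda>_ _. 0)" for n by (simp add: sqrt_tables_def d fun_eq_iff)
  qed (simp add: sqrt_tables_def)
  show "table_invariant two_thirds_tables"
    unfolding table_invariant_def
  proof (intro conjI allI impI)
    show "two_thirds_tables n (\<lambda>_ _. 0) (\<lambda>_. 0) {} (\<lambda>_ _. 0)" for n by (simp add: two_thirds_tables_def d fun_eq_iff)
  qed (simp add: two_thirds_tables_def j)
  show "table_invariant clique4_tables"
    unfolding table_invariant_def
  proof (intro conjI allI impI)
    show "clique4_tables n (\<lambda>_ _. 0) (\<lambda>_. 0) {} (\<lambda>_ _. 0)" for n by (simp add: clique4_tables_def d fun_eq_iff)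
  qed (simp add: clique4_tables_def)
qed

context source_graph
begin

sublocale wgraph n a
proof
  fix u v
  show "a u v = a v u" by (rule a_sym)
  show "a u v = 0" if "n \<le> u" using simple_edgesD[OF E, of u v] that by (auto simp: amat_def)
qed (simp_all add: amat_def)

lemma ds_length:
  assumes "adjacency_lists E L"
  shows "length (L s) = ds"
proof -
  have L: "distinct (L s)" "set (L s) = {w. {s, w} \<in> E}" using assms by (auto simp: adjacency_lists_def)
  have "set (L s) = {w\<in>{..<n}. {s, w} \<in> E}" using simple_edgesD[OF E] unfolding L(2) by blast
  then have "card (set (L s)) = ds" by (simp add: smark_def Int_def)
  then show ?thesis using distinct_card[OF L(1)] by simp
qed

lemma sigma_le: "\<sigma> u \<le> 1" by (simp add: smark_def)

lemma ds_le: "ds \<le> n"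
  using sum_le_mult[of n \<sigma> 1] sigma_le by simp

lemma count_le:
  "count claw \<le> 4 * (n + 1) ^ 4" "count cycle3 \<le> 4 * (n + 1) ^ 4" "count path3 \<le> 4 * (n + 1) ^ 4"
  "count paw \<le> 4 * (n + 1) ^ 4" "count cycle4 \<le> 4 * (n + 1) ^ 4" "count diamond \<le> 4 * (n + 1) ^ 4"
  "count clique4 \<le> 4 * (n + 1) ^ 4"
proof -
  have le: "every u \<le> 1" for u by simp
  note ag = aggregate_le[of \<sigma> every, OF sigma_le le] and ag' = aggregate_le[of \<sigma> \<sigma>, OF sigma_le sigma_le]
  have 4: "(n + 1) ^ 4 = (n + 1) * ((n + 1) * ((n + 1) * (n + 1)))" by (simp only: power4_eq_xxxx mult.assoc)
  have b4: "n * (n * (n * n)) \<le> (n + 1) ^ 4" unfolding 4 by (intro mult_le_mono) auto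
  have "1 * (n * (n * n)) \<le> (n + 1) ^ 4" unfolding 4 by (intro mult_le_mono) auto
  then have b3: "n * (n * n) \<le> (n + 1) ^ 4" by simp
  have "ds * (ds - 1) * (ds - 2) \<le> n * n * n" using ds_le by (intro mult_le_mono) auto
  then have "ds * (ds - 1) * (ds - 2) \<le> n * (n * n)" by (simp only: mult.assoc)
  then show "count claw \<le> 4 * (n + 1) ^ 4" using count_claw ag(6) b3 by linarith
  show "count cycle3 \<le> 4 * (n + 1) ^ 4" using count_cycle3 ag(1) b3 by linarith
  note m = mult_le_mono[OF ds_le ag(1)] mult_le_mono[OF ds_le ag(2)]
  show "count path3 \<le> 4 * (n + 1) ^ 4" using count_path3 ag(3) m b3 b4 by linarith
  show "count paw \<le> 4 * (n + 1) ^ 4"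
    using count_paw ag'(3) ag(4) m b3 b4 by linarith
  show "count cycle4 \<le> 4 * (n + 1) ^ 4" using count_cycle4 ag(5) b3 by linarith
  show "count diamond \<le> 4 * (n + 1) ^ 4" using count_diamond ag'(5) ag'(4) b3 by linarith
  show "count clique4 \<le> 4 * (n + 1) ^ 4" using count_clique4 ag(7) b3 by linarith
qed

end

section \<open>Query expressions\<close>

abbreviation "sdeg \<equiv> Degree Source"

lemma count_queryI:
  assumes "\<And>I. indep I scratch qe" "isomorphic_graphs P Q" "simple_graph P"
    and "\<And>n s E. source_graph n s E \<Longrightarrow> s_subgraph_count ({..<n}, E) Q s \<le> 4 * (n + 1) ^ 4"
    and "\<And>n s E L H T I. source_graph n s E \<Longrightarrow> length (L s) = (\<Sum>u<n. smark s E u) \<Longrightarrow>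
      Good n (amat s E) (smark s E) H T \<Longrightarrow> in_nbs I = L \<Longrightarrow> in_s I = s \<Longrightarrow>
      ev I T qe = s_subgraph_count ({..<n}, E) Q s"
  shows "count_query P Good qe"
  unfolding count_query_def s_subgraph_count_iso[OF assms(2,3)]
proof (intro conjI allI impI)
  fix n s E L H T
  assume sg: "source_graph n s E" and L: "adjacency_lists E L" and G: "Good n (amat s E) (smark s E) H T"
  show "ev (query_inputs n s L) T qe = s_subgraph_count ({..<n}, E) Q s"
    by (rule assms(5)[where L = L and s = s and n = n and E = E, OF sg source_graph.ds_length[OF sg L] G]) (simp_all add: query_inputs_def)
qed (use assms(1,4) in auto)

lemma two_thirds_tables_scalars:
  assumes "two_thirds_tables n a s H T"
  shows "T 41 0 = gT n a s" "T 42 0 = gD n a s" "T 43 0 = gB n a s s" "T 44 0 = gY n a every s"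
    "T 45 0 = gY n a s s" "T 46 0 = gQ n a every s" "T 47 0 = gQ n a s s"
proof -
  have "T (jY m) = scalar (gY n a (wt m s) s) \<and> T (jQ m) = scalar (gQ n a (wt m s) s)" for m
    using assms unfolding two_thirds_tables_def by blast
  from this[of False] this[of True]
  show "T 44 0 = gY n a every s" "T 45 0 = gY n a s s" "T 46 0 = gQ n a every s" "T 47 0 = gQ n a s s"
    by (simp_all add: jdefs wt_def)
  show "T 41 0 = gT n a s" "T 42 0 = gD n a s" "T 43 0 = gB n a s s"
    using assms by (simp_all add: two_thirds_tables_def)
qed

lemma query_claw:
  assumes "isomorphic_graphs P claw" "simple_graph P"
  shows "count_query P claw_tables (Div (Add (Mul (Mul sdeg (Sub sdeg (Num 1))) (Sub sdeg (Num 2))) (Mul (Num 3) (Sub (var 50) (var 42)))) (Num 6))"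
  by (rule count_queryI[OF _ assms source_graph.count_le(1)], simp_all add: scratch_def)
    (drule source_graph.count_claw, simp add: claw_tables_def)

lemma query_cycle3:
  assumes "isomorphic_graphs P cycle3" "simple_graph P"
  shows "count_query P sqrt_tables (Div (var 41) (Num 2))"
  by (rule count_queryI[OF _ assms source_graph.count_le(2)], simp_all add: scratch_def)
    (drule source_graph.count_cycle3, simp add: sqrt_tables_def)

lemma query_path3:
  assumes "isomorphic_graphs P path3" "simple_graph P"
  shows "count_query P sqrt_tables (Sub (Add (var 49) (Mul sdeg (var 42))) (Add (Mul (Num 2) (var 42)) (var 41)))"
  by (rule count_queryI[OF _ assms source_graph.count_le(3)], simp_all add: scratch_def)
    (drule source_graph.count_path3, simp add: sqrt_tables_def)

lemma query_paw:
  assumes "isomorphic_graphs P paw" "simple_graph P"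
  shows "count_query P two_thirds_tables (Div (Sub (Add (Add (Mul sdeg (var 41)) (Mul (Num 2) (var 43))) (var 44)) (Mul (Num 4) (var 41))) (Num 2))"
  by (rule count_queryI[OF _ assms source_graph.count_le(4)], simp_all add: scratch_def)
    (drule source_graph.count_paw, simp add: two_thirds_tables_scalars)

lemma query_cycle4:
  assumes "isomorphic_graphs P cycle4" "simple_graph P"
  shows "count_query P two_thirds_tables (Div (Sub (var 46) (var 42)) (Num 2))"
  by (rule count_queryI[OF _ assms source_graph.count_le(5)], simp_all add: scratch_def)
    (drule source_graph.count_cycle4, simp add: two_thirds_tables_scalars)

lemma query_diamond:
  assumes "isomorphic_graphs P diamond" "simple_graph P"
  shows "count_query P two_thirds_tables (Div (Sub (Add (var 47) (var 45)) (var 41)) (Num 2))"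
  by (rule count_queryI[OF _ assms source_graph.count_le(6)], simp_all add: scratch_def)
    (drule source_graph.count_diamond, simp add: two_thirds_tables_scalars)

lemma query_clique4:
  assumes "isomorphic_graphs P clique4" "simple_graph P"
  shows "count_query P clique4_tables (Div (var 51) (Num 6))"
  by (rule count_queryI[OF _ assms source_graph.count_le(7)], simp_all add: scratch_def)
    (drule source_graph.count_clique4, simp add: clique4_tables_def)

lemma machine12:
  assumes us: "update_step S W n s E x L"
  shows "64 * n \<le> S \<Longrightarrow> machine1 S W (update_inputs n s x L)"
    "64 * n ^ 2 \<le> S \<Longrightarrow> machine2 S W (update_inputs n s x L)"
proof -
  interpret update_step S W n s E x L by (rule us)
  show 1: "machine1 S W I" if "64 * n \<le> S" by unfold_locales (use that in simp)
  assume 2: "64 * n ^ 2 \<le> S"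
  have "n \<le> n ^ 2" by (rule self_le_power) (use s in auto)
  then have "64 * n \<le> S" using 2 by linarith
  then interpret machine1 S W I by (rule 1)
  show "machine2 S W I" by unfold_locales (use 2 in \<open>simp add: power2_eq_square\<close>)
qed

text \<open>The number of neighbours of \<open>w\<close> and the sum of their degrees are both
  bounded by the total degree, which is twice the number of edges.\<close>

lemma two_step_cost_le:
  assumes us: "update_step S W n s E x L"
  shows "two_step_cost (update_inputs n s x L) {} w \<le> 4 * card (apply_update x E)"
proof -
  interpret update_step S W n s E x L by (rule us)
  note hs = handshake[OF vd(5)]
  have sub: "set (L w) \<subseteq> {..<n}" using simple_edgesD[OF vd(5), of w] unfolding set_L by auto
  have "(\<Sum>z\<in>set (L w). deg E' z) \<le> (\<Sum>z<n. deg E' z)" by (rule sum_mono2) (use sub in auto)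
  then have 1: "(\<Sum>z\<in>set (L w). deg E' z) \<le> 2 * card E'" unfolding hs .
  have 2: "card (set (L w)) \<le> 2 * card E'"
  proof (cases "w < n")
    case True
    then have "deg E' w \<le> (\<Sum>z<n. deg E' z)" by (intro member_le_sum) auto
    then show ?thesis unfolding hs by (simp add: deg_def set_L)
  next
    case False
    then have "{w, z} \<notin> E'" for z using simple_edgesD[OF vd(5), of w z] by blast
    then have "set (L w) = {}" unfolding set_L by simp
    then show ?thesis by simp
  qed
  have "two_step_cost I {} w = card (set (L w)) + (\<Sum>z\<in>set (L w). deg E' z)"
    unfolding two_step_cost_def update_inputs_sel length_deg by (simp only: sum.distrib card_eq_sum)
  then show ?thesis using 1 2 by linarith
qed

theorem theorem3p18:
  fixes P :: "'b ugraph"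
  assumes "simple_graph P" and "connected_graph P"
  shows "(isomorphic_graphs P claw \<longrightarrow>
            maintainable_worst_case P (\<lambda>m. 1) (\<lambda>n. 1)) \<and>
         (isomorphic_graphs P cycle3 \<or> isomorphic_graphs P path3 \<longrightarrow>
            maintainable_amortized P (\<lambda>m. sqrt m) (\<lambda>n. n)) \<and>
         (isomorphic_graphs P paw \<or> isomorphic_graphs P cycle4 \<or> isomorphic_graphs P diamond \<longrightarrow>
            maintainable_amortized P (\<lambda>m. m powr (2 / 3)) (\<lambda>n. n ^ 2)) \<and>
         (isomorphic_graphs P clique4 \<longrightarrow>
            maintainable_worst_case P (\<lambda>m. m) (\<lambda>n. 1))"
proof (intro conjI impI)
  note P = assms(1)
  have ex2: "exponent 2 (1 / 2)" and ex3: "exponent 3 (2 / 3)" by unfold_locales auto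
  show "maintainable_worst_case P (\<lambda>m. 1) (\<lambda>n. 1)" if "isomorphic_graphs P claw"
    by (rule direct_maintainable[where B = "\<lambda>_. 0" and C = 1,
        OF edge_claw_ok mark_claw_ok table_invariant_Good(1) _ _ _ _ query_claw[OF that P]])
      (simp_all add: no_cost_def)
  have heavy2: "maintainable_amortized P (\<lambda>m. sqrt m) (\<lambda>n. n)" if "count_query P sqrt_tables qe" for qe
  proof -
    have "maintainable_amortized P (\<lambda>m. m powr (1 / 2)) (\<lambda>n. n)"
      by (rule heavy_maintainable[OF edge2_ok mark2_ok status2_ok table_invariant_Good(2) machine12(1) order_refl ex2 that])
    moreover have "real (max 1 m) powr (1 / 2) = sqrt (real (max 1 m))" for m by (rule powr_half_sqrt) simp
    ultimately show ?thesis unfolding maintainable_amortized_def by (simp only:)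
  qed
  have heavy3: "maintainable_amortized P (\<lambda>m. m powr (2 / 3)) (\<lambda>n. n ^ 2)" if "count_query P two_thirds_tables qe" for qe
    by (rule heavy_maintainable[OF edge3_ok mark3_ok status3_ok table_invariant_Good(3) machine12(2) _ ex3 that])
      (simp_all add: power2_eq_square)
  show "maintainable_amortized P (\<lambda>m. sqrt m) (\<lambda>n. n)"
    if "isomorphic_graphs P cycle3 \<or> isomorphic_graphs P path3"
    using that query_cycle3[OF _ P] query_path3[OF _ P] heavy2 by blast
  show "maintainable_amortized P (\<lambda>m. m powr (2 / 3)) (\<lambda>n. n ^ 2)"
    if "isomorphic_graphs P paw \<or> isomorphic_graphs P cycle4 \<or> isomorphic_graphs P diamond"
    using that query_paw[OF _ P] query_cycle4[OF _ P] query_diamond[OF _ P] heavy3 by blast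
  \<comment> \<open>Two endpoints cost at most \<open>4 * m\<close> each, and
    \<open>1 + 2 * (4 * m)\<close> is at most 9 times \<open>max 1 m\<close>.\<close>
  show "maintainable_worst_case P (\<lambda>m. m) (\<lambda>n. 1)" if "isomorphic_graphs P clique4"
    by (rule direct_maintainable[where B = "\<lambda>m. 4 * m" and C = 9,
        OF edge_clique4_ok mark_clique4_ok table_invariant_Good(4) two_step_cost_le _ _ _ query_clique4[OF that P]])
      auto
qed

end
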